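(* Let $S$ be a closed oriented surface of genus $>1$, let $\mathcal{B}(S)$ be the deformation space of convex $\mathbb{R}P^2$-structures on $S$, and let $\iota:\mathcal{T}(S)\hookrightarrow\mathcal{B}(S)$ be the embedding of Teichmüller space as the Teichmüller locus. Let $g_{DG}$ and $g_{Loftin}$ be the DG metric and the Loftin metric on $\mathcal{B}(S)$, and let $g_{WP}$ be the Weil--Petersson metric on $\mathcal{T}(S)$. Then $g_{DG}$ and $g_{Loftin}$ both restrict to a constant multiple of the Weil--Petersson metric on Teichmüller space; that is, there are constants $c_1,c_2>0$ with $\iota^*g_{DG}=c_1\,g_{WP}$ and $\iota^*g_{Loftin}=c_2\,g_{WP}$.
   Context: **Goldman space.** Let $S$ be a closed oriented surface of genus $>1$, $\pi=\pi_1(S)$. A convex $\mathbb{R}P^2$-structure on a surface $M$ is an atlas with values in $\mathbb{R}P^2$ and locally projective transition maps whose developing map is a diffeomorphism of $\widetilde M$ onto a convex domain $\Omega$ in some affine $\mathbb{R}^2\subset\mathbb{R}P^2$; then $M=\Omega/\Gamma$ with $\Gamma\subset PGL(3,\mathbb{R})\cong SL(3,\mathbb{R})$ acting discretely and properly discontinuously. For $M$ diffeomorphic to $S$ the domain $\Omega$ is bounded (in a suitable affine chart). $\mathcal{B}(S)$ is the set of pairs $(f,M)$, $f:S\to M$ a diffeomorphism onto a convex $\mathbb{R}P^2$-manifold, modulo $(f,M)\sim(f',M')$ iff there is a projective isomorphism $h:M\to M'$ with $h\circ f$ isotopic to $f'$. The holonomy map embeds $\mathcal{B}(S)$ as an open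 set of the smooth part of $\mathrm{Hom}(\pi,PGL(3,\mathbb{R}))/PGL(3,\mathbb{R})$. The tangent space of $\mathcal{B}(S)$ at $[\rho]$ is $H^1(S;sl(3,\mathbb{R})_{Ad\rho})$, where $sl(3,\mathbb{R})_{Ad\rho}=\widetilde S\times sl(3,\mathbb{R})/\{(\tilde s,x)\sim(\gamma\tilde s,Ad\rho(\gamma)x)\}$ is the flat bundle over $S$. **Cone.** For $[\rho]\in\mathcal{B}(S)$ with $S\cong\Omega/\Gamma$, $\Gamma=\rho(\pi)\subset SL(3,\mathbb{R})$ and $\Omega\subset\{x_3=1\}\cong\mathbb{R}^2$ bounded convex, let $\mathcal{C}=\{(tx,t): x\in\Omega,\ t>0\}\subset\mathbb{R}^3$. **Cheng--Yau metric.** There is a unique strictly convex function $\sigma$ on $\mathcal{C}$ with $\det(\tfrac13(\log\sigma)_{ij})=\sigma^2$ and $\sigma\to\infty$ at $\partial\mathcal{C}$; the Cheng--Yau metric is $h=\tfrac13 d^2\log\sigma$. It is invariant under linear automorphisms of $\mathcal{C}$. The hypersurface $H=\sigma^{-1}(1)$ is the hyperbolic affine sphere asymptotic to $\partial\mathcal{C}$ with center $0$ and affine mean curvature $-1$, and its affine (Blaschke) metric is the restriction of $h$ to $H$. Via radial projection $H\to\Omega$ and the quotient $\Omega\to S$ it descends to a Riemannian metric on $S$. **Loftin metric.** For $x\in H$, the inner product $h_x$ on $\mathbb{R}^3$ induces the inner product $l_x=h_x\otimes h_x^*$ on $sl(3,\mathbb{R})\subset gl(3,\mathbb{R})\cong\mathbb{R}^3\otimes(\mathbb{R}^3)^*$,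 where $h_x^*$ is the dual inner product. By invariance this descends to a fibre metric $l$ on $sl(3,\mathbb{R})_{Ad\rho}$: $l(\phi,\phi')|_p=l_x(\tilde\phi_x,\tilde\phi'_x)$ for any $x\in H$ over $p\in S$, with $\tilde\phi,\tilde\phi'$ the lifts to $H$. The Blaschke metric and the orientation of $S$ give a Hodge star, $\alpha\wedge *\beta=\langle\alpha,\beta\rangle\,dvol$. On $\mathcal{A}^1(S,sl(3,\mathbb{R})_{Ad\rho})$ define by linearity $$\tilde g(\sigma\otimes\phi,\sigma'\otimes\phi')=\int_S(\sigma\wedge *\sigma')\,l(\phi,\phi').$$ Let $\sharp$ be the isomorphism from $sl(3,\mathbb{R})_{Ad\rho}$ to its dual flat bundle given by $(\sharp v)(u)=l(u,v)$, extended to forms; let $\delta=-\sharp^{-1}*^{-1}d*\sharp$ and $\Delta=d\delta+\delta d$ ($d$ the flat exterior derivative). A form is harmonic if $\Delta\xi=0$, equivalently $d\xi=0$ and $\delta\xi=0$. Each class in $H^1(S;sl(3,\mathbb{R})_{Ad\rho})$ has a unique harmonic representative, and $g_{Loftin}([\alpha],[\beta])=\tilde g(\alpha_{harm},\beta_{harm})$. **DG metric (Darvishzadeh--Goldman).** Let $\mathcal{C}^*$ be the dual cone of linear functionals positive on $\mathcal{C}$, and $k(x)=\int_{\mathcal{C}^*}e^{-\psi(x)}d\psi$ for $x\in\mathcal{C}$ (Lebesgue measure). The Koszul--Vinberg metric is $h^{KV}=d^2\log k$ on $\mathcal{C}$; it is positive definite and $Aut(\mathcal{C})$-invariant. For $x\in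 k^{-1}(1)$, the inner product $h^{KV}_x$ on $\mathbb{R}^3$ induces the inner product $l^{DG}_x=h^{KV}_x\otimes(h^{KV}_x)^*$ on $sl(3,\mathbb{R})\subset\mathbb{R}^3\otimes(\mathbb{R}^3)^*$, which by invariance descends to a fibre metric $l^{DG}$ on $sl(3,\mathbb{R})_{Ad\rho}$: $l^{DG}(\phi,\phi')|_p=l^{DG}_x(\tilde\phi_x,\tilde\phi'_x)$ for any $x\in k^{-1}(1)$ over $p\in S$, with $\tilde\phi,\tilde\phi'$ the lifts to $k^{-1}(1)$. The map $m:\Omega\to\mathcal{C}$, $[p]\mapsto k(p)^{1/3}p$, has image $k^{-1}(1)$, and the $\Gamma$-invariant metric $m^*(d^2\log k)$ descends to a Riemannian metric on $S$, used in place of the Blaschke metric; with the orientation of $S$ it gives a Hodge star $*_{DG}$. On $\mathcal{A}^1(S,sl(3,\mathbb{R})_{Ad\rho})$ define by linearity $$\tilde g_{DG}(\sigma\otimes\phi,\sigma'\otimes\phi')=\int_S(\sigma\wedge *_{DG}\sigma')\,l^{DG}(\phi,\phi').$$ Let $\sharp_{DG}$ be the isomorphism from $sl(3,\mathbb{R})_{Ad\rho}$ to its dual flat bundle given by $(\sharp_{DG}v)(u)=l^{DG}(u,v)$, extended to forms; let $\delta_{DG}=-\sharp_{DG}^{-1}*_{DG}^{-1}d*_{DG}\sharp_{DG}$ and $\Delta_{DG}=d\delta_{DG}+\delta_{DG}d$. A form is DG-harmonic if $\Delta_{DG}\xi=0$, equivalently $d\xi=0$ and $\delta_{DG}\xi=0$.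 Each class in $H^1(S;sl(3,\mathbb{R})_{Ad\rho})$ has a unique DG-harmonic representative, and $g_{DG}([\alpha],[\beta])$ is the $\tilde g_{DG}$-pairing of the DG-harmonic representatives of $[\alpha]$ and $[\beta]$. **Teichmüller locus.** $\iota$ sends a hyperbolic structure $\mathbb{H}^2/\rho'(\pi)$, $\rho':\pi\to PSL(2,\mathbb{R})$, to the convex $\mathbb{R}P^2$-structure with holonomy $\Phi\circ\rho'$, where $\Phi:PSL(2,\mathbb{R})\to SO(2,1)\subset SL(3,\mathbb{R})$ is the irreducible representation (equivalently, the structures for which $\Omega$ is the unit disc $\{t_1^2+t_2^2<1\}$ up to projective equivalence). **Weil--Petersson metric.** The Riemannian metric on $\mathcal{T}(S)$ dual to the cometric $\langle\phi\,dz^2,\psi\,dz^2\rangle_{WP}=\mathrm{Re}\int_S\phi\overline{\psi}\,y^2\,dx\,dy$ on holomorphic quadratic differentials ($z=x+iy$ the coordinate on the universal cover $\mathbb{H}^2$). *)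

theory Defs
  imports "HOL-Complex_Analysis.Complex_Analysis" "HOL-Homology.Homology"
begin

no_notation fps_nth (infixl "$" 75)

section \<open>Smooth maps\<close>

fun Ck_on :: "nat \<Rightarrow> 'a::euclidean_space set \<Rightarrow> ('a \<Rightarrow> 'b::real_normed_vector) \<Rightarrow> bool" where
  "Ck_on 0 U f \<longleftrightarrow> continuous_on U f"
| "Ck_on (Suc k) U f \<longleftrightarrow> (\<forall>x\<in>U. f differentiable (at x)) \<and>
     (\<forall>v. Ck_on k U (\<lambda>x. frechet_derivative f (at x) v))"

text \<open>Only used for open \<open>U\<close>.\<close>
definition smooth_on :: "'a::euclidean_space set \<Rightarrow> ('a \<Rightarrow> 'b::real_normed_vector) \<Rightarrow> bool" where
  "smooth_on U f \<longleftrightarrow> (\<forall>k. Ck_on k U f)"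

lemma Ck_cong:
  assumes "open U" "Ck_on k U f" "\<And>x. x \<in> U \<Longrightarrow> f x = g x"
  shows "Ck_on k U g"
  using assms(2,3)
proof (induction k arbitrary: f g)
  case 0
  then show ?case by (metis Ck_on.simps(1) continuous_on_cong)
next
  case (Suc k)
  have D: "(g has_derivative frechet_derivative f (at x)) (at x)" if "x \<in> U" for x
    using Suc.prems that assms(1)
    by (metis Ck_on.simps(2) frechet_derivative_works has_derivative_transform_within_open)
  then have E: "frechet_derivative f (at x) = frechet_derivative g (at x)" if "x \<in> U" for x
    using that frechet_derivative_at by blast
  show ?case
    using Suc.IH[of "\<lambda>x. frechet_derivative f (at x) _" "\<lambda>x. frechet_derivative g (at x) _"] D E Suc.prems(1)
    by (auto simp: differentiable_def) 
qed

lemma Ck_SucI: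
  assumes "open U" "\<And>x. x \<in> U \<Longrightarrow> (f has_derivative f' x) (at x)" "\<And>v. Ck_on k U (\<lambda>x. f' x v)"
  shows "Ck_on (Suc k) U f"
proof -
  have "frechet_derivative f (at x) = f' x" if "x \<in> U" for x
    using assms(2) that frechet_derivative_at by metis
  then show ?thesis
    using assms Ck_cong[OF assms(1) assms(3)] by (auto simp: differentiable_def)
qed

lemma Ck_SucD: "Ck_on (Suc k) U f \<Longrightarrow> x \<in> U \<Longrightarrow> (f has_derivative frechet_derivative f (at x)) (at x)"
  using frechet_derivative_works by auto

lemma Ck_Suc: "Ck_on (Suc k) U f \<Longrightarrow> Ck_on k U f"
proof (induction k arbitrary: f)
  case 0
  then show ?case
    by (simp add: continuous_at_imp_continuous_on differentiable_imp_continuous_within)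
qed auto

lemma Ck_const: "open U \<Longrightarrow> Ck_on k U (\<lambda>_. c)"
proof (induction k arbitrary: c)
  case (Suc k) then show ?case by (intro Ck_SucI[where f'="\<lambda>_ _. 0"]) auto
qed auto

lemma Ck_linear: "bounded_linear f \<Longrightarrow> open U \<Longrightarrow> Ck_on k U f"
proof (cases k)
  case (Suc j)
  assume "bounded_linear f" "open U"
  then show ?thesis
    unfolding Suc by (intro Ck_SucI[where f'="\<lambda>_. f"] Ck_const bounded_linear_imp_has_derivative)
qed (simp add: linear_continuous_on)

lemma Ck_add: "open U \<Longrightarrow> Ck_on k U f \<Longrightarrow> Ck_on k U g \<Longrightarrow> Ck_on k U (\<lambda>x. f x + g x)"
proof (induction k arbitrary: f g)
  case (Suc k)
  show ?case
    by (rule Ck_SucI[OF Suc.prems(1) has_derivative_add[OF Ck_SucD[OF Suc.prems(2)] Ck_SucD[OF Suc.prems(3)]]])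
      (use Suc in auto)
qed (auto intro: continuous_on_add)

lemma Ck_sum: "open U \<Longrightarrow> (\<And>i. i \<in> I \<Longrightarrow> Ck_on k U (f i)) \<Longrightarrow> Ck_on k U (\<lambda>x. \<Sum>i\<in>I. f i x)"
  by (induction I rule: infinite_finite_induct) (auto intro: Ck_const Ck_add)

lemma Ck_bilinear:
  assumes "bounded_bilinear pr" "open U" "Ck_on k U f" "Ck_on k U g"
  shows "Ck_on k U (\<lambda>x. pr (f x) (g x))"
  using assms(3,4)
proof (induction k arbitrary: f g)
  case 0 then show ?case using assms(1) by (simp add: bounded_bilinear.continuous_on)
next
  case (Suc k)
  have "Ck_on k U f" "Ck_on k U g" using Suc.prems by (auto intro: Ck_Suc)
  then have "Ck_on k U (\<lambda>x. pr (f x) (frechet_derivative g (at x) v) + pr (frechet_derivative f (at x) v) (g x))" for v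
    using Suc.prems by (intro Ck_add[OF assms(2)] Suc.IH) auto
  then show ?case
    using bounded_bilinear.FDERIV[OF assms(1) Ck_SucD[OF Suc.prems(1)] Ck_SucD[OF Suc.prems(2)]]
    by (intro Ck_SucI[OF assms(2)])
qed

lemma Ck_compose:
  assumes "open U" "open V" "f ` U \<subseteq> V" "Ck_on k V g" "Ck_on k U f"
  shows "Ck_on k U (\<lambda>x. g (f x))"
  using assms(4,5)
proof (induction k arbitrary: g)
  case 0 then show ?case using assms(3) by (auto intro: continuous_on_compose2)
next
  case (Suc k)
  let ?g' = "\<lambda>y. frechet_derivative g (at y)" and ?f' = "\<lambda>x. frechet_derivative f (at x)"
  have D: "((\<lambda>x. g (f x)) has_derivative (\<lambda>v. \<Sum>b\<in>Basis. (?f' x v \<bullet> b) *\<^sub>R ?g' (f x) b)) (at x)"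
    if x: "x \<in> U" for x
  proof -
    have gd: "(g has_derivative ?g' (f x)) (at (f x))"
      using Suc.prems(1) x assms(3) by (intro Ck_SucD) auto
    then have "linear (?g' (f x))" by (rule has_derivative_linear)
    then have "?g' (f x) w = (\<Sum>b\<in>Basis. (w \<bullet> b) *\<^sub>R ?g' (f x) b)" for w
      using linear_sum[of "?g' (f x)" "\<lambda>b. (w \<bullet> b) *\<^sub>R b" Basis]
      by (simp add: euclidean_representation linear_scale)
    then have "?g' (f x) (?f' x v) = (\<Sum>b\<in>Basis. (?f' x v \<bullet> b) *\<^sub>R ?g' (f x) b)" for v .
    then show ?thesis
      using has_derivative_compose[OF Ck_SucD[OF Suc.prems(2) x] gd] by presburger
  qed
  have "Ck_on k U (\<lambda>x. (?f' x v \<bullet> b) *\<^sub>R ?g' (f x) b)" for v b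
    using Suc.prems Suc.IH[of "\<lambda>y. ?g' y b"] Ck_Suc[OF Suc.prems(2)]
    by (intro Ck_bilinear[OF bounded_bilinear_scaleR assms(1)] Ck_bilinear[OF bounded_bilinear_inner assms(1)]
        Ck_const[OF assms(1)]) auto
  then show ?case
    by (intro Ck_SucI[OF assms(1) D] Ck_sum[OF assms(1)]) auto
qed

lemma Ck_inverse: "Ck_on k {x. x \<noteq> 0} (inverse :: real \<Rightarrow> real)"
proof (induction k)
  case 0 then show ?case by (auto intro!: continuous_on_inverse)
next
  case (Suc k)
  have o: "open {x. x \<noteq> (0::real)}" by (simp add: open_Collect_neq)
  have "(inverse has_derivative (\<lambda>v. inverse x * inverse x * (- v))) (at x)" if "x \<in> {x. x \<noteq> 0}" for x :: real
    using has_derivative_inverse'[of x UNIV] that by (simp add: mult_ac)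
  then show ?case
    by (rule Ck_SucI[OF o]) (assumption | intro Ck_bilinear[OF bounded_bilinear_mult o] Suc Ck_const o)+
qed

lemma Ck_sqrt: "Ck_on k {0<..} sqrt"
proof (induction k)
  case (Suc k)
  have o: "open {x. x \<noteq> (0::real)}" "open {0::real<..}" by (simp_all add: open_Collect_neq)
  have "(sqrt has_derivative (\<lambda>v. (inverse (sqrt x) * (1/2)) * v)) (at x)" if "x \<in> {0<..}" for x
  proof -
    have "(sqrt has_real_derivative (inverse (sqrt x) * (1/2))) (at x)"
      using DERIV_real_sqrt[of x] that by simp
    then show ?thesis by (simp only: has_field_derivative_def)
  qed
  then show ?case
    by (rule Ck_SucI[OF o(2)])
      (assumption | intro Ck_bilinear[OF bounded_bilinear_mult o(2)] Ck_const o Ck_compose[OF o(2,1) _ Ck_inverse Suc] | force)+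
qed (auto intro: continuous_intros)

lemma smooth_cong: "open U \<Longrightarrow> smooth_on U f \<Longrightarrow> (\<And>x. x \<in> U \<Longrightarrow> f x = g x) \<Longrightarrow> smooth_on U g"
  unfolding smooth_on_def by (metis Ck_cong)

lemma smooth_const: "open U \<Longrightarrow> smooth_on U (\<lambda>_. c)"
  unfolding smooth_on_def by (metis Ck_const)

lemma smooth_linear: "open U \<Longrightarrow> bounded_linear f \<Longrightarrow> smooth_on U f"
  unfolding smooth_on_def by (metis Ck_linear)

lemma smooth_compose:
  "smooth_on V g \<Longrightarrow> smooth_on U f \<Longrightarrow> f ` U \<subseteq> V \<Longrightarrow> open U \<Longrightarrow> open V \<Longrightarrow> smooth_on U (\<lambda>x. g (f x))"
  unfolding smooth_on_def by (metis Ck_compose)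

lemma smooth_add: "open U \<Longrightarrow> smooth_on U f \<Longrightarrow> smooth_on U g \<Longrightarrow> smooth_on U (\<lambda>x. f x + g x)"
  unfolding smooth_on_def by (metis Ck_add)

lemma smooth_scaleR: "open U \<Longrightarrow> smooth_on U f \<Longrightarrow> smooth_on U g \<Longrightarrow> smooth_on U (\<lambda>x. f x *\<^sub>R g x)"
  unfolding smooth_on_def using Ck_bilinear[OF bounded_bilinear_scaleR] by blast

lemma smooth_mult: "open U \<Longrightarrow> smooth_on U f \<Longrightarrow> smooth_on U g \<Longrightarrow> smooth_on U (\<lambda>x. f x * g x :: real)"
  unfolding smooth_on_def using Ck_bilinear[OF bounded_bilinear_mult] by blast

lemma smooth_linear_compose: "open U \<Longrightarrow> bounded_linear g \<Longrightarrow> smooth_on U f \<Longrightarrow> smooth_on U (\<lambda>x. g (f x))"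
  for f :: "_ \<Rightarrow> 'b::euclidean_space"
  using smooth_compose[OF smooth_linear[OF open_UNIV]] by blast

lemma smooth_minus: "open U \<Longrightarrow> smooth_on U f \<Longrightarrow> smooth_on U g \<Longrightarrow> smooth_on U (\<lambda>x. f x - g x :: real)"
  using smooth_add[of U f "\<lambda>x. - g x"] smooth_linear_compose[OF _ bounded_linear_minus[OF bounded_linear_ident]]
  by auto

lemma smooth_inverse: "open U \<Longrightarrow> smooth_on U f \<Longrightarrow> (\<And>x. x \<in> U \<Longrightarrow> f x \<noteq> 0) \<Longrightarrow> smooth_on U (\<lambda>x. inverse (f x) :: real)"
  by (rule smooth_compose[where V="{x. x \<noteq> 0}"]) (auto simp: smooth_on_def Ck_inverse open_Collect_neq)

lemma smooth_sqrt: "open U \<Longrightarrow> smooth_on U f \<Longrightarrow> (\<And>x. x \<in> U \<Longrightarrow> f x > 0) \<Longrightarrow> smooth_on U (\<lambda>x. sqrt (f x) :: real)"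
  by (rule smooth_compose[where V="{0<..}"]) (auto simp: smooth_on_def Ck_sqrt)

definition diffeo_onto :: "('a::euclidean_space \<Rightarrow> 'b::euclidean_space) \<Rightarrow> 'b set \<Rightarrow> bool" where
  "diffeo_onto f V \<longleftrightarrow> open V \<and> bij_betw f UNIV V \<and> smooth_on UNIV f \<and> smooth_on V (inv_into UNIV f)"

section \<open>Surfaces\<close>

text \<open>The universal cover of a closed oriented surface of positive genus is diffeomorphic to
  the oriented plane, so such a surface is presented by a universal covering \<open>p\<close> of \<open>S\<close> by the
  plane.  The local inverses of \<open>p\<close> are the charts; they form a smooth oriented atlas exactly when
  the deck transformations are smooth and preserve the orientation.  The deck group plays the role
  of the fundamental group of \<open>S\<close>.\<close>

type_synonym plane = "real^2"

definition deck :: "(plane \<Rightarrow> 's) \<Rightarrow> (plane \<Rightarrow> plane) set" where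
  "deck p = {\<gamma>. (\<exists>\<delta>. homeomorphism UNIV UNIV \<gamma> \<delta>) \<and> p \<circ> \<gamma> = p}"

definition closed_oriented_surface :: "'s::t2_space set \<Rightarrow> (plane \<Rightarrow> 's) \<Rightarrow> bool" where
  "closed_oriented_surface S p \<longleftrightarrow> compact S \<and> covering_space UNIV p S \<and>
     (\<forall>\<gamma>\<in>deck p. smooth_on UNIV \<gamma> \<and> (\<forall>s. det (matrix (frechet_derivative \<gamma> (at s))) > 0))"

definition has_genus :: "'s::topological_space set \<Rightarrow> nat \<Rightarrow> bool" where
  "has_genus S g \<longleftrightarrow> homology_group 1 (top_of_set S) \<cong> free_Abelian_group {..<2 * g}"

text \<open>A Borel section of the covering; integrating a deck-invariant density over it is integrating
  over the surface, whatever section is chosen.\<close>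
definition fundamental_domain :: "(plane \<Rightarrow> 's) \<Rightarrow> plane set" where
  "fundamental_domain p = (SOME D. D \<in> sets borel \<and> bij_betw p D (range p))"

section \<open>Hyperbolic and convex projective structures\<close>

text \<open>A marked structure, that is a diffeomorphism from \<open>S\<close> to a quotient \<open>X/\<Gamma>\<close>, is given by its lift
  to universal covers \<open>d : plane \<rightarrow> X\<close> (the developing map) and the holonomy \<open>r\<close> of the deck group.
  An isomorphism of quotients is induced by a group element \<open>A\<close>; an isotopy of maps from \<open>S\<close> to
  \<open>X'/\<Gamma>'\<close> lifts to an isotopy through equivariant diffeomorphisms onto \<open>X'\<close>.\<close>

type_synonym ('x, 'm) marked = "(plane \<Rightarrow> 'x) \<times> ((plane \<Rightarrow> plane) \<Rightarrow> 'm)"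

definition marked_equiv ::
  "('x::topological_space, 'm) marked set \<Rightarrow> 'm set \<Rightarrow> ('m \<Rightarrow> 'x \<Rightarrow> 'x \<Rightarrow> bool)
     \<Rightarrow> (('x, 'm) marked \<times> ('x, 'm) marked) set" where
  "marked_equiv M G moves = {((d, r), (d', r')). (d, r) \<in> M \<and> (d', r') \<in> M \<and>
     (\<exists>A\<in>G. \<exists>F::real \<Rightarrow> plane \<Rightarrow> 'x.
        continuous_on ({0..1} \<times> UNIV) (\<lambda>(t, s). F t s) \<and>
        (\<forall>s. moves A (d s) (F 0 s)) \<and> F 1 = d' \<and>
        (\<forall>t\<in>{0..1}. (F t, r') \<in> M \<and> range (F t) = range d'))}"

definition SL :: "(real^'n^'n) set" where
  "SL = {A. det A = 1}"

definition sl :: "(real^'n^'n) set" where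
  "sl = {A. trace A = 0}"

definition Ad :: "real^'n^'n \<Rightarrow> real^'n^'n \<Rightarrow> real^'n^'n" where
  "Ad A X = A ** X ** matrix_inv A"

definition upper_half_plane :: "complex set" where
  "upper_half_plane = {z. Im z > 0}"

definition mobius :: "real^2^2 \<Rightarrow> complex \<Rightarrow> complex" where
  "mobius A = moebius (of_real (A$1$1)) (of_real (A$1$2)) (of_real (A$2$1)) (of_real (A$2$2))"

text \<open>Elements of \<open>PSL(2,\<real>)\<close> are represented by matrices in \<open>SL(2,\<real>)\<close>, so the holonomy is
  multiplicative up to sign.\<close>
definition hyperbolic_structures :: "(plane \<Rightarrow> 's) \<Rightarrow> (complex, real^2^2) marked set" where
  "hyperbolic_structures p = {(d, r).
     diffeo_onto d upper_half_plane \<and>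
     (\<forall>s. Im (cnj (frechet_derivative d (at s) (axis 1 1)) * frechet_derivative d (at s) (axis 2 1)) > 0) \<and>
     (\<forall>\<gamma>\<in>deck p. r \<gamma> \<in> SL \<and> (\<forall>s. d (\<gamma> s) = mobius (r \<gamma>) (d s))) \<and>
     (\<forall>\<gamma>\<in>deck p. \<forall>\<delta>\<in>deck p. r (\<gamma> \<circ> \<delta>) = r \<gamma> ** r \<delta> \<or> r (\<gamma> \<circ> \<delta>) = - (r \<gamma> ** r \<delta>))}"

definition teichmueller_space :: "(plane \<Rightarrow> 's) \<Rightarrow> (complex, real^2^2) marked set set" where
  "teichmueller_space p = hyperbolic_structures p //
     marked_equiv (hyperbolic_structures p) SL (\<lambda>A z w. w = mobius A z)"

definition affine_point :: "plane \<Rightarrow> real^3" where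
  "affine_point x = vector [x$1, x$2, 1]"

definition proj_maps :: "real^3^3 \<Rightarrow> plane \<Rightarrow> plane \<Rightarrow> bool" where
  "proj_maps A x y \<longleftrightarrow> (\<exists>c. c \<noteq> 0 \<and> A *v affine_point x = c *\<^sub>R affine_point y)"

definition convex_structures :: "(plane \<Rightarrow> 's) \<Rightarrow> (plane, real^3^3) marked set" where
  "convex_structures p = {(d, r).
     diffeo_onto d (range d) \<and> convex (range d) \<and> bounded (range d) \<and>
     (\<forall>\<gamma>\<in>deck p. r \<gamma> \<in> SL \<and> (\<forall>s. proj_maps (r \<gamma>) (d s) (d (\<gamma> s)))) \<and>
     (\<forall>\<gamma>\<in>deck p. \<forall>\<delta>\<in>deck p. r (\<gamma> \<circ> \<delta>) = r \<gamma> ** r \<delta>)}"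

text \<open>The space \<open>\<B>(S)\<close>.\<close>
definition goldman_space :: "(plane \<Rightarrow> 's) \<Rightarrow> (plane, real^3^3) marked set set" where
  "goldman_space p = convex_structures p //
     marked_equiv (convex_structures p) SL proj_maps"

section \<open>The Teichmueller locus\<close>

text \<open>The irreducible representation \<open>\<Phi>\<close> is the action \<open>X \<mapsto> A X A\<^sup>T\<close> on symmetric matrices, in
  coordinates in which the determinant is \<open>x\<^sub>3\<^sup>2 - x\<^sub>1\<^sup>2 - x\<^sub>2\<^sup>2\<close>.  Sending \<open>z = A \<i>\<close> to \<open>A A\<^sup>T\<close> gives
  the equivariant map from the upper half plane to the Klein model in the unit disc.\<close>

definition sym_of :: "real^3 \<Rightarrow> real^2^2" where
  "sym_of x = vector [vector [x$3 + x$1, x$2], vector [x$2, x$3 - x$1]]"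

definition coords_of :: "real^2^2 \<Rightarrow> real^3" where
  "coords_of M = vector [(M$1$1 - M$2$2) / 2, M$1$2, (M$1$1 + M$2$2) / 2]"

definition Phi :: "real^2^2 \<Rightarrow> real^3^3" where
  "Phi A = matrix (\<lambda>x. coords_of (A ** sym_of x ** transpose A))"

definition dPhi :: "real^2^2 \<Rightarrow> real^3^3" where
  "dPhi = frechet_derivative Phi (at (mat 1))"

definition klein :: "complex \<Rightarrow> plane" where
  "klein z = vector [((cmod z)\<^sup>2 - 1) / ((cmod z)\<^sup>2 + 1), 2 * Re z / ((cmod z)\<^sup>2 + 1)]"

definition teich_embedding :: "(complex, real^2^2) marked \<Rightarrow> (plane, real^3^3) marked" where
  "teich_embedding = (\<lambda>(d, r). (klein \<circ> d, Phi \<circ> r))"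

lemma Phi_mult_vec: "Phi A *v x = coords_of (A ** sym_of x ** transpose A)"
proof -
  have "linear (\<lambda>x. coords_of (A ** sym_of x ** transpose A))"
    by (rule linearI)
      (simp_all add: vec_eq_iff forall_3 coords_of_def sym_of_def matrix_matrix_mult_def transpose_def sum_2 algebra_simps
        add_divide_distrib diff_divide_distrib)
  then show ?thesis unfolding Phi_def by (simp add: matrix_works linear_matrix_vector_mul_eq)
qed

lemma sym_of_coords_of:
  assumes "transpose M = M"
  shows "sym_of (coords_of M) = M"
proof -
  have "M$1$2 = M$2$1"
    using arg_cong[OF assms, of "\<lambda>M. M$2$1"] by (simp add: transpose_def)
  then show ?thesis
    unfolding vec_eq_iff forall_2 by (simp add: coords_of_def sym_of_def diff_divide_distrib add_divide_distrib)
qed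

lemma transpose_sym_of: "transpose (sym_of x) = sym_of x"
  by (simp add: vec_eq_iff forall_2 sym_of_def transpose_def)

lemma Phi_mult: "Phi (A ** B) = Phi A ** Phi B"
proof -
  have "Phi (A ** B) *v x = Phi A *v (Phi B *v x)" for x
  proof -
    have "transpose (B ** sym_of x ** transpose B) = B ** sym_of x ** transpose B"
      by (simp add: matrix_transpose_mul transpose_sym_of matrix_mul_assoc)
    then have "Phi A *v (Phi B *v x) = coords_of (A ** (B ** sym_of x ** transpose B) ** transpose A)"
      by (simp add: Phi_mult_vec sym_of_coords_of)
    then show ?thesis by (simp add: Phi_mult_vec matrix_transpose_mul matrix_mul_assoc)
  qed
  then show ?thesis by (simp add: matrix_eq matrix_vector_mul_assoc)
qed

lemma Phi_uminus: "Phi (- A) = Phi A"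
  unfolding matrix_eq Phi_mult_vec
  by (simp add: vec_eq_iff forall_3 coords_of_def sym_of_def matrix_matrix_mult_def transpose_def sum_2
      algebra_simps add_divide_distrib diff_divide_distrib)

lemma det_Phi: "det (Phi A) = det A ^ 3"
proof -
  define a b c d where abcd': "a = A$1$1" "b = A$1$2" "c = A$2$1" "d = A$2$2"
  note abcd = abcd'[symmetric]
  have v: "Phi A *v x = vector
      [((a\<^sup>2 - b\<^sup>2 - c\<^sup>2 + d\<^sup>2) * x$1 + 2 * (a * b - c * d) * x$2 + (a\<^sup>2 + b\<^sup>2 - c\<^sup>2 - d\<^sup>2) * x$3) / 2,
       (a * c - b * d) * x$1 + (a * d + b * c) * x$2 + (a * c + b * d) * x$3,
       ((a\<^sup>2 - b\<^sup>2 + c\<^sup>2 - d\<^sup>2) * x$1 + 2 * (a * b + c * d) * x$2 + (a\<^sup>2 + b\<^sup>2 + c\<^sup>2 + d\<^sup>2) * x$3) / 2]" for x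
    unfolding Phi_mult_vec vec_eq_iff forall_3
    by (simp add: coords_of_def sym_of_def matrix_matrix_mult_def transpose_def sum_2 abcd, 
      simp add: power2_eq_square algebra_simps)
  have m: "Phi A $ i $ j = (Phi A *v axis j 1) $ i" for i j
    by (simp add: matrix_vector_mult_basis column_def)
  show ?thesis
    unfolding det_3 det_2 m v abcd
    by (simp add: axis_def, simp add: field_simps power2_eq_square power3_eq_cube)
qed

lemma klein_mobius:
  assumes "A \<in> SL" "Im z > 0"
  shows "proj_maps (Phi A) (klein z) (klein (mobius A z))"
proof -
  define x y where "x = Re z" "y = Im z"
  then have z: "z = Complex x y" by simp
  define a b c d where "a = A$1$1" "b = A$1$2" "c = A$2$1" "d = A$2$2"
  note abcd = this
  define q where "q = (c * x + d)\<^sup>2 + (c * y)\<^sup>2"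
  have y: "y > 0" using assms z by simp
  have det: "a * d - b * c = 1" using assms(1) by (simp add: SL_def det_2 abcd)
  have q: "q > 0"
  proof (cases "c = 0")
    case True
    then have "d \<noteq> 0" using det by auto
    then show ?thesis using True by (simp add: q_def)
  next
    case False then show ?thesis using y by (simp add: q_def sum_power2_gt_zero_iff)
  qed
  define w where "w = mobius A z"
  have w: "w = Complex (((a * x + b) * (c * x + d) + a * c * y\<^sup>2) / q) (y / q)"
  proof -
    have "y = (a * d - b * c) * y" using det by simp
    then show ?thesis
    unfolding w_def mobius_def moebius_def z
    by (simp add: complex_eq_iff abcd[symmetric] Re_divide Im_divide q_def, simp add: power2_eq_square algebra_simps)
  qed
  have nw: "(cmod w)\<^sup>2 = ((a * x + b)\<^sup>2 + (a * y)\<^sup>2) / q"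
  proof -
    have "(cmod w)\<^sup>2 = (((a * x + b) * (c * x + d) + a * c * y\<^sup>2)\<^sup>2 + y\<^sup>2) / q\<^sup>2"
      unfolding w cmod_power2 complex.sel power_divide by (rule add_divide_distrib[symmetric])
    also have "((a * x + b) * (c * x + d) + a * c * y\<^sup>2)\<^sup>2 + y\<^sup>2
        = ((a * x + b) * (c * x + d) + a * c * y\<^sup>2)\<^sup>2 + (a * d - b * c)\<^sup>2 * y\<^sup>2" using det by simp
    also have "\<dots> = ((a * x + b)\<^sup>2 + (a * y)\<^sup>2) * q"
      unfolding q_def by (simp add: power2_eq_square algebra_simps)
    finally show ?thesis using q by (simp add: power2_eq_square)
  qed
  define N R where "N = (a * x + b)\<^sup>2 + (a * y)\<^sup>2" and "R = (a * x + b) * (c * x + d) + a * c * y\<^sup>2"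
  define P where "P u = (vector [((cmod u)\<^sup>2 - 1) / 2, Re u, ((cmod u)\<^sup>2 + 1) / 2] :: real^3)" for u
  have pos: "(cmod u)\<^sup>2 + 1 > 0" for u
    using zero_le_power2[of "cmod u"] by linarith
  have P: "P u = (((cmod u)\<^sup>2 + 1) / 2) *\<^sub>R affine_point (klein u)" for u
    using pos[of u] by (simp add: P_def vec_eq_iff forall_3 affine_point_def klein_def)
  have "q *\<^sub>R P w = vector [(N - q) / 2, R, (N + q) / 2]"
  proof -
    have "q * ((N / q - 1) / 2) = (N - q) / 2" "q * ((N / q + 1) / 2) = (N + q) / 2" "q * (R / q) = R"
      using q by (simp_all add: diff_divide_distrib right_diff_distrib distrib_left add_divide_distrib)
    moreover have "Re w = R / q" "(cmod w)\<^sup>2 = N / q"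
      by (simp add: w R_def) (simp only: nw N_def)
    ultimately show ?thesis
      unfolding P_def by (simp add: vec_eq_iff forall_3)
  qed
  also have "\<dots> = coords_of (A ** sym_of (P z) ** transpose A)"
    unfolding vec_eq_iff forall_3 P_def z cmod_power2 N_def R_def q_def
    by (simp add: coords_of_def sym_of_def matrix_matrix_mult_def transpose_def sum_2 abcd[symmetric],
        simp add: power2_eq_square field_simps)
  finally have "Phi A *v P z = q *\<^sub>R P w" by (simp add: Phi_mult_vec)
  then have "(((cmod z)\<^sup>2 + 1) / 2) *\<^sub>R (Phi A *v affine_point (klein z))
      = (q * ((cmod w)\<^sup>2 + 1) / 2) *\<^sub>R affine_point (klein w)"
    unfolding P by (simp add: matrix_vector_mult_scaleR)
  then have "Phi A *v affine_point (klein z)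
      = (inverse (((cmod z)\<^sup>2 + 1) / 2) * (q * ((cmod w)\<^sup>2 + 1) / 2)) *\<^sub>R affine_point (klein w)"
    using pos[of z] by (metis (no_types) divide_pos_pos less_numeral_extra(3) scaleR_scaleR scaleR_one
        left_inverse zero_less_numeral)
  moreover have "inverse (((cmod z)\<^sup>2 + 1) / 2) * (q * ((cmod w)\<^sup>2 + 1) / 2) \<noteq> 0"
    using q pos[of z] pos[of w] by simp
  ultimately show ?thesis unfolding proj_maps_def w_def by blast
qed


definition disc :: "plane set" where
  "disc = {x. (x$1)\<^sup>2 + (x$2)\<^sup>2 < 1}"

definition klein_inv :: "plane \<Rightarrow> complex" where
  "klein_inv x = Complex (x$2 / (1 - x$1)) (sqrt (1 - (x$1)\<^sup>2 - (x$2)\<^sup>2) / (1 - x$1))"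

lemma disc_ball: "disc = ball 0 1"
  by (auto simp: disc_def norm_vec_def L2_set_def sum_2)

lemma disc_less1: assumes "x \<in> disc" shows "x$1 < 1"
proof -
  have "(x$1)\<^sup>2 < 1" using assms zero_le_power2[of "x$2"] unfolding disc_def mem_Collect_eq by linarith
  then show ?thesis using abs_square_less_1[of "x$1"] by linarith
qed

lemma klein_disc:
  assumes "z \<in> upper_half_plane"
  shows "klein z \<in> disc" "klein_inv (klein z) = z"
proof -
  define x y m where "x = Re z" "y = Im z" "m = (cmod z)\<^sup>2 + 1"
  note d = this
  have y: "y > 0" using assms by (simp add: upper_half_plane_def d)
  have m: "m = x\<^sup>2 + y\<^sup>2 + 1" by (simp add: d cmod_power2)
  have m0: "m > 0" unfolding m using zero_le_power2[of x] zero_le_power2[of y] by linarith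
  have k: "klein z $ 1 = (m - 2) / m" "klein z $ 2 = 2 * x / m" by (simp_all add: klein_def d)
  have "1 - (klein z $ 1)\<^sup>2 - (klein z $ 2)\<^sup>2 = (m\<^sup>2 - (m - 2)\<^sup>2 - (2 * x)\<^sup>2) / m\<^sup>2"
    unfolding k power_divide using m0 by (simp add: divide_simps)
  also have "m\<^sup>2 - (m - 2)\<^sup>2 - (2 * x)\<^sup>2 = (2 * y)\<^sup>2"
    unfolding m by (simp add: power2_eq_square algebra_simps)
  finally have e: "1 - (klein z $ 1)\<^sup>2 - (klein z $ 2)\<^sup>2 = (2 * y / m)\<^sup>2" by (simp add: power_divide)
  have pos: "2 * y / m > 0" using y m0 by simp
  have "(2 * y / m)\<^sup>2 > 0" using zero_less_power[OF pos] .
  then show "klein z \<in> disc" unfolding disc_def mem_Collect_eq using e by linarith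
  have s: "sqrt (1 - (klein z $ 1)\<^sup>2 - (klein z $ 2)\<^sup>2) = 2 * y / m" unfolding e real_sqrt_abs by (rule abs_of_pos[OF pos])
  have "1 - klein z $ 1 = 2 / m" unfolding k using m0 by (simp add: field_simps)
  then show "klein_inv (klein z) = z"
    unfolding klein_inv_def s unfolding k using m0 by (simp add: complex_eq_iff d)
qed

lemma klein_inv:
  assumes "x \<in> disc"
  shows "klein_inv x \<in> upper_half_plane" "klein (klein_inv x) = x"
proof -
  define u v where "u = x$1" "v = x$2"
  note d = this
  have u: "1 - u > 0" using disc_less1[OF assms] by (simp add: d)
  have p: "1 - u\<^sup>2 - v\<^sup>2 > 0" using assms by (simp add: disc_def d)
  show "klein_inv x \<in> upper_half_plane"
    using u p by (simp add: klein_inv_def upper_half_plane_def d)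
  have "(cmod (klein_inv x))\<^sup>2 = (v\<^sup>2 + (1 - u\<^sup>2 - v\<^sup>2)) / (1 - u)\<^sup>2"
    unfolding klein_inv_def cmod_power2 complex.sel power_divide d[symmetric] real_sqrt_pow2[OF less_imp_le[OF p]]
    by (rule add_divide_distrib[symmetric])
  also have "\<dots> = (1 + u) / (1 - u)"
    using u by (simp add: divide_simps, simp add: power2_eq_square algebra_simps)
  finally have n: "(cmod (klein_inv x))\<^sup>2 = (1 + u) / (1 - u)" .
  then have n1: "(cmod (klein_inv x))\<^sup>2 + 1 = 2 / (1 - u)" "(cmod (klein_inv x))\<^sup>2 - 1 = 2 * u / (1 - u)"
    using u by (simp_all add: field_simps)
  show "klein (klein_inv x) = x"
    unfolding klein_def n1 using u by (simp add: vec_eq_iff forall_2 klein_inv_def d)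
qed

lemma range_klein:
  assumes "diffeo_onto d upper_half_plane"
  shows "range (klein \<circ> d) = disc"
proof -
  have "range d = upper_half_plane" using assms by (auto simp: diffeo_onto_def bij_betw_def)
  then have "range (klein \<circ> d) = klein ` upper_half_plane" by (metis image_comp)
  also have "\<dots> = disc" using klein_disc(1) klein_inv by (force intro: image_eqI[where x="klein_inv _"])
  finally show ?thesis .
qed


lemma diffeo_klein:
  assumes d: "diffeo_onto d upper_half_plane"
  shows "diffeo_onto (klein \<circ> d) disc"
proof -
  have o: "open upper_half_plane" "open disc"
    using d by (simp_all add: diffeo_onto_def disc_ball)
  have bij: "bij_betw d UNIV upper_half_plane" and sm: "smooth_on UNIV d" "smooth_on upper_half_plane (inv_into UNIV d)"
    using d by (simp_all add: diffeo_onto_def)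
  have bk: "bij_betw klein upper_half_plane disc"
    using klein_disc klein_inv by (intro bij_betw_byWitness[where f'=klein_inv]) auto
  have b: "bij_betw (klein \<circ> d) UNIV disc" using bij_betw_trans[OF bij bk] .
  have e: "vector [p, q] = p *\<^sub>R axis 1 1 + q *\<^sub>R (axis 2 1 :: plane)" for p q
    by (simp add: vec_eq_iff forall_2 axis_def)
  have e': "Complex p q = p *\<^sub>R 1 + q *\<^sub>R \<i>" for p q
    by (simp add: complex_eq_iff)
  have cm: "smooth_on UNIV (\<lambda>z. (cmod z)\<^sup>2)"
    unfolding cmod_power2 unfolding power2_eq_square
    by (intro smooth_add smooth_mult smooth_linear bounded_linear_Re bounded_linear_Im open_UNIV)
  have pos: "(cmod z)\<^sup>2 + 1 \<noteq> 0" for z using zero_le_power2[of "cmod z"] by linarith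
  have k: "smooth_on UNIV klein"
    unfolding klein_def[abs_def] e divide_inverse
    by (intro smooth_add smooth_scaleR smooth_mult smooth_inverse smooth_minus smooth_const smooth_linear
        bounded_linear_Re cm open_UNIV pos)
  have nz: "1 - x$1 \<noteq> 0" "1 - x$1 * x$1 - x$2 * x$2 > 0" if "x \<in> disc" for x
    using disc_less1[OF that] that by (auto simp: disc_def power2_eq_square)
  have ki: "smooth_on disc klein_inv"
    unfolding klein_inv_def[abs_def] e' divide_inverse power2_eq_square
    by (intro smooth_add smooth_scaleR smooth_mult smooth_inverse smooth_sqrt smooth_minus smooth_const smooth_linear
        bounded_linear_vec_nth o nz)
  have "smooth_on disc (\<lambda>x. inv_into UNIV d (klein_inv x))"
    using klein_inv(1) by (intro smooth_compose[OF sm(2) ki _ o(2,1)]) auto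
  moreover have "inv_into UNIV d (klein_inv x) = inv_into UNIV (klein \<circ> d) x" if "x \<in> disc" for x
  proof (rule inv_into_f_eq[symmetric])
    show "inj (klein \<circ> d)" using b by (simp add: bij_betw_def)
    show "(klein \<circ> d) (inv_into UNIV d (klein_inv x)) = x"
      using that klein_inv bij by (simp add: bij_betw_def f_inv_into_f)
  qed simp
  ultimately have "smooth_on disc (inv_into UNIV (klein \<circ> d))" by (rule smooth_cong[OF o(2)])
  moreover have "smooth_on UNIV (klein \<circ> d)"
    using smooth_compose[OF k sm(1)] by (simp add: comp_def)
  ultimately show ?thesis using b o unfolding diffeo_onto_def by blast
qed

lemma teich_embedding_convex:
  assumes "X \<in> hyperbolic_structures p"
  shows "teich_embedding X \<in> convex_structures p"
proof -
  obtain d r where X: "X = (d, r)" by (cases X)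
  have d: "diffeo_onto d upper_half_plane" using assms by (simp add: X hyperbolic_structures_def)
  have up: "Im (d s) > 0" for s
    using d by (auto simp: diffeo_onto_def bij_betw_def upper_half_plane_def)
  have "det (Phi (r \<gamma>)) = 1" if "r \<gamma> \<in> SL" for \<gamma> using that by (simp add: det_Phi SL_def)
  moreover have "Phi (r (\<gamma> \<circ> \<delta>)) = Phi (r \<gamma>) ** Phi (r \<delta>)"
    if "r (\<gamma> \<circ> \<delta>) = r \<gamma> ** r \<delta> \<or> r (\<gamma> \<circ> \<delta>) = - (r \<gamma> ** r \<delta>)" for \<gamma> \<delta>
    using that by (auto simp: Phi_mult Phi_uminus)
  ultimately show ?thesis
    using assms diffeo_klein[OF d] range_klein[OF d] klein_mobius[OF _ up]
    by (simp add: X teich_embedding_def convex_structures_def hyperbolic_structures_def disc_ball SL_def comp_def)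
qed


lemma teich_embedding_goldman_space:
  assumes "T \<in> teichmueller_space p" "X \<in> T"
  shows "\<exists>B\<in>goldman_space p. teich_embedding X \<in> B"
proof -
  have "X \<in> hyperbolic_structures p"
    using assms by (auto simp: teichmueller_space_def quotient_def marked_equiv_def)
  then have Y: "teich_embedding X \<in> convex_structures p" by (rule teich_embedding_convex)
  obtain d r where dr: "teich_embedding X = (d, r)" by (cases "teich_embedding X")
  have "continuous_on UNIV d"
    using Y unfolding dr convex_structures_def diffeo_onto_def smooth_on_def by (auto dest: spec[where x=0])
  then have "continuous_on ({0..1} \<times> UNIV) (\<lambda>(t::real, s). d s)"
    by (auto simp: case_prod_beta intro!: continuous_intros continuous_on_subset[of UNIV d] elim: continuous_on_compose2)
  moreover have "mat 1 \<in> SL" "proj_maps (mat 1) x x" for x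
    by (auto simp: SL_def proj_maps_def intro: exI[where x=1])
  ultimately have "((d, r), (d, r)) \<in> marked_equiv (convex_structures p) SL proj_maps"
    using Y unfolding marked_equiv_def dr by (auto intro!: bexI[where x="mat 1"] exI[where x="\<lambda>_. d"])
  then show ?thesis
    using Y unfolding goldman_space_def dr by (blast intro: quotientI)
qed

section \<open>Forms with values in the flat bundle\<close>

text \<open>Forms on \<open>S\<close> with values in the flat adjoint bundle are equivariant forms on the universal cover.
  A \<open>k\<close>-form takes a point and \<open>k\<close> tangent vectors.\<close>

type_synonym 'v form1 = "plane \<Rightarrow> plane \<Rightarrow> 'v"
type_synonym 'v form2 = "plane \<Rightarrow> plane \<Rightarrow> plane \<Rightarrow> 'v"

definition bundle_sections ::
  "(plane \<Rightarrow> 's) \<Rightarrow> ((plane \<Rightarrow> plane) \<Rightarrow> real^'n^'n) \<Rightarrow> (plane \<Rightarrow> real^'n^'n) set" where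
  "bundle_sections p r = {f. smooth_on UNIV f \<and> range f \<subseteq> sl \<and>
     (\<forall>\<gamma>\<in>deck p. \<forall>s. f (\<gamma> s) = Ad (r \<gamma>) (f s))}"

definition bundle_forms1 ::
  "(plane \<Rightarrow> 's) \<Rightarrow> ((plane \<Rightarrow> plane) \<Rightarrow> real^'n^'n) \<Rightarrow> (real^'n^'n) form1 set" where
  "bundle_forms1 p r = {\<alpha>. (\<forall>s. linear (\<alpha> s) \<and> range (\<alpha> s) \<subseteq> sl) \<and>
     (\<forall>v. smooth_on UNIV (\<lambda>s. \<alpha> s v)) \<and>
     (\<forall>\<gamma>\<in>deck p. \<forall>s v. \<alpha> (\<gamma> s) (frechet_derivative \<gamma> (at s) v) = Ad (r \<gamma>) (\<alpha> s v))}"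

definition d0 :: "(plane \<Rightarrow> 'v::real_normed_vector) \<Rightarrow> 'v form1" where
  "d0 f s v = frechet_derivative f (at s) v"

definition d1 :: "'v::real_normed_vector form1 \<Rightarrow> 'v form2" where
  "d1 \<alpha> s v w = frechet_derivative (\<lambda>t. \<alpha> t w) (at s) v - frechet_derivative (\<lambda>t. \<alpha> t v) (at s) w"

definition closed_forms1 ::
  "(plane \<Rightarrow> 's) \<Rightarrow> ((plane \<Rightarrow> plane) \<Rightarrow> real^'n^'n) \<Rightarrow> (real^'n^'n) form1 set" where
  "closed_forms1 p r = {\<alpha> \<in> bundle_forms1 p r. \<forall>s v w. d1 \<alpha> s v w = 0}"

definition cohomologous ::
  "(plane \<Rightarrow> 's) \<Rightarrow> ((plane \<Rightarrow> plane) \<Rightarrow> real^'n^'n) \<Rightarrow> ((real^'n^'n) form1 \<times> (real^'n^'n) form1) set" where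
  "cohomologous p r = {(\<alpha>, \<beta>). \<alpha> \<in> closed_forms1 p r \<and> \<beta> \<in> closed_forms1 p r \<and>
     (\<exists>f\<in>bundle_sections p r. \<forall>s v. \<beta> s v - \<alpha> s v = d0 f s v)}"

text \<open>For the holonomy \<open>r\<close> of a convex projective structure this is the tangent space of \<open>\<B>(S)\<close>, for
  that of a hyperbolic structure the tangent space of Teichmueller space.\<close>
definition H1 ::
  "(plane \<Rightarrow> 's) \<Rightarrow> ((plane \<Rightarrow> plane) \<Rightarrow> real^'n^'n) \<Rightarrow> (real^'n^'n) form1 set set" where
  "H1 p r = closed_forms1 p r // cohomologous p r"

text \<open>The differential of the embedding: \<open>r \<mapsto> \<Phi> \<circ> r\<close> induces composition with \<open>d\<Phi>\<close> on classes.\<close>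
definition d_teich_embedding ::
  "(plane \<Rightarrow> 's) \<Rightarrow> (complex, real^2^2) marked \<Rightarrow> (real^2^2) form1 set \<Rightarrow> (real^3^3) form1 set" where
  "d_teich_embedding p X u =
     cohomologous p (snd (teich_embedding X)) `` ((\<lambda>\<alpha> s v. dPhi (\<alpha> s v)) ` u)"

section \<open>Hodge theory\<close>

text \<open>\<open>G s\<close> is the matrix of a Riemannian metric on the plane.  On one-forms
  \<open>(*\<alpha>)\<^sub>j = sqrt (det G) G\<^bsup>ki\<^esup> \<alpha>\<^sub>i \<epsilon>\<^sub>k\<^sub>j\<close>, the solution of \<open>\<alpha> \<and> *\<beta> = \<langle>\<alpha>, \<beta>\<rangle> dvol\<close>.\<close>

definition area :: "plane \<Rightarrow> plane \<Rightarrow> real" where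
  "area v w = v$1 * w$2 - v$2 * w$1"

definition star1 :: "(plane \<Rightarrow> real^2^2) \<Rightarrow> 'v::real_vector form1 \<Rightarrow> 'v form1" where
  "star1 G \<alpha> s v = sqrt (det (G s)) *\<^sub>R
     (\<Sum>i\<in>UNIV. \<Sum>k\<in>UNIV. (matrix_inv (G s) $ k $ i * area (axis k 1) v) *\<^sub>R \<alpha> s (axis i 1))"

definition star2 :: "(plane \<Rightarrow> real^2^2) \<Rightarrow> 'v::real_vector form2 \<Rightarrow> (plane \<Rightarrow> 'v)" where
  "star2 G \<omega> s = (1 / sqrt (det (G s))) *\<^sub>R \<omega> s (axis 1 1) (axis 2 1)"

text \<open>Forms with values in the dual bundle are written as families of scalar forms indexed by
  \<open>B \<in> sl\<close>; the flat derivative acts for each fixed \<open>B\<close>.\<close>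

definition sharp_inv :: "(plane \<Rightarrow> real^3^3 \<Rightarrow> real^3^3 \<Rightarrow> real) \<Rightarrow> plane \<Rightarrow> (real^3^3 \<Rightarrow> real) \<Rightarrow> real^3^3" where
  "sharp_inv l s w = (THE A. A \<in> sl \<and> (\<forall>B\<in>sl. l s B A = w B))"

text \<open>\<open>\<delta> = - \<sharp>\<inverse> *\<inverse> d * \<sharp>\<close>.  The inverse of the star from functions to two-forms is \<open>star2\<close>; the
  inverse of the star on one-forms is its negative.  With this sign \<open>\<delta>\<close> on two-forms is minus the adjoint
  of \<open>d\<close>; the kernel of the Laplacian on one-forms is the same for either sign.\<close>

definition delta1 ::
  "(plane \<Rightarrow> real^2^2) \<Rightarrow> (plane \<Rightarrow> real^3^3 \<Rightarrow> real^3^3 \<Rightarrow> real) \<Rightarrow> (real^3^3) form1 \<Rightarrow> (plane \<Rightarrow> real^3^3)" where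
  "delta1 G l \<alpha> s = - sharp_inv l s (\<lambda>B. star2 G (d1 (star1 G (\<lambda>t v. l t B (\<alpha> t v)))) s)"

definition delta2 ::
  "(plane \<Rightarrow> real^2^2) \<Rightarrow> (plane \<Rightarrow> real^3^3 \<Rightarrow> real^3^3 \<Rightarrow> real) \<Rightarrow> (real^3^3) form2 \<Rightarrow> (real^3^3) form1" where
  "delta2 G l \<omega> s v =
     - sharp_inv l s (\<lambda>B. - star1 G (d0 (star2 G (\<lambda>t v w. l t B (\<omega> t v w)))) s v)"

definition laplacian ::
  "(plane \<Rightarrow> real^2^2) \<Rightarrow> (plane \<Rightarrow> real^3^3 \<Rightarrow> real^3^3 \<Rightarrow> real) \<Rightarrow> (real^3^3) form1 \<Rightarrow> (real^3^3) form1" where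
  "laplacian G l \<alpha> s v = d0 (delta1 G l \<alpha>) s v + delta2 G l (d1 \<alpha>) s v"

definition form_product ::
  "(plane \<Rightarrow> 's) \<Rightarrow> (plane \<Rightarrow> real^2^2) \<Rightarrow> (plane \<Rightarrow> real^3^3 \<Rightarrow> real^3^3 \<Rightarrow> real) \<Rightarrow>
     (real^3^3) form1 \<Rightarrow> (real^3^3) form1 \<Rightarrow> real" where
  "form_product p G l \<alpha> \<beta> = (LINT s:fundamental_domain p|lborel.
     l s (\<alpha> s (axis 1 1)) (star1 G \<beta> s (axis 2 1)) - l s (\<alpha> s (axis 2 1)) (star1 G \<beta> s (axis 1 1)))"

definition harmonic_rep ::
  "(plane \<Rightarrow> real^2^2) \<Rightarrow> (plane \<Rightarrow> real^3^3 \<Rightarrow> real^3^3 \<Rightarrow> real) \<Rightarrow> (real^3^3) form1 set \<Rightarrow> (real^3^3) form1" where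
  "harmonic_rep G l a = (THE \<xi>. \<xi> \<in> a \<and> (\<forall>s v. laplacian G l \<xi> s v = 0))"

definition L2_metric ::
  "(plane \<Rightarrow> 's) \<Rightarrow> (plane \<Rightarrow> real^2^2) \<Rightarrow> (plane \<Rightarrow> real^3^3 \<Rightarrow> real^3^3 \<Rightarrow> real) \<Rightarrow>
     (real^3^3) form1 set \<Rightarrow> (real^3^3) form1 set \<Rightarrow> real" where
  "L2_metric p G l a b = form_product p G l (harmonic_rep G l a) (harmonic_rep G l b)"

section \<open>The Loftin metric and the DG metric\<close>

definition cone :: "plane set \<Rightarrow> (real^3) set" where
  "cone \<Omega> = {t *\<^sub>R affine_point x | t x. t > 0 \<and> x \<in> \<Omega>}"

definition hessian :: "(real^3 \<Rightarrow> real) \<Rightarrow> real^3 \<Rightarrow> real^3^3" where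
  "hessian f x = (\<chi> i j. frechet_derivative (\<lambda>y. frechet_derivative f (at y) (axis j 1)) (at x) (axis i 1))"

definition tensor_product_metric :: "real^3^3 \<Rightarrow> real^3^3 \<Rightarrow> real^3^3 \<Rightarrow> real" where
  "tensor_product_metric H A B = (\<Sum>i\<in>UNIV. \<Sum>j\<in>UNIV. \<Sum>k\<in>UNIV. \<Sum>l\<in>UNIV.
     A$i$j * B$k$l * H$i$k * matrix_inv H $ j $ l)"

definition pullback_metric :: "(real^3 \<Rightarrow> real^3^3) \<Rightarrow> (plane \<Rightarrow> real^3) \<Rightarrow> plane \<Rightarrow> real^2^2" where
  "pullback_metric H m s = (\<chi> i j.
     frechet_derivative m (at s) (axis i 1) \<bullet> (H (m s) *v frechet_derivative m (at s) (axis j 1)))"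

text \<open>\<open>H\<close> is a metric on the cone and \<open>m\<close> the developing map into a level hypersurface.\<close>
definition hypersurface_metric ::
  "(plane \<Rightarrow> 's) \<Rightarrow> (real^3 \<Rightarrow> real^3^3) \<Rightarrow> (plane \<Rightarrow> real^3) \<Rightarrow>
     (real^3^3) form1 set \<Rightarrow> (real^3^3) form1 set \<Rightarrow> real" where
  "hypersurface_metric p H m =
     L2_metric p (pullback_metric H m) (\<lambda>s. tensor_product_metric (H (m s)))"

definition cheng_yau_metric :: "(real^3 \<Rightarrow> real) \<Rightarrow> real^3 \<Rightarrow> real^3^3" where
  "cheng_yau_metric \<sigma> x = (1/3) *\<^sub>R hessian (\<lambda>y. ln (\<sigma> y)) x"

text \<open>The equation and the blow-up at \<open>\<partial>C\<close> impose nothing at infinity and have further solutions: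
  on the light cone, functions \<open>exp (F \<tau>)\<close> of Lorentzian length \<open>\<tau>\<close> with \<open>F'' F'\<^sup>2 = 27 \<tau>\<^sup>2 exp (2 F)\<close>
  form a family of solutions besides \<open>\<tau>\<^bsup>-3\<^esup>\<close>.  The Cheng-Yau solution is the one whose metric
  is invariant under the linear automorphisms of the cone.\<close>
definition cheng_yau_potential :: "(real^3) set \<Rightarrow> (real^3 \<Rightarrow> real) \<Rightarrow> bool" where
  "cheng_yau_potential C \<sigma> \<longleftrightarrow> smooth_on C \<sigma> \<and> (\<forall>x\<in>C. \<sigma> x > 0) \<and>
     (\<forall>x\<in>C. \<forall>y\<in>C. \<forall>t. x \<noteq> y \<and> 0 < t \<and> t < 1 \<longrightarrow>
        \<sigma> ((1 - t) *\<^sub>R x + t *\<^sub>R y) < (1 - t) * \<sigma> x + t * \<sigma> y) \<and>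
     (\<forall>x\<in>C. det (cheng_yau_metric \<sigma> x) = (\<sigma> x)\<^sup>2) \<and>
     (\<forall>y\<in>frontier C. filterlim \<sigma> at_top (at y within C)) \<and>
     (\<forall>A. (*v) A ` C = C \<longrightarrow>
        (\<forall>x\<in>C. transpose A ** cheng_yau_metric \<sigma> (A *v x) ** A = cheng_yau_metric \<sigma> x))"

definition cheng_yau :: "(real^3) set \<Rightarrow> real^3 \<Rightarrow> real" where
  "cheng_yau C = (SOME \<sigma>. cheng_yau_potential C \<sigma>)"

text \<open>The inverse of the radial projection of the affine sphere \<open>\<sigma> = 1\<close>.\<close>
definition affine_sphere_map :: "(real^3 \<Rightarrow> real) \<Rightarrow> plane \<Rightarrow> real^3" where
  "affine_sphere_map \<sigma> x = (THE y. \<sigma> y = 1 \<and> (\<exists>t>0. y = t *\<^sub>R affine_point x))"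

definition loftin_metric ::
  "(plane \<Rightarrow> 's) \<Rightarrow> (plane, real^3^3) marked \<Rightarrow> (real^3^3) form1 set \<Rightarrow> (real^3^3) form1 set \<Rightarrow> real" where
  "loftin_metric p X = (let d = fst X; \<sigma> = cheng_yau (cone (range d)) in
     hypersurface_metric p (cheng_yau_metric \<sigma>) (affine_sphere_map \<sigma> \<circ> d))"

definition dual_cone :: "(real^3) set \<Rightarrow> (real^3) set" where
  "dual_cone C = {\<psi>. \<forall>x\<in>C. \<psi> \<bullet> x > 0}"

definition koszul_vinberg :: "(real^3) set \<Rightarrow> real^3 \<Rightarrow> real" where
  "koszul_vinberg C x = (LINT \<psi>:dual_cone C|lborel. exp (- (\<psi> \<bullet> x)))"

definition dg_metric ::
  "(plane \<Rightarrow> 's) \<Rightarrow> (plane, real^3^3) marked \<Rightarrow> (real^3^3) form1 set \<Rightarrow> (real^3^3) form1 set \<Rightarrow> real" where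
  "dg_metric p X = (let d = fst X; k = koszul_vinberg (cone (range d)) in
     hypersurface_metric p (hessian (\<lambda>y. ln (k y)))
       (\<lambda>s. root 3 (k (affine_point (d s))) *\<^sub>R affine_point (d s)))"

section \<open>The Weil-Petersson metric\<close>

definition quadratic_differentials ::
  "(plane \<Rightarrow> 's) \<Rightarrow> (complex, real^2^2) marked \<Rightarrow> (complex \<Rightarrow> complex) set" where
  "quadratic_differentials p X = {\<phi>. \<phi> holomorphic_on upper_half_plane \<and>
     (\<forall>\<gamma>\<in>deck p. \<forall>z\<in>upper_half_plane.
        \<phi> (mobius (snd X \<gamma>) z) * (deriv (mobius (snd X \<gamma>)) z)\<^sup>2 = \<phi> z)}"

definition wp_cometric ::
  "(plane \<Rightarrow> 's) \<Rightarrow> (complex, real^2^2) marked \<Rightarrow> (complex \<Rightarrow> complex) \<Rightarrow> (complex \<Rightarrow> complex) \<Rightarrow> real" where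
  "wp_cometric p X \<phi> \<psi> =
     Re (LINT z:fst X ` fundamental_domain p|lborel. \<phi> z * cnj (\<psi> z) * of_real ((Im z)\<^sup>2))"

text \<open>The vector field \<open>z \<mapsto> d/dt (exp (t A) z)\<close> on the upper half plane.\<close>
definition killing_field :: "real^2^2 \<Rightarrow> complex \<Rightarrow> complex" where
  "killing_field A z = of_real (A$1$2) + of_real (A$1$1 - A$2$2) * z - of_real (A$2$1) * z\<^sup>2"

text \<open>Let \<open>df = \<alpha>\<close> on the universal cover, so that \<open>f (\<gamma> s) = Ad (r \<gamma>) (f s) + u \<gamma>\<close> with \<open>u\<close> the cocycle
  of \<open>\<alpha>\<close>.  The vector field \<open>V z = killing_field (f z) z\<close> is the velocity of developing maps whose
  holonomies have velocity \<open>u\<close>, and the Beltrami coefficient varies with velocity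
  \<open>\<partial>V/\<partial>(cnj z)\<close>.  Killing fields being holomorphic, only \<open>f\<close> is differentiated.\<close>
definition beltrami ::
  "(complex, real^2^2) marked \<Rightarrow> (real^2^2) form1 \<Rightarrow> complex \<Rightarrow> complex" where
  "beltrami X \<alpha> z = (let e = inv_into UNIV (fst X); a = (\<lambda>v. \<alpha> (e z) (frechet_derivative e (at z) v)) in
     (killing_field (a 1) z + \<i> * killing_field (a \<i>) z) / 2)"

definition teich_pairing ::
  "(plane \<Rightarrow> 's) \<Rightarrow> (complex, real^2^2) marked \<Rightarrow> (real^2^2) form1 \<Rightarrow> (complex \<Rightarrow> complex) \<Rightarrow> real" where
  "teich_pairing p X \<alpha> \<phi> = Re (LINT z:fst X ` fundamental_domain p|lborel. beltrami X \<alpha> z * \<phi> z)"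

definition wp_dual ::
  "(plane \<Rightarrow> 's) \<Rightarrow> (complex, real^2^2) marked \<Rightarrow> (real^2^2) form1 set \<Rightarrow> (complex \<Rightarrow> complex)" where
  "wp_dual p X u = (SOME \<phi>. \<phi> \<in> quadratic_differentials p X \<and>
     (\<forall>\<alpha>\<in>u. \<forall>\<psi>\<in>quadratic_differentials p X. teich_pairing p X \<alpha> \<psi> = wp_cometric p X \<phi> \<psi>))"

definition wp_metric ::
  "(plane \<Rightarrow> 's) \<Rightarrow> (complex, real^2^2) marked \<Rightarrow> (real^2^2) form1 set \<Rightarrow> (real^2^2) form1 set \<Rightarrow> real" where
  "wp_metric p X u v = wp_cometric p X (wp_dual p X u) (wp_dual p X v)"

end

theory Submission
  imports Defs "HOL-Probability.Probability"
begin

text \<open>On the Teichmueller locus the cone is the light cone.  The Koszul-Vinberg function and the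
  Cheng-Yau potential are invariant under its automorphisms, which act transitively, so both are
  multiples of \<open>q\<^bsup>-3/2\<^esup>\<close> with \<open>q\<close> the Lorentz form.  Hence both metrics are the \<open>L\<^sup>2\<close> metric of
  harmonic forms for a multiple of the hyperbolic metric on the surface, which does not matter in
  dimension two, and the same fibre metric.  For a quadratic differential \<open>\<phi>\<close> let \<open>\<omega>\<close> be the real part
  of \<open>\<phi> P dz\<close>, where \<open>P z\<close> is the nilpotent matrix with Killing field \<open>w \<mapsto> (w - z)\<^sup>2\<close>.  The image of \<open>\<omega>\<close> in
  \<open>sl(3)\<close> is harmonic, its \<open>L\<^sup>2\<close> products are 16 times the Weil-Petersson products of quadratic differentials,
  and its Beltrami coefficient \<open>-2 y\<^sup>2 cnj \<phi>\<close> makes \<open>\<omega>\<close> dual to \<open>-2 \<phi>\<close>.  This gives the constant 4 in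
  both cases, once every class contains some \<open>\<omega>\<close>.  For that, let \<open>\<mu> = \<partial>V/\<partial>(cnj z)\<close> be the Beltrami coefficient of
  a class.  An \<open>SL(2,\<real>)\<close>-covariant correction of the Cauchy kernel gives an invariant vector field \<open>W\<close> such
  that \<open>\<mu> - \<partial>W/\<partial>(cnj z) = -2 y\<^sup>2 cnj \<phi>\<close> with \<open>\<phi>\<close> the Bergman projection of \<open>\<mu>\<close>.  What is left of \<open>V\<close> after
  subtracting \<open>W\<close> and the field of \<open>\<omega>\<close> is holomorphic, and its two-jet is the missing section.\<close>

text \<open>The harmonic representative is a definite description, so each class in question needs a
  harmonic form and a proof that it is the only one. Uniqueness is integration by parts on S and
  rests on Stokes' theorem for an arbitrary Borel section of the covering. Existence avoids elliptic
  theory: the metrics are evaluated only on classes in the image of the embedding, and there the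
  explicit forms suffice. These are harmonic because \<open>dPhi (nilp z c)\<close> is self-adjoint
  for the fibre metric over z; star and fibre metric therefore turn the form of \<phi> into that of
  -i \<phi>, which is closed as well. The corrected Cauchy kernel is integrated over the whole half
  plane, so its covariance passes to the field by a change of variables, without a sum over the
  group. It decays like the fourth power of w, hence a bounded coefficient is enough, and
  compactness of S provides the bound. The two-jet of the field left over has as differential the
  form of half its third derivative, which is a quadratic differential by Bol's lemma; this is added
  to the Bergman projection to give the final \<phi>.\<close>

abbreviation (input) fderiv ("\<D>") where
  "\<D> f x \<equiv> frechet_derivative f (at x)"

abbreviation upper_half ("\<H>") where "\<H> \<equiv> upper_half_plane"

section \<open>Calculus\<close>

text \<open>Dominated convergence for the remainder quotients: the mean value inequality bounds the
  increment of \<open>f\<close> and the hypothesis bounds the linear part, each by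
  \<open>norm (B t)\<close> after division by the distance. This form, for a full derivative rather
  than one variable, serves the Poincare lemma and the dbar equation.\<close>

lemma has_derivative_integral:
  fixes f :: "'a::real_normed_vector \<Rightarrow> 'b \<Rightarrow> 'c::{banach,second_countable_topology}"
  assumes e: "e > 0"
    and int: "\<And>x. x \<in> ball x0 e \<Longrightarrow> integrable M (f x)"
    and D: "\<And>x t. x \<in> ball x0 e \<Longrightarrow> t \<in> space M \<Longrightarrow> ((\<lambda>x. f x t) has_derivative f' x t) (at x)"
    and bd: "\<And>x t v. x \<in> ball x0 e \<Longrightarrow> t \<in> space M \<Longrightarrow> norm (f' x t v) \<le> B t * norm v"
    and B: "integrable M B" and meas: "\<And>v. (\<lambda>t. f' x0 t v) \<in> borel_measurable M"
  shows "integrable M (\<lambda>t. f' x0 t v)"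
    and "((\<lambda>x. \<integral>t. f x t \<partial>M) has_derivative (\<lambda>v. \<integral>t. f' x0 t v \<partial>M)) (at x0)"
proof -
  let ?q = "\<lambda>y t. (1 / norm (y - x0)) *\<^sub>R (f y t - f x0 t - f' x0 t (y - x0))"
  have x0: "x0 \<in> ball x0 e" using e by simp
  have Bp: "t \<in> space M \<Longrightarrow> norm (f' x t v) \<le> norm (B t) * norm v" if "x \<in> ball x0 e" for x t v
    using bd[OF that, of t v] by (smt (verit) mult_right_mono norm_ge_zero real_norm_def abs_ge_self)
  have Lip: "norm (f x t - f x0 t) \<le> norm (B t) * norm (x - x0)" if "x \<in> ball x0 e" "t \<in> space M" for x t
  proof (rule differentiable_bound[of "ball x0 e" "\<lambda>x. f x t" "\<lambda>x. f' x t"])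
    show "onorm (f' y t) \<le> norm (B t)" if "y \<in> ball x0 e" for y
      using Bp[OF that \<open>t \<in> space M\<close>] by (intro onorm_bound) auto
    show "((\<lambda>x. f x t) has_derivative f' y t) (at y within ball x0 e)" if "y \<in> ball x0 e" for y
      using D[OF that \<open>t \<in> space M\<close>] has_derivative_at_withinI by blast
  qed (use that x0 in auto)
  have lin: "linear (f' x0 t)" if "t \<in> space M" for t
    using D[OF x0 that] has_derivative_linear by blast
  show I: "integrable M (\<lambda>t. f' x0 t v)" for v
  proof (rule Bochner_Integration.integrable_bound[of M "\<lambda>t. B t * norm v"])
    show "AE t in M. norm (f' x0 t v) \<le> norm (B t * norm v)"
      using Bp[OF x0, of _ v] by (intro AE_I2) (simp add: abs_mult)
  qed (use B meas in auto)
  have "((\<lambda>y. \<integral>t. ?q y t \<partial>M) \<longlongrightarrow> (\<integral>t. 0 \<partial>M)) (at x0)"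
  proof (subst tendsto_at_iff_sequentially, intro allI impI)
    fix X assume X: "\<forall>i. X i \<in> UNIV - {x0}" and Xl: "X \<longlonglongrightarrow> x0"
    \<comment> \<open>Only a tail of the sequence lies in the ball where the bounds hold, so
      convergence is proved for the sequence shifted by \<open>N\<close>.\<close>
    have "eventually (\<lambda>i. X i \<in> ball x0 e) sequentially"
      using Xl e by (auto simp: tendsto_iff dist_commute)
    then obtain N where N: "\<And>i. i \<ge> N \<Longrightarrow> X i \<in> ball x0 e" by (auto simp: eventually_sequentially)
    have "(\<lambda>i. \<integral>t. ?q (X (i+N)) t \<partial>M) \<longlonglongrightarrow> (\<integral>t. 0 \<partial>M)"
    proof (rule integral_dominated_convergence[where w="\<lambda>t. 2 * norm (B t)"])
      show "integrable M (\<lambda>t. 2 * norm (B t))" using B by auto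
      show "(\<lambda>t. ?q (X (i+N)) t) \<in> borel_measurable M" for i
        using int[OF N[of "i+N"]] int[OF x0] meas by auto
      show "AE t in M. norm (?q (X (i+N)) t) \<le> 2 * norm (B t)" for i
      proof (rule AE_I2)
        fix t assume t: "t \<in> space M"
        have "norm (f (X (i+N)) t - f x0 t - f' x0 t (X (i+N) - x0)) \<le> norm (B t) * norm (X (i+N) - x0) + norm (B t) * norm (X (i+N) - x0)"
          using Lip[OF N[of "i+N"] t] Bp[OF x0 t, of "X (i+N) - x0"] by (intro norm_triangle_le_diff) auto
        moreover have "norm (X (i+N) - x0) > 0" using X by simp
        ultimately show "norm (?q (X (i+N)) t) \<le> 2 * norm (B t)"
          by (simp only: norm_scaleR) (simp add: field_simps)
      qed
      show "AE t in M. (\<lambda>i. ?q (X (i+N)) t) \<longlonglongrightarrow> 0"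
      proof (rule AE_I2)
        fix t assume t: "t \<in> space M"
        have "((\<lambda>y. ?q y t) \<longlongrightarrow> 0) (at x0)"
          using D[OF x0 t] unfolding has_derivative_at_within by (simp add: divide_inverse)
        then show "(\<lambda>i. ?q (X (i+N)) t) \<longlonglongrightarrow> 0"
          by (rule filterlim_compose) (use X LIMSEQ_ignore_initial_segment[OF Xl, of N] in \<open>auto simp: filterlim_at\<close>)
      qed
    qed simp
    then show "((\<lambda>y. \<integral>t. ?q y t \<partial>M) \<circ> X) \<longlonglongrightarrow> (\<integral>t. 0 \<partial>M)"
      unfolding comp_def by (rule LIMSEQ_offset)
  qed
  then have L: "((\<lambda>y. \<integral>t. ?q y t \<partial>M) \<longlongrightarrow> 0) (at x0)"
    by simp
  have "eventually (\<lambda>y. (\<integral>t. ?q y t \<partial>M)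
      = ((\<integral>t. f y t \<partial>M) - (\<integral>t. f x0 t \<partial>M) - (\<integral>t. f' x0 t (y - x0) \<partial>M)) /\<^sub>R norm (y - x0)) (at x0)"
    unfolding eventually_at
  proof (intro exI[of _ e] conjI ballI impI e)
    fix y assume "y \<noteq> x0 \<and> dist y x0 < e"
    then have y: "y \<in> ball x0 e" by (simp add: dist_commute)
    show "(\<integral>t. ?q y t \<partial>M)
      = ((\<integral>t. f y t \<partial>M) - (\<integral>t. f x0 t \<partial>M) - (\<integral>t. f' x0 t (y - x0) \<partial>M)) /\<^sub>R norm (y - x0)"
      using int[OF y] int[OF x0] I by (simp add: inverse_eq_divide)
  qed
  from Lim_transform_eventually[OF L this]
  have "((\<lambda>y. ((\<integral>t. f y t \<partial>M) - (\<integral>t. f x0 t \<partial>M) - (\<integral>t. f' x0 t (y - x0) \<partial>M)) /\<^sub>R norm (y - x0)) \<longlongrightarrow> 0) (at x0)" .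
  moreover have "bounded_linear (\<lambda>v. \<integral>t. f' x0 t v \<partial>M)"
  proof (rule bounded_linear_intro[where K="\<integral>t. norm (B t) \<partial>M"])
    show "(\<integral>t. f' x0 t (v + w) \<partial>M) = (\<integral>t. f' x0 t v \<partial>M) + (\<integral>t. f' x0 t w \<partial>M)" for v w
      by (subst Bochner_Integration.integral_add[symmetric, OF I I], rule Bochner_Integration.integral_cong) (auto simp: linear_add lin)
    show "(\<integral>t. f' x0 t (r *\<^sub>R v) \<partial>M) = r *\<^sub>R (\<integral>t. f' x0 t v \<partial>M)" for r v
      by (subst integral_scaleR_right[symmetric], rule Bochner_Integration.integral_cong) (auto simp: linear_scale lin)
    show "norm (\<integral>t. f' x0 t v \<partial>M) \<le> norm v * (\<integral>t. norm (B t) \<partial>M)" for v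
    proof -
      have "norm (\<integral>t. f' x0 t v \<partial>M) \<le> (\<integral>t. norm (B t) * norm v \<partial>M)"
        using B Bp[OF x0, of _ v] by (intro order_trans[OF integral_norm_bound] integral_mono integrable_norm I) auto
      then show ?thesis by (simp add: mult.commute)
    qed
  qed
  ultimately show "((\<lambda>x. \<integral>t. f x t \<partial>M) has_derivative (\<lambda>v. \<integral>t. f' x0 t v \<partial>M)) (at x0)"
    unfolding has_derivative_at_within by blast
qed

text \<open>Preimages of boxes are boxes with the same side lengths, and the volumes of boxes
  characterise Lebesgue measure.\<close>

lemma distr_lborel_basis_isometry:
  fixes T :: "'a::euclidean_space \<Rightarrow> 'b::euclidean_space"
  assumes lin: "linear T" and iso: "\<And>x y. T x \<bullet> T y = x \<bullet> y" and B: "T ` Basis = Basis"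
  shows "distr lborel borel T = lborel"
proof (rule lborel_eqI[symmetric])
  have inj: "inj_on T Basis"
  proof (rule inj_onI)
    fix x y assume "T x = T y"
    then have "(x - y) \<bullet> (x - y) = 0" by (simp add: iso[symmetric] linear_diff[OF lin])
    then show "x = y" by simp
  qed
  have m: "T \<in> borel_measurable lborel"
    using linear_continuous_on[OF linear_conv_bounded_linear[THEN iffD1, OF lin]] by (simp add: borel_measurable_continuous_onI)
  fix l u :: 'b assume le: "\<And>b. b \<in> Basis \<Longrightarrow> l \<bullet> b \<le> u \<bullet> b"
  define t where "t x = (\<Sum>b\<in>Basis. (x \<bullet> T b) *\<^sub>R b)" for x :: 'b
  have t: "t x \<bullet> b = x \<bullet> T b" if "b \<in> Basis" for x b
    using that by (simp add: t_def)
  have "T -` box l u = box (t l) (t u)"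
  proof -
    have "T x \<in> box l u \<longleftrightarrow> (\<forall>b\<in>T ` Basis. l \<bullet> b < T x \<bullet> b \<and> T x \<bullet> b < u \<bullet> b)" for x
      unfolding B by (simp add: mem_box)
    then show ?thesis by (auto simp: mem_box t iso)
  qed
  moreover have "(\<Prod>b\<in>Basis. (t u - t l) \<bullet> b) = (\<Prod>b\<in>T ` Basis. (u - l) \<bullet> b)"
    by (subst prod.reindex[OF inj]) (auto simp: inner_diff_left t intro!: prod.cong)
  moreover have "t l \<bullet> b \<le> t u \<bullet> b" if "b \<in> Basis" for b
    using le[of "T b"] B that by (auto simp: t)
  ultimately show "emeasure (distr lborel borel T) (box l u) = ennreal (\<Prod>b\<in>Basis. (u - l) \<bullet> b)"
    using m by (subst emeasure_distr) (auto simp: emeasure_lborel_box B)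
qed simp

section \<open>Identifying the plane with the complex numbers\<close>

definition cplx :: "plane \<Rightarrow> complex" where
  "cplx v = Complex (v$1) (v$2)"

definition uncplx :: "complex \<Rightarrow> plane" where
  "uncplx z = vector [Re z, Im z]"

lemma cplx_uncplx [simp]: "cplx (uncplx z) = z" "uncplx (cplx v) = v"
  by (simp_all add: cplx_def uncplx_def vec_eq_iff forall_2)

lemma bounded_linear_cplx: "bounded_linear cplx" "bounded_linear uncplx"
  by (simp_all add: linear_conv_bounded_linear[symmetric])
     (rule linearI; simp add: cplx_def uncplx_def complex_eq_iff vec_eq_iff forall_2)+

lemma Basis_plane: "(Basis :: plane set) = {axis 1 1, axis 2 1}"
  by (auto simp: Basis_vec_def UNIV_2)

lemma lborel_cplx: "distr lborel borel cplx = lborel"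
proof (rule distr_lborel_basis_isometry)
  show "linear cplx" using bounded_linear_cplx by (simp add: bounded_linear.linear)
  show "cplx x \<bullet> cplx y = x \<bullet> y" for x y
    by (simp add: cplx_def inner_complex_def inner_vec_def sum_2)
  show "cplx ` Basis = Basis"
    by (auto simp: Basis_plane Basis_complex_def cplx_def axis_def complex_eq_iff)
qed

lemma measurable_Complex: "(\<lambda>(x, y). Complex x y) \<in> measurable lborel borel"
  by (auto simp: case_prod_beta complex_eq_iff borel_measurable_complex_iff intro!: borel_measurable_continuous_onI continuous_intros)

lemma lborel_Complex: "distr lborel borel (\<lambda>(x, y). Complex x y) = lborel"
proof (rule distr_lborel_basis_isometry)
  show "linear (\<lambda>(x, y). Complex x y)" by (rule linearI) (auto simp: complex_eq_iff)
  show "(case x of (x, y) \<Rightarrow> Complex x y) \<bullet> (case y of (x, y) \<Rightarrow> Complex x y) = x \<bullet> y" for x y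
    by (simp add: inner_complex_def inner_prod_def case_prod_beta)
  show "(\<lambda>(x, y). Complex x y) ` Basis = Basis"
    by (auto simp: Basis_prod_def Basis_complex_def complex_eq_iff)
qed

text \<open>The antiderivative 2 sqrt (u / (1 + u)) has finite limits at both ends. The integrand is
  the one-variable factor in the product bound for \<open>cauchy_majorant\<close>.\<close>

lemma integrable_half_line: 
  "set_integrable lborel {0<..} (\<lambda>u. 1 / (sqrt u * (1 + u) * sqrt (1 + u)))"
proof -
  let ?f = "\<lambda>u::real. 1 / (sqrt u * (1 + u) * sqrt (1 + u))"
  let ?F = "\<lambda>u::real. 2 * sqrt (u / (1 + u))"
  have "set_integrable lborel (einterval 0 \<infinity>) ?f"
  proof (rule interval_integral_FTC_nonneg)
    show "DERIV ?F u :> ?f u" if "0 < ereal u" for u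
    proof -
      have u: "u > 0" using that by simp
      have "(?F has_real_derivative 2 * ((inverse (sqrt (u / (1 + u))) / 2) * ((1 + u - u) / (1 + u)\<^sup>2))) (at u)"
        using u by (auto intro!: derivative_eq_intros simp: power2_eq_square divide_simps)
      also have "2 * ((inverse (sqrt (u / (1 + u))) / 2) * ((1 + u - u) / (1 + u)\<^sup>2)) = sqrt (1 + u) / (sqrt u * ((1 + u) * (1 + u)))"
        using u by (simp add: real_sqrt_divide power2_eq_square)
      also have "\<dots> = sqrt (1 + u) / (sqrt u * (1 + u) * (sqrt (1 + u) * sqrt (1 + u)))"
        using u by simp
      also have "\<dots> = ?f u"
        using u by (simp add: divide_simps)
      finally show ?thesis .
    qed
    show "isCont ?f u" if "0 < ereal u" for u
      using that by (intro continuous_intros) auto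
    show "AE u in lborel. 0 < ereal u \<longrightarrow> ereal u < \<infinity> \<longrightarrow> 0 \<le> ?f u"
      by (auto intro!: AE_I2)
    show "((?F \<circ> real_of_ereal) \<longlongrightarrow> 0) (at_right 0)"
      unfolding zero_ereal_def ereal_tendsto_simps1(2)
      by (auto simp: ereal_tendsto_simps intro!: tendsto_eq_intros)
    have "(?F \<longlongrightarrow> 2) at_top" by real_asymp
    then show "((?F \<circ> real_of_ereal) \<longlongrightarrow> 2) (at_left \<infinity>)"
      by (simp add: ereal_tendsto_simps)
  qed simp
  then show ?thesis by (simp add: einterval_def greaterThan_def zero_ereal_def[symmetric])
qed

lemma nn_integral_lborel_product:
  fixes a :: "real \<Rightarrow> real"
  assumes am: "a \<in> borel_measurable lborel" and a0: "\<And>x. a x \<ge> 0"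
  shows "(\<integral>\<^sup>+v. ennreal (a (fst v) * a (snd v)) \<partial>lborel) = (\<integral>\<^sup>+x. ennreal (a x) \<partial>lborel) * (\<integral>\<^sup>+x. ennreal (a x) \<partial>lborel)"
proof -
  let ?I = "\<integral>\<^sup>+x. ennreal (a x) \<partial>lborel"
  have "(\<integral>\<^sup>+v. ennreal (a (fst v) * a (snd v)) \<partial>lborel) = (\<integral>\<^sup>+x. \<integral>\<^sup>+y. ennreal (a x * a y) \<partial>lborel \<partial>lborel)"
  proof -
    have [measurable]: "a \<in> borel_measurable borel" using am by simp
    have "(\<lambda>v. ennreal (a (fst v) * a (snd v))) \<in> borel_measurable (lborel \<Otimes>\<^sub>M lborel)" by measurable
    from lborel.nn_integral_fst[OF this] show ?thesis by (simp add: lborel_prod)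
  qed
  also have "\<dots> = (\<integral>\<^sup>+x. ennreal (a x) * ?I \<partial>lborel)"
    using am by (simp add: ennreal_mult a0 nn_integral_cmult)
  also have "\<dots> = ?I * ?I"
    using am by (intro nn_integral_multc) auto
  finally show ?thesis .
qed

text \<open>It has the singularity of the Cauchy kernel at 0 and fourth-power decay at infinity, so
  a single integrability statement covers both the kernel of compactly supported functions and the
  smooth kernels of the dbar problem.\<close>

definition cauchy_majorant :: "complex \<Rightarrow> real" where
  "cauchy_majorant w = 1 / (cmod w * (1 + cmod w) ^ 3)"

lemma cauchy_majorant_nonneg: "cauchy_majorant w \<ge> 0"
  by (simp add: cauchy_majorant_def)

text \<open>Polar coordinates are replaced by a product bound. The modulus r dominates |x| and |y|,
  and r (1 + r)^3 is the square of sqrt r (1 + r)^(3/2); giving one of the two factors to each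
  coordinate separates the variables.\<close>

lemma integrable_cauchy_majorant: "integrable lborel cauchy_majorant"
proof (rule integrableI_bounded)
  show "cauchy_majorant \<in> borel_measurable lborel"
    unfolding cauchy_majorant_def by measurable
  define b where "b = (\<lambda>u::real. 1 / (sqrt u * (1 + u) * sqrt (1 + u)))"
  let ?b = "\<integral>\<^sup>+u. ennreal (indicator {0<..} u * b u) \<partial>lborel"
  define a where "a u = b \<bar>u\<bar>" for u :: real
  have a0: "a u \<ge> 0" for u by (simp add: a_def b_def)
  have am: "a \<in> borel_measurable lborel" unfolding a_def b_def by measurable
  have bfin: "?b < \<infinity>"
  proof -
    have "?b = (\<integral>\<^sup>+u. ennreal (norm (indicat_real {0<..} u *\<^sub>R b u)) \<partial>lborel)"
      by (intro nn_integral_cong) (auto simp: b_def indicator_def)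
    then show ?thesis using integrable_half_line unfolding set_integrable_def b_def[symmetric] integrable_iff_bounded by simp
  qed
  have afin: "(\<integral>\<^sup>+u. ennreal (a u) \<partial>lborel) < \<infinity>"
  proof -
    have neg: "(\<integral>\<^sup>+u. ennreal (indicator {0<..} (-u) * b (-u)) \<partial>lborel) = ?b"
      by (subst (2) lborel_distr_uminus[symmetric]) (subst nn_integral_distr; simp add: b_def)
    have "(\<integral>\<^sup>+u. ennreal (a u) \<partial>lborel) \<le> (\<integral>\<^sup>+u. ennreal (indicator {0<..} u * b u) + ennreal (indicator {0<..} (-u) * b (-u)) \<partial>lborel)"
    proof (rule nn_integral_mono)
      fix u :: real show "ennreal (a u) \<le> ennreal (indicator {0<..} u * b u) + ennreal (indicator {0<..} (-u) * b (-u))"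
        by (cases "u > 0"; cases "u = 0") (auto simp: a_def b_def)
    qed
    also have "\<dots> = ?b + (\<integral>\<^sup>+u. ennreal (indicator {0<..} (-u) * b (-u)) \<partial>lborel)"
      by (rule nn_integral_add) (simp_all add: b_def)
    also have "\<dots> < \<infinity>" unfolding neg using bfin by (simp add: less_top)
    finally show ?thesis .
  qed
  have le: "cauchy_majorant (Complex x y) \<le> a x * a y" if "x \<noteq> 0" "y \<noteq> 0" for x y
  proof -
    let ?r = "cmod (Complex x y)"
    have r: "\<bar>x\<bar> \<le> ?r" "\<bar>y\<bar> \<le> ?r" using abs_Re_le_cmod[of "Complex x y"] abs_Im_le_cmod[of "Complex x y"] by auto
    have s: "sqrt \<bar>x\<bar> \<le> sqrt ?r" "sqrt \<bar>y\<bar> \<le> sqrt ?r" "sqrt (1 + \<bar>x\<bar>) \<le> sqrt (1 + ?r)" "sqrt (1 + \<bar>y\<bar>) \<le> sqrt (1 + ?r)"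
      using r by auto
    have "(sqrt \<bar>x\<bar> * (1 + \<bar>x\<bar>) * sqrt (1 + \<bar>x\<bar>)) * (sqrt \<bar>y\<bar> * (1 + \<bar>y\<bar>) * sqrt (1 + \<bar>y\<bar>))
        \<le> (sqrt ?r * (1 + ?r) * sqrt (1 + ?r)) * (sqrt ?r * (1 + ?r) * sqrt (1 + ?r))"
      by (intro mult_mono s add_mono r order_refl) auto
    also have "\<dots> = (sqrt ?r * sqrt ?r) * (1 + ?r)\<^sup>2 * (sqrt (1 + ?r) * sqrt (1 + ?r))"
      by (simp only: power2_eq_square mult_ac)
    also have "\<dots> = ?r * (1 + ?r) ^ 3"
      by (simp add: power2_eq_square power3_eq_cube del: complex_norm)
    finally have "1 / (?r * (1 + ?r) ^ 3) \<le> 1 / ((sqrt \<bar>x\<bar> * (1 + \<bar>x\<bar>) * sqrt (1 + \<bar>x\<bar>)) * (sqrt \<bar>y\<bar> * (1 + \<bar>y\<bar>) * sqrt (1 + \<bar>y\<bar>)))"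
      using that r by (intro divide_left_mono mult_pos_pos zero_less_power) (auto simp del: complex_norm simp: add_pos_nonneg)
    then show ?thesis by (simp add: a_def b_def cauchy_majorant_def)
  qed
  have "(\<integral>\<^sup>+w. ennreal (norm (cauchy_majorant w)) \<partial>lborel) = (\<integral>\<^sup>+v. ennreal (cauchy_majorant (Complex (fst v) (snd v))) \<partial>(lborel :: (real \<times> real) measure))"
    by (subst lborel_Complex[symmetric], subst nn_integral_distr[OF measurable_Complex])
       (auto simp: case_prod_beta cauchy_majorant_nonneg cauchy_majorant_def[abs_def])
  also have "\<dots> \<le> (\<integral>\<^sup>+v. ennreal (a (fst v) * a (snd v)) \<partial>(lborel :: (real \<times> real) measure))"
  proof (rule nn_integral_mono_AE)
    \<comment> \<open>The axes must be excluded: division by zero makes \<open>a 0\<close> equal to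
      0, so the product bound fails there.\<close>
    have "AE v in (lborel \<Otimes>\<^sub>M lborel :: (real \<times> real) measure). fst v \<noteq> 0 \<and> snd v \<noteq> 0"
    proof (rule lborel_pair.AE_pair_measure)
      show "AE x in lborel. AE y in lborel. fst (x::real, y::real) \<noteq> 0 \<and> snd (x, y) \<noteq> 0"
        by (rule eventually_mono[OF AE_lborel_singleton[of 0]]) (auto intro: eventually_mono[OF AE_lborel_singleton[of 0]])
    qed measurable
    then show "AE v in (lborel :: (real \<times> real) measure). ennreal (cauchy_majorant (Complex (fst v) (snd v))) \<le> ennreal (a (fst v) * a (snd v))"
      unfolding lborel_prod by eventually_elim (auto intro!: ennreal_leI le)
  qed
  also have "\<dots> = (\<integral>\<^sup>+x. ennreal (a x) \<partial>lborel) * (\<integral>\<^sup>+x. ennreal (a x) \<partial>lborel)"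
    by (rule nn_integral_lborel_product[OF am a0])
  also have "\<dots> < \<infinity>"
    using ennreal_mult_less_top[of "\<integral>\<^sup>+x. ennreal (a x) \<partial>lborel" "\<integral>\<^sup>+x. ennreal (a x) \<partial>lborel"] afin by auto
  finally show "(\<integral>\<^sup>+w. ennreal (norm (cauchy_majorant w)) \<partial>lborel) < \<infinity>" .
qed

text \<open>Both claims come from one identity of measures: the density |det g'| on
  \<open>S\<close>, pushed forward by \<open>g\<close>, is Lebesgue measure restricted to the image.
  It is tested on a Borel set through the volume formula for the differentiable injective image of
  its preimage.\<close>

lemma set_integral_substitution:
  fixes g :: "real^'n::{finite,wellorder} \<Rightarrow> real^'n::_" and f :: "real^'n::_ \<Rightarrow> 'b::{banach,second_countable_topology}"
  assumes S: "open S" and D: "\<And>x. x \<in> S \<Longrightarrow> (g has_derivative g' x) (at x)"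
    and inj: "inj_on g S" and J: "continuous_on S (\<lambda>x. det (matrix (g' x)))"
    and f: "f \<in> borel_measurable borel"
  shows "set_integrable lborel (g ` S) f \<longleftrightarrow> set_integrable lborel S (\<lambda>x. \<bar>det (matrix (g' x))\<bar> *\<^sub>R f (g x))" (is ?A)
    and "(LINT x:g ` S|lborel. f x) = (LINT x:S|lborel. \<bar>det (matrix (g' x))\<bar> *\<^sub>R f (g x))" (is ?B)
proof -
  let ?J = "\<lambda>x. \<bar>det (matrix (g' x))\<bar>"
  \<comment> \<open>\<open>g\<close> and its Jacobian are extended by 0 off \<open>S\<close>, so
    that both are Borel functions on the whole space and \<open>distr\<close> and
    \<open>density\<close> apply.\<close>
  define G where "G x = (if x \<in> S then g x else 0)" for x
  define j where "j x = (if x \<in> S then ?J x else 0)" for x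
  have gc: "continuous_on S g"
    using D by (meson has_derivative_continuous continuous_at_imp_continuous_on)
  have oS: "S \<in> sets borel" using S by simp
  have ogS: "open (g ` T)" if "open T" "T \<subseteq> S" for T
    by (rule invariance_of_domain) (use that gc inj in \<open>auto intro: continuous_on_subset inj_on_subset\<close>)
  have Gm: "G \<in> borel_measurable borel"
    unfolding G_def by (rule borel_measurable_continuous_on_if[OF oS gc]) simp
  have jm: "j \<in> borel_measurable borel"
    unfolding j_def by (rule borel_measurable_continuous_on_if[OF oS]) (auto intro: continuous_intros J)
  have gSb: "g ` S \<in> sets borel" using ogS[of S] S by simp
  have j0: "j x \<ge> 0" for x by (simp add: j_def)
  let ?M = "density lborel (\<lambda>x. ennreal (j x))"
  have M: "distr ?M borel G = density lborel (indicator (g ` S))"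
  proof (rule measure_eqI)
    fix A :: "(real^'n::_) set" assume "A \<in> sets (distr ?M borel G)"
    then have A: "A \<in> sets borel" by simp
    define T where "T = G -` A \<inter> S"
    have T: "T \<in> sets borel" using measurable_sets[OF Gm A] oS by (auto simp: T_def)
    have TS: "T \<subseteq> S" by (auto simp: T_def)
    have gT: "g ` T = A \<inter> g ` S" by (auto simp: T_def G_def)
    have gTb: "g ` T \<in> sets borel" unfolding gT using A gSb by auto
    have Tl: "T \<in> sets lebesgue" using T by (simp add: sets_completionI_sets)
    have DT: "(g has_derivative g' x) (at x within T)" if "x \<in> T" for x
      using D that TS has_derivative_at_withinI by blast
    have injT: "inj_on g T" using inj TS inj_on_subset by blast
    let ?JT = "\<lambda>x. ?J x * indicator T x"
    let ?N = "\<integral>\<^sup>+x. ennreal (?JT x) \<partial>lborel"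
    have "emeasure (distr ?M borel G) A = (\<integral>\<^sup>+x. ennreal (j x) * indicator (G -` A) x \<partial>lborel)"
      using Gm jm A by (subst emeasure_distr) (auto simp: emeasure_density measurable_sets[OF Gm A, simplified])
    also have "\<dots> = ?N"
      by (intro nn_integral_cong) (auto simp: T_def j_def indicator_def)
    also have "\<dots> = emeasure lborel (g ` T)"
    proof -
      have jT: "?JT = (\<lambda>x. j x * indicator T x)"
        by (rule ext) (use TS in \<open>auto simp: j_def indicator_def\<close>)
      have m: "?JT \<in> borel_measurable borel"
        unfolding jT using jm T by measurable
      note H = has_measure_differentiable_image[OF Tl DT injT]
      have eq: "((\<lambda>x. ?J x) has_integral m) T \<longleftrightarrow> (?JT has_integral m) UNIV" for m
      proof -
        have "?JT = (\<lambda>x. if x \<in> T then ?J x else 0)"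
          by (auto simp: indicator_def)
        then show ?thesis by (simp only: has_integral_restrict_UNIV)
      qed
      show ?thesis
      \<comment> \<open>The volume formula speaks of images of finite measure. In the infinite case
        it is used backwards: a finite volume of the image would make the integral finite.\<close>
      proof (cases "?N < \<infinity>")
        case True
        then have i: "integrable lborel ?JT"
          using m by (intro integrableI_bounded) (auto simp: abs_mult)
        have "(?JT has_integral (\<integral>x. ?J x * indicator T x \<partial>lborel)) UNIV"
          by (rule has_integral_integral_lborel[OF i])
        then have *: "g ` T \<in> lmeasurable" "measure lebesgue (g ` T) = (\<integral>x. ?J x * indicator T x \<partial>lborel)"
          using H eq by blast+
        have "emeasure lborel (g ` T) = emeasure lebesgue (g ` T)" using gTb by simp
        also have "\<dots> = ennreal (\<integral>x. ?J x * indicator T x \<partial>lborel)"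
          using * by (simp add: emeasure_eq_measure2)
        also have "\<dots> = ?N"
          by (rule nn_integral_eq_integral[symmetric, OF i]) auto
        finally show ?thesis by simp
      next
        case False
        have "emeasure lborel (g ` T) = \<infinity>"
        proof (rule ccontr)
          assume "emeasure lborel (g ` T) \<noteq> \<infinity>"
          then have "g ` T \<in> lmeasurable" using gTb by (auto simp: fmeasurable_def less_top)
          then have "(?JT has_integral (measure lebesgue (g ` T))) UNIV"
            using H eq by blast
          then have "?N = ennreal (measure lebesgue (g ` T))"
            by (intro nn_integral_has_integral_lborel m) auto
          then show False using False by simp
        qed
        then show ?thesis using False by (simp add: not_less top_unique)
      qed
    qed
    also have "\<dots> = emeasure (density lborel (indicator (g ` S))) A"
    proof -
      have "emeasure (density lborel (indicator (g ` S))) A = (\<integral>\<^sup>+x. indicator (g ` S) x * indicator A x \<partial>lborel)"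
        using A gSb by (subst emeasure_density) auto
      also have "\<dots> = (\<integral>\<^sup>+x. indicator (g ` T) x \<partial>lborel)"
        by (simp add: gT indicator_inter_arith mult.commute)
      also have "\<dots> = emeasure lborel (g ` T)" using gTb by simp
      finally show ?thesis by simp
    qed
    finally show "emeasure (distr ?M borel G) A = emeasure (density lborel (indicator (g ` S))) A" .
  qed simp
  have h: "(\<lambda>x. f (G x)) \<in> borel_measurable borel" by (rule measurable_compose[OF Gm f])
  have i1: "integrable (distr ?M borel G) f \<longleftrightarrow> set_integrable lborel S (\<lambda>x. ?J x *\<^sub>R f (g x))"
  proof -
    have "integrable (distr ?M borel G) f \<longleftrightarrow> integrable lborel (\<lambda>x. j x *\<^sub>R f (G x))"
      using Gm jm f j0 h by (simp add: integrable_distr_eq integrable_density)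
    also have "(\<lambda>x. j x *\<^sub>R f (G x)) = (\<lambda>x. indicator S x *\<^sub>R (?J x *\<^sub>R f (g x)))"
      by (auto simp: j_def G_def)
    finally show ?thesis unfolding set_integrable_def .
  qed
  have i2: "integral\<^sup>L (distr ?M borel G) f = (LINT x:S|lborel. ?J x *\<^sub>R f (g x))"
  proof -
    have "integral\<^sup>L (distr ?M borel G) f = (\<integral>x. j x *\<^sub>R f (G x) \<partial>lborel)"
      using Gm jm f j0 h by (simp add: integral_distr integral_density)
    also have "(\<lambda>x. j x *\<^sub>R f (G x)) = (\<lambda>x. indicator S x *\<^sub>R (?J x *\<^sub>R f (g x)))"
      by (auto simp: j_def G_def)
    finally show ?thesis unfolding set_lebesgue_integral_def .
  qed
  have ind: "density lborel (indicator (g ` S)) = density lborel (\<lambda>x. ennreal (indicator (g ` S) x))"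
    by (intro density_cong) (use gSb in \<open>auto simp: indicator_def\<close>)
  have i3: "integrable (density lborel (indicator (g ` S))) f \<longleftrightarrow> set_integrable lborel (g ` S) f"
    unfolding ind set_integrable_def using f gSb by (subst integrable_density) auto
  have i4: "integral\<^sup>L (density lborel (indicator (g ` S))) f = (LINT x:g ` S|lborel. f x)"
    unfolding ind set_lebesgue_integral_def using f gSb by (subst integral_density) auto
  show ?A ?B using i1 i2 i3 i4 unfolding M by auto
qed

text \<open>The determinant of a real linear map into \<open>complex\<close>, in the shape of the
  orientation condition on developing maps.\<close>

definition jac :: "(plane \<Rightarrow> complex) \<Rightarrow> real" where
  "jac D = Im (cnj (D (axis 1 1)) * D (axis 2 1))"

lemma det_matrix_uncplx: "det (matrix (\<lambda>v. uncplx (D v))) = jac D"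
  by (simp add: det_2 matrix_def jac_def uncplx_def)

lemma set_integral_cplx:
  fixes f :: "complex \<Rightarrow> 'b::{banach,second_countable_topology}"
  assumes "set_borel_measurable borel A f"
  shows "set_integrable lborel A f \<longleftrightarrow> set_integrable lborel (cplx -` A) (\<lambda>v. f (cplx v))"
    and "(LINT z:A|lborel. f z) = (LINT v:cplx -` A|lborel. f (cplx v))"
proof -
  have c: "cplx \<in> measurable lborel borel"
    using linear_continuous_on[OF bounded_linear_cplx(1)] by (simp add: borel_measurable_continuous_onI)
  have m: "(\<lambda>z. indicat_real A z *\<^sub>R f z) \<in> borel_measurable borel"
    using assms by (simp add: set_borel_measurable_def)
  have e: "indicat_real A (cplx v) = indicator (cplx -` A) v" for v by (simp add: indicator_def)
  show "set_integrable lborel A f \<longleftrightarrow> set_integrable lborel (cplx -` A) (\<lambda>v. f (cplx v))"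
    unfolding set_integrable_def by (subst lborel_cplx[symmetric], subst integrable_distr_eq[OF c m]) (simp add: e)
  show "(LINT z:A|lborel. f z) = (LINT v:cplx -` A|lborel. f (cplx v))"
    unfolding set_lebesgue_integral_def by (subst lborel_cplx[symmetric], subst integral_distr[OF c m]) (simp add: e)
qed

lemma set_integral_substitution_complex:
  fixes g :: "plane \<Rightarrow> complex" and f :: "complex \<Rightarrow> 'b::{banach,second_countable_topology}"
  assumes S: "open S" and D: "\<And>x. x \<in> S \<Longrightarrow> (g has_derivative g' x) (at x)"
    and inj: "inj_on g S" and J: "continuous_on S (\<lambda>x. jac (g' x))"
    and f: "set_borel_measurable borel (g ` S) f"
  shows "set_integrable lborel (g ` S) f \<longleftrightarrow> set_integrable lborel S (\<lambda>x. \<bar>jac (g' x)\<bar> *\<^sub>R f (g x))"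
    and "(LINT x:g ` S|lborel. f x) = (LINT x:S|lborel. \<bar>jac (g' x)\<bar> *\<^sub>R f (g x))"
proof -
  define h where "h z = indicat_real (g ` S) z *\<^sub>R f z" for z
  have h: "h \<in> borel_measurable borel" using f by (simp add: set_borel_measurable_def h_def[abs_def])
  have c: "cplx \<in> borel_measurable borel"
    using linear_continuous_on[OF bounded_linear_cplx(1)] by (simp add: borel_measurable_continuous_onI)
  have im: "cplx -` g ` S = (\<lambda>x. uncplx (g x)) ` S"
  proof (rule equalityI; rule subsetI)
    fix v assume "v \<in> cplx -` g ` S"
    then obtain x where "x \<in> S" "cplx v = g x" by auto
    then show "v \<in> (\<lambda>x. uncplx (g x)) ` S" by (metis cplx_uncplx(2) imageI)
  qed auto
  have D': "((\<lambda>x. uncplx (g x)) has_derivative (\<lambda>v. uncplx (g' x v))) (at x)" if "x \<in> S" for x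
    using D[OF that] bounded_linear.has_derivative[OF bounded_linear_cplx(2)] by blast
  have inj': "inj_on (\<lambda>x. uncplx (g x)) S"
  proof (rule inj_onI)
    fix x y assume "x \<in> S" "y \<in> S" and "uncplx (g x) = uncplx (g y)"
    then have "g x = g y" by (metis cplx_uncplx(1))
    then show "x = y" using inj_onD[OF inj] \<open>x \<in> S\<close> \<open>y \<in> S\<close> by simp
  qed
  note * = set_integral_substitution[OF S D' inj', unfolded det_matrix_uncplx, OF _ J measurable_compose[OF c h]]
  have hf: "indicat_real (g ` S) z *\<^sub>R h z = indicat_real (g ` S) z *\<^sub>R f z" for z by (simp add: h_def indicator_def)
  have gh: "h (g x) = f (g x)" if "x \<in> S" for x using that by (simp add: h_def)
  have h1: "set_integrable lborel (g ` S) f \<longleftrightarrow> set_integrable lborel (g ` S) h"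
    unfolding set_integrable_def hf ..
  have h2: "(LINT x:g ` S|lborel. f x) = (LINT x:g ` S|lborel. h x)"
    unfolding set_lebesgue_integral_def hf ..
  have h3: "set_integrable lborel S (\<lambda>x. \<bar>jac (g' x)\<bar> *\<^sub>R h (g x)) \<longleftrightarrow> set_integrable lborel S (\<lambda>x. \<bar>jac (g' x)\<bar> *\<^sub>R f (g x))"
    by (intro set_integrable_cong) (auto simp: gh)
  have h4: "(LINT x:S|lborel. \<bar>jac (g' x)\<bar> *\<^sub>R h (g x)) = (LINT x:S|lborel. \<bar>jac (g' x)\<bar> *\<^sub>R f (g x))"
    using S by (intro set_lebesgue_integral_cong) (auto simp: gh)
  have hm: "set_borel_measurable borel (g ` S) h"
    using f by (simp add: set_borel_measurable_def hf)
  note c1 = set_integral_cplx[OF hm, unfolded im]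
  show "set_integrable lborel (g ` S) f \<longleftrightarrow> set_integrable lborel S (\<lambda>x. \<bar>jac (g' x)\<bar> *\<^sub>R f (g x))"
    unfolding h1 h3[symmetric] c1 using *(1) by simp
  show "(LINT x:g ` S|lborel. f x) = (LINT x:S|lborel. \<bar>jac (g' x)\<bar> *\<^sub>R f (g x))"
    unfolding h2 h4[symmetric] c1 using *(2) by simp
qed

lemma set_integral_substitution_holomorphic:
  fixes g :: "complex \<Rightarrow> complex" and f :: "complex \<Rightarrow> 'b::{banach,second_countable_topology}"
  assumes S: "open S" and D: "\<And>z. z \<in> S \<Longrightarrow> (g has_field_derivative g' z) (at z)"
    and inj: "inj_on g S" and J: "continuous_on S g'"
    and f: "set_borel_measurable borel (g ` S) f"
  shows "set_integrable lborel (g ` S) f \<longleftrightarrow> set_integrable lborel S (\<lambda>z. (cmod (g' z))\<^sup>2 *\<^sub>R f (g z))"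
    and "(LINT z:g ` S|lborel. f z) = (LINT z:S|lborel. (cmod (g' z))\<^sup>2 *\<^sub>R f (g z))"
proof -
  have cc: "continuous_on A cplx" for A using bounded_linear_cplx(1) by (rule linear_continuous_on)
  have oS: "open (cplx -` S)" using S cc by (simp add: open_vimage)
  have e: "cplx ` cplx -` S = S" by (force intro: cplx_uncplx(1)[symmetric] image_eqI[where x="uncplx _"])
  have im: "(\<lambda>v. g (cplx v)) ` (cplx -` S) = g ` S"
    using e by (metis image_image)
  have DD: "((\<lambda>v. g (cplx v)) has_derivative (\<lambda>v. g' (cplx x) * cplx v)) (at x)" if "x \<in> cplx -` S" for x
    by (rule has_derivative_compose[OF bounded_linear_imp_has_derivative[OF bounded_linear_cplx(1)]])
      (use D[of "cplx x"] that in \<open>simp add: has_field_derivative_def\<close>)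
  have inj': "inj_on (\<lambda>v. g (cplx v)) (cplx -` S)"
  proof (rule inj_onI)
    fix x y assume "x \<in> cplx -` S" "y \<in> cplx -` S" "g (cplx x) = g (cplx y)"
    then have "cplx x = cplx y" using inj_onD[OF inj] by simp
    then show "x = y" by (metis cplx_uncplx(2))
  qed
  have jc: "jac (\<lambda>v. w * cplx v) = (cmod w)\<^sup>2" for w
    unfolding jac_def cmod_power2 by (simp add: cplx_def axis_def power2_eq_square)
  have J': "continuous_on (cplx -` S) (\<lambda>x. jac (\<lambda>v. g' (cplx x) * cplx v))"
    unfolding jc by (intro continuous_intros continuous_on_compose2[OF J cc]) auto
  note * = set_integral_substitution_complex[OF oS DD inj' J', unfolded im jc abs_power2 abs_norm_cancel, OF _ f]
  have fm: "set_borel_measurable borel S (\<lambda>z. (cmod (g' z))\<^sup>2 *\<^sub>R f (g z))"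
  proof -
    define G where "G z = (if z \<in> S then g z else 0)" for z
    have gc: "continuous_on S g" using D by (meson DERIV_isCont continuous_at_imp_continuous_on)
    have Gm: "G \<in> borel_measurable borel"
      unfolding G_def using S by (intro borel_measurable_continuous_on_if gc) auto
    have "(\<lambda>z. if z \<in> S then g' z else 0) \<in> borel_measurable borel"
      using S by (intro borel_measurable_continuous_on_if J) auto
    note this[measurable]
    have q: "(\<lambda>z. (cmod (if z \<in> S then g' z else 0))\<^sup>2) \<in> borel_measurable borel" by measurable
    have "(\<lambda>z. (cmod (if z \<in> S then g' z else 0))\<^sup>2 *\<^sub>R (indicat_real (g ` S) (G z) *\<^sub>R f (G z))) \<in> borel_measurable borel"
      by (rule borel_measurable_scaleR[OF q measurable_compose[OF Gm f[unfolded set_borel_measurable_def]]])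
    moreover have "(\<lambda>z. (cmod (if z \<in> S then g' z else 0))\<^sup>2 *\<^sub>R (indicat_real (g ` S) (G z) *\<^sub>R f (G z))) = (\<lambda>z. indicator S z *\<^sub>R ((cmod (g' z))\<^sup>2 *\<^sub>R f (g z)))"
      by (auto simp: G_def indicator_def)
    ultimately show ?thesis by (simp add: set_borel_measurable_def)
  qed
  show "set_integrable lborel (g ` S) f \<longleftrightarrow> set_integrable lborel S (\<lambda>z. (cmod (g' z))\<^sup>2 *\<^sub>R f (g z))"
    using * set_integral_cplx[OF fm] by simp
  show "(LINT z:g ` S|lborel. f z) = (LINT z:S|lborel. (cmod (g' z))\<^sup>2 *\<^sub>R f (g z))"
    using * set_integral_cplx[OF fm] by simp
qed

section \<open>Integrals of derivatives of compactly supported functions\<close>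

lemma integrable_compact_support:
  fixes f :: "'a::euclidean_space \<Rightarrow> 'b::{banach,second_countable_topology}"
  assumes "continuous_on UNIV f" "compact K" "\<And>x. x \<notin> K \<Longrightarrow> f x = 0"
  shows "integrable lborel f"
proof -
  have "(\<lambda>x. indicator K x *\<^sub>R f x) = f" using assms(3) by (auto simp: indicator_def)
  then show ?thesis
    using borel_integrable_compact[OF assms(2) continuous_on_subset[OF assms(1)]] by simp
qed

text \<open>The integral of a translate does not depend on the translation; differentiate in the translation.\<close>
lemma integral_derivative_compact_support:
  fixes f :: "'a::euclidean_space \<Rightarrow> 'b::{banach,second_countable_topology}"
  assumes D: "\<And>x. (f has_derivative f' x) (at x)" and c: "continuous_on UNIV (\<lambda>x. f' x v)"
    and K: "compact K" "\<And>x. x \<notin> K \<Longrightarrow> f x = 0"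
  shows "integrable lborel (\<lambda>x. f' x v)" "(\<integral>x. f' x v \<partial>lborel) = 0"
proof -
  have f'0: "f' x w = 0" if "x \<notin> K" for x w
  proof -
    have "(f has_derivative (\<lambda>_. 0)) (at x)"
      by (rule has_derivative_transform_within_open[of "\<lambda>_. 0" _ _ _ "- K"])
        (use K that in \<open>auto simp: compact_imp_closed open_Compl\<close>)
    then show ?thesis using D has_derivative_unique by metis
  qed
  have fc: "continuous_on UNIV f" using D by (meson has_derivative_continuous continuous_at_imp_continuous_on)
  show "integrable lborel (\<lambda>x. f' x v)"
    by (rule integrable_compact_support[OF c K(1)]) (simp add: f'0)
  obtain R where R: "R > 0" "K \<subseteq> cball 0 R"
    using compact_imp_bounded[OF K(1)] by (metis bounded_pos subsetI mem_cball_0)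
  have "bounded ((\<lambda>x. f' x v) ` K)"
    by (intro compact_imp_bounded compact_continuous_image continuous_on_subset[OF c] K(1)) simp
  then obtain B where B: "B > 0" "\<And>x. x \<in> K \<Longrightarrow> norm (f' x v) \<le> B"
    by (auto simp: bounded_pos)
  have B': "norm (f' x v) \<le> B" for x using B f'0 by (cases "x \<in> K") auto
  define F where "F t x = f (t *\<^sub>R v + x)" for t :: real and x
  have Ft: "(\<integral>x. F t x \<partial>lborel) = (\<integral>x. f x \<partial>lborel)" for t
  proof -
    have "(\<integral>x. f x \<partial>lborel) = (\<integral>x. f x \<partial>distr lborel borel ((+) (t *\<^sub>R v)))" by (simp add: lborel_distr_plus)
    also have "\<dots> = (\<integral>x. F t x \<partial>lborel)"
      unfolding F_def using fc by (subst integral_distr) (auto simp: borel_measurable_continuous_onI)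
    finally show ?thesis by simp
  qed
  \<comment> \<open>This ball contains the supports of all translates with |t| < 1, so a constant
    multiple of its indicator dominates the derivatives.\<close>
  let ?C = "cball 0 (R + norm v) :: 'a set"
  have "((\<lambda>t. \<integral>x. F t x \<partial>lborel) has_derivative (\<lambda>s. \<integral>x. s *\<^sub>R f' (0 *\<^sub>R v + x) v \<partial>lborel)) (at 0)"
  proof (rule has_derivative_integral(2)[where e=1 and B="\<lambda>x. B * indicator ?C x"])
    show "integrable lborel (F t)" for t
      unfolding F_def
    proof (rule integrable_compact_support)
      show "continuous_on UNIV (\<lambda>x. f (t *\<^sub>R v + x))"
        by (intro continuous_intros continuous_on_compose2[OF fc]) auto
      show "compact ((\<lambda>x. x - t *\<^sub>R v) ` K)"
        by (intro compact_continuous_image continuous_intros K)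
      show "f (t *\<^sub>R v + x) = 0" if "x \<notin> (\<lambda>x. x - t *\<^sub>R v) ` K" for x
        using that by (intro K(2)) (force simp: image_iff algebra_simps)
    qed
    show "((\<lambda>t. F t x) has_derivative (\<lambda>s. s *\<^sub>R f' (t *\<^sub>R v + x) v)) (at t)" for t x
    proof -
      have "((\<lambda>t. f (t *\<^sub>R v + x)) has_derivative (\<lambda>s. f' (t *\<^sub>R v + x) (s *\<^sub>R v))) (at t)"
        by (rule has_derivative_compose[OF _ D]) (auto intro!: derivative_eq_intros)
      then show ?thesis
        using linear_scale[OF has_derivative_linear[OF D]] by (simp add: F_def)
    qed
    show "(\<lambda>x. s *\<^sub>R f' (0 *\<^sub>R v + x) v) \<in> borel_measurable lborel" for s
      using borel_measurable_continuous_onI[OF c] by simp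
    show "norm (s *\<^sub>R f' (t *\<^sub>R v + x) v) \<le> B * indicator ?C x * norm s" if "t \<in> ball 0 1" for t x s
    proof (cases "x \<in> ?C")
      case True
      then show ?thesis using mult_right_mono[OF B'[of "t *\<^sub>R v + x"], of "\<bar>s\<bar>"] by (simp add: mult.commute)
    next
      case False
      have "norm (t *\<^sub>R v) \<le> norm v" using that by (simp add: mult_left_le_one_le)
      then have "norm (t *\<^sub>R v + x) > R" using False norm_diff_ineq[of x "t *\<^sub>R v"] by (simp add: add.commute)
      then have "t *\<^sub>R v + x \<notin> K" using R by auto
      then show ?thesis using f'0 B(1) by simp
    qed
    have "emeasure lborel ?C < \<infinity>" by (intro emeasure_bounded_finite) simp
    then show "integrable lborel (\<lambda>x. B * indicator ?C x)" by (simp add: less_top)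
  qed simp
  then have "((\<lambda>t. \<integral>x. f x \<partial>lborel) has_derivative (\<lambda>s. s *\<^sub>R (\<integral>x. f' x v \<partial>lborel))) (at 0)"
    unfolding Ft by simp
  moreover have "((\<lambda>t::real. \<integral>x. f x \<partial>lborel) has_derivative (\<lambda>s. 0)) (at 0)" by simp
  ultimately have "(\<lambda>s::real. s *\<^sub>R (\<integral>x. f' x v \<partial>lborel)) = (\<lambda>s. 0)" by (rule has_derivative_unique)
  from fun_cong[OF this, of 1] show "(\<integral>x. f' x v \<partial>lborel) = 0" by simp
qed

section \<open>Closure properties of smooth maps and symmetry of second derivatives\<close>

lemma smooth_derivative: "smooth_on U f \<Longrightarrow> x \<in> U \<Longrightarrow> (f has_derivative \<D> f x) (at x)"
  unfolding smooth_on_def by (meson Ck_SucD)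

lemma smooth_fderiv: "smooth_on U f \<Longrightarrow> smooth_on U (\<lambda>x. \<D> f x v)"
  unfolding smooth_on_def using Ck_on.simps(2)[of _ U f] by blast

lemma smooth_cont: "smooth_on U f \<Longrightarrow> continuous_on U f"
  unfolding smooth_on_def by (metis Ck_on.simps(1))

lemma smooth_subset: "smooth_on U f \<Longrightarrow> V \<subseteq> U \<Longrightarrow> smooth_on V f"
proof -
  have "Ck_on k U f \<Longrightarrow> V \<subseteq> U \<Longrightarrow> Ck_on k V f" for k and f :: "'a \<Rightarrow> 'b"
    by (induction k arbitrary: f) (auto intro: continuous_on_subset)
  then show "smooth_on U f \<Longrightarrow> V \<subseteq> U \<Longrightarrow> smooth_on V f" by (simp add: smooth_on_def)
qed

lemma smooth_bilinear:
  "bounded_bilinear pr \<Longrightarrow> open U \<Longrightarrow> smooth_on U f \<Longrightarrow> smooth_on U g \<Longrightarrow> smooth_on U (\<lambda>x. pr (f x) (g x))"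
  unfolding smooth_on_def using Ck_bilinear by blast

lemma smooth_times: "open U \<Longrightarrow> smooth_on U f \<Longrightarrow> smooth_on U g \<Longrightarrow> smooth_on U (\<lambda>x. f x * g x)"
  for f :: "'a::euclidean_space \<Rightarrow> 'b::{real_normed_algebra, euclidean_space}"
  by (rule smooth_bilinear[OF bounded_bilinear_mult])

lemma smooth_sum: "open U \<Longrightarrow> (\<And>i. i \<in> I \<Longrightarrow> smooth_on U (f i)) \<Longrightarrow> smooth_on U (\<lambda>x. \<Sum>i\<in>I. f i x)"
  unfolding smooth_on_def by (metis Ck_sum)

lemma smooth_uminus: "open U \<Longrightarrow> smooth_on U f \<Longrightarrow> smooth_on U (\<lambda>x. - f x)"
  for f :: "_ \<Rightarrow> 'b::euclidean_space"
  using smooth_linear_compose[OF _ bounded_linear_minus[OF bounded_linear_ident]] by auto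

lemma smooth_diff: "open U \<Longrightarrow> smooth_on U f \<Longrightarrow> smooth_on U g \<Longrightarrow> smooth_on U (\<lambda>x. f x - g x)"
  for f :: "_ \<Rightarrow> 'b::euclidean_space"
  using smooth_add[OF _ _ smooth_uminus, of U f g] by simp

lemma smooth_power: "open U \<Longrightarrow> smooth_on U f \<Longrightarrow> smooth_on U (\<lambda>x. f x ^ n)"
  for f :: "'a::euclidean_space \<Rightarrow> 'b::{real_normed_algebra_1, euclidean_space}"
  by (induction n) (auto intro: smooth_const smooth_times)

lemma smooth_divide: "open U \<Longrightarrow> smooth_on U f \<Longrightarrow> smooth_on U g \<Longrightarrow> (\<And>x. x \<in> U \<Longrightarrow> g x \<noteq> 0) \<Longrightarrow> smooth_on U (\<lambda>x. f x / g x :: real)"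
  unfolding divide_inverse by (intro smooth_mult smooth_inverse)

lemma smooth_nth: "open U \<Longrightarrow> smooth_on U f \<Longrightarrow> smooth_on U (\<lambda>x. f x $ i)"
  for f :: "_ \<Rightarrow> 'b::euclidean_space ^ 'n"
  by (rule smooth_linear_compose[OF _ bounded_linear_vec_nth])

lemma smooth_vec:
  fixes f :: "'a::euclidean_space \<Rightarrow> 'b::euclidean_space ^ 'n"
  assumes "open U" "\<And>i. smooth_on U (\<lambda>x. f x $ i)"
  shows "smooth_on U f"
proof -
  have "bounded_linear (axis i :: 'b \<Rightarrow> 'b ^ 'n)" for i
    by (simp add: linear_conv_bounded_linear[symmetric]) (rule linearI; simp add: axis_def vec_eq_iff)
  then have "smooth_on U (\<lambda>x. axis i (f x $ i) :: 'b ^ 'n)" for i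
    by (rule smooth_linear_compose[OF assms(1) _ assms(2)])
  then have "smooth_on U (\<lambda>x. \<Sum>i\<in>UNIV. axis i (f x $ i) :: 'b ^ 'n)"
    by (intro smooth_sum assms)
  moreover have "(\<Sum>i\<in>UNIV. axis i (f x $ i)) = f x" for x
    by (simp add: vec_eq_iff axis_def if_distrib[of "\<lambda>v. v $ _"] sum.delta' cong: if_cong)
  ultimately show ?thesis by simp
qed

lemma smooth_matrix:
  fixes f :: "'a::euclidean_space \<Rightarrow> real ^ 'm ^ 'n"
  assumes "open U" "\<And>i j. smooth_on U (\<lambda>x. f x $ i $ j)"
  shows "smooth_on U f"
  by (intro smooth_vec assms)

lemma linear_Basis_sum: "linear f \<Longrightarrow> f v = (\<Sum>b\<in>Basis. (v \<bullet> b) *\<^sub>R f b)"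
  for f :: "'a::euclidean_space \<Rightarrow> 'b::real_vector"
  using linear_sum[of f "\<lambda>b. (v \<bullet> b) *\<^sub>R b" Basis] by (simp add: euclidean_representation linear_scale)

text \<open>Smoothness of a form is stated for each constant vector; expansion in the basis
  transfers it to a vector that varies with the point.\<close>

lemma smooth_linear_apply:
  fixes w :: "'a::euclidean_space \<Rightarrow> 'c::euclidean_space" and L :: "'a \<Rightarrow> 'c \<Rightarrow> 'b::euclidean_space"
  assumes U: "open U" and L: "\<And>x. x \<in> U \<Longrightarrow> linear (L x)" "\<And>v. smooth_on U (\<lambda>x. L x v)" and w: "smooth_on U w"
  shows "smooth_on U (\<lambda>x. L x (w x))"
proof -
  have "smooth_on U (\<lambda>x. \<Sum>b\<in>Basis. (w x \<bullet> b) *\<^sub>R L x b)"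
    by (intro smooth_sum U smooth_scaleR L smooth_bilinear[OF bounded_bilinear_inner] w smooth_const)
  then show ?thesis
    by (rule smooth_cong[OF U]) (simp add: linear_Basis_sum[OF L(1), symmetric])
qed

lemma holomorphic_smooth: "f holomorphic_on U \<Longrightarrow> open U \<Longrightarrow> smooth_on U f"
proof -
  assume U: "open U"
  have "Ck_on k U f" if "f holomorphic_on U" for k f
    using that
  proof (induction k arbitrary: f)
    case 0 then show ?case by (simp add: holomorphic_on_imp_continuous_on)
  next
    case (Suc k)
    have "Ck_on k U (\<lambda>x. deriv f x * v)" for v
      using Suc holomorphic_deriv[OF Suc.prems U] by (intro Suc.IH holomorphic_intros U)
    moreover have "(f has_derivative (\<lambda>v. deriv f x * v)) (at x)" if "x \<in> U" for x
      using holomorphic_derivI[OF Suc.prems U that] by (simp add: has_field_derivative_def)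
    ultimately show ?case by (intro Ck_SucI[OF U])
  qed
  then show "f holomorphic_on U \<Longrightarrow> smooth_on U f" by (simp add: smooth_on_def)
qed

lemma mean_value_line:
  fixes f :: "'a::real_normed_vector \<Rightarrow> real"
  assumes "h > 0" "\<And>t. (f has_derivative f' (x + t *\<^sub>R v)) (at (x + t *\<^sub>R v))"
  shows "\<exists>t. 0 < t \<and> t < h \<and> f (x + h *\<^sub>R v) - f x = h * f' (x + t *\<^sub>R v) v"
proof -
  have "((\<lambda>t. f (x + t *\<^sub>R v)) has_real_derivative f' (x + t *\<^sub>R v) v) (at t)" for t
  proof -
    have "((\<lambda>t. f (x + t *\<^sub>R v)) has_derivative (\<lambda>s. f' (x + t *\<^sub>R v) (s *\<^sub>R v))) (at t)"
      by (rule has_derivative_compose[where f="\<lambda>t. x + t *\<^sub>R v" and g=f], (auto intro!: derivative_eq_intros)[1], rule assms(2))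
    then show ?thesis
      using linear_scale[OF has_derivative_linear[OF assms(2)[of t]]] 
      by (simp add: has_field_derivative_def mult.commute[of _ "f' (x + t *\<^sub>R v) v"])
  qed
  then show ?thesis
    using MVT2[of 0 h "\<lambda>t. f (x + t *\<^sub>R v)" "\<lambda>t. f' (x + t *\<^sub>R v) v"] assms(1) by auto
qed

text \<open>The second difference \<open>?Q v w h\<close> is symmetric in v and w. Two applications
  of the mean value theorem express it as h^2 times a mixed derivative at a point within distance of
  order h, and continuity of the mixed derivative lets h tend to 0.\<close>

lemma symmetric_second_derivative_real:
  fixes f :: "'a::euclidean_space \<Rightarrow> real"
  assumes f: "smooth_on UNIV f"
  shows "\<D> (\<lambda>y. frechet_derivative f (at y) v) x w
    = \<D> (\<lambda>y. frechet_derivative f (at y) w) x v"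
proof -
  let ?D = "\<lambda>v y. \<D> f y v"
  let ?DD = "\<lambda>v w y. frechet_derivative (?D v) (at y) w"
  have D: "(f has_derivative \<D> f y) (at y)" for y
    using smooth_derivative[OF f] by simp
  have DD: "(?D v has_derivative frechet_derivative (?D v) (at y)) (at y)" for v y
    using smooth_derivative[OF smooth_fderiv[OF f]] by simp
  have cont: "isCont (?DD v w) x" for v w
    using smooth_cont[OF smooth_fderiv[OF smooth_fderiv[OF f]]]
    by (simp add: continuous_on_eq_continuous_at)
  let ?Q = "\<lambda>v w h. f (x + h *\<^sub>R v + h *\<^sub>R w) - f (x + h *\<^sub>R v) - (f (x + h *\<^sub>R w) - f x)"
  have key: "\<exists>s t. 0 < s \<and> s < h \<and> 0 < t \<and> t < h \<and> ?Q v w h / h\<^sup>2 = ?DD v w (x + s *\<^sub>R v + t *\<^sub>R w)"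
    if h: "h > 0" for h v w
  proof -
    have "((\<lambda>y. f (y + h *\<^sub>R w) - f y) has_derivative (\<lambda>v. ?D v (y + h *\<^sub>R w) - ?D v y)) (at y)" for y
    proof (rule has_derivative_diff[OF _ D])
      show "((\<lambda>y. f (y + h *\<^sub>R w)) has_derivative (\<lambda>v. ?D v (y + h *\<^sub>R w))) (at y)"
        by (rule has_derivative_compose[OF _ D]) (auto intro!: derivative_eq_intros)
    qed
    from mean_value_line[OF h this, of x v] obtain s where s: "0 < s" "s < h"
      "?Q v w h = h * (?D v (x + s *\<^sub>R v + h *\<^sub>R w) - ?D v (x + s *\<^sub>R v))"
      by auto
    from mean_value_line[OF h DD, of "x + s *\<^sub>R v" w v] obtain t where t: "0 < t" "t < h"
      "?D v (x + s *\<^sub>R v + h *\<^sub>R w) - ?D v (x + s *\<^sub>R v) = h * ?DD v w (x + s *\<^sub>R v + t *\<^sub>R w)" by auto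
    show ?thesis using s t h by (intro exI[of _ s] exI[of _ t]) (simp add: power2_eq_square)
  qed
  let ?h = "\<lambda>n. 1 / real (Suc n)"
  have h0: "?h \<longlonglongrightarrow> 0" by (rule LIMSEQ_Suc[OF lim_1_over_n])
  have lim: "(\<lambda>n. ?Q a b (?h n) / (?h n)\<^sup>2) \<longlonglongrightarrow> ?DD a b x" for a b
  proof -
    have "\<exists>s t. 0 < s \<and> s < ?h n \<and> 0 < t \<and> t < ?h n \<and> ?Q a b (?h n) / (?h n)\<^sup>2 = ?DD a b (x + s *\<^sub>R a + t *\<^sub>R b)" for n
      by (rule key) simp
    then obtain s t where st: "\<And>n. 0 < s n" "\<And>n. s n < ?h n" "\<And>n. 0 < t n" "\<And>n. t n < ?h n"
      "\<And>n. ?Q a b (?h n) / (?h n)\<^sup>2 = ?DD a b (x + s n *\<^sub>R a + t n *\<^sub>R b)"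
      by metis
    have "s \<longlonglongrightarrow> 0" "t \<longlonglongrightarrow> 0"
      by (rule real_tendsto_sandwich[OF _ _ tendsto_const h0]; intro always_eventually allI less_imp_le st)+
    then have "(\<lambda>n. x + s n *\<^sub>R a + t n *\<^sub>R b) \<longlonglongrightarrow> x + 0 *\<^sub>R a + 0 *\<^sub>R b"
      by (intro tendsto_intros)
    from isCont_tendsto_compose[OF cont this[simplified]] show ?thesis by (simp only: st)
  qed
  have "?Q v w h = ?Q w v h" for h by (simp add: algebra_simps)
  then have "(\<lambda>n. ?Q v w (?h n) / (?h n)\<^sup>2) \<longlonglongrightarrow> ?DD w v x" by (simp only: lim)
  from LIMSEQ_unique[OF lim this] show ?thesis .
qed

lemma frechet_derivative_linear_compose:
  assumes "bounded_linear g" "f differentiable (at x)"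
  shows "\<D> (\<lambda>x. g (f x)) x v = g (\<D> f x v)"
  using bounded_linear.has_derivative[OF assms(1) assms(2)[unfolded frechet_derivative_works]]
  by (metis frechet_derivative_at)

lemma symmetric_second_derivative:
  fixes f :: "'a::euclidean_space \<Rightarrow> 'b::euclidean_space"
  assumes f: "smooth_on UNIV f"
  shows "\<D> (\<lambda>y. frechet_derivative f (at y) v) x w
    = \<D> (\<lambda>y. frechet_derivative f (at y) w) x v"
proof (rule euclidean_eqI)
  fix b :: 'b
  have d: "f differentiable (at y)" for y
    using smooth_derivative[OF f] by (auto simp: differentiable_def)
  have dd: "(\<lambda>y. \<D> f y v) differentiable (at y)" for y v
    using smooth_derivative[OF smooth_fderiv[OF f]] by (auto simp: differentiable_def)
  have fb: "smooth_on UNIV (\<lambda>x. f x \<bullet> b)"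
    by (intro smooth_linear_compose[OF open_UNIV _ f] bounded_linear_inner_left)
  note L = frechet_derivative_linear_compose[OF bounded_linear_inner_left[of b]]
  show "\<D> (\<lambda>y. frechet_derivative f (at y) v) x w \<bullet> b
    = \<D> (\<lambda>y. frechet_derivative f (at y) w) x v \<bullet> b"
    using symmetric_second_derivative_real[OF fb, of v x w] by (simp add: L[OF d] L[OF dd])
qed

lemma d1_d0: "smooth_on UNIV f \<Longrightarrow> d1 (d0 f) s v w = 0"
  for f :: "plane \<Rightarrow> 'b::euclidean_space"
  by (simp add: d1_def d0_def symmetric_second_derivative)

section \<open>Surfaces and Stokes\<close>

locale surface =
  fixes S :: "'s::t2_space set" and p :: "plane \<Rightarrow> 's"
  assumes surface: "closed_oriented_surface S p"
begin

lemma compact_S: "compact S" and cover: "covering_space UNIV p S"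
  using surface by (auto simp: closed_oriented_surface_def)

lemma deck_smooth: "\<gamma> \<in> deck p \<Longrightarrow> smooth_on UNIV \<gamma>"
  and deck_det: "\<gamma> \<in> deck p \<Longrightarrow> det (matrix (\<D> \<gamma> s)) > 0"
  using surface by (auto simp: closed_oriented_surface_def)

lemma deck_derivative: "\<gamma> \<in> deck p \<Longrightarrow> (\<gamma> has_derivative \<D> \<gamma> s) (at s)"
  using smooth_derivative[OF deck_smooth] by simp

lemma p_continuous: "continuous_on A p"
  using covering_space_imp_continuous[OF cover] continuous_on_subset by blast

lemma range_p: "range p = S"
  using covering_space_imp_surjective[OF cover] .

lemma p_in [simp]: "p x \<in> S"
  using range_p by blast

lemma open_vimage_p: "openin (top_of_set S) V \<Longrightarrow> open (p -` V)"
  using continuous_openin_preimage[OF p_continuous[of UNIV], of S V] by auto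

lemma p_open_map:
  assumes "open U" shows "openin (top_of_set S) (p ` U)"
proof (subst openin_subopen, intro ballI)
  fix y assume "y \<in> p ` U"
  then obtain x where x: "x \<in> U" "y = p x" by auto
  obtain T u q where T: "x \<in> T" "openin (top_of_set UNIV) T" "p x \<in> u" "openin (top_of_set S) u" "homeomorphism T u p q"
    using covering_space_local_homeomorphism[OF cover, of x] by auto
  have "openin (top_of_set T) (T \<inter> U)" using assms by (simp add: openin_open_Int)
  then have "openin (top_of_set u) (p ` (T \<inter> U))" by (rule homeomorphism_imp_open_map[OF T(5)])
  then have "openin (top_of_set S) (p ` (T \<inter> U))" using T(4) openin_trans by blast
  then show "\<exists>V. openin (top_of_set S) V \<and> y \<in> V \<and> V \<subseteq> p ` U" using x T by blast
qed

lemma p_locally_inj: "\<exists>e>0. inj_on p (ball x e)"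
proof -
  obtain T u q where T: "x \<in> T" "openin (top_of_set UNIV) T" "homeomorphism T u p q"
    by (rule covering_space_local_homeomorphism[OF cover UNIV_I])
  then have "open T" by simp
  then obtain e where "e > 0" "ball x e \<subseteq> T" using T(1) open_contains_ball by blast
  moreover have "inj_on p T" using T(3) by (metis homeomorphism_def inj_on_inverseI)
  ultimately show ?thesis using inj_on_subset by blast
qed

lemma deck_p: "\<gamma> \<in> deck p \<Longrightarrow> p (\<gamma> x) = p x"
  by (auto simp: deck_def dest: fun_cong[of _ _ x])

lemma deck_homeo: "\<gamma> \<in> deck p \<Longrightarrow> \<exists>\<delta>\<in>deck p. homeomorphism UNIV UNIV \<gamma> \<delta>"
proof -
  assume "\<gamma> \<in> deck p"
  then obtain \<delta> where h: "homeomorphism UNIV UNIV \<gamma> \<delta>" "p \<circ> \<gamma> = p" by (auto simp: deck_def)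
  then have "\<gamma> (\<delta> x) = x" for x by (simp add: homeomorphism_def)
  then have "p \<circ> \<delta> = p" using fun_cong[OF h(2), of "\<delta> _"] by auto
  then show ?thesis using h(1) homeomorphism_sym[of UNIV UNIV \<gamma> \<delta>] unfolding deck_def by blast
qed

lemma deck_bij: "\<gamma> \<in> deck p \<Longrightarrow> bij \<gamma>"
  by (auto simp: deck_def homeomorphism_def bij_def inj_on_def) (metis)

lemma deck_continuous: "\<gamma> \<in> deck p \<Longrightarrow> continuous_on A \<gamma>"
  by (auto simp: deck_def homeomorphism_def intro: continuous_on_subset)

lemma deck_open: "\<gamma> \<in> deck p \<Longrightarrow> open U \<Longrightarrow> open (\<gamma> ` U)"
  using homeomorphism_imp_open_map[of UNIV UNIV \<gamma> _ U] by (auto simp: deck_def)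

text \<open>Both maps lift \<open>p\<close> through the covering \<open>p\<close>, and lifts on a
  connected space that agree at a point agree everywhere.\<close>

lemma deck_unique:
  assumes "\<gamma> \<in> deck p" "\<delta> \<in> deck p" "\<gamma> x = \<delta> x"
  shows "\<gamma> = \<delta>"
proof
  fix y
  show "\<gamma> y = \<delta> y"
  proof (rule covering_space_lift_unique[OF cover, where f=p and T=UNIV and a=x and ?g1.0=\<gamma> and ?g2.0=\<delta>])
    show "p y = p (\<gamma> y)" "p y = p (\<delta> y)" for y using assms deck_p by auto
  qed (use assms deck_continuous p_continuous in auto)
qed

text \<open>The library lifts maps into normed spaces only; so lift the identity of the plane through the
  first projection of the fibre product of two copies of \<open>p\<close>, which is a covering of the plane.\<close>
lemma lift_through:
  assumes "p x = p y"
  shows "\<exists>\<gamma>. continuous_on UNIV \<gamma> \<and> p \<circ> \<gamma> = p \<and> \<gamma> x = y"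
proof -
  define R where "R = {z. p (fst z) = p (snd z)}"
  have "covering_space R fst (UNIV :: plane set)"
  proof
    show "continuous_on R fst" by (intro continuous_intros)
    show "fst ` R = UNIV" by (force simp: R_def image_iff intro: exI[of _ "(_, _)"])
    fix x :: plane
    obtain T v where T: "p x \<in> T" "openin (top_of_set S) T" "\<Union>v = UNIV \<inter> p -` T" 
       and vo: "\<And>u. u \<in> v \<Longrightarrow> openin (top_of_set UNIV) u" and vd: "pairwise disjnt v"
       and vh: "\<And>u. u \<in> v \<Longrightarrow> \<exists>q. homeomorphism u T p q"
      using cover p_in[of x] unfolding covering_space_def by meson
    obtain u0 where u0: "u0 \<in> v" "x \<in> u0" using T by blast
    have pu0: "p ` u0 \<subseteq> T" using u0 T by blast
    \<comment> \<open>The sheets over \<open>u0\<close>: each sheet \<open>w\<close> of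
      \<open>p\<close> over \<open>T\<close> meets the fibre product, above \<open>u0\<close>, in
      the graph of the local inverse of \<open>p\<close> into \<open>w\<close> composed with
      \<open>p\<close>.\<close>
    define V where "V = (\<lambda>w. R \<inter> (u0 \<times> w)) ` v"
    have "\<Union>V = R \<inter> fst -` u0"
    proof
      show "R \<inter> fst -` u0 \<subseteq> \<Union>V"
      proof
        fix z assume z: "z \<in> R \<inter> fst -` u0"
        then have "p (snd z) \<in> T" using pu0 by (auto simp: R_def)
        then have "snd z \<in> \<Union>v" unfolding T(3) by blast
        then obtain w where "w \<in> v" "snd z \<in> w" by blast
        then have "z \<in> R \<inter> (u0 \<times> w)" using z by (auto simp: mem_Times_iff)
        then show "z \<in> \<Union>V" using \<open>w \<in> v\<close> unfolding V_def by blast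
      qed
    qed (auto simp: V_def)
    moreover have "openin (top_of_set R) u" if uV: "u \<in> V" for u
    proof -
      obtain w where "w \<in> v" "u = R \<inter> (u0 \<times> w)" using uV by (auto simp: V_def)
      then show ?thesis using vo[OF u0(1)] vo[OF \<open>w \<in> v\<close>] by (auto intro!: openin_open_Int open_Times)
    qed
    moreover have "pairwise disjnt V"
    proof -
      have "disjnt (R \<inter> (u0 \<times> w)) (R \<inter> (u0 \<times> w'))" if "w \<in> v" "w' \<in> v" "R \<inter> (u0 \<times> w) \<noteq> R \<inter> (u0 \<times> w')" for w w'
        using pairwiseD[OF vd that(1,2)] that(3) by (auto simp: disjnt_def)
      then show ?thesis unfolding V_def pairwise_def by blast
    qed
    moreover have "\<exists>q. homeomorphism u u0 fst q" if uV: "u \<in> V" for u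
    proof -
      obtain w where w: "w \<in> v" "u = R \<inter> (u0 \<times> w)" using uV by (auto simp: V_def)
      obtain q where q: "homeomorphism w T p q" using vh[OF w(1)] by blast
      have qw: "q t \<in> w" "p (q t) = t" if "t \<in> T" for t using q that by (auto simp: homeomorphism_def)
      have qp: "q (p t) = t" if "t \<in> w" for t using q that by (auto simp: homeomorphism_def)
      have "homeomorphism u u0 fst (\<lambda>t. (t, q (p t)))"
        unfolding homeomorphism_def
      proof (intro conjI ballI)
        show "continuous_on u0 (\<lambda>t. (t, q (p t)))"
          using q pu0 by (intro continuous_intros continuous_on_compose2[of T q u0 p] p_continuous) (auto simp: homeomorphism_def)
        have im: "(t, q (p t)) \<in> u" if "t \<in> u0" for t using that pu0 qw[of "p t"] by (auto simp: w R_def)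
        show fg: "(fst z, q (p (fst z))) = z" if "z \<in> u" for z
          using that qp[of "snd z"] by (auto simp: w R_def)
        show "(\<lambda>t. (t, q (p t))) ` u0 = u"
        proof
          show "u \<subseteq> (\<lambda>t. (t, q (p t))) ` u0"
          proof
            fix z assume z: "z \<in> u"
            then have "fst z \<in> u0" by (auto simp: w)
            then show "z \<in> (\<lambda>t. (t, q (p t))) ` u0" using image_eqI[of z "\<lambda>t. (t, q (p t))" "fst z" u0] fg[OF z] by simp
          qed
        qed (use im in auto)
        show "fst ` u = u0"
        proof
          show "u0 \<subseteq> fst ` u"
          proof
            fix t assume "t \<in> u0"
            then show "t \<in> fst ` u" using image_eqI[of t fst "(t, q (p t))" u] im by simp
          qed
        qed (auto simp: w)
      qed (auto intro: continuous_intros)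
      then show ?thesis by blast
    qed
    ultimately show "\<exists>T. x \<in> T \<and> openin (top_of_set UNIV) T \<and> (\<exists>v. \<Union>v = R \<inter> fst -` T \<and> (\<forall>u\<in>v. openin (top_of_set R) u) \<and> pairwise disjnt v \<and> (\<forall>u\<in>v. \<exists>q. homeomorphism u T fst q))"
      using u0 vo by (intro exI[of _ u0] conjI exI[of _ V]) auto
  qed
  moreover have "(x, y) \<in> R" using assms by (simp add: R_def)
  moreover have "simply_connected (UNIV :: plane set)" "locally path_connected (UNIV :: plane set)"
    by (auto intro: convex_imp_simply_connected convex_imp_locally_path_connected)
  ultimately have "\<exists>g. continuous_on UNIV g \<and> g \<in> UNIV \<rightarrow> R \<and> g x = (x, y) \<and> (\<forall>z. fst (g z) = z)"
    by (elim covering_space_lift_strong[of R fst UNIV "(x, y)" x UNIV "\<lambda>x. x"]) auto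
  then obtain g where g: "continuous_on UNIV g" "g \<in> UNIV \<rightarrow> R" "g x = (x, y)" "\<And>z. fst (g z) = z" by blast
  have "p (snd (g z)) = p z" for z
  proof -
    have "g z \<in> R" using g(2) by auto
    then show ?thesis using g(4)[of z] by (simp add: R_def)
  qed
  then show ?thesis
    using g by (intro exI[of _ "snd \<circ> g"]) (auto simp: intro!: continuous_on_compose continuous_intros)
qed

text \<open>The lift taking x to y and the lift taking y to x compose, in either order, to a lift
  with a fixed point, which is the identity. Hence they are inverse homeomorphisms.\<close>

lemma deck_transitive:
  assumes "p x = p y"
  obtains \<gamma> where "\<gamma> \<in> deck p" "\<gamma> x = y"
proof -
  obtain \<gamma> where \<gamma>: "continuous_on UNIV \<gamma>" "p \<circ> \<gamma> = p" "\<gamma> x = y" using lift_through[OF assms] by blast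
  obtain \<delta> where \<delta>: "continuous_on UNIV \<delta>" "p \<circ> \<delta> = p" "\<delta> y = x" using lift_through[OF assms[symmetric]] by blast
  have id: "g z = z" if "continuous_on UNIV g" "p \<circ> g = p" "g a = a" for g a z
  proof (rule covering_space_lift_unique[OF cover, where f=p and T=UNIV and a=a and ?g1.0=g and ?g2.0="\<lambda>z. z"])
    show "p y = p (g y)" for y using fun_cong[OF that(2), of y] by simp
  qed (use that p_continuous in auto)
  have "\<gamma> (\<delta> z) = z" for z
    using id[of "\<gamma> \<circ> \<delta>" y z] \<gamma> \<delta> by (auto simp: comp_assoc[symmetric] intro: continuous_on_compose2)
  moreover have "\<delta> (\<gamma> z) = z" for z
    using id[of "\<delta> \<circ> \<gamma>" x z] \<gamma> \<delta> by (auto simp: comp_assoc[symmetric] intro: continuous_on_compose2)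
  ultimately have "homeomorphism UNIV UNIV \<gamma> \<delta>"
    using \<gamma> \<delta> by (auto simp: homeomorphism_def image_iff) metis+
  then show ?thesis using \<gamma> that by (auto simp: deck_def)
qed

text \<open>The translates of a disc on which \<open>p\<close> is injective are pairwise disjoint
  open sets, and the plane has room for countably many of them.\<close>

lemma countable_deck: "countable (deck p)"
proof -
  obtain e where e: "e > 0" "inj_on p (ball 0 e)" using p_locally_inj by blast
  have inj: "\<gamma> = \<delta>" if gd: "\<gamma> \<in> deck p" "\<delta> \<in> deck p" "\<gamma> ` ball 0 e \<inter> \<delta> ` ball 0 e \<noteq> {}" for \<gamma> \<delta>
  proof -
    obtain a b where ab: "a \<in> ball 0 e" "b \<in> ball 0 e" "\<gamma> a = \<delta> b" using gd(3) by blast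
    then have "p a = p b" using gd deck_p by metis
    then have "a = b" using ab inj_onD[OF e(2)] by blast
    then show ?thesis using ab gd deck_unique by blast
  qed
  have ne: "\<gamma> ` ball 0 e \<noteq> {}" for \<gamma> :: "plane \<Rightarrow> plane" using e by auto
  have "countable ((\<lambda>\<gamma>. \<gamma> ` ball 0 e) ` deck p)"
  proof (rule countable_disjoint_open_subsets)
    show "pairwise disjnt ((\<lambda>\<gamma>. \<gamma> ` ball 0 e) ` deck p)"
      unfolding pairwise_def disjnt_def using inj by blast
  qed (use deck_open in auto)
  moreover have "inj_on (\<lambda>\<gamma>. \<gamma> ` ball 0 e) (deck p)"
    by (rule inj_onI) (use inj ne in auto)
  ultimately show ?thesis by (rule countable_image_inj_on)
qed

text \<open>Discs of this radius are used to cover S, while discs of twice the radius still embed.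
  The gap leaves room for bump functions supported in the smaller closed disc.\<close>

definition inj_radius :: "plane \<Rightarrow> real" where
  "inj_radius x = (SOME e. e > 0 \<and> inj_on p (ball x (2 * e)))"

lemma inj_radius: "inj_radius x > 0" "inj_on p (ball x (2 * inj_radius x))"
proof -
  obtain e where "e > 0" "inj_on p (ball x e)" using p_locally_inj by blast
  then have "e / 2 > 0 \<and> inj_on p (ball x (2 * (e / 2)))" by simp
  from someI[of "\<lambda>e. e > 0 \<and> inj_on p (ball x (2 * e))", OF this]
  show "inj_radius x > 0" "inj_on p (ball x (2 * inj_radius x))" by (auto simp: inj_radius_def)
qed

lemma inj_ball: "inj_on p (ball c (inj_radius c))"
  by (rule inj_on_subset[OF inj_radius(2)[of c]]) (use inj_radius(1)[of c] in auto)

lemma finite_ball_cover: "\<exists>F. finite F \<and> S = (\<Union>c\<in>F. p ` ball c (inj_radius c))"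
proof -
  let ?C = "range (\<lambda>c. p ` ball c (inj_radius c))"
  have "S \<subseteq> \<Union>?C"
  proof
    fix y assume "y \<in> S"
    then obtain x where "y = p x" using range_p by blast
    then have "y \<in> p ` ball x (inj_radius x)" using inj_radius(1) by auto
    then show "y \<in> \<Union>?C" by blast
  qed
  then obtain D where D: "D \<subseteq> ?C" "finite D" "S \<subseteq> \<Union>D"
  proof -
    have "(\<forall>c\<in>?C. openin (top_of_set S) c) \<and> S \<subseteq> \<Union>?C" using \<open>S \<subseteq> \<Union>?C\<close> p_open_map by blast
    then have "\<exists>D\<subseteq>?C. finite D \<and> S \<subseteq> \<Union>D" using compact_S unfolding compact_eq_openin_cover by blast
    then show ?thesis using that by blast
  qed
  then obtain F where "finite F" "D = (\<lambda>c. p ` ball c (inj_radius c)) ` F" using finite_subset_image[OF D(2,1)] by auto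
  then show ?thesis using D by (intro exI[of _ F]) (auto simp: subset_iff)
qed

text \<open>This gives meaning to the choice in \<open>fundamental_domain\<close>. From each disc of
  a finite cover only those points are kept whose image has not been reached by an earlier
  disc.\<close>

lemma fundamental_domain_ex: "\<exists>D. D \<in> sets borel \<and> bij_betw p D (range p)"
proof -
  obtain F where F: "finite F" "S = (\<Union>c\<in>F. p ` ball c (inj_radius c))" using finite_ball_cover by blast
  obtain c n where c: "F = c ` {i::nat. i < n}" using finite_imp_nat_seg_image_inj_on[OF F(1)] by blast
  define B where "B i = ball (c i) (inj_radius (c i))" for i
  have SB: "S = (\<Union>i<n. p ` B i)" using F(2) unfolding c B_def by (simp add: lessThan_def image_image)
  define D where "D = (\<Union>i<n. B i - (\<Union>j<i. p -` p ` B j))"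
  have "open (p -` p ` B j)" for j by (rule open_vimage_p[OF p_open_map]) (simp add: B_def)
  then have "D \<in> sets borel" unfolding D_def B_def by auto
  moreover have "inj_on p D"
  proof (rule inj_onI)
    fix x y assume xy: "x \<in> D" "y \<in> D" "p x = p y"
    obtain i where i: "x \<in> B i" "\<And>j. j < i \<Longrightarrow> p x \<notin> p ` B j" using xy(1) by (auto simp: D_def)
    obtain j where j: "y \<in> B j" "\<And>i. i < j \<Longrightarrow> p y \<notin> p ` B i" using xy(2) by (auto simp: D_def)
    have "i = j"
    proof (rule linorder_cases[of i j])
      assume "i < j" then show ?thesis using j(2)[of i] i(1) xy(3) by (metis imageI)
    next
      assume "j < i" then show ?thesis using i(2)[of j] j(1) xy(3) by (metis imageI)
    qed
    moreover have "inj_on p (B i)"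
      unfolding B_def by (rule inj_ball)
    ultimately show "x = y" using i j xy(3) by (auto dest: inj_onD)
  qed
  moreover have "S \<subseteq> p ` D"
  proof
    fix y assume "y \<in> S"
    then have ex: "\<exists>i. i < n \<and> y \<in> p ` B i" using SB by auto
    define i where "i = (LEAST i. i < n \<and> y \<in> p ` B i)"
    have i: "i < n" "y \<in> p ` B i" using LeastI_ex[OF ex] by (auto simp: i_def)
    have "y \<notin> p ` B j" if "j < i" for j using not_less_Least[of j "\<lambda>i. i < n \<and> y \<in> p ` B i"] that i by (auto simp: i_def)
    then show "y \<in> p ` D" using i unfolding D_def by (fastforce simp: image_iff)
  qed
  ultimately show ?thesis using range_p by (auto simp: bij_betw_def)
qed

lemma fundamental_domain: "fundamental_domain p \<in> sets borel" "inj_on p (fundamental_domain p)" "p ` fundamental_domain p = S"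
  using someI_ex[OF fundamental_domain_ex] range_p by (auto simp: fundamental_domain_def bij_betw_def)

end

section \<open>Integration of invariant densities over S\<close>

lemma nn_integral_set_integral_eq:
  fixes f :: "'a \<Rightarrow> 'b::{banach,second_countable_topology}"
  assumes "set_integrable M A f"
  shows "(\<integral>\<^sup>+x. ennreal (norm (f x)) * indicator A x \<partial>M) = ennreal (LINT x:A|M. norm (f x))"
proof -
  have "integrable M (\<lambda>x. norm (indicat_real A x *\<^sub>R f x))"
    using assms unfolding set_integrable_def by (rule integrable_norm)
  from nn_integral_eq_integral[OF this]
  have "(\<integral>\<^sup>+x. ennreal (norm (indicat_real A x *\<^sub>R f x)) \<partial>M) = ennreal (\<integral>x. norm (indicat_real A x *\<^sub>R f x) \<partial>M)" by auto
  moreover have "(\<integral>\<^sup>+x. ennreal (norm (indicat_real A x *\<^sub>R f x)) \<partial>M) = (\<integral>\<^sup>+x. ennreal (norm (f x)) * indicator A x \<partial>M)"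
    by (intro nn_integral_cong) (auto simp: indicator_def)
  ultimately show ?thesis by (simp add: set_lebesgue_integral_def)
qed

context surface
begin

text \<open>The coefficient of a two-form that descends to S. Deck transformations preserve the
  orientation, so the determinant enters without absolute value.\<close>

definition invariant_density :: "(plane \<Rightarrow> 'b::euclidean_space) \<Rightarrow> bool" where
  "invariant_density b \<longleftrightarrow> continuous_on UNIV b \<and>
     (\<forall>\<gamma>\<in>deck p. \<forall>s. det (matrix (\<D> \<gamma> s)) *\<^sub>R b (\<gamma> s) = b s)"

lemma deck_det_continuous: "\<gamma> \<in> deck p \<Longrightarrow> continuous_on A (\<lambda>s. det (matrix (\<D> \<gamma> s)))"
proof -
  assume g: "\<gamma> \<in> deck p"
  have "continuous_on A (\<lambda>s. \<D> \<gamma> s v)" for v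
    using smooth_cont[OF smooth_fderiv[OF deck_smooth[OF g]]] continuous_on_subset by blast
  then show ?thesis unfolding det_2 matrix_def by (auto intro!: continuous_intros)
qed

lemma integral_deck:
  assumes b: "invariant_density b" and g: "\<gamma> \<in> deck p" and E: "E \<in> sets borel" and i: "set_integrable lborel E b"
  shows "\<gamma> ` E \<in> sets borel" "set_integrable lborel (\<gamma> ` E) b" "(LINT s:\<gamma> ` E|lborel. b s) = (LINT s:E|lborel. b s)"
    "(LINT s:\<gamma> ` E|lborel. norm (b s)) = (LINT s:E|lborel. norm (b s))"
proof -
  obtain \<delta> where \<delta>: "\<delta> \<in> deck p" "homeomorphism UNIV UNIV \<gamma> \<delta>" using deck_homeo[OF g] by blast
  have im: "\<gamma> ` E = \<delta> -` E" using \<delta>(2) by (force simp: homeomorphism_def)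
  show gE: "\<gamma> ` E \<in> sets borel"
    unfolding im using measurable_sets[OF borel_measurable_continuous_onI[OF deck_continuous[OF \<delta>(1)]] E] by simp
  have bc: "b \<in> borel_measurable borel" using b by (simp add: invariant_density_def borel_measurable_continuous_onI)
  have rg: "range \<gamma> = UNIV" and inj: "inj_on \<gamma> UNIV" using deck_bij[OF g] by (auto simp: bij_def)
  have ind: "indicat_real (\<gamma> ` E) (\<gamma> s) = indicator E s" for s using inj by (auto simp: indicator_def inj_def)
  have eq: "\<bar>det (matrix (\<D> \<gamma> s))\<bar> *\<^sub>R b (\<gamma> s) = b s" for s
    using b g deck_det[OF g, of s] by (simp add: invariant_density_def abs_of_pos)
  have eqn: "\<bar>det (matrix (\<D> \<gamma> s))\<bar> * norm (b (\<gamma> s)) = norm (b s)" for s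
    using arg_cong[OF eq[of s], of norm] by simp
  note * = set_integral_substitution[OF open_UNIV deck_derivative[OF g] inj deck_det_continuous[OF g], unfolded rg]
  have m: "(\<lambda>s. indicat_real (\<gamma> ` E) s *\<^sub>R b s) \<in> borel_measurable borel" using bc gE by auto
  have mn: "(\<lambda>s. indicat_real (\<gamma> ` E) s *\<^sub>R norm (b s)) \<in> borel_measurable borel" using bc gE by auto
  have sc: "c *\<^sub>R (indicat_real E s *\<^sub>R b (\<gamma> s)) = indicat_real E s *\<^sub>R (c *\<^sub>R b (\<gamma> s))" for c s by simp
  have scn: "c *\<^sub>R (indicat_real E s *\<^sub>R norm (b (\<gamma> s))) = indicat_real E s *\<^sub>R (c * norm (b (\<gamma> s)))" for c s by simp
  show "set_integrable lborel (\<gamma> ` E) b"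
    using *(1)[OF m] i unfolding ind sc eq by (simp add: set_integrable_def)
  show "(LINT s:\<gamma> ` E|lborel. b s) = (LINT s:E|lborel. b s)"
    using *(2)[OF m] unfolding ind sc eq by (simp add: set_lebesgue_integral_def)
  show "(LINT s:\<gamma> ` E|lborel. norm (b s)) = (LINT s:E|lborel. norm (b s))"
    using *(2)[OF mn] unfolding ind scn eqn by (simp add: set_lebesgue_integral_def)
qed

text \<open>Integrals of invariant densities over two Borel sections of the same part of \<open>S\<close> agree, because
  countably many deck transformations carry the pieces of one to the pieces of the other.\<close>
lemma integral_sections:
  assumes b: "invariant_density b" and A: "A1 \<in> sets borel" "A2 \<in> sets borel"
    and inj: "inj_on p A1" "inj_on p A2" and pA: "p ` A1 = p ` A2" and i: "set_integrable lborel A2 b"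
  shows "set_integrable lborel A1 b" "(LINT s:A1|lborel. b s) = (LINT s:A2|lborel. b s)"
proof -
  \<comment> \<open>Deck transformations are numbered by \<open>I\<close>; pieces with an index
    outside \<open>I\<close> are empty, so that all unions and series run over the natural
    numbers.\<close>
  define I where "I = to_nat_on (deck p) ` deck p"
  define \<gamma> where "\<gamma> n = from_nat_into (deck p) n" for n
  have g: "\<gamma> n \<in> deck p" if "n \<in> I" for n
    using that countable_deck by (auto simp: I_def \<gamma>_def)
  have gi: "m = n" if "m \<in> I" "n \<in> I" "\<gamma> m = \<gamma> n" for m n
    using that countable_deck by (auto simp: I_def \<gamma>_def)
  have gex: "\<exists>n\<in>I. \<gamma> n = \<delta>" if "\<delta> \<in> deck p" for \<delta>
    using that countable_deck by (auto simp: I_def \<gamma>_def)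
  define E where "E n = (if n \<in> I then A2 \<inter> \<gamma> n -` A1 else {})" for n
  define G where "G n = (if n \<in> I then \<gamma> n ` E n else {})" for n
  have Eb: "E n \<in> sets borel" for n
    using A measurable_sets[OF borel_measurable_continuous_onI[OF deck_continuous[OF g]] A(1)] by (auto simp: E_def)
  have Ei: "set_integrable lborel (E n) b" for n
    by (rule set_integrable_subset[OF i]) (use Eb in \<open>auto simp: E_def\<close>)
  have Gb: "G n \<in> sets borel" and Gi: "set_integrable lborel (G n) b"
    and GI: "(LINT s:G n|lborel. b s) = (LINT s:E n|lborel. b s)"
    and GN: "(LINT s:G n|lborel. norm (b s)) = (LINT s:E n|lborel. norm (b s))" for n
    using integral_deck[OF b g Eb Ei, of n n] by (auto simp: G_def E_def)
  have uE: "(\<Union>n. E n) = A2"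
  proof
    show "A2 \<subseteq> (\<Union>n. E n)"
    proof
      fix x assume x: "x \<in> A2"
      then have "p x \<in> p ` A1" using pA by blast
      then obtain y where y: "y \<in> A1" "p x = p y" by blast
      obtain \<delta> where "\<delta> \<in> deck p" "\<delta> x = y" using deck_transitive[OF y(2)] .
      then show "x \<in> (\<Union>n. E n)" using gex[of \<delta>] x y by (auto simp: E_def)
    qed
  qed (auto simp: E_def)
  have uG: "(\<Union>n. G n) = A1"
  proof
    show "A1 \<subseteq> (\<Union>n. G n)"
    proof
      fix y assume y: "y \<in> A1"
      then have "p y \<in> p ` A2" using pA by blast
      then obtain x where x: "x \<in> A2" "p x = p y" by force
      obtain \<delta> where "\<delta> \<in> deck p" "\<delta> x = y" using deck_transitive[OF x(2)] .
      then show "y \<in> (\<Union>n. G n)" using gex[of \<delta>] x y by (auto simp: E_def G_def image_iff)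
    qed
  qed (auto simp: E_def G_def)
  have dE: "E m \<inter> E n = {}" if "m \<noteq> n" for m n
  proof (rule ccontr)
    assume "E m \<inter> E n \<noteq> {}"
    then obtain x where x: "m \<in> I" "n \<in> I" "\<gamma> m x \<in> A1" "\<gamma> n x \<in> A1" by (auto simp: E_def split: if_splits)
    then have "p (\<gamma> m x) = p (\<gamma> n x)" using deck_p g by simp
    then have "\<gamma> m x = \<gamma> n x" using inj_onD[OF inj(1)] x by blast
    then show False using deck_unique[OF g g] gi x that by blast
  qed
  have dG: "G m \<inter> G n = {}" if "m \<noteq> n" for m n
  proof (rule ccontr)
    assume "G m \<inter> G n \<noteq> {}"
    then obtain x y where x: "m \<in> I" "n \<in> I" "x \<in> A2" "y \<in> A2" "\<gamma> m x = \<gamma> n y" by (auto simp: E_def G_def split: if_splits)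
    then have "p x = p y" using deck_p[OF g[OF x(1)], of x] deck_p[OF g[OF x(2)], of y] by simp
    then have "x = y" using inj_onD[OF inj(2)] x by blast
    then show False using deck_unique[OF g g] gi x that by blast
  qed
  have bm: "b \<in> borel_measurable lborel" using b by (simp add: invariant_density_def borel_measurable_continuous_onI)
  \<comment> \<open>Integrability over \<open>A1\<close> has to come first, from the nonnegative
    integrals of the norm. Only then may the integral of \<open>b\<close> itself be split into a
    series.\<close>
  have "(\<integral>\<^sup>+s. ennreal (norm (b s)) * indicator A1 s \<partial>lborel) = suminf (\<lambda>n. \<integral>\<^sup>+s. ennreal (norm (b s)) * indicator (G n) s \<partial>lborel)"
    unfolding uG[symmetric] using bm Gb dG by (intro nn_integral_disjoint_family) (auto simp: disjoint_family_on_def)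
  also have "\<dots> = suminf (\<lambda>n. \<integral>\<^sup>+s. ennreal (norm (b s)) * indicator (E n) s \<partial>lborel)"
    unfolding nn_integral_set_integral_eq[OF Gi] nn_integral_set_integral_eq[OF Ei] GN ..
  also have "\<dots> = (\<integral>\<^sup>+s. ennreal (norm (b s)) * indicator A2 s \<partial>lborel)"
    unfolding uE[symmetric] using bm Eb dE by (intro nn_integral_disjoint_family[symmetric]) (auto simp: disjoint_family_on_def)
  also have "\<dots> < \<infinity>" unfolding nn_integral_set_integral_eq[OF i] by simp
  finally have fin: "(\<integral>\<^sup>+s. ennreal (norm (b s)) * indicator A1 s \<partial>lborel) < \<infinity>" .
  have "(\<integral>\<^sup>+s. ennreal (norm (indicat_real A1 s *\<^sub>R b s)) \<partial>lborel) = (\<integral>\<^sup>+s. ennreal (norm (b s)) * indicator A1 s \<partial>lborel)"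
    by (intro nn_integral_cong) (auto simp: indicator_def)
  then show i1: "set_integrable lborel A1 b"
    unfolding set_integrable_def using fin bm A by (intro integrableI_bounded) (auto simp del: norm_scaleR)
  have "(LINT s:A1|lborel. b s) = suminf (\<lambda>n. LINT s:G n|lborel. b s)"
    using i1 unfolding uG[symmetric] using Gb dG by (intro lebesgue_integral_countable_add) auto
  also have "\<dots> = (LINT s:A2|lborel. b s)"
    using i unfolding uE[symmetric] GI using Eb dE by (intro lebesgue_integral_countable_add[symmetric]) auto
  finally show "(LINT s:A1|lborel. b s) = (LINT s:A2|lborel. b s)" .
qed

abbreviation (input) "FD \<equiv> fundamental_domain p"

text \<open>The section of the covering is an unstructured Borel set. Over the image of an embedded
  disc it can be exchanged for the disc itself, where analysis is possible.\<close>

lemma integral_over_piece: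
  assumes b: "invariant_density b" and B: "open B" "inj_on p B" "bounded B"
  shows "FD \<inter> p -` p ` B \<in> sets borel" "set_integrable lborel (FD \<inter> p -` p ` B) b"
    "set_integrable lborel B b" "(LINT s:FD \<inter> p -` p ` B|lborel. b s) = (LINT s:B|lborel. b s)"
proof -
  show m: "FD \<inter> p -` p ` B \<in> sets borel"
    using open_vimage_p[OF p_open_map[OF B(1)]] fundamental_domain(1) by auto
  have "compact (closure B)" using B by simp
  then have "set_integrable lborel (closure B) b"
    unfolding set_integrable_def using b by (intro borel_integrable_compact) (auto simp: invariant_density_def intro: continuous_on_subset)
  then show i: "set_integrable lborel B b"
    by (rule set_integrable_subset) (use B closure_subset in auto)
  have "p ` (FD \<inter> p -` p ` B) = p ` B" 
  proof
    show "p ` B \<subseteq> p ` (FD \<inter> p -` p ` B)"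
    proof
      fix y assume y: "y \<in> p ` B"
      then have "y \<in> p ` FD" unfolding fundamental_domain(3) by auto
      then show "y \<in> p ` (FD \<inter> p -` p ` B)" using y by auto
    qed
  qed auto
  moreover have "inj_on p (FD \<inter> p -` p ` B)" by (rule inj_on_subset[OF fundamental_domain(2)]) auto
  ultimately show "set_integrable lborel (FD \<inter> p -` p ` B) b" "(LINT s:FD \<inter> p -` p ` B|lborel. b s) = (LINT s:B|lborel. b s)"
    using integral_sections[OF b m _ _ B(2) _ i] B(1) by auto
qed

text \<open>The chosen section may be unbounded in the plane; integrability comes from a finite
  cover of S by embedded discs.\<close>

lemma invariant_density_integrable:
  assumes b: "invariant_density b" shows "set_integrable lborel FD b"
proof -
  obtain F where F: "finite F" "S = (\<Union>c\<in>F. p ` ball c (inj_radius c))" using finite_ball_cover by blast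
  have "set_integrable lborel (\<Union>c\<in>F. FD \<inter> p -` p ` ball c (inj_radius c)) b"
    using integral_over_piece[OF b open_ball inj_ball bounded_ball] by (intro set_integrable_UN F) auto
  moreover have "(\<Union>c\<in>F. FD \<inter> p -` p ` ball c (inj_radius c)) = FD"
    using F(2) p_in by blast
  ultimately show ?thesis by simp
qed

text \<open>Positivity at one point would persist on a nonempty open part of an embedded disc, which
  is not a null set. This turns vanishing integrals of squared norms into pointwise
  vanishing.\<close>

lemma invariant_density_vanishes:
  fixes b :: "plane \<Rightarrow> real"
  assumes b: "invariant_density b" and nn: "\<And>s. b s \<ge> 0" and z: "(LINT s:FD|lborel. b s) = 0"
  shows "b s = 0"
proof (rule ccontr)
  assume "b s \<noteq> 0"
  then have bs: "b s > 0" using nn[of s] by simp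
  let ?B = "ball s (inj_radius s)"
  note P = integral_over_piece[OF b open_ball inj_ball[of s] bounded_ball]
  have "(LINT s:FD \<inter> p -` p ` ?B|lborel. b s) \<le> (LINT s:FD|lborel. b s)"
    unfolding set_lebesgue_integral_def
    by (rule integral_mono) (use P(2) invariant_density_integrable[OF b] nn in \<open>auto simp: set_integrable_def indicator_def\<close>)
  then have "(\<integral>x. indicat_real ?B x *\<^sub>R b x \<partial>lborel) \<le> 0" using P(4) z by (simp add: set_lebesgue_integral_def)
  moreover have "(\<integral>x. indicat_real ?B x *\<^sub>R b x \<partial>lborel) \<ge> 0" using nn by (intro Bochner_Integration.integral_nonneg) auto
  ultimately have eq: "(\<integral>x. indicat_real ?B x *\<^sub>R b x \<partial>lborel) = 0" by linarith
  have "AE x in lborel. 0 \<le> indicat_real ?B x *\<^sub>R b x" using nn by (intro AE_I2) auto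
  from integral_nonneg_eq_0_iff_AE[OF P(3)[unfolded set_integrable_def] this] eq
  have "AE x in lborel. indicat_real ?B x *\<^sub>R b x = 0" by blast
  then have "AE x in lborel. x \<notin> ?B \<inter> {x. b x > 0}" by eventually_elim auto
  moreover have o: "open (?B \<inter> {x. b x > 0})"
    using b by (intro open_Int open_ball open_Collect_less) (auto simp: invariant_density_def)
  ultimately have "?B \<inter> {x. b x > 0} = {}"
  proof -
    assume ae: "AE x in lborel. x \<notin> ?B \<inter> {x. b x > 0}"
    show ?thesis
    proof (rule ccontr)
      assume "?B \<inter> {x. b x > 0} \<noteq> {}"
      moreover have "?B \<inter> {x. b x > 0} \<in> null_sets lebesgue"
        using AE_completion[OF ae] o by (subst AE_iff_null_sets) auto
      ultimately show False using open_not_negligible[OF o] by (simp add: negligible_iff_null_sets)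
    qed
  qed
  moreover have "s \<in> ?B \<inter> {x. b x > 0}" using bs inj_radius(1)[of s] by simp
  ultimately show False by blast
qed

end

section \<open>Stokes' theorem on S\<close>

lemma frechet_eq: "(f has_derivative f') (at x) \<Longrightarrow> \<D> f x = f'"
  by (rule frechet_derivative_at[symmetric])

lemma Ck_Union:
  assumes "\<And>V. V \<in> \<V> \<Longrightarrow> open V" "\<And>V. V \<in> \<V> \<Longrightarrow> Ck_on k V f"
  shows "Ck_on k (\<Union>\<V>) f"
  using assms(2)
proof (induction k arbitrary: f)
  case 0
  then show ?case using assms(1) by (auto intro!: continuous_on_open_Union)
qed auto

text \<open>Forms are multiplied by a partition of unity made of bump functions that are once
  continuously differentiable, so this is the class in which Stokes' theorem is proved.\<close>

definition form_C1 :: "real form1 \<Rightarrow> bool" where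
  "form_C1 \<alpha> \<longleftrightarrow> (\<forall>s. linear (\<alpha> s)) \<and> (\<forall>v. Ck_on 1 UNIV (\<lambda>s. \<alpha> s v))"

lemma form_C1_derivative:
  assumes "form_C1 \<alpha>"
  shows "((\<lambda>s. \<alpha> s v) has_derivative \<D> (\<lambda>s. \<alpha> s v) s) (at s)"
  using assms Ck_SucD[of 0 UNIV "\<lambda>s. \<alpha> s v" s] by (auto simp: form_C1_def)

lemma form_C1_derivative_continuous:
  assumes "form_C1 \<alpha>"
  shows "continuous_on A (\<lambda>s. \<D> (\<lambda>s. \<alpha> s v) s w)"
  by (rule continuous_on_subset[OF _ subset_UNIV]) (use assms in \<open>simp add: form_C1_def\<close>)

lemma form_C1_d1_continuous:
  assumes "form_C1 \<alpha>" shows "continuous_on A (\<lambda>s. d1 \<alpha> s v w)"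
  unfolding d1_def by (rule continuous_on_diff; rule form_C1_derivative_continuous[OF assms])

lemma linear_plane: "linear f \<Longrightarrow> f v = v$1 *\<^sub>R f (axis 1 1) + v$2 *\<^sub>R f (axis 2 1)"
  for f :: "plane \<Rightarrow> 'b::real_vector"
  by (subst linear_Basis_sum) (auto simp: Basis_plane inner_axis axis_eq_axis)

text \<open>The product rule for a form at a moving point on a moving vector. With the point
  \<gamma> s and the vector \<open>\<D> \<gamma> s v\<close> it differentiates a pullback.\<close>

lemma form_C1_moving:
  assumes \<alpha>: "form_C1 \<alpha>" and g: "(g has_derivative g') (at s)" and w: "(w has_derivative w') (at s)"
  shows "((\<lambda>s. \<alpha> (g s) (w s)) has_derivative
    (\<lambda>v. \<D> (\<lambda>x. \<alpha> x (w s)) (g s) (g' v) + \<alpha> (g s) (w' v))) (at s)"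
proof -
  let ?e1 = "axis 1 1 :: plane" and ?e2 = "axis 2 1 :: plane"
  have lin: "linear (\<alpha> x)" for x using \<alpha> by (simp add: form_C1_def)
  have e: "\<alpha> x u = u$1 * \<alpha> x ?e1 + u$2 * \<alpha> x ?e2" for x u
    using linear_plane[OF lin, of x u] by simp
  note D = form_C1_derivative[OF \<alpha>]
  have Dg: "((\<lambda>s. \<alpha> (g s) u) has_derivative (\<lambda>v. \<D> (\<lambda>x. \<alpha> x u) (g s) (g' v))) (at s)" for u
    by (rule has_derivative_compose[OF g D])
  have wi: "((\<lambda>s. w s $ i) has_derivative (\<lambda>v. w' v $ i)) (at s)" for i
    by (rule bounded_linear.has_derivative[OF bounded_linear_vec_nth w])
  have "((\<lambda>s. w s $ 1 * \<alpha> (g s) ?e1 + w s $ 2 * \<alpha> (g s) ?e2) has_derivative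
    (\<lambda>v. (w s $ 1 * \<D> (\<lambda>x. \<alpha> x ?e1) (g s) (g' v) + w' v $ 1 * \<alpha> (g s) ?e1)
      + (w s $ 2 * \<D> (\<lambda>x. \<alpha> x ?e2) (g s) (g' v) + w' v $ 2 * \<alpha> (g s) ?e2))) (at s)"
    by (intro has_derivative_add has_derivative_mult Dg wi)
  moreover have "\<D> (\<lambda>x. \<alpha> x (w s)) (g s) u
     = w s $ 1 * \<D> (\<lambda>x. \<alpha> x ?e1) (g s) u + w s $ 2 * \<D> (\<lambda>x. \<alpha> x ?e2) (g s) u" for u
  proof -
    have hd: "((\<lambda>x. w s $ 1 * \<alpha> x ?e1 + w s $ 2 * \<alpha> x ?e2) has_derivative
      (\<lambda>u. w s $ 1 * \<D> (\<lambda>x. \<alpha> x ?e1) (g s) u + w s $ 2 * \<D> (\<lambda>x. \<alpha> x ?e2) (g s) u)) (at (g s))"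
      by (intro has_derivative_add has_derivative_mult_right D)
    have eq: "(\<lambda>x. \<alpha> x (w s)) = (\<lambda>x. w s $ 1 * \<alpha> x ?e1 + w s $ 2 * \<alpha> x ?e2)"
      by (rule ext) (rule e)
    show ?thesis by (simp only: eq frechet_eq[OF hd])
  qed
  ultimately show ?thesis
    unfolding e[of _ "w _"] e[of _ "w' _"] by (simp add: algebra_simps)
qed

lemma d1_linear:
  assumes "form_C1 \<alpha>"
  shows "d1 \<alpha> s v w = area v w * d1 \<alpha> s (axis 1 1) (axis 2 1)"
proof -
  let ?e1 = "axis 1 1 :: plane" and ?e2 = "axis 2 1 :: plane"
  define F where "F u v = \<D> (\<lambda>x. \<alpha> x u) s v" for u v
  have l1: "linear (F u)" for u
    unfolding F_def[abs_def] using form_C1_derivative[OF assms] has_derivative_linear by blast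
  have l2: "F u v = u$1 * F ?e1 v + u$2 * F ?e2 v" for u v
  proof -
    have lin: "linear (\<alpha> x)" for x using assms by (simp add: form_C1_def)
    have hd: "((\<lambda>x. u$1 * \<alpha> x ?e1 + u$2 * \<alpha> x ?e2) has_derivative (\<lambda>v. u$1 * F ?e1 v + u$2 * F ?e2 v)) (at s)"
      unfolding F_def by (intro has_derivative_add has_derivative_mult_right form_C1_derivative assms)
    have eq: "(\<lambda>x. \<alpha> x u) = (\<lambda>x. u$1 * \<alpha> x ?e1 + u$2 * \<alpha> x ?e2)"
      by (rule ext) (use linear_plane[OF lin, of _ u] in simp)
    show ?thesis unfolding F_def[of u] by (simp only: eq frechet_eq[OF hd])
  qed
  have l1': "F u v = v$1 * F u ?e1 + v$2 * F u ?e2" for u v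
    using linear_plane[OF l1, of u v] by simp
  have d: "d1 \<alpha> s v w = F w v - F v w" for v w by (simp add: d1_def F_def)
  show ?thesis
    unfolding d l2[of w v] l2[of v w] l1'[of ?e1 v] l1'[of ?e2 v] l1'[of ?e1 w] l1'[of ?e2 w] area_def by (simp add: algebra_simps)
qed

text \<open>The exterior derivative commutes with pullback: the terms with second derivatives of
  \<gamma> cancel by symmetry, and a two-form on the plane picks up the determinant.\<close>

lemma d1_pullback:
  assumes \<alpha>: "form_C1 \<alpha>" and g: "smooth_on UNIV \<gamma>"
    and inv: "\<And>s v. \<alpha> (\<gamma> s) (\<D> \<gamma> s v) = \<beta> s v"
  shows "det (matrix (\<D> \<gamma> s)) * d1 \<alpha> (\<gamma> s) (axis 1 1) (axis 2 1) = d1 \<beta> s (axis 1 1) (axis 2 1)"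
proof -
  let ?D = "\<lambda>s. \<D> \<gamma> s"
  have D: "(\<gamma> has_derivative ?D s) (at s)" for s using smooth_derivative[OF g] by simp
  have DD: "((\<lambda>s. ?D s v) has_derivative \<D> (\<lambda>s. ?D s v) s) (at s)" for v s
    using smooth_derivative[OF smooth_fderiv[OF g]] by simp
  have D\<beta>: "((\<lambda>s. \<beta> s w) has_derivative (\<lambda>v. \<D> (\<lambda>x. \<alpha> x (?D s w)) (\<gamma> s) (?D s v) + \<alpha> (\<gamma> s) (\<D> (\<lambda>s. ?D s w) s v))) (at s)" for w
    using form_C1_moving[OF \<alpha> D[of s] DD[of w s]] by (simp add: inv)
  then have "\<D> (\<lambda>s. \<beta> s w) s v = \<D> (\<lambda>x. \<alpha> x (?D s w)) (\<gamma> s) (?D s v) + \<alpha> (\<gamma> s) (\<D> (\<lambda>s. ?D s w) s v)" for v w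
    by (simp only: frechet_eq[OF D\<beta>])
  then have d1_eq: "d1 \<beta> s v w = d1 \<alpha> (\<gamma> s) (?D s v) (?D s w)" for v w
    by (simp add: d1_def symmetric_second_derivative[OF g, of w s v])
  then have "d1 \<beta> s (axis 1 1) (axis 2 1) = area (?D s (axis 1 1)) (?D s (axis 2 1)) * d1 \<alpha> (\<gamma> s) (axis 1 1) (axis 2 1)"
    by (simp only: d1_eq) (rule d1_linear[OF \<alpha>])
  then show ?thesis by (simp add: area_def det_2 matrix_def mult.commute)
qed

lemma integral_d1_compact_support:
  assumes \<alpha>: "form_C1 \<alpha>" and K: "compact K" "\<And>s v. s \<notin> K \<Longrightarrow> \<alpha> s v = 0"
  shows "(\<integral>s. d1 \<alpha> s (axis 1 1) (axis 2 1) \<partial>lborel) = 0"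
  unfolding d1_def
  using integral_derivative_compact_support[OF form_C1_derivative[OF \<alpha>] form_C1_derivative_continuous[OF \<alpha>] K]
  by (subst Bochner_Integration.integral_diff) auto

text \<open>Squaring the positive part gives one continuous derivative at 0, which is all that
  \<open>form_C1\<close> asks for.\<close>

definition bump :: "real \<Rightarrow> real" where
  "bump t = (max 0 t)\<^sup>2"

lemma bump_C1: "Ck_on 1 UNIV bump"
proof -
  have "(bump has_derivative (\<lambda>v. (2 * max 0 t) * v)) (at t)" for t
  proof -
    consider "t > 0" | "t < 0" | "t = 0" by linarith
    then show ?thesis
    proof cases
      case 1
      have "((\<lambda>t. t\<^sup>2) has_derivative (\<lambda>v. (2 * t) * v)) (at t)" by (auto intro!: derivative_eq_intros)
      then have "(bump has_derivative (\<lambda>v. (2 * t) * v)) (at t)"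
        by (rule has_derivative_transform_within_open[where s="{0<..}"]) (use 1 in \<open>auto simp: bump_def\<close>)
      then show ?thesis using 1 by simp
    next
      case 2
      have "((\<lambda>t. 0::real) has_derivative (\<lambda>v. 0)) (at t)" by simp
      then have "(bump has_derivative (\<lambda>v. 0)) (at t)"
        by (rule has_derivative_transform_within_open[where s="{..<0}"]) (use 2 in \<open>auto simp: bump_def\<close>)
      then show ?thesis using 2 by simp
    next
      case 3
      have "(bump has_real_derivative 0) (at 0)"
        unfolding has_field_derivative_iff
      proof (rule Lim_null_comparison)
        show "\<forall>\<^sub>F y in at 0. norm ((bump y - bump 0) / (y - 0)) \<le> \<bar>y\<bar>"
        proof (rule always_eventually, rule allI)
          fix y :: real show "norm ((bump y - bump 0) / (y - 0)) \<le> \<bar>y\<bar>"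
            by (cases "y > 0") (auto simp: bump_def power2_eq_square max_def)
        qed
        show "((\<lambda>y. \<bar>y\<bar>) \<longlongrightarrow> 0) (at (0::real))" by (auto intro!: tendsto_eq_intros)
      qed
      moreover have "(*) 0 = (\<lambda>v::real. 0)" by auto
      ultimately show ?thesis using 3 by (simp add: has_field_derivative_def)
    qed
  qed
  then have "Ck_on (Suc 0) UNIV bump"
    by (intro Ck_SucI[OF open_UNIV]) (auto intro!: continuous_intros)
  then show ?thesis by simp
qed

definition ball_bump :: "'a::euclidean_space \<Rightarrow> real \<Rightarrow> 'a \<Rightarrow> real" where
  "ball_bump c r x = bump (r\<^sup>2 - (x - c) \<bullet> (x - c))"

lemma ball_bump_C1: "Ck_on 1 UNIV (ball_bump c r)"
proof -
  have l: "Ck_on 1 UNIV (\<lambda>x. x - c)"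
    using Ck_add[OF open_UNIV Ck_linear[OF bounded_linear_ident open_UNIV] Ck_const[OF open_UNIV], of 1 "- c"] by simp
  have q: "Ck_on 1 UNIV (\<lambda>x. - ((x - c) \<bullet> (x - c)))"
    using Ck_bilinear[OF bounded_bilinear_mult open_UNIV Ck_const[OF open_UNIV] Ck_bilinear[OF bounded_bilinear_inner open_UNIV l l], of "-1"] by simp
  then have "Ck_on 1 UNIV (\<lambda>x. r\<^sup>2 + - ((x - c) \<bullet> (x - c)))"
    by (intro Ck_add Ck_const) auto
  from Ck_compose[OF open_UNIV open_UNIV _ bump_C1 this] show ?thesis
    by (simp add: ball_bump_def[abs_def])
qed

lemma ball_bump_nonneg: "ball_bump c r x \<ge> 0" by (simp add: ball_bump_def bump_def)

lemma ball_bump_pos: "x \<in> ball c r \<Longrightarrow> ball_bump c r x > 0"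
proof -
  assume "x \<in> ball c r"
  then have "norm (x - c) < r" by (simp add: dist_norm norm_minus_commute)
  then have "(norm (x - c))\<^sup>2 < r\<^sup>2" by (intro power_strict_mono) auto
  then show ?thesis by (simp add: ball_bump_def bump_def power2_norm_eq_inner max_def)
qed

lemma ball_bump_zero: "x \<notin> cball c r \<Longrightarrow> r > 0 \<Longrightarrow> ball_bump c r x = 0"
proof -
  assume r: "x \<notin> cball c r" "r > 0"
  then have "r \<le> norm (x - c)" by (simp add: dist_norm norm_minus_commute)
  then have "r\<^sup>2 \<le> (norm (x - c))\<^sup>2" using r by (intro power_mono) auto
  then show ?thesis by (simp add: ball_bump_def bump_def power2_norm_eq_inner max_def)
qed

context surface
begin

text \<open>The sum of a bump function over all deck transformations. As the double disc embeds, at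
  most one summand is nonzero at each point, and it is found by moving the point into the
  disc.\<close>

definition averaged_bump :: "plane \<Rightarrow> plane \<Rightarrow> real" where
  "averaged_bump c s = (if p s \<in> p ` ball c (2 * inj_radius c)
     then ball_bump c (inj_radius c) (inv_into (ball c (2 * inj_radius c)) p (p s)) else 0)"

lemma averaged_bump_deck: "\<gamma> \<in> deck p \<Longrightarrow> averaged_bump c (\<gamma> s) = averaged_bump c s"
  by (simp add: averaged_bump_def deck_p)

lemma averaged_bump_on_ball: "s \<in> ball c (2 * inj_radius c) \<Longrightarrow> averaged_bump c s = ball_bump c (inj_radius c) s"
  using inv_into_f_f[OF inj_radius(2)] by (simp add: averaged_bump_def)

lemma averaged_bump_nonneg: "averaged_bump c s \<ge> 0"
  by (simp add: averaged_bump_def ball_bump_nonneg)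

lemma averaged_bump_pos: "p s \<in> p ` ball c (inj_radius c) \<Longrightarrow> averaged_bump c s > 0"
proof -
  assume "p s \<in> p ` ball c (inj_radius c)"
  then obtain x where x: "x \<in> ball c (inj_radius c)" "p x = p s" by auto
  then obtain \<gamma> where "\<gamma> \<in> deck p" "\<gamma> s = x" using deck_transitive[of s x] by metis
  then have "averaged_bump c s = averaged_bump c x" using averaged_bump_deck by metis
  also have "\<dots> = ball_bump c (inj_radius c) x" using x(1) inj_radius(1)[of c] by (intro averaged_bump_on_ball) auto
  finally show ?thesis using ball_bump_pos[OF x(1)] by simp
qed

lemma averaged_bump_zero: "p s \<notin> p ` cball c (inj_radius c) \<Longrightarrow> averaged_bump c s = 0"
proof -
  let ?B = "ball c (2 * inj_radius c)"
  assume a: "p s \<notin> p ` cball c (inj_radius c)"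
  show ?thesis
  proof (cases "p s \<in> p ` ?B")
    case True
    then have "p (inv_into ?B p (p s)) = p s" by (rule f_inv_into_f)
    then have "inv_into ?B p (p s) \<notin> cball c (inj_radius c)" using a imageI by metis
    from ball_bump_zero[OF this inj_radius(1)] show ?thesis unfolding averaged_bump_def by simp
  qed (simp add: averaged_bump_def)
qed

text \<open>The plane is covered by the open set lying over the complement of the small closed disc,
  where the function is 0, and by the deck preimages of the double disc, on each of which it is a
  single bump composed with a deck transformation.\<close>

lemma averaged_bump_C1: "Ck_on 1 UNIV (averaged_bump c)"
proof -
  let ?B = "ball c (2 * inj_radius c)"
  let ?V = "insert (- (p -` p ` cball c (inj_radius c))) ((\<lambda>\<gamma>. \<gamma> -` ?B) ` deck p)"
  have "compact (p ` cball c (inj_radius c))" by (intro compact_continuous_image p_continuous compact_cball)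
  then have "closed (p ` cball c (inj_radius c))" by (rule compact_imp_closed)
  then have "closed (p -` p ` cball c (inj_radius c))"
    using continuous_closed_vimage[of "p ` cball c (inj_radius c)" p] p_continuous[of UNIV] by (simp add: continuous_on_eq_continuous_at)
  then have o1: "open (- (p -` p ` cball c (inj_radius c)))" by (simp add: open_Compl)
  have o2: "open (\<gamma> -` ?B)" if "\<gamma> \<in> deck p" for \<gamma>
    using deck_continuous[OF that, of UNIV] by (simp add: open_vimage)
  have "Ck_on 1 (\<Union>?V) (averaged_bump c)"
  proof (rule Ck_Union)
    fix V assume "V \<in> ?V"
    then show "open V" using o1 o2 by auto
    consider "V = - (p -` p ` cball c (inj_radius c))" | \<gamma> where "\<gamma> \<in> deck p" "V = \<gamma> -` ?B" using \<open>V \<in> ?V\<close> by blast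
    then show "Ck_on 1 V (averaged_bump c)"
    proof cases
      case 1
      have "Ck_on 1 V (\<lambda>_. 0::real)" using 1 o1 by (intro Ck_const) simp
      then show ?thesis by (rule Ck_cong[OF \<open>open V\<close>]) (use 1 averaged_bump_zero in auto)
    next
      case 2
      have "Ck_on 1 V \<gamma>" using smooth_subset[OF deck_smooth[OF 2(1)], of V] by (simp add: smooth_on_def)
      then have "Ck_on 1 V (\<lambda>s. ball_bump c (inj_radius c) (\<gamma> s))"
        by (intro Ck_compose[OF \<open>open V\<close> open_UNIV _ ball_bump_C1]) auto
      then show ?thesis
      proof (rule Ck_cong[OF \<open>open V\<close>])
        fix s assume "s \<in> V"
        then have "averaged_bump c (\<gamma> s) = ball_bump c (inj_radius c) (\<gamma> s)" using 2 by (intro averaged_bump_on_ball) auto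
        then show "ball_bump c (inj_radius c) (\<gamma> s) = averaged_bump c s" using averaged_bump_deck[OF 2(1)] by simp
      qed
    qed
  qed
  moreover have "\<Union>?V = UNIV"
  proof -
    have "s \<in> \<Union>?V" for s
    proof (cases "s \<in> p -` p ` cball c (inj_radius c)")
      case True
      then obtain x where x: "x \<in> cball c (inj_radius c)" "p s = p x" by auto
      then obtain \<gamma> where "\<gamma> \<in> deck p" "\<gamma> s = x" using deck_transitive[of s x] by metis
      moreover have "x \<in> ?B" using x inj_radius(1)[of c] by auto
      ultimately show ?thesis by auto
    qed auto
    then show ?thesis by blast
  qed
  ultimately show ?thesis by simp
qed

text \<open>A partition of unity subordinate to embedded discs reduces to compactly supported forms on the plane.\<close>
theorem stokes:
  assumes \<beta>: "form_C1 \<beta>" and inv: "\<And>\<gamma> s v. \<gamma> \<in> deck p \<Longrightarrow> \<beta> (\<gamma> s) (\<D> \<gamma> s v) = \<beta> s v"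
  shows "(LINT s:FD|lborel. d1 \<beta> s (axis 1 1) (axis 2 1)) = 0"
proof -
  let ?e1 = "axis 1 1 :: plane" and ?e2 = "axis 2 1 :: plane"
  obtain F where F: "finite F" "S = (\<Union>c\<in>F. p ` ball c (inj_radius c))" using finite_ball_cover by blast
  define \<Psi> where "\<Psi> s = (\<Sum>c\<in>F. averaged_bump c s)" for s
  have \<Psi>pos: "\<Psi> s > 0" for s
  proof -
    have "p s \<in> (\<Union>c\<in>F. p ` ball c (inj_radius c))" unfolding F(2)[symmetric] by simp
    then obtain c where "c \<in> F" "p s \<in> p ` ball c (inj_radius c)" by (elim UN_E)
    then show ?thesis unfolding \<Psi>_def using F(1) averaged_bump_pos averaged_bump_nonneg by (intro sum_pos2[of F c]) auto
  qed
  have \<Psi>d: "\<Psi> (\<gamma> s) = \<Psi> s" if "\<gamma> \<in> deck p" for \<gamma> s using averaged_bump_deck[OF that] by (simp add: \<Psi>_def)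
  have \<Psi>C: "Ck_on 1 UNIV \<Psi>" unfolding \<Psi>_def by (intro Ck_sum open_UNIV averaged_bump_C1)
  have iC: "Ck_on 1 UNIV (\<lambda>s. inverse (\<Psi> s))"
    using \<Psi>pos by (intro Ck_compose[OF open_UNIV _ _ Ck_inverse \<Psi>C]) (auto simp: open_Collect_neq less_imp_neq[symmetric])
  have lin: "linear (\<beta> s)" for s using \<beta> by (simp add: form_C1_def)
  have times: "form_C1 (\<lambda>s v. f s * inverse (\<Psi> s) * \<beta> s v)" if "Ck_on 1 UNIV f" for f
  proof -
    have "linear (\<lambda>v. f s * inverse (\<Psi> s) * \<beta> s v)" for s
      using lin[of s] by (simp add: linear_iff algebra_simps)
    then show ?thesis
      unfolding form_C1_def using \<beta> that iC by (auto simp: form_C1_def simp del: One_nat_def intro!: Ck_bilinear[OF bounded_bilinear_mult open_UNIV])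
  qed
  define \<beta>c where "\<beta>c c s v = averaged_bump c s * inverse (\<Psi> s) * \<beta> s v" for c s v
  have \<beta>cC: "form_C1 (\<beta>c c)" for c unfolding \<beta>c_def by (rule times[OF averaged_bump_C1])
  have dens: "invariant_density (\<lambda>s. d1 (\<beta>c c) s ?e1 ?e2)" for c
    unfolding invariant_density_def
  proof (intro conjI ballI allI form_C1_d1_continuous[OF \<beta>cC])
    fix \<gamma> s assume g: "\<gamma> \<in> deck p"
    show "det (matrix (\<D> \<gamma> s)) *\<^sub>R d1 (\<beta>c c) (\<gamma> s) ?e1 ?e2 = d1 (\<beta>c c) s ?e1 ?e2"
      using d1_pullback[OF \<beta>cC deck_smooth[OF g], where \<beta>="\<beta>c c" and s=s] by (simp add: \<beta>c_def averaged_bump_deck[OF g] \<Psi>d[OF g] inv[OF g])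
  qed
  have zero: "(LINT s:FD|lborel. d1 (\<beta>c c) s ?e1 ?e2) = 0" for c
  proof -
    let ?B = "ball c (2 * inj_radius c)" and ?K = "cball c (inj_radius c)"
    \<comment> \<open>On the double disc this agrees with \<open>\<beta>c c\<close>, but the other
      translates of the bump are dropped, so that the form has compact support in the plane.\<close>
    define \<alpha> where "\<alpha> s v = ball_bump c (inj_radius c) s * inverse (\<Psi> s) * \<beta> s v" for s v
    have \<alpha>C: "form_C1 \<alpha>" unfolding \<alpha>_def by (rule times[OF ball_bump_C1])
    have \<alpha>0: "\<alpha> s v = 0" if "s \<notin> ?K" for s v using ball_bump_zero[OF that inj_radius(1)] by (simp add: \<alpha>_def)
    have loc: "d1 f s v w = d1 g s v w" if "open U" "s \<in> U" "\<And>t v. t \<in> U \<Longrightarrow> f t v = g t v" "form_C1 g" for f g :: "real form1" and U s v w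
    proof -
      have "\<D> (\<lambda>t. f t v) s = \<D> (\<lambda>t. g t v) s" for v
        by (rule frechet_eq, rule has_derivative_transform_within_open[OF form_C1_derivative[OF that(4)] that(1,2)]) (simp add: that(3))
      then show ?thesis by (simp add: d1_def)
    qed
    have zC: "form_C1 (\<lambda>s v. 0)" by (simp add: form_C1_def linear_iff frechet_derivative_const)
    have out: "d1 (\<beta>c c) s ?e1 ?e2 = 0" if "p s \<notin> p ` ?B" for s
    proof -
      have "compact (p ` ?K)" by (intro compact_continuous_image p_continuous compact_cball)
      then have "closed (p -` p ` ?K)"
        using continuous_closed_vimage[OF compact_imp_closed, of "p ` ?K" p] p_continuous[of UNIV] by (simp add: continuous_on_eq_continuous_at)
      then have "open (- (p -` p ` ?K))" by (simp add: open_Compl)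
      moreover have "s \<in> - (p -` p ` ?K)" using that inj_radius(1)[of c] by (force simp: image_iff)
      ultimately have "d1 (\<beta>c c) s ?e1 ?e2 = d1 (\<lambda>s v. 0) s ?e1 ?e2"
        by (rule loc[OF _ _ _ zC]) (simp add: \<beta>c_def averaged_bump_zero)
      then show ?thesis by (simp add: d1_def frechet_derivative_const)
    qed
    have inB: "d1 (\<beta>c c) s ?e1 ?e2 = d1 \<alpha> s ?e1 ?e2" if "s \<in> ?B" for s
      by (rule loc[OF open_ball that _ \<alpha>C]) (simp add: \<beta>c_def \<alpha>_def averaged_bump_on_ball)
    have outB: "d1 \<alpha> s ?e1 ?e2 = 0" if "s \<notin> ?B" for s
    proof -
      have "s \<in> - ?K" "open (- ?K)" using that inj_radius(1)[of c] by auto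
      then have "d1 \<alpha> s ?e1 ?e2 = d1 (\<lambda>s v. 0) s ?e1 ?e2" by (intro loc[OF _ _ _ zC]) (auto intro: \<alpha>0)
      then show ?thesis by (simp add: d1_def frechet_derivative_const)
    qed
    note P = integral_over_piece[OF dens open_ball inj_radius(2)[of c] bounded_ball]
    have "(LINT s:FD|lborel. d1 (\<beta>c c) s ?e1 ?e2) = (LINT s:FD \<inter> p -` p ` ?B|lborel. d1 (\<beta>c c) s ?e1 ?e2)"
      unfolding set_lebesgue_integral_def by (intro Bochner_Integration.integral_cong) (auto simp: indicator_def out)
    also have "\<dots> = (LINT s:?B|lborel. d1 (\<beta>c c) s ?e1 ?e2)" by (rule P(4))
    also have "\<dots> = (\<integral>s. d1 \<alpha> s ?e1 ?e2 \<partial>lborel)"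
      unfolding set_lebesgue_integral_def by (intro Bochner_Integration.integral_cong) (auto simp: indicator_def inB outB)
    also have "\<dots> = 0" by (rule integral_d1_compact_support[OF \<alpha>C compact_cball \<alpha>0])
    finally show ?thesis .
  qed
  have "d1 \<beta> s ?e1 ?e2 = (\<Sum>c\<in>F. d1 (\<beta>c c) s ?e1 ?e2)" for s
  proof -
    have "(\<lambda>t. \<beta> t v) = (\<lambda>t. \<Sum>c\<in>F. \<beta>c c t v)" for v
      using \<Psi>pos by (auto simp: \<beta>c_def sum_distrib_right[symmetric] \<Psi>_def[symmetric] less_imp_neq[symmetric])
    then have "((\<lambda>t. \<beta> t v) has_derivative (\<lambda>w. \<Sum>c\<in>F. \<D> (\<lambda>t. \<beta>c c t v) s w)) (at s)" for v
      using has_derivative_sum[of F "\<lambda>c t. \<beta>c c t v" "\<lambda>c. \<D> (\<lambda>t. \<beta>c c t v) s" "at s"] form_C1_derivative[OF \<beta>cC]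
      by simp
    then have "\<D> (\<lambda>t. \<beta> t v) s = (\<lambda>w. \<Sum>c\<in>F. \<D> (\<lambda>t. \<beta>c c t v) s w)" for v
      by (rule frechet_eq)
    then show ?thesis by (simp add: d1_def sum_subtractf)
  qed
  then have "(LINT s:FD|lborel. d1 \<beta> s ?e1 ?e2) = (\<Sum>c\<in>F. LINT s:FD|lborel. d1 (\<beta>c c) s ?e1 ?e2)"
    unfolding set_lebesgue_integral_def using invariant_density_integrable[OF dens]
    by (simp add: sum_distrib_left set_integrable_def Bochner_Integration.integral_sum)
  then show ?thesis by (simp add: zero)
qed

end

section \<open>The light cone\<close>

definition lorentz :: "real^3 \<Rightarrow> real^3 \<Rightarrow> real" where
  "lorentz x y = x$3 * y$3 - x$1 * y$1 - x$2 * y$2"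

abbreviation lq :: "real^3 \<Rightarrow> real" where
  "lq x \<equiv> lorentz x x"

definition lcone :: "(real^3) set" where
  "lcone = {x. x$3 > 0 \<and> lq x > 0}"

definition apex :: "real^3" where
  "apex = vector [0, 0, 1]"

text \<open>The Hessian of -(1/2) log of the Lorentz form, that is, one third of the Hessian of the
  logarithm of its power -3/2.\<close>

definition cone_metric :: "real^3 \<Rightarrow> real^3^3" where
  "cone_metric x = (\<chi> i j. 2 * lorentz x (axis i 1) * lorentz x (axis j 1) / (lq x)\<^sup>2 - lorentz (axis i 1) (axis j 1) / lq x)"

lemma lorentz_bilinear:
  "lorentz (x + y) z = lorentz x z + lorentz y z" "lorentz x (y + z) = lorentz x y + lorentz x z"
  "lorentz (c *\<^sub>R x) z = c * lorentz x z" "lorentz x (c *\<^sub>R z) = c * lorentz x z"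
  "lorentz (x - y) z = lorentz x z - lorentz y z" "lorentz x (y - z) = lorentz x y - lorentz x z"
  by (simp_all add: lorentz_def algebra_simps)

lemma lorentz_commute: "lorentz x y = lorentz y x"
  by (simp add: lorentz_def mult.commute)

lemma lorentz_axis: "lorentz x (axis 1 1) = - x$1" "lorentz x (axis 2 1) = - x$2" "lorentz x (axis 3 1) = x$3"
  by (simp_all add: lorentz_def axis_def)

lemma cone_disc: "cone disc = lcone"
proof (intro equalityI subsetI)
  fix x assume "x \<in> cone disc"
  then obtain t u where x: "x = t *\<^sub>R affine_point u" "t > 0" "(u$1)\<^sup>2 + (u$2)\<^sup>2 < 1" by (auto simp: cone_def disc_def)
  have "lq x = t\<^sup>2 * (1 - (u$1)\<^sup>2 - (u$2)\<^sup>2)"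
    by (simp add: x affine_point_def lorentz_def power2_eq_square algebra_simps)
  then show "x \<in> lcone" using x by (simp add: lcone_def affine_point_def)
next
  fix x assume "x \<in> lcone"
  then have x: "x$3 > 0" "lq x > 0" by (auto simp: lcone_def)
  define u :: plane where "u = vector [x$1 / x$3, x$2 / x$3]"
  have "(u$1)\<^sup>2 + (u$2)\<^sup>2 = ((x$1)\<^sup>2 + (x$2)\<^sup>2) / (x$3)\<^sup>2" by (simp add: u_def power_divide add_divide_distrib)
  also have "\<dots> < 1" using x by (simp add: lorentz_def power2_eq_square)
  finally have "u \<in> disc" by (simp add: disc_def)
  moreover have "x = (x$3) *\<^sub>R affine_point u" using x by (simp add: vec_eq_iff forall_3 affine_point_def u_def)
  ultimately show "x \<in> cone disc" using x unfolding cone_def by blast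
qed

lemma continuous_lorentz [continuous_intros]:
  "continuous_on A f \<Longrightarrow> continuous_on A g \<Longrightarrow> continuous_on A (\<lambda>x. lorentz (f x) (g x))"
  unfolding lorentz_def by (intro continuous_intros)

lemma open_lcone: "open lcone"
  unfolding lcone_def by (intro open_Collect_conj open_Collect_less continuous_intros)

lemma apex_in: "apex \<in> lcone" and lq_apex: "lq apex = 1"
  by (simp_all add: apex_def lcone_def lorentz_def)

text \<open>The reversed Cauchy-Schwarz inequality with its equality case. The difference of the two
  sides is \<open>u1\<^sup>2 + u2\<^sup>2 - d\<^sup>2\<close> in the minors of the pair, and the
  relation expressing \<open>y$3 * d\<close> by \<open>u1\<close> and \<open>u2\<close> bounds d,
  because y is timelike.\<close>

lemma lorentz_lcone:
  assumes "x \<in> lcone" "y \<in> lcone"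
  shows "lorentz x y > 0" "(lorentz x y)\<^sup>2 \<ge> lq x * lq y"
    "(lorentz x y)\<^sup>2 = lq x * lq y \<Longrightarrow> \<exists>c. x = c *\<^sub>R y"
proof -
  have x: "x$3 > 0" "(x$1)\<^sup>2 + (x$2)\<^sup>2 < (x$3)\<^sup>2" and y: "y$3 > 0" "(y$1)\<^sup>2 + (y$2)\<^sup>2 < (y$3)\<^sup>2"
    using assms by (auto simp: lcone_def lorentz_def power2_eq_square)
  have cs: "(x$1 * y$1 + x$2 * y$2)\<^sup>2 \<le> ((x$1)\<^sup>2 + (x$2)\<^sup>2) * ((y$1)\<^sup>2 + (y$2)\<^sup>2)"
    using sum_squares_ge_zero[of "x$1 * y$2 - x$2 * y$1" 0] by (simp add: power2_eq_square algebra_simps)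
  also have "\<dots> < (x$3)\<^sup>2 * (y$3)\<^sup>2" using x y by (intro mult_strict_mono') auto
  finally have "(x$1 * y$1 + x$2 * y$2)\<^sup>2 < (x$3 * y$3)\<^sup>2" by (simp add: power_mult_distrib)
  then have "x$1 * y$1 + x$2 * y$2 < x$3 * y$3" using x y power2_less_imp_less[of _ "x$3 * y$3"] by (simp add: less_imp_le)
  then show "lorentz x y > 0" by (simp add: lorentz_def)
  define u1 u2 where "u1 = x$1 * y$3 - x$3 * y$1" and "u2 = x$2 * y$3 - x$3 * y$2"
  define d where "d = x$1 * y$2 - x$2 * y$1"
  have id: "(y$3)\<^sup>2 * ((lorentz x y)\<^sup>2 - lq x * lq y) = (y$3)\<^sup>2 * (u1\<^sup>2 + u2\<^sup>2 - d\<^sup>2)"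
    by (simp add: lorentz_def u1_def u2_def d_def power2_eq_square algebra_simps)
  have dd: "y$3 * d = u1 * y$2 - u2 * y$1" by (simp add: u1_def u2_def d_def algebra_simps)
  have "(y$3 * d)\<^sup>2 \<le> (u1\<^sup>2 + u2\<^sup>2) * ((y$1)\<^sup>2 + (y$2)\<^sup>2)"
    unfolding dd using sum_squares_ge_zero[of "u1 * y$1 + u2 * y$2" 0] by (simp add: power2_eq_square algebra_simps)
  then have ge: "(y$3)\<^sup>2 * (u1\<^sup>2 + u2\<^sup>2 - d\<^sup>2) \<ge> (u1\<^sup>2 + u2\<^sup>2) * ((y$3)\<^sup>2 - (y$1)\<^sup>2 - (y$2)\<^sup>2)"
    by (simp add: power_mult_distrib algebra_simps)
  moreover have "(u1\<^sup>2 + u2\<^sup>2) * ((y$3)\<^sup>2 - (y$1)\<^sup>2 - (y$2)\<^sup>2) \<ge> 0" using y by (intro mult_nonneg_nonneg) auto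
  ultimately have "(y$3)\<^sup>2 * ((lorentz x y)\<^sup>2 - lq x * lq y) \<ge> 0" unfolding id by linarith
  then show "(lorentz x y)\<^sup>2 \<ge> lq x * lq y" using y by (simp add: zero_le_mult_iff)
  show "\<exists>c. x = c *\<^sub>R y" if "(lorentz x y)\<^sup>2 = lq x * lq y"
  proof -
    have "(y$3)\<^sup>2 * (u1\<^sup>2 + u2\<^sup>2 - d\<^sup>2) = 0" unfolding id[symmetric] that by simp
    then have "(u1\<^sup>2 + u2\<^sup>2) * ((y$3)\<^sup>2 - (y$1)\<^sup>2 - (y$2)\<^sup>2) \<le> 0" using ge by linarith
    then have "u1\<^sup>2 + u2\<^sup>2 \<le> 0" using y by (simp add: mult_le_0_iff)
    then have "u1 = 0" "u2 = 0" using sum_power2_le_zero_iff[of u1 u2] by auto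
    then have "x = (x$3 / y$3) *\<^sub>R y" using y by (simp add: vec_eq_iff forall_3 u1_def u2_def field_simps)
    then show ?thesis by blast
  qed
qed

lemma lcone_add: "x \<in> lcone \<Longrightarrow> y \<in> lcone \<Longrightarrow> x + y \<in> lcone"
  using lorentz_lcone(1)[of x y]
  by (simp add: lcone_def lorentz_bilinear lorentz_commute[of y x])

lemma lcone_scale: "x \<in> lcone \<Longrightarrow> c > 0 \<Longrightarrow> c *\<^sub>R x \<in> lcone"
  by (simp add: lcone_def lorentz_bilinear)

text \<open>Every vector is a difference of cone vectors, so bilinear identities that hold on the
  cone hold everywhere.\<close>

lemma lcone_translate: "\<exists>t>0. x + t *\<^sub>R apex \<in> lcone"
proof -
  define n where "n = \<bar>x$1\<bar> + \<bar>x$2\<bar>"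
  define t where "t = n + \<bar>x$3\<bar> + 1"
  have n: "(x$1)\<^sup>2 + (x$2)\<^sup>2 \<le> n\<^sup>2" by (simp add: n_def power2_sum)
  have t: "t > 0" "x$3 + t > n" "n \<ge> 0" by (auto simp: t_def n_def)
  then have "n\<^sup>2 < (x$3 + t)\<^sup>2" by (intro power_strict_mono) auto
  then have "x + t *\<^sub>R apex \<in> lcone" using n t by (simp add: lcone_def lorentz_def apex_def power2_eq_square)
  then show ?thesis using t by blast
qed

text \<open>The Lorentz form is the polarised determinant of symmetric matrices, and the determinant
  of A X A^T is (det A)^2 det X.\<close>

lemma lq_Phi: "lorentz (Phi A *v x) (Phi A *v y) = (det A)\<^sup>2 * lorentz x y"
  unfolding Phi_mult_vec
  by (simp add: lorentz_def coords_of_def sym_of_def matrix_matrix_mult_def transpose_def sum_2 det_2) (simp add: field_simps power2_eq_square)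

text \<open>The third coordinate is half the trace of A X A^T, a sum of two values of the positive
  form X at the rows of A. It cannot be 0, since the Lorentz form stays positive.\<close>

lemma Phi_lcone:
  assumes "det A = 1" "x \<in> lcone" shows "Phi A *v x \<in> lcone"
proof -
  define a b c d where abcd: "a = A$1$1" "b = A$1$2" "c = A$2$1" "d = A$2$2"
  have x: "x$3 > 0" "lq x > 0" using assms by (auto simp: lcone_def)
  have x31: "x$3 + x$1 > 0"
  proof -
    have "(x$1)\<^sup>2 < (x$3)\<^sup>2" using x zero_le_square[of "x$2"] unfolding lorentz_def power2_eq_square by linarith
    then have "\<bar>x$1\<bar> < x$3" using x(1) by (metis abs_le_square_iff abs_of_pos linorder_not_less)
    then show ?thesis by linarith
  qed
  have psd: "u\<^sup>2 * (x$3 + x$1) + 2 * u * v * x$2 + v\<^sup>2 * (x$3 - x$1) \<ge> 0" for u v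
  proof -
    have "(x$3 + x$1) * (u\<^sup>2 * (x$3 + x$1) + 2 * u * v * x$2 + v\<^sup>2 * (x$3 - x$1)) = (u * (x$3 + x$1) + v * x$2)\<^sup>2 + v\<^sup>2 * lq x"
      by (simp add: lorentz_def power2_eq_square algebra_simps)
    also have "\<dots> \<ge> 0" using x by simp
    finally show ?thesis using x31 by (simp add: zero_le_mult_iff)
  qed
  have "2 * (Phi A *v x) $ 3 = (a\<^sup>2 * (x$3 + x$1) + 2 * a * b * x$2 + b\<^sup>2 * (x$3 - x$1)) + (c\<^sup>2 * (x$3 + x$1) + 2 * c * d * x$2 + d\<^sup>2 * (x$3 - x$1))"
    unfolding Phi_mult_vec
    by (simp add: coords_of_def sym_of_def matrix_matrix_mult_def transpose_def sum_2 abcd[symmetric]) (simp add: power2_eq_square algebra_simps)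
  then have ge: "(Phi A *v x) $ 3 \<ge> 0" using psd[of a b] psd[of c d] by linarith
  have q: "lq (Phi A *v x) > 0" using x assms by (simp add: lq_Phi)
  have "(Phi A *v x) $ 3 \<noteq> 0"
  proof
    assume "(Phi A *v x) $ 3 = 0"
    then have "lq (Phi A *v x) \<le> 0" by (simp add: lorentz_def)
    then show False using q by simp
  qed
  then show ?thesis using ge q by (simp add: lcone_def)
qed

lemma Phi_mat_1: "Phi (mat 1) = mat 1"
  by (rule matrix_eq[THEN iffD2]) (simp add: Phi_mult_vec vec_eq_iff forall_3 coords_of_def sym_of_def transpose_mat)

lemma matrix_inv_right: "invertible A \<Longrightarrow> A ** matrix_inv A = mat 1"
  and matrix_inv_left: "invertible A \<Longrightarrow> matrix_inv A ** A = mat 1"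
  for A :: "real^'n^'n"
  unfolding invertible_def matrix_inv_def by (metis (mono_tags, lifting) someI_ex)+

lemma matrix_inv_eqI: "A ** B = mat 1 \<Longrightarrow> matrix_inv A = B"
  for A B :: "real^'n^'n"
proof -
  assume AB: "A ** B = mat 1"
  then have "invertible A" using invertible_right_inverse by blast
  then have "matrix_inv A ** (A ** B) = B" by (simp add: matrix_mul_assoc matrix_inv_left)
  then show "matrix_inv A = B" by (simp add: AB)
qed

lemma Phi_matrix_inv:
  assumes "det A = 1" shows "matrix_inv (Phi A) = Phi (matrix_inv A)" "det (matrix_inv A) = 1"
proof -
  have i: "invertible A" using assms by (simp add: invertible_det_nz)
  have "Phi A ** Phi (matrix_inv A) = mat 1"
    by (simp add: Phi_mult[symmetric] matrix_inv_right[OF i] Phi_mat_1)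
  then show "matrix_inv (Phi A) = Phi (matrix_inv A)" by (rule matrix_inv_eqI)
  have "det A * det (matrix_inv A) = 1" by (simp add: det_mul[symmetric] matrix_inv_right[OF i])
  then show "det (matrix_inv A) = 1" using assms by simp
qed

lemma Phi_image_lcone:
  assumes "det A = 1" "c > 0" shows "(*v) (c *\<^sub>R Phi A) ` lcone = lcone"
proof
  show "(*v) (c *\<^sub>R Phi A) ` lcone \<subseteq> lcone"
    using Phi_lcone[OF assms(1)] lcone_scale assms(2) by (auto simp: scaleR_matrix_vector_assoc[symmetric])
  show "lcone \<subseteq> (*v) (c *\<^sub>R Phi A) ` lcone"
  proof
    fix x assume x: "x \<in> lcone"
    have i: "invertible A" using assms by (simp add: invertible_det_nz)
    let ?y = "(1 / c) *\<^sub>R (Phi (matrix_inv A) *v x)"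
    have "?y \<in> lcone" using x assms by (intro lcone_scale Phi_lcone Phi_matrix_inv) auto
    moreover have "(c *\<^sub>R Phi A) *v ?y = x"
    proof -
      have "(c *\<^sub>R Phi A) *v ?y = (c * (1 / c)) *\<^sub>R (Phi A *v (Phi (matrix_inv A) *v x))"
        by (simp only: scaleR_matrix_vector_assoc[symmetric] matrix_vector_mult_scaleR scaleR_scaleR mult.commute)
      then show ?thesis
        using assms(2) by (simp add: matrix_vector_mul_assoc Phi_mult[symmetric] matrix_inv_right[OF i] Phi_mat_1)
    qed
    ultimately show "x \<in> (*v) (c *\<^sub>R Phi A) ` lcone" by (rule image_eqI[OF sym, rotated])
  qed
qed

text \<open>Cholesky factorisation: \<open>apex\<close> corresponds to the identity matrix, and a
  positive symmetric matrix of determinant 1 is A A^T with A lower triangular.\<close>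

lemma lcone_transitive:
  assumes "x \<in> lcone"
  obtains A where "det A = 1" "x = (sqrt (lq x) *\<^sub>R Phi A) *v apex"
proof -
  have x: "x$3 > 0" "lq x > 0" using assms by (auto simp: lcone_def)
  define y where "y = (1 / sqrt (lq x)) *\<^sub>R x"
  have y: "y \<in> lcone" "lq y = 1" "x = sqrt (lq x) *\<^sub>R y"
    using x by (simp_all add: y_def lcone_scale assms lorentz_bilinear)
  have y31: "y$3 + y$1 > 0"
  proof -
    have "(y$1)\<^sup>2 < (y$3)\<^sup>2" using y(2) zero_le_square[of "y$2"] unfolding lorentz_def power2_eq_square by linarith
    then have "\<bar>y$1\<bar> < y$3" using y(1) by (metis (mono_tags, lifting) abs_le_square_iff abs_of_pos lcone_def linorder_not_less mem_Collect_eq)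
    then show ?thesis by linarith
  qed
  define s where "s = sqrt (y$3 + y$1)"
  have s: "s > 0" "s * s = y$3 + y$1" using y31 by (auto simp: s_def)
  define A :: "real^2^2" where "A = vector [vector [s, 0], vector [y$2 / s, 1 / s]]"
  have "det A = 1" using s by (simp add: A_def det_2)
  moreover have "Phi A *v apex = y"
  proof -
    have e: "y$3 - y$1 = (1 + (y$2)\<^sup>2) / (s * s)" using y(2) s y31 by (simp add: lorentz_def power2_eq_square field_simps)
    have C: "coords_of (A ** sym_of apex ** transpose A) = vector [((s * s) - (1 + (y$2)\<^sup>2) / (s * s)) / 2, y$2, ((s * s) + (1 + (y$2)\<^sup>2) / (s * s)) / 2]"
      unfolding vec_eq_iff forall_3 using s(1)
      by (simp add: apex_def coords_of_def sym_of_def matrix_matrix_mult_def transpose_def sum_2 A_def power2_eq_square add_divide_distrib)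
    show ?thesis
      unfolding Phi_mult_vec C[unfolded e[symmetric], unfolded s(2)] by (simp add: vec_eq_iff forall_3)
  qed
  ultimately show ?thesis using that[of A] y(3) by (simp add: scaleR_matrix_vector_assoc[symmetric])
qed

text \<open>The power -3/2 of the Lorentz form. Up to a factor it is the only function on the cone
  on which automorphisms act through the inverse of their determinant.\<close>

definition lorentz_pot :: "real^3 \<Rightarrow> real" where
  "lorentz_pot x = 1 / (lq x * sqrt (lq x))"

lemma has_derivative_lorentz [derivative_intros]:
  assumes "(f has_derivative f') (at x within A)" "(g has_derivative g') (at x within A)"
  shows "((\<lambda>x. lorentz (f x) (g x)) has_derivative (\<lambda>v. lorentz (f x) (g' v) + lorentz (f' v) (g x))) (at x within A)"
proof -
  have n: "((\<lambda>x. f x $ i) has_derivative (\<lambda>v. f' v $ i)) (at x within A)" "((\<lambda>x. g x $ i) has_derivative (\<lambda>v. g' v $ i)) (at x within A)" for i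
    using assms by (auto intro: bounded_linear.has_derivative[OF bounded_linear_vec_nth])
  show ?thesis
    unfolding lorentz_def by (rule derivative_eq_intros n refl)+ (simp add: algebra_simps)
qed

text \<open>The logarithm turns the unknown factor c into an additive constant and leaves -(3/2) log
  of the Lorentz form, hence the 3. The potentials of both metrics are covered.\<close>

lemma hessian_ln_potential:
  assumes c: "c > 0" and F: "\<And>y. y \<in> lcone \<Longrightarrow> F y = c * lorentz_pot y" and x: "x \<in> lcone"
  shows "hessian (\<lambda>y. ln (F y)) x = 3 *\<^sub>R cone_metric x"
proof -
  have q: "lq y > 0" if "y \<in> lcone" for y using that by (simp add: lcone_def)
  have L: "ln (F y) = ln c - (3/2) * ln (lq y)" if y: "y \<in> lcone" for y
  proof -
    have "ln (F y) = ln c - (ln (lq y) + ln (sqrt (lq y)))"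
      using q[OF y] c by (simp add: F[OF y] lorentz_pot_def ln_mult ln_div)
    then show ?thesis using q[OF y] by (simp add: ln_sqrt)
  qed
  have D: "((\<lambda>y. ln (F y)) has_derivative (\<lambda>v. - 3 * lorentz y v / lq y)) (at y)" if y: "y \<in> lcone" for y
  proof -
    have "((\<lambda>y. ln c - (3/2) * ln (lq y)) has_derivative (\<lambda>v. - 3 * lorentz y v / lq y)) (at y)"
      using q[OF y] by (auto intro!: derivative_eq_intros simp: fun_eq_iff lorentz_commute field_simps)
    then show ?thesis
      by (rule has_derivative_transform_within_open[OF _ open_lcone y]) (simp add: L)
  qed
  have DD: "((\<lambda>y. \<D> (\<lambda>y. ln (F y)) y w) has_derivative
      (\<lambda>v. 3 * (2 * lorentz x v * lorentz x w / (lq x)\<^sup>2 - lorentz v w / lq x))) (at x)" for w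
  proof -
    have "((\<lambda>y. - 3 * lorentz y w / lq y) has_derivative (\<lambda>v. 3 * (2 * lorentz x v * lorentz x w / (lq x)\<^sup>2 - lorentz v w / lq x))) (at x)"
    proof (rule has_derivative_eq_rhs)
      have N: "((\<lambda>y. - 3 * lorentz y w) has_derivative (\<lambda>v. - 3 * lorentz v w)) (at x)"
        by (rule derivative_eq_intros refl)+ (simp add: lorentz_def)
      have L: "(lq has_derivative (\<lambda>v. 2 * lorentz x v)) (at x)"
        by (rule derivative_eq_intros refl)+ (simp add: lorentz_commute[of _ x])
      show "((\<lambda>y. - 3 * lorentz y w / lq y) has_derivative (\<lambda>v. (- 3 * lorentz v w * lq x - - 3 * lorentz x w * (2 * lorentz x v)) / (lq x * lq x))) (at x)"
        using q[OF x] by (intro has_derivative_divide' N L) simp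
      show "(\<lambda>v. (- 3 * lorentz v w * lq x - - 3 * lorentz x w * (2 * lorentz x v)) / (lq x * lq x)) = (\<lambda>v. 3 * (2 * lorentz x v * lorentz x w / (lq x)\<^sup>2 - lorentz v w / lq x))"
        using q[OF x] by (simp add: fun_eq_iff power2_eq_square divide_simps mult_ac)
    qed
    then show ?thesis
      by (rule has_derivative_transform_within_open[OF _ open_lcone x]) (simp add: frechet_derivative_at[OF D, symmetric])
  qed
  show ?thesis
    by (simp add: hessian_def frechet_derivative_at[OF DD, symmetric] cone_metric_def vec_eq_iff)
qed

lemma cone_metric_apex: "cone_metric apex = mat 1"
  by (simp add: cone_metric_def vec_eq_iff forall_3 lorentz_axis lq_apex mat_def) (simp add: apex_def axis_def)

lemma cone_metric_scale: "cone_metric (c *\<^sub>R x) = (1 / c\<^sup>2) *\<^sub>R cone_metric x"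
  by (simp add: cone_metric_def vec_eq_iff lorentz_bilinear power2_eq_square right_diff_distrib mult_ac)

lemma inner_transpose: "u \<bullet> (transpose A *v w) = (A *v u) \<bullet> w"
  for A :: "real^'n^'m"
  by (metis dot_lmul_matrix inner_commute transpose_matrix_vector)

lemma cone_metric_bilinear: "u \<bullet> (cone_metric x *v v) = 2 * lorentz x u * lorentz x v / (lq x)\<^sup>2 - lorentz u v / lq x"
proof -
  have "u \<bullet> (cone_metric x *v v) = (\<Sum>i\<in>UNIV. \<Sum>j\<in>UNIV. u$i * v$j * cone_metric x $ i $ j)"
    by (simp add: inner_vec_def matrix_vector_mult_def sum_distrib_left mult_ac)
  also have "\<dots> = 2 * lorentz x u * lorentz x v / (lq x)\<^sup>2 - lorentz u v / lq x"
    by (simp add: cone_metric_def sum_3 lorentz_axis) (simp add: lorentz_def axis_def field_simps add_divide_distrib diff_divide_distrib)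
  finally show ?thesis .
qed

lemma matrix_eq_bilinear: "(\<And>u v. u \<bullet> (A *v v) = u \<bullet> (B *v v)) \<Longrightarrow> A = B"
  for A B :: "real^'n^'n"
  by (rule matrix_eq[THEN iffD2]) (metis vector_eq_rdot inner_commute)

text \<open>Numerators and denominators of \<open>cone_metric\<close> have the same degree in the
  Lorentz form, so a similarity factor cancels.\<close>

lemma cone_metric_pullback:
  assumes "\<And>u v. lorentz (A *v u) (A *v v) = c * lorentz u v" "c \<noteq> 0"
  shows "transpose A ** cone_metric (A *v x) ** A = cone_metric x"
proof (rule matrix_eq_bilinear)
  fix u v
  have "u \<bullet> ((transpose A ** cone_metric (A *v x) ** A) *v v) = (A *v u) \<bullet> (cone_metric (A *v x) *v (A *v v))"
    by (simp only: matrix_vector_mul_assoc[symmetric] inner_transpose)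
  also have "\<dots> = u \<bullet> (cone_metric x *v v)"
    unfolding cone_metric_bilinear assms(1) using assms(2) by (simp add: power2_eq_square field_simps)
  finally show "u \<bullet> ((transpose A ** cone_metric (A *v x) ** A) *v v) = u \<bullet> (cone_metric x *v v)" .
qed

lemma cone_metric_symmetric: "transpose (cone_metric x) = cone_metric x"
  by (simp add: cone_metric_def transpose_def vec_eq_iff lorentz_commute mult.commute)

section \<open>The Koszul-Vinberg function of the light cone\<close>

lemma dual_cone_borel: 
  assumes "open C" "C \<noteq> {}" shows "dual_cone C \<in> sets borel"
proof -
  \<comment> \<open>The strict inequalities define the closed dual cone without 0: a nonzero
    functional that vanishes at a point of the open set C is negative at some nearby point of
    C.\<close>
  have "dual_cone C = (\<Inter>x\<in>C. {\<psi>. \<psi> \<bullet> x \<ge> 0}) - {0}"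
  proof (intro equalityI subsetI)
    fix \<psi> assume p: "\<psi> \<in> (\<Inter>x\<in>C. {\<psi>. \<psi> \<bullet> x \<ge> 0}) - {0}"
    have "\<psi> \<bullet> x > 0" if x: "x \<in> C" for x
    proof (rule ccontr)
      assume "\<not> \<psi> \<bullet> x > 0"
      then have z: "\<psi> \<bullet> x = 0" using p x by force
      obtain e where e: "e > 0" "ball x e \<subseteq> C" using assms(1) x open_contains_ball by blast
      define y where "y = x - (e / (2 * norm \<psi>)) *\<^sub>R \<psi>"
      have "\<psi> \<noteq> 0" using p by simp
      then have "y \<in> ball x e" using e by (simp add: y_def dist_norm)
      then have "\<psi> \<bullet> y \<ge> 0" using p e by blast
      moreover have "\<psi> \<bullet> y < 0" using z e \<open>\<psi> \<noteq> 0\<close> by (simp add: y_def inner_diff_right)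
      ultimately show False by simp
    qed
    then show "\<psi> \<in> dual_cone C" by (simp add: dual_cone_def)
  qed (use assms in \<open>fastforce simp: dual_cone_def less_imp_le\<close>)
  moreover have "closed (\<Inter>x\<in>C. {\<psi>. \<psi> \<bullet> x \<ge> 0})"
    by (intro closed_INT ballI closed_Collect_le continuous_intros)
  ultimately show ?thesis by simp
qed

text \<open>The third coordinate of a dual vector bounds the absolute values of the other two, so
  exp of minus it is at most a product of three such factors; this accounts for the division by 3.
  The 18 is the quadratic Taylor term of exp (t / 3).\<close>

lemma exp_neg_abs_integral: "(\<integral>\<^sup>+t. ennreal (exp (- \<bar>t\<bar> / 3)) \<partial>lborel) < \<infinity>"
proof -
  have i: "integrable lborel (\<lambda>t::real. 18 * inverse (1 + t\<^sup>2))"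
    using integrable_inverse_1_plus_square by (simp add: set_integrable_def einterval_def)
  have "exp (- \<bar>t\<bar> / 3) \<le> 18 * inverse (1 + t\<^sup>2)" for t :: real
  proof -
    have "1 + t\<^sup>2 / 18 \<le> exp (\<bar>t\<bar> / 3)"
      using exp_lower_Taylor_quadratic[of "\<bar>t\<bar> / 3"] by (simp add: power_divide)
    then have "1 + t\<^sup>2 \<le> 18 * exp (\<bar>t\<bar> / 3)" by simp
    then show ?thesis by (simp add: exp_minus field_simps add_pos_nonneg)
  qed
  then have "(\<integral>\<^sup>+t. ennreal (exp (- \<bar>t\<bar> / 3)) \<partial>lborel) \<le> (\<integral>\<^sup>+t. ennreal (18 * inverse (1 + t\<^sup>2)) \<partial>lborel)"
    by (intro nn_integral_mono ennreal_leI)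
  also have "\<dots> < \<infinity>" using i by (subst nn_integral_eq_integral) auto
  finally show ?thesis .
qed

lemma dual_lcone_bound:
  assumes "\<psi> \<in> dual_cone lcone" shows "\<bar>\<psi>$1\<bar> \<le> \<psi>$3" "\<bar>\<psi>$2\<bar> \<le> \<psi>$3"
proof -
  have *: "0 \<le> \<psi>$3 + a * \<psi>$1 + b * \<psi>$2" if ab: "a\<^sup>2 + b\<^sup>2 = 1" for a b
  proof (rule field_le_epsilon)
    fix e :: real assume e: "e > 0"
    \<comment> \<open>The test vector (a, b, 1) lies on the boundary of the cone. It is pushed
      inside by e / n, and this n keeps the resulting error at most e.\<close>
    define n where "n = \<bar>\<psi>$3\<bar> + 1"
    define x :: "real^3" where "x = vector [a, b, 1 + e / n]"
    have n: "n > 0" by (simp add: n_def)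
    then have "(1 + e / n) * (1 + e / n) > 1 * 1" using e by (intro mult_strict_mono) (auto simp: field_simps)
    then have "x \<in> lcone" using ab e n by (simp add: x_def lcone_def lorentz_def power2_eq_square add_pos_pos)
    then have "0 < \<psi> \<bullet> x" using assms by (simp add: dual_cone_def)
    also have "\<psi> \<bullet> x = \<psi>$3 + a * \<psi>$1 + b * \<psi>$2 + e * (\<psi>$3 / n)" by (simp add: inner_vec_def sum_3 x_def algebra_simps)
    also have "e * (\<psi>$3 / n) \<le> e * 1" using e n by (intro mult_left_mono) (auto simp: n_def field_simps)
    finally show "0 \<le> \<psi>$3 + a * \<psi>$1 + b * \<psi>$2 + e" by simp
  qed
  show "\<bar>\<psi>$1\<bar> \<le> \<psi>$3" "\<bar>\<psi>$2\<bar> \<le> \<psi>$3"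
    using *[of 1 0] *[of "-1" 0] *[of 0 1] *[of 0 "-1"] by auto
qed

lemma lcone_self_dual: "lcone \<subseteq> dual_cone lcone"
proof
  fix \<psi> assume p: "\<psi> \<in> lcone"
  have "\<psi> \<bullet> x > 0" if x: "x \<in> lcone" for x
  proof -
    define y :: "real^3" where "y = vector [- x$1, - x$2, x$3]"
    have "y \<in> lcone" using x by (simp add: y_def lcone_def lorentz_def)
    from lorentz_lcone(1)[OF p this] show ?thesis by (simp add: y_def lorentz_def inner_vec_def sum_3)
  qed
  then show "\<psi> \<in> dual_cone lcone" by (simp add: dual_cone_def)
qed

lemma lcone_ne: "lcone \<noteq> {}" using apex_in by auto

text \<open>Integrability has to be shown, because the integral of a function that is not integrable
  is 0 by convention. Positivity then follows since the dual cone contains the open cone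
  itself.\<close>

lemma koszul_vinberg_apex: "koszul_vinberg lcone apex > 0"
proof -
  let ?D = "dual_cone lcone"
  let ?f = "\<lambda>\<psi>::real^3. indicat_real ?D \<psi> *\<^sub>R exp (- (\<psi> \<bullet> apex))"
  have Db: "?D \<in> sets borel" by (rule dual_cone_borel[OF open_lcone lcone_ne])
  have ap: "\<psi> \<bullet> apex = \<psi>$3" for \<psi> by (simp add: apex_def inner_vec_def sum_3)
  have i: "integrable lborel ?f"
  proof (rule integrableI_bounded)
    show "?f \<in> borel_measurable lborel"
      using Db by measurable
    have "(\<integral>\<^sup>+\<psi>. ennreal (norm (?f \<psi>)) \<partial>lborel) 
      \<le> (\<integral>\<^sup>+\<psi>. (\<Prod>b\<in>Basis. ennreal (exp (- \<bar>\<psi> \<bullet> b\<bar> / 3))) \<partial>(lborel :: (real^3) measure))"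
    proof (rule nn_integral_mono)
      fix \<psi> :: "real^3"
      have "norm (?f \<psi>) \<le> exp (- (\<bar>\<psi>$1\<bar> + \<bar>\<psi>$2\<bar> + \<bar>\<psi>$3\<bar>) / 3)"
        using dual_lcone_bound[of \<psi>] by (auto simp: indicator_def ap)
      also have "\<dots> = (\<Prod>b\<in>Basis. exp (- \<bar>\<psi> \<bullet> b\<bar> / 3))"
      proof -
        have B: "(Basis :: (real^3) set) = {axis 1 1, axis 2 1, axis 3 1}" by (auto simp: Basis_vec_def UNIV_3)
        have "axis 1 1 \<noteq> (axis 2 1 :: real^3)" "axis 1 1 \<noteq> (axis 3 1 :: real^3)" "axis 2 1 \<noteq> (axis 3 1 :: real^3)" by (auto simp: axis_eq_axis)
        then show ?thesis unfolding B by (simp add: inner_axis exp_add[symmetric] add_divide_distrib diff_divide_distrib)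
      qed
      finally show "ennreal (norm (?f \<psi>)) \<le> (\<Prod>b\<in>Basis. ennreal (exp (- \<bar>\<psi> \<bullet> b\<bar> / 3)))"
        by (subst prod_ennreal) (auto intro!: ennreal_leI)
    qed
    also have "\<dots> = (\<Prod>b\<in>(Basis :: (real^3) set). \<integral>\<^sup>+t. ennreal (exp (- \<bar>t\<bar> / 3)) \<partial>lborel)"
      by (rule nn_integral_lborel_prod) auto
    also have "\<dots> < \<infinity>" using exp_neg_abs_integral by (simp add: power_less_top_ennreal)
    finally show "(\<integral>\<^sup>+\<psi>. ennreal (norm (?f \<psi>)) \<partial>lborel) < \<infinity>" .
  qed
  have "koszul_vinberg lcone apex \<ge> 0" unfolding koszul_vinberg_def set_lebesgue_integral_def by (intro Bochner_Integration.integral_nonneg) auto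
  moreover have "koszul_vinberg lcone apex \<noteq> 0"
  proof
    assume "koszul_vinberg lcone apex = 0"
    moreover have "AE \<psi> in lborel. 0 \<le> ?f \<psi>" by (intro AE_I2) auto
    ultimately have "AE \<psi> in lborel. ?f \<psi> = 0"
      using integral_nonneg_eq_0_iff_AE[OF i] by (simp add: koszul_vinberg_def set_lebesgue_integral_def)
    then have "AE \<psi> in lborel. \<psi> \<notin> lcone"
      by eventually_elim (use lcone_self_dual in \<open>auto simp: indicator_def split: if_splits\<close>)
    then have "lcone \<in> null_sets lebesgue"
      using AE_completion open_lcone by (subst AE_iff_null_sets) auto
    then show False using open_not_negligible[OF open_lcone lcone_ne] by (simp add: negligible_iff_null_sets)
  qed
  ultimately show ?thesis by simp
qed

text \<open>Substitution of the transpose of A, which preserves the dual cone. A is invertible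
  because it maps onto an open set, which spans the space.\<close>

lemma koszul_vinberg_linear:
  assumes C: "open C" "C \<noteq> {}" and A: "(*v) A ` C = C"
  shows "\<bar>det A\<bar> * koszul_vinberg C (A *v x) = koszul_vinberg C x" "det A \<noteq> 0"
proof -
  let ?D = "dual_cone C"
  have Db: "?D \<in> sets borel" by (rule dual_cone_borel[OF C])
  have inv: "invertible A"
  proof -
    have "interior C \<noteq> {}" using C by (simp add: interior_open)
    then have "\<not> dim C < DIM(real^3)" using empty_interior_lowdim by blast
    then have "dim C = DIM(real^3)" using dim_subset_UNIV[of C] by simp
    then have "span C = UNIV" using dim_eq_full by blast
    then have "(*v) A ` UNIV = UNIV"
      using linear_span_image[OF matrix_vector_mul_linear[of A], of C] A by simp
    then show ?thesis by (metis invertible_right_inverse matrix_right_invertible_surjective)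
  qed
  then show d: "det A \<noteq> 0" by (simp add: invertible_det_nz)
  have invT: "invertible (transpose A)" using d by (simp add: invertible_det_nz det_transpose)
  have mem: "transpose A *v \<psi> \<in> ?D \<longleftrightarrow> \<psi> \<in> ?D" for \<psi>
  proof -
    have "transpose A *v \<psi> \<in> ?D \<longleftrightarrow> (\<forall>x\<in>C. \<psi> \<bullet> (A *v x) > 0)"
      unfolding dual_cone_def by (simp only: mem_Collect_eq inner_commute[of "transpose A *v \<psi>"] inner_transpose inner_commute[of \<psi>])
    also have "\<dots> \<longleftrightarrow> (\<forall>y\<in>(*v) A ` C. \<psi> \<bullet> y > 0)" by blast
    finally show ?thesis by (simp add: A dual_cone_def)
  qed
  have rg: "range ((*v) (transpose A)) = UNIV"
    using matrix_right_invertible_surjective[of "transpose A"] invT invertible_right_inverse by blast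
  have inj: "inj ((*v) (transpose A))"
    using matrix_left_invertible_injective[of "transpose A"] invT invertible_left_inverse by blast
  have m: "(\<lambda>\<psi>. indicat_real ?D \<psi> *\<^sub>R exp (- (\<psi> \<bullet> x))) \<in> borel_measurable borel" using Db by measurable
  have D: "((*v) (transpose A) has_derivative (*v) (transpose A)) (at y)" for y
    by (intro bounded_linear_imp_has_derivative matrix_vector_mul_bounded_linear)
  have "koszul_vinberg C x = (LINT \<psi>:UNIV|lborel. indicat_real ?D \<psi> *\<^sub>R exp (- (\<psi> \<bullet> x)))"
    by (simp add: koszul_vinberg_def set_lebesgue_integral_def)
  also have "\<dots> = (LINT \<psi>:UNIV|lborel. \<bar>det A\<bar> *\<^sub>R (indicat_real ?D (transpose A *v \<psi>) *\<^sub>R exp (- ((transpose A *v \<psi>) \<bullet> x))))"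
    by (rule set_integral_substitution(2)[OF open_UNIV D inj _ m, unfolded rg matrix_of_matrix_vector_mul det_transpose, OF continuous_on_const])
  also have "\<dots> = \<bar>det A\<bar> * koszul_vinberg C (A *v x)"
  proof -
    have "(transpose A *v \<psi>) \<bullet> x = \<psi> \<bullet> (A *v x)" for \<psi>
      by (subst (1 2) inner_commute) (rule inner_transpose)
    moreover have "indicat_real ?D (transpose A *v \<psi>) = indicat_real ?D \<psi>" for \<psi>
      unfolding indicator_def mem ..
    ultimately have e: "indicat_real ?D (transpose A *v \<psi>) *\<^sub>R exp (- ((transpose A *v \<psi>) \<bullet> x)) = indicat_real ?D \<psi> *\<^sub>R exp (- (\<psi> \<bullet> (A *v x)))" for \<psi>
      by simp
    show ?thesis
      unfolding koszul_vinberg_def set_lebesgue_integral_def e by simp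
  qed
  finally show "\<bar>det A\<bar> * koszul_vinberg C (A *v x) = koszul_vinberg C x" by simp
qed

lemma det_scaleR_3: "det (c *\<^sub>R A) = c ^ 3 * det A" for A :: "real^3^3"
  by (simp add: det_3 power3_eq_cube algebra_simps)

text \<open>Transitivity of the automorphisms determines F by its value at \<open>apex\<close>; the
  automorphism taking \<open>apex\<close> to x has determinant \<open>sqrt (lq x) ^ 3\<close>. The
  statement is applied to the Koszul-Vinberg function and to the Cheng-Yau potential.\<close>

lemma potential_from_invariance:
  fixes F :: "real^3 \<Rightarrow> real"
  assumes "\<And>A x. (*v) A ` lcone = lcone \<Longrightarrow> x \<in> lcone \<Longrightarrow> \<bar>det A\<bar> * F (A *v x) = F x" and x: "x \<in> lcone"
  shows "F x = F apex * lorentz_pot x"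
proof -
  obtain A where A: "det A = 1" "x = (sqrt (lq x) *\<^sub>R Phi A) *v apex" using lcone_transitive[OF x] by blast
  have s: "sqrt (lq x) > 0" using x by (simp add: lcone_def)
  have "det (sqrt (lq x) *\<^sub>R Phi A) = sqrt (lq x) ^ 3"
    by (simp add: det_scaleR_3 det_Phi A(1))
  then have "F apex = sqrt (lq x) ^ 3 * F x"
    using assms(1)[OF Phi_image_lcone[OF A(1) s] apex_in] A(2) s by (simp add: abs_of_pos)
  moreover have "sqrt (lq x) ^ 3 = lq x * sqrt (lq x)" using x by (simp add: power3_eq_cube lcone_def)
  ultimately show ?thesis using s x by (simp add: lorentz_pot_def lcone_def)
qed

section \<open>Linear automorphisms and the Cheng-Yau potential of the light cone\<close>

lemma lorentz_pot_eq: "lorentz_pot x = 1 / sqrt (lq x) ^ 3" if "x \<in> lcone"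
  using that by (simp add: lorentz_pot_def power3_eq_cube lcone_def)

text \<open>The convex function u^(-3) lies strictly above its tangent at m; the gap is a square
  times a positive quadratic form.\<close>

lemma cube_tangent:
  fixes u m :: real
  assumes "u > 0" "m > 0" "u \<noteq> m"
  shows "1 / u ^ 3 > 1 / m ^ 3 - 3 * (u - m) / m ^ 4"
proof -
  have a: "m ^ 4 - (m - 3 * (u - m)) * u ^ 3 = (u - m)\<^sup>2 * (3 * u\<^sup>2 + 2 * u * m + m\<^sup>2)"
    by (simp add: power2_eq_square power3_eq_cube power4_eq_xxxx algebra_simps)
  have "1 / m ^ 3 - 3 * (u - m) / m ^ 4 = (m - 3 * (u - m)) / m ^ 4"
    using assms(2) by (simp add: diff_divide_distrib power3_eq_cube power4_eq_xxxx)
  moreover have "1 / u ^ 3 - (m - 3 * (u - m)) / m ^ 4 = (m ^ 4 - (m - 3 * (u - m)) * u ^ 3) / (u ^ 3 * m ^ 4)"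
    using assms(1,2) by (subst diff_frac_eq) auto
  then have "1 / u ^ 3 - (m - 3 * (u - m)) / m ^ 4 > 0"
    unfolding a using assms by (simp add: add_pos_pos)
  ultimately show ?thesis by simp
qed

text \<open>The square root of the Lorentz form is concave by reversed Cauchy-Schwarz, and u^(-3) is
  decreasing and convex. Strictness has two sources: for different Lorentzian lengths the tangent
  inequality, for equal lengths the equality case of Cauchy-Schwarz.\<close>

lemma lorentz_pot_convex:
  assumes xy: "x \<in> lcone" "y \<in> lcone" "x \<noteq> y" and t: "0 < t" "t < 1"
  shows "lorentz_pot ((1 - t) *\<^sub>R x + t *\<^sub>R y) < (1 - t) * lorentz_pot x + t * lorentz_pot y"
proof -
  define r where "r = sqrt (lq x)"
  define s where "s = sqrt (lq y)"
  define z where "z = (1 - t) *\<^sub>R x + t *\<^sub>R y"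
  define m where "m = (1 - t) * r + t * s"
  have q: "lq x > 0" "lq y > 0" using xy by (auto simp: lcone_def)
  then have rs: "r > 0" "s > 0" "r\<^sup>2 = lq x" "s\<^sup>2 = lq y" by (auto simp: r_def s_def)
  have z: "z \<in> lcone" unfolding z_def using xy t by (intro lcone_add lcone_scale) auto
  have m: "m > 0" using rs t by (simp add: m_def add_pos_pos)
  have qz: "lq z = m\<^sup>2 + 2 * t * (1 - t) * (lorentz x y - r * s)"
    by (simp add: z_def m_def lorentz_bilinear lorentz_commute[of y x] rs(3,4)[symmetric] power2_eq_square algebra_simps)
  have B: "lorentz x y \<ge> r * s"
    using lorentz_lcone(1,2)[OF xy(1,2)] rs by (intro power2_le_imp_le[of "r * s"]) (auto simp: power_mult_distrib)
  have qzp: "lq z > 0" using z by (simp add: lcone_def)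
  have "lq z \<ge> m\<^sup>2" using B t unfolding qz by simp
  then have zm: "sqrt (lq z) \<ge> m" using m by (simp add: real_le_rsqrt)
  have pz: "lorentz_pot z \<le> 1 / m ^ 3"
    unfolding lorentz_pot_eq[OF z] using zm m qzp by (intro divide_left_mono power_mono mult_pos_pos zero_less_power) auto
  show ?thesis
  proof (cases "r = s")
    case True
    have "lorentz x y \<noteq> r * s"
    proof
      assume "lorentz x y = r * s"
      then have "(lorentz x y)\<^sup>2 = lq x * lq y" by (simp add: rs(3,4)[symmetric] power_mult_distrib)
      then obtain c where c: "x = c *\<^sub>R y" using lorentz_lcone(3)[OF xy(1,2)] by blast
      have "c * lq y = lq y" using \<open>lorentz x y = r * s\<close> True rs(4) by (simp add: c lorentz_bilinear power2_eq_square)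
      then show False using q xy(3) c by simp
    qed
    then have "lq z > m\<^sup>2" using B t unfolding qz by simp
    then have "sqrt (lq z) > m" using m by (simp add: real_less_rsqrt)
    then have "lorentz_pot z < 1 / m ^ 3"
      unfolding lorentz_pot_eq[OF z] using m qzp by (intro divide_strict_left_mono power_strict_mono mult_pos_pos zero_less_power) auto
    moreover have "m = r" using True by (simp add: m_def algebra_simps)
    moreover have "(1 - t) * lorentz_pot x + t * lorentz_pot y = 1 / r ^ 3"
      using True by (simp add: lorentz_pot_eq xy r_def[symmetric] s_def[symmetric]) (simp add: True algebra_simps diff_divide_distrib)
    ultimately show ?thesis by (simp add: z_def)
  next
    case False
    have e1: "r - m = t * (r - s)" "s - m = (1 - t) * (s - r)" by (simp_all add: m_def algebra_simps)
    then have ne: "r \<noteq> m" "s \<noteq> m" using False t by auto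
    have "(1 - t) * (1 / r ^ 3) > (1 - t) * (1 / m ^ 3 - 3 * (r - m) / m ^ 4)"
      by (rule mult_strict_left_mono[OF cube_tangent[OF rs(1) m ne(1)]]) (use t in simp)
    moreover have "t * (1 / s ^ 3) > t * (1 / m ^ 3 - 3 * (s - m) / m ^ 4)"
      by (rule mult_strict_left_mono[OF cube_tangent[OF rs(2) m ne(2)] t(1)])
    moreover have "(1 - t) * (1 / m ^ 3 - 3 * (r - m) / m ^ 4) + t * (1 / m ^ 3 - 3 * (s - m) / m ^ 4) = 1 / m ^ 3"
      unfolding e1 using m by (simp add: field_simps)
    ultimately show ?thesis
      using pz by (simp add: lorentz_pot_eq[OF xy(1)] lorentz_pot_eq[OF xy(2)] r_def[symmetric] s_def[symmetric] z_def[symmetric])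
  qed
qed

lemma lorentz_pot_pos: "x \<in> lcone \<Longrightarrow> lorentz_pot x > 0"
  by (simp add: lorentz_pot_def lcone_def)

lemma lorentz_pot_smooth: "smooth_on lcone lorentz_pot"
proof -
  have "smooth_on lcone lq"
    unfolding lorentz_def[abs_def]
    by (intro smooth_minus smooth_mult smooth_linear bounded_linear_vec_nth open_lcone)
  then show ?thesis
    unfolding lorentz_pot_def[abs_def]
    by (intro smooth_divide smooth_mult smooth_sqrt smooth_const open_lcone) (auto simp: lcone_def)
qed

text \<open>All frontier points, the vertex included, are null vectors: a limit of cone points with
  positive Lorentz form has positive third coordinate and so lies in the open cone.\<close>

lemma lorentz_pot_frontier:
  assumes "y \<in> frontier lcone"
  shows "filterlim lorentz_pot at_top (at y within lcone)"
proof -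
  have "closed {x. x$3 \<ge> 0 \<and> lq x \<ge> 0}"
    by (intro closed_Collect_conj closed_Collect_le continuous_intros)
  then have "closure lcone \<subseteq> {x. x$3 \<ge> 0 \<and> lq x \<ge> 0}"
    by (intro closure_minimal) (auto simp: lcone_def)
  then have y: "y$3 \<ge> 0" "lq y \<ge> 0" "y \<notin> lcone"
    using assms open_lcone by (auto simp: frontier_def interior_open)
  have q0: "lq y = 0"
  proof (rule ccontr)
    assume "lq y \<noteq> 0"
    then have "lq y > 0" using y by simp
    moreover have "y$3 \<noteq> 0"
    proof
      assume "y$3 = 0"
      then have "lq y \<le> 0" by (simp add: lorentz_def)
      then show False using \<open>lq y > 0\<close> by simp
    qed
    ultimately show False using y by (simp add: lcone_def)
  qed
  have "continuous_on UNIV (\<lambda>x. lq x * sqrt (lq x))" by (intro continuous_intros)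
  then have "((\<lambda>x. lq x * sqrt (lq x)) \<longlongrightarrow> lq y * sqrt (lq y)) (at y within lcone)"
    by (auto simp: continuous_on_def intro: tendsto_within_subset)
  then have "((\<lambda>x. lq x * sqrt (lq x)) \<longlongrightarrow> 0) (at y within lcone)" by (simp add: q0)
  moreover have "\<forall>\<^sub>F x in at y within lcone. 0 < lq x * sqrt (lq x)"
    by (auto simp: eventually_at_filter lcone_def)
  ultimately have "filterlim (\<lambda>x. inverse (lq x * sqrt (lq x))) at_top (at y within lcone)"
    by (rule filterlim_inverse_at_top)
  then show ?thesis by (simp add: lorentz_pot_def[abs_def] divide_inverse)
qed

lemma koszul_vinberg_lcone:
  "x \<in> lcone \<Longrightarrow> koszul_vinberg lcone x = koszul_vinberg lcone apex * lorentz_pot x"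
  by (rule potential_from_invariance) (use koszul_vinberg_linear(1)[OF open_lcone lcone_ne] in auto)

text \<open>Linear automorphisms of the light cone are Lorentz similarities: the invariance of the
  Koszul-Vinberg function shows that they scale the Lorentz form.\<close>
lemma lcone_automorphism:
  assumes A: "(*v) A ` lcone = lcone"
  obtains c where "c \<noteq> 0" "\<And>u v. lorentz (A *v u) (A *v v) = c * lorentz u v"
proof -
  define k where "k = koszul_vinberg lcone"
  define \<rho> where "\<rho> = sqrt (lq (A *v apex))"
  have AC: "A *v x \<in> lcone" if "x \<in> lcone" for x using A that by blast
  have q: "lq x > 0" if "x \<in> lcone" for x using that by (simp add: lcone_def)
  have \<rho>: "\<rho> > 0" using q[OF AC[OF apex_in]] by (simp add: \<rho>_def)
  have inv: "\<bar>det A\<bar> * lorentz_pot (A *v x) = lorentz_pot x" if "x \<in> lcone" for x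
    using koszul_vinberg_linear(1)[OF open_lcone lcone_ne A, of x] koszul_vinberg_apex
    by (simp add: koszul_vinberg_lcone that AC)
  have cub: "sqrt (lq (A *v x)) ^ 3 = \<bar>det A\<bar> * sqrt (lq x) ^ 3" if "x \<in> lcone" for x
    using inv[OF that] q[OF that] q[OF AC[OF that]] by (simp add: lorentz_pot_eq that AC field_simps)
  have \<rho>3: "\<rho> ^ 3 = \<bar>det A\<bar>" using cub[OF apex_in] by (simp add: \<rho>_def lq_apex)
  have qA: "lq (A *v x) = \<rho>\<^sup>2 * lq x" if x: "x \<in> lcone" for x
  proof -
    have "sqrt (lq (A *v x)) ^ 3 = (\<rho> * sqrt (lq x)) ^ 3" using cub[OF x] by (simp add: power_mult_distrib \<rho>3)
    then have "sqrt (lq (A *v x)) = \<rho> * sqrt (lq x)"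
      using \<rho> q[OF x] q[OF AC[OF x]] by (subst (asm) power_eq_iff_eq_base) auto
    then have "(sqrt (lq (A *v x)))\<^sup>2 = (\<rho> * sqrt (lq x))\<^sup>2" by simp
    then show ?thesis using q[OF x] q[OF AC[OF x]] by (simp add: power_mult_distrib)
  qed
  \<comment> \<open>The quadratic form is known on the cone only. It is polarised there, and then
    each argument in turn is freed by writing a vector as a difference of cone vectors.\<close>
  have pol: "lorentz (A *v x) (A *v y) = \<rho>\<^sup>2 * lorentz x y" if x: "x \<in> lcone" "y \<in> lcone" for x y
    using qA[OF lcone_add[OF x]] qA[OF x(1)] qA[OF x(2)]
    by (simp add: matrix_vector_right_distrib lorentz_bilinear lorentz_commute[of y x] lorentz_commute[of "A *v y" "A *v x"] algebra_simps)
  have half: "lorentz (A *v u) (A *v y) = \<rho>\<^sup>2 * lorentz u y" if y: "y \<in> lcone" for u y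
  proof -
    obtain t where t: "t > 0" "u + t *\<^sub>R apex \<in> lcone" using lcone_translate by blast
    show ?thesis
      using pol[OF t(2) y] pol[OF apex_in y]
      by (simp add: matrix_vector_right_distrib matrix_vector_mult_scaleR lorentz_bilinear algebra_simps)
  qed
  have "lorentz (A *v u) (A *v v) = \<rho>\<^sup>2 * lorentz u v" for u v
  proof -
    obtain t where t: "t > 0" "v + t *\<^sub>R apex \<in> lcone" using lcone_translate by blast
    show ?thesis
      using half[OF t(2), of u] half[OF apex_in, of u]
      by (simp add: matrix_vector_right_distrib matrix_vector_mult_scaleR lorentz_bilinear algebra_simps)
  qed
  then show ?thesis using that[of "\<rho>\<^sup>2"] \<rho> by simp
qed

text \<open>By invariance the determinant is transported from \<open>apex\<close>, where the metric
  is the identity. It yields the Cheng-Yau equation for \<open>lorentz_pot\<close> with no extra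
  factor.\<close>

lemma det_cone_metric:
  assumes x: "x \<in> lcone" shows "det (cone_metric x) = (lorentz_pot x)\<^sup>2"
proof -
  obtain A where A: "det A = 1" "x = (sqrt (lq x) *\<^sub>R Phi A) *v apex" using lcone_transitive[OF x] by blast
  define T where "T = sqrt (lq x) *\<^sub>R Phi A"
  have q: "lq x > 0" using x by (simp add: lcone_def)
  have "lorentz (T *v u) (T *v v) = lq x * lorentz u v" for u v
    using q by (simp add: T_def scaleR_matrix_vector_assoc[symmetric] lorentz_bilinear lq_Phi A(1))
  then have "transpose T ** cone_metric (T *v apex) ** T = cone_metric apex"
    using q by (intro cone_metric_pullback) auto
  then have "det (transpose T ** cone_metric x ** T) = 1" using A(2) by (simp add: T_def[symmetric] cone_metric_apex)
  then have "(det T)\<^sup>2 * det (cone_metric x) = 1" by (simp add: det_mul power2_eq_square mult_ac)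
  moreover have "det T = sqrt (lq x) ^ 3"
    by (simp add: T_def det_scaleR_3 det_Phi A(1))
  ultimately show ?thesis using q by (simp add: lorentz_pot_eq[OF x] power_divide field_simps)
qed

lemma cheng_yau_metric_potential:
  assumes "c > 0" "\<And>y. y \<in> lcone \<Longrightarrow> \<sigma> y = c * lorentz_pot y" "x \<in> lcone"
  shows "cheng_yau_metric \<sigma> x = cone_metric x"
  by (simp add: cheng_yau_metric_def hessian_ln_potential[OF assms])

lemma cheng_yau_potential_lcone: "cheng_yau_potential lcone lorentz_pot"
  unfolding cheng_yau_potential_def
proof (intro conjI ballI allI impI)
  fix A x assume A: "(*v) A ` lcone = lcone" and x: "x \<in> lcone"
  obtain c where c: "c \<noteq> 0" "\<And>u v. lorentz (A *v u) (A *v v) = c * lorentz u v" using lcone_automorphism[OF A] by blast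
  have "A *v x \<in> lcone" using A x by blast
  then show "transpose A ** cheng_yau_metric lorentz_pot (A *v x) ** A = cheng_yau_metric lorentz_pot x"
    using cone_metric_pullback[OF c(2,1)] x by (simp add: cheng_yau_metric_potential[where c=1])
qed (use lorentz_pot_smooth lorentz_pot_pos lorentz_pot_convex lorentz_pot_frontier det_cone_metric
      cheng_yau_metric_potential[where c=1] in auto)

text \<open>This identifies the function picked by the choice operator. Invariance of the metric and
  the determinant equation make the potential scale by the inverse determinant under automorphisms,
  so it is a multiple of \<open>lorentz_pot\<close>; the equation at \<open>apex\<close> makes the
  factor 1.\<close>

lemma cheng_yau_lcone:
  assumes x: "x \<in> lcone" shows "cheng_yau lcone x = lorentz_pot x"
proof -
  let ?\<sigma> = "cheng_yau lcone"
  have P: "cheng_yau_potential lcone ?\<sigma>"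
    unfolding cheng_yau_def by (rule someI[of _ lorentz_pot]) (rule cheng_yau_potential_lcone)
  have pos: "?\<sigma> y > 0" and dt: "det (cheng_yau_metric ?\<sigma> y) = (?\<sigma> y)\<^sup>2" if "y \<in> lcone" for y
    using P that by (auto simp: cheng_yau_potential_def)
  have eq: "?\<sigma> y = ?\<sigma> apex * lorentz_pot y" if "y \<in> lcone" for y
  proof (rule potential_from_invariance[OF _ that])
    fix A z assume A: "(*v) A ` lcone = lcone" and z: "z \<in> lcone"
    have Az: "A *v z \<in> lcone" using A z by blast
    have "transpose A ** cheng_yau_metric ?\<sigma> (A *v z) ** A = cheng_yau_metric ?\<sigma> z"
      using P A z by (simp add: cheng_yau_potential_def)
    then have "det A * det (cheng_yau_metric ?\<sigma> (A *v z)) * det A = det (cheng_yau_metric ?\<sigma> z)"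
      by (metis det_mul det_transpose)
    then have "(\<bar>det A\<bar> * ?\<sigma> (A *v z))\<^sup>2 = (?\<sigma> z)\<^sup>2"
      by (simp add: dt z Az power_mult_distrib power2_eq_square mult_ac)
    then show "\<bar>det A\<bar> * ?\<sigma> (A *v z) = ?\<sigma> z"
      using pos[OF z] pos[OF Az] by (subst (asm) power_eq_iff_eq_base) auto
  qed
  have "cheng_yau_metric ?\<sigma> apex = cone_metric apex"
    by (rule cheng_yau_metric_potential[OF pos[OF apex_in] eq apex_in])
  then have "(?\<sigma> apex)\<^sup>2 = 1" using dt[OF apex_in] by (simp add: cone_metric_apex)
  then have "?\<sigma> apex = 1" using pos[OF apex_in] by (simp add: power2_eq_1_iff)
  then show ?thesis using eq[OF x] by simp
qed

text \<open>The coordinates of A A^T for z = A i, that is, of the symmetric matrix with rows (|z|^2,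
  Re z) and (Re z, 1), divided by Im z. It lifts \<open>klein\<close> to the unit
  hyperboloid.\<close>

definition hyperboloid :: "complex \<Rightarrow> real^3" where
  "hyperboloid z = vector [((cmod z)\<^sup>2 - 1) / (2 * Im z), Re z / Im z, ((cmod z)\<^sup>2 + 1) / (2 * Im z)]"

lemma lq_hyperboloid: "Im z \<noteq> 0 \<Longrightarrow> lq (hyperboloid z) = 1"
  by (simp add: lorentz_def hyperboloid_def cmod_power2 field_simps) (simp add: power2_eq_square algebra_simps)

lemma affine_point_klein: "Im z \<noteq> 0 \<Longrightarrow> affine_point (klein z) = (2 * Im z / ((cmod z)\<^sup>2 + 1)) *\<^sub>R hyperboloid z"
proof -
  assume z: "Im z \<noteq> 0"
  define N where "N = (cmod z)\<^sup>2"
  have "N \<ge> 0" by (simp add: N_def)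
  then have N: "N + 1 \<noteq> 0" by linarith
  show ?thesis
    unfolding affine_point_def klein_def hyperboloid_def vec_eq_iff forall_3 N_def[symmetric] using z N by simp
qed

lemma hyperboloid_lcone: "Im z > 0 \<Longrightarrow> hyperboloid z \<in> lcone"
proof -
  assume "Im z > 0"
  moreover have "(cmod z)\<^sup>2 + 1 > 0" using zero_le_power2[of "cmod z"] by linarith
  ultimately show ?thesis using lq_hyperboloid[of z] by (simp add: lcone_def) (simp add: hyperboloid_def)
qed

lemma affine_sphere_map_klein:
  assumes z: "Im z > 0" and s: "\<And>x. x \<in> lcone \<Longrightarrow> \<sigma> x = lorentz_pot x"
  shows "affine_sphere_map \<sigma> (klein z) = hyperboloid z"
  unfolding affine_sphere_map_def
proof (rule the_equality)
  have "(cmod z)\<^sup>2 + 1 > 0" using zero_le_power2[of "cmod z"] by linarith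
  then have c: "2 * Im z / ((cmod z)\<^sup>2 + 1) > 0" using z by simp
  define c where "c = 2 * Im z / ((cmod z)\<^sup>2 + 1)"
  have ap: "affine_point (klein z) = c *\<^sub>R hyperboloid z" using z by (simp add: affine_point_klein c_def)
  note h = hyperboloid_lcone[OF z] lq_hyperboloid[of z]
  show "\<sigma> (hyperboloid z) = 1 \<and> (\<exists>t>0. hyperboloid z = t *\<^sub>R affine_point (klein z))"
    using z h c by (auto simp: s lorentz_pot_def ap c_def[symmetric] intro!: exI[of _ "1 / c"])
  fix y assume "\<sigma> y = 1 \<and> (\<exists>t>0. y = t *\<^sub>R affine_point (klein z))"
  then obtain t where t: "t > 0" "y = (t * c) *\<^sub>R hyperboloid z" "\<sigma> y = 1" by (auto simp: ap)
  have "c > 0" using c by (simp add: c_def)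
  then have tc: "t * c > 0" by (rule mult_pos_pos[OF t(1)])
  have y: "y \<in> lcone" unfolding t(2) by (rule lcone_scale[OF h(1) tc])
  have "lq y = (t * c)\<^sup>2" using h(2) z by (simp add: t(2) lorentz_bilinear power2_eq_square)
  then have "sqrt (lq y) = t * c" using tc by simp
  then have "(t * c) ^ 3 = 1" using t(3) s[OF y] by (simp add: lorentz_pot_eq[OF y])
  then have "t * c = 1" using tc power_eq_iff_eq_base[of 3 "t * c" 1] by simp
  then show "y = hyperboloid z" by (simp add: t(2))
qed

lemma hyperboloid_derivative:
  assumes "Im z \<noteq> 0"
  shows "(hyperboloid has_derivative (\<lambda>w. vector [(Re z * Re w + Im z * Im w) / Im z - ((cmod z)\<^sup>2 - 1) * Im w / (2 * (Im z)\<^sup>2),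
     Re w / Im z - Re z * Im w / (Im z)\<^sup>2, (Re z * Re w + Im z * Im w) / Im z - ((cmod z)\<^sup>2 + 1) * Im w / (2 * (Im z)\<^sup>2)])) (at z)"
    (is "(_ has_derivative ?D) _")
proof -
  have e: "vector [a, b, c] = a *\<^sub>R axis 1 1 + b *\<^sub>R axis 2 1 + c *\<^sub>R (axis 3 1 :: real^3)" for a b c
    by (simp add: vec_eq_iff forall_3 axis_def)
  have D: "((\<lambda>z. ((cmod z)\<^sup>2 + k) / (2 * Im z)) has_derivative (\<lambda>w. (Re z * Re w + Im z * Im w) / Im z - ((cmod z)\<^sup>2 + k) * Im w / (2 * (Im z)\<^sup>2))) (at z)" for k
    unfolding cmod_power2 using assms
    by (auto intro!: derivative_eq_intros simp: fun_eq_iff) (simp add: field_simps power2_eq_square)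
  have D2: "((\<lambda>z. Re z / Im z) has_derivative (\<lambda>w. Re w / Im z - Re z * Im w / (Im z)\<^sup>2)) (at z)"
    using assms by (auto intro!: derivative_eq_intros simp: fun_eq_iff) (simp add: field_simps power2_eq_square)
  show ?thesis
    unfolding hyperboloid_def[abs_def] e
    using D[of "-1"] D[of 1] D2 by (intro has_derivative_add has_derivative_scaleR_left) auto
qed

text \<open>Tangent vectors are Lorentz-orthogonal to the position vector, so the first term of
  \<open>cone_metric\<close> drops out and minus the Lorentz form remains, which is the hyperbolic
  metric.\<close>

lemma hyperboloid_metric:
  assumes z: "Im z \<noteq> 0" and D: "(hyperboloid has_derivative D) (at z)"
  shows "D v \<bullet> (cone_metric (hyperboloid z) *v D w) = (v \<bullet> w) / (Im z)\<^sup>2"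
proof -
  define x y where "x = Re z" and "y = Im z"
  have D': "D = (\<lambda>w. vector [(x * Re w + y * Im w) / y - ((cmod z)\<^sup>2 - 1) * Im w / (2 * y\<^sup>2),
     Re w / y - x * Im w / y\<^sup>2, (x * Re w + y * Im w) / y - ((cmod z)\<^sup>2 + 1) * Im w / (2 * y\<^sup>2)])"
    using has_derivative_unique[OF D hyperboloid_derivative[OF z]] by (simp add: x_def y_def)
  have y: "y \<noteq> 0" using z by (simp add: y_def)
  have 0: "lorentz (hyperboloid z) (D w) = 0" for w
    unfolding D' using y
    by (simp add: lorentz_def hyperboloid_def cmod_power2 x_def[symmetric] y_def[symmetric]) (simp add: field_simps power2_eq_square)
  have 1: "lorentz (D v) (D w) = - (v \<bullet> w) / y\<^sup>2"
    unfolding D' using y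
    by (simp add: lorentz_def cmod_power2 inner_complex_def x_def[symmetric] y_def[symmetric]) (simp add: field_simps power2_eq_square)
  show ?thesis unfolding cone_metric_bilinear 0 1 using z by (simp add: lq_hyperboloid y_def)
qed

text \<open>c times the hyperbolic metric, pulled back by the developing map. The factor c is kept
  to treat both metrics at once.\<close>

definition conformal_metric :: "real \<Rightarrow> (plane \<Rightarrow> complex) \<Rightarrow> plane \<Rightarrow> real^2^2" where
  "conformal_metric c d s = (\<chi> i j. c * (\<D> d s (axis i 1) \<bullet> \<D> d s (axis j 1)) / (Im (d s))\<^sup>2)"

definition fibre_metric :: "(plane \<Rightarrow> complex) \<Rightarrow> plane \<Rightarrow> real^3^3 \<Rightarrow> real^3^3 \<Rightarrow> real" where
  "fibre_metric d s = tensor_product_metric (cone_metric (hyperboloid (d s)))"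

lemma pullback_hyperboloid:
  assumes d: "d differentiable (at s)" and z: "Im (d s) \<noteq> 0" and r: "\<rho> \<noteq> 0"
    and H: "H (\<rho> *\<^sub>R hyperboloid (d s)) = c *\<^sub>R cone_metric (\<rho> *\<^sub>R hyperboloid (d s))"
  shows "pullback_metric H (\<lambda>s. \<rho> *\<^sub>R hyperboloid (d s)) s = conformal_metric c d s"
proof -
  have Dd: "(d has_derivative \<D> d s) (at s)" using d frechet_derivative_works by blast
  define D where "D = \<D> hyperboloid (d s)"
  have Dh: "(hyperboloid has_derivative D) (at (d s))"
    unfolding D_def frechet_eq[OF hyperboloid_derivative[OF z]] by (rule hyperboloid_derivative[OF z])
  have "((\<lambda>s. \<rho> *\<^sub>R hyperboloid (d s)) has_derivative (\<lambda>v. \<rho> *\<^sub>R D (\<D> d s v))) (at s)"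
    by (intro has_derivative_scaleR_right has_derivative_compose[OF Dd Dh])
  then have "\<D> (\<lambda>s. \<rho> *\<^sub>R hyperboloid (d s)) s = (\<lambda>v. \<rho> *\<^sub>R D (\<D> d s v))" by (rule frechet_eq)
  then show ?thesis
    using r unfolding pullback_metric_def H cone_metric_scale conformal_metric_def
    by (simp add: scaleR_matrix_vector_assoc[symmetric] matrix_vector_mult_scaleR hyperboloid_metric[OF z Dh] vec_eq_iff power2_eq_square)
qed

lemma matrix_mult_scaleR: "(a *\<^sub>R A) ** (b *\<^sub>R B) = (a * b) *\<^sub>R (A ** B)"
  for A :: "real^'n^'m" and B :: "real^'k^'n"
  by (simp add: matrix_matrix_mult_def vec_eq_iff sum_distrib_left mult_ac)

text \<open>A factor in the metric cancels against the dual metric; this is why the Loftin and DG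
  fibre metrics coincide over the Teichmueller locus.\<close>

lemma tensor_product_metric_scale:
  assumes "c \<noteq> 0" "invertible H"
  shows "tensor_product_metric (c *\<^sub>R H) = tensor_product_metric H"
proof -
  have "matrix_inv (c *\<^sub>R H) = (1 / c) *\<^sub>R matrix_inv H"
    using assms by (intro matrix_inv_eqI) (simp add: matrix_mult_scaleR matrix_inv_right)
  then show ?thesis using assms by (simp add: tensor_product_metric_def[abs_def] mult_ac)
qed

lemma invertible_cone_metric: "x \<in> lcone \<Longrightarrow> invertible (cone_metric x)"
  using lorentz_pot_pos[of x] by (simp add: invertible_det_nz det_cone_metric)

lemma hyperbolic_structure_facts:
  assumes "(d, r) \<in> hyperbolic_structures p"
  shows "diffeo_onto d \<H>" "Im (d s) > 0" "d differentiable (at s)" "range (klein \<circ> d) = disc"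
proof -
  show d: "diffeo_onto d \<H>" using assms by (simp add: hyperbolic_structures_def)
  then show "Im (d s) > 0" by (auto simp: diffeo_onto_def bij_betw_def upper_half_plane_def)
  show "d differentiable (at s)" using d smooth_derivative[of UNIV d s] by (auto simp: diffeo_onto_def differentiable_def)
  show "range (klein \<circ> d) = disc" by (rule range_klein[OF d])
qed

theorem loftin_metric_hyperbolic:
  assumes X: "(d, r) \<in> hyperbolic_structures p"
  shows "loftin_metric p (teich_embedding (d, r)) = L2_metric p (conformal_metric 1 d) (fibre_metric d)"
proof -
  note h = hyperbolic_structure_facts[OF X]
  have m: "affine_sphere_map (cheng_yau lcone) (klein (d s)) = hyperboloid (d s)" for s
    using affine_sphere_map_klein[OF h(2)] cheng_yau_lcone by blast
  have H: "cheng_yau_metric (cheng_yau lcone) (hyperboloid (d s)) = cone_metric (hyperboloid (d s))" for s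
    by (rule cheng_yau_metric_potential[where c=1]) (auto simp: cheng_yau_lcone hyperboloid_lcone h(2))
  have nz: "Im (d s) \<noteq> 0" for s using h(2)[of s] by simp
  have "pullback_metric (cheng_yau_metric (cheng_yau lcone)) (\<lambda>s. hyperboloid (d s)) = conformal_metric 1 d"
    using pullback_hyperboloid[OF h(3) nz, where \<rho>=1 and c=1] H by (intro ext) simp
  then show ?thesis
    by (simp add: loftin_metric_def teich_embedding_def Let_def h(4)[unfolded comp_def] cone_disc hypersurface_metric_def comp_def m H fibre_metric_def[abs_def])
qed

text \<open>The DG construction takes the whole Hessian of the logarithm where Cheng-Yau takes a
  third of it, hence the factor 3. The level set is the hyperboloid enlarged by \<rho>, and \<rho>
  cancels because \<open>cone_metric\<close> is homogeneous of degree -2.\<close>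

theorem dg_metric_hyperbolic:
  assumes X: "(d, r) \<in> hyperbolic_structures p"
  shows "dg_metric p (teich_embedding (d, r)) = L2_metric p (conformal_metric 3 d) (fibre_metric d)"
proof -
  note h = hyperbolic_structure_facts[OF X]
  define k where "k = koszul_vinberg lcone"
  define \<rho> where "\<rho> = root 3 (k apex)"
  have ka: "k apex > 0" using koszul_vinberg_apex by (simp add: k_def)
  have k: "k x = k apex * lorentz_pot x" if "x \<in> lcone" for x
    using koszul_vinberg_lcone[OF that] by (simp add: k_def)
  have \<rho>: "\<rho> > 0" using ka by (simp add: \<rho>_def)
  have m: "root 3 (k (affine_point (klein z))) *\<^sub>R affine_point (klein z) = \<rho> *\<^sub>R hyperboloid z" if z: "Im z > 0" for z
  proof -
    define c where "c = 2 * Im z / ((cmod z)\<^sup>2 + 1)"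
    have "(cmod z)\<^sup>2 + 1 > 0" using zero_le_power2[of "cmod z"] by linarith
    then have c: "c > 0" using z by (simp add: c_def)
    have ap: "affine_point (klein z) = c *\<^sub>R hyperboloid z" using z by (simp add: affine_point_klein c_def)
    have cl: "c *\<^sub>R hyperboloid z \<in> lcone" by (rule lcone_scale[OF hyperboloid_lcone[OF z] c])
    have "lq (c *\<^sub>R hyperboloid z) = c\<^sup>2" using z by (simp add: lorentz_bilinear lq_hyperboloid power2_eq_square)
    then have "k (c *\<^sub>R hyperboloid z) = k apex / c ^ 3" using c by (simp add: k[OF cl] lorentz_pot_eq[OF cl])
    then have "root 3 (k (c *\<^sub>R hyperboloid z)) = \<rho> / c" using c by (simp add: real_root_divide \<rho>_def real_root_power_cancel)
    then show ?thesis unfolding ap using c by simp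
  qed
  have cl: "\<rho> *\<^sub>R hyperboloid (d s) \<in> lcone" for s
    by (rule lcone_scale[OF hyperboloid_lcone[OF h(2)] \<rho>])
  have H: "hessian (\<lambda>y. ln (k y)) (\<rho> *\<^sub>R hyperboloid (d s)) = 3 *\<^sub>R cone_metric (\<rho> *\<^sub>R hyperboloid (d s))" for s
    by (rule hessian_ln_potential[OF ka k cl])
  have nz: "Im (d s) \<noteq> 0" for s using h(2)[of s] by simp
  have G: "pullback_metric (hessian (\<lambda>y. ln (k y))) (\<lambda>s. \<rho> *\<^sub>R hyperboloid (d s)) = conformal_metric 3 d"
    using pullback_hyperboloid[OF h(3) nz, where \<rho>=\<rho> and c=3] H \<rho> by (intro ext) simp
  have l: "tensor_product_metric (hessian (\<lambda>y. ln (k y)) (\<rho> *\<^sub>R hyperboloid (d s))) = fibre_metric d s" for s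
  proof -
    have "hessian (\<lambda>y. ln (k y)) (\<rho> *\<^sub>R hyperboloid (d s)) = (3 / \<rho>\<^sup>2) *\<^sub>R cone_metric (hyperboloid (d s))"
      unfolding H cone_metric_scale by simp
    then show ?thesis
      using \<rho> tensor_product_metric_scale[of "3 / \<rho>\<^sup>2" "cone_metric (hyperboloid (d s))"] invertible_cone_metric[OF hyperboloid_lcone[OF h(2)[of s]]]
      by (simp add: fibre_metric_def)
  qed
  show ?thesis
    by (simp add: dg_metric_def teich_embedding_def Let_def h(4)[unfolded comp_def] cone_disc hypersurface_metric_def comp_def m[OF h(2)] k_def[symmetric] G l)
qed

section \<open>Moebius transformations and equivariance of the hyperboloid\<close>

lemma mobius_eq: "mobius A z = (of_real (A$1$1) * z + of_real (A$1$2)) / (of_real (A$2$1) * z + of_real (A$2$2))"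
  by (simp add: mobius_def moebius_def)

text \<open>The factor of automorphy: its inverse square is the derivative of the transformation,
  and all weights below are counted in its powers.\<close>

definition mden :: "real^2^2 \<Rightarrow> complex \<Rightarrow> complex" where
  "mden A z = of_real (A$2$1) * z + of_real (A$2$2)"

lemma mden_nz:
  assumes "A \<in> SL" "Im z > 0" shows "mden A z \<noteq> 0"
proof
  assume 0: "mden A z = 0"
  then have "A$2$1 * Im z = 0" by (simp add: mden_def complex_eq_iff)
  then have "A$2$1 = 0" using assms(2) by simp
  moreover have "A$2$2 = 0" using 0 \<open>A$2$1 = 0\<close> by (simp add: mden_def complex_eq_iff)
  ultimately show False using assms(1) by (simp add: SL_def det_2)
qed

lemma SL_det: "A \<in> SL \<Longrightarrow> A$1$1 * A$2$2 - A$1$2 * A$2$1 = 1" for A :: "real^2^2"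
  by (simp add: SL_def det_2)

lemma Im_mobius:
  assumes "A \<in> SL" "Im z > 0" shows "Im (mobius A z) = Im z / (cmod (mden A z))\<^sup>2"
proof -
  have "Im (mobius A z) = ((A$1$1 * A$2$2 - A$1$2 * A$2$1) * Im z) / (cmod (mden A z))\<^sup>2"
    unfolding mobius_eq mden_def[symmetric] Im_divide cmod_power2
    by (simp add: mden_def algebra_simps)
  then show ?thesis using SL_det[OF assms(1)] by simp
qed

lemma Im_mobius_pos: "A \<in> SL \<Longrightarrow> Im z > 0 \<Longrightarrow> Im (mobius A z) > 0"
  by (simp add: Im_mobius mden_nz)

lemma mobius_diff:
  assumes "A \<in> SL" "mden A z \<noteq> 0" "mden A w \<noteq> 0"
  shows "mobius A z - mobius A w = (z - w) / (mden A z * mden A w)"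
proof -
  have "(of_real (A$1$1) * of_real (A$2$2) - of_real (A$1$2) * of_real (A$2$1) :: complex) = 1"
    using SL_det[OF assms(1)] by (metis of_real_1 of_real_diff of_real_mult)
  moreover have "(of_real (A$1$1) * z + of_real (A$1$2)) * mden A w - (of_real (A$1$1) * w + of_real (A$1$2)) * mden A z
      = (of_real (A$1$1) * of_real (A$2$2) - of_real (A$1$2) * of_real (A$2$1)) * (z - w)"
    unfolding mden_def by (simp add: algebra_simps)
  ultimately have "(of_real (A$1$1) * z + of_real (A$1$2)) * mden A w - (of_real (A$1$1) * w + of_real (A$1$2)) * mden A z = z - w"
    by simp
  then show ?thesis
    using assms(2,3) unfolding mobius_eq mden_def[symmetric] by (simp add: diff_frac_eq)
qed

lemma mobius_derivative:
  assumes "A \<in> SL" "mden A z \<noteq> 0"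
  shows "(mobius A has_field_derivative 1 / (mden A z)\<^sup>2) (at z)"
proof -
  have e: "(of_real (A$1$1) * of_real (A$2$2) - of_real (A$1$2) * of_real (A$2$1) :: complex) = 1"
    using SL_det[OF assms(1)] by (metis of_real_1 of_real_diff of_real_mult)
  have D: "((\<lambda>z. (of_real (A$1$1) * z + of_real (A$1$2)) / (of_real (A$2$1) * z + of_real (A$2$2))) has_field_derivative
     (of_real (A$1$1) * (of_real (A$2$1) * z + of_real (A$2$2)) - (of_real (A$1$1) * z + of_real (A$1$2)) * of_real (A$2$1)) /
       ((of_real (A$2$1) * z + of_real (A$2$2)) * (of_real (A$2$1) * z + of_real (A$2$2)))) (at z)"
    using assms(2) by (intro DERIV_divide) (auto intro!: derivative_eq_intros simp: mden_def)
  have "of_real (A$1$1) * (of_real (A$2$1) * z + of_real (A$2$2)) - (of_real (A$1$1) * z + of_real (A$1$2)) * of_real (A$2$1) = 1"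
    using e by (simp add: algebra_simps)
  with D show ?thesis unfolding mobius_eq[abs_def] by (simp add: mden_def power2_eq_square)
qed

lemma deriv_mobius: "A \<in> SL \<Longrightarrow> Im z > 0 \<Longrightarrow> deriv (mobius A) z = 1 / (mden A z)\<^sup>2"
  using mobius_derivative mden_nz DERIV_imp_deriv by blast

lemma matrix_inv_SL2: "A \<in> SL \<Longrightarrow> matrix_inv A = vector [vector [A$2$2, - A$1$2], vector [- A$2$1, A$1$1]]"
  for A :: "real^2^2"
  by (rule matrix_inv_eqI) (use SL_det[of A] in \<open>simp add: matrix_matrix_mult_def vec_eq_iff forall_2 sum_2 mat_def algebra_simps\<close>)

text \<open>Equivariance of the Klein model gives equality up to a factor k. Both sides have Lorentz
  form 1, so k^2 = 1, and both lie in the forward cone, so k = 1.\<close>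

lemma hyperboloid_mobius:
  assumes A: "A \<in> SL" and z: "Im z > 0"
  shows "hyperboloid (mobius A z) = Phi A *v hyperboloid z"
proof -
  let ?w = "mobius A z"
  have w: "Im ?w > 0" by (rule Im_mobius_pos[OF A z])
  obtain c where c: "c \<noteq> 0" "Phi A *v affine_point (klein z) = c *\<^sub>R affine_point (klein ?w)"
    using klein_mobius[OF A z] by (auto simp: proj_maps_def)
  define a where "a u = 2 * Im u / ((cmod u)\<^sup>2 + 1)" for u
  have ap: "a u > 0" if "Im u > 0" for u
  proof -
    have "(cmod u)\<^sup>2 + 1 > 0" using zero_le_power2[of "cmod u"] by linarith
    then show ?thesis using that by (simp add: a_def)
  qed
  have "a z *\<^sub>R (Phi A *v hyperboloid z) = (c * a ?w) *\<^sub>R hyperboloid ?w"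
    using c(2) z w by (simp add: affine_point_klein a_def matrix_vector_mult_scaleR)
  then have "(1 / a z) *\<^sub>R (a z *\<^sub>R (Phi A *v hyperboloid z)) = (1 / a z) *\<^sub>R ((c * a ?w) *\<^sub>R hyperboloid ?w)" by simp
  then have e: "Phi A *v hyperboloid z = (c * a ?w / a z) *\<^sub>R hyperboloid ?w"
    using ap[OF z] by simp
  define k where "k = c * a ?w / a z"
  have d1: "det A = 1" using A by (simp add: SL_def)
  have "lq (Phi A *v hyperboloid z) = 1" using z by (simp add: lq_Phi d1 lq_hyperboloid)
  then have "k\<^sup>2 = 1" using w unfolding e k_def[symmetric] by (simp add: lorentz_bilinear lq_hyperboloid power2_eq_square)
  moreover have "Phi A *v hyperboloid z \<in> lcone" by (rule Phi_lcone[OF d1 hyperboloid_lcone[OF z]])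
  then have "k * hyperboloid ?w $ 3 > 0" unfolding e k_def[symmetric] by (simp add: lcone_def)
  moreover have "hyperboloid ?w $ 3 > 0" using hyperboloid_lcone[OF w] by (simp add: lcone_def)
  ultimately have "k = 1" by (auto simp: power2_eq_1_iff zero_less_mult_iff)
  then show ?thesis using e unfolding k_def[symmetric] by simp
qed

section \<open>The differential of the representation and the nilpotent matrices\<close>

lemma dPhi_eq:
  "dPhi X = vector [vector [X$1$1 + X$2$2, X$1$2 - X$2$1, X$1$1 - X$2$2],
     vector [X$2$1 - X$1$2, X$1$1 + X$2$2, X$2$1 + X$1$2],
     vector [X$1$1 - X$2$2, X$1$2 + X$2$1, X$1$1 + X$2$2]]" (is "_ = ?D X")
proof -
  have P: "Phi A = (\<chi> i j. coords_of (A ** sym_of (axis j 1) ** transpose A) $ i)" for A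
    by (simp add: vec_eq_iff Phi_mult_vec[symmetric] matrix_vector_mult_basis column_def)
  have "(Phi has_derivative ?D) (at (mat 1))"
  proof -
    have c: "((\<lambda>A. A $ i $ j) has_derivative (\<lambda>X. X $ i $ j)) (at (mat 1 :: real^2^2))" for i j
      by (intro bounded_linear_imp_has_derivative bounded_linear_compose[OF bounded_linear_vec_nth bounded_linear_vec_nth])
    have "((\<lambda>A. Phi A $ i $ j) has_derivative (\<lambda>X. ?D X $ i $ j)) (at (mat 1))" for i j
    proof -
      have "\<forall>i j. ((\<lambda>A. Phi A $ i $ j) has_derivative (\<lambda>X. ?D X $ i $ j)) (at (mat 1))"
        unfolding forall_3 P
        by (simp add: coords_of_def sym_of_def matrix_matrix_mult_def transpose_def sum_2 axis_def)
          (intro conjI; (rule derivative_eq_intros c refl)+; simp add: mat_def fun_eq_iff)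
      then show ?thesis by blast
    qed
    then show ?thesis
      by (subst has_derivative_componentwise_within) (auto simp: Basis_vec_def inner_axis)
  qed
  then show ?thesis unfolding dPhi_def by (simp only: frechet_eq)
qed

lemma linear_dPhi: "linear dPhi"
  by (rule linearI) (simp_all add: dPhi_eq vec_eq_iff forall_3 algebra_simps)

lemma dPhi_mult_vec: "dPhi X *v x = coords_of (X ** sym_of x + sym_of x ** transpose X)"
  unfolding dPhi_eq vec_eq_iff forall_3
  by (simp add: coords_of_def sym_of_def matrix_matrix_mult_def matrix_vector_mult_def transpose_def sum_2 sum_3 field_simps)

lemma dPhi_sl: "X \<in> sl \<Longrightarrow> dPhi X \<in> sl"
  by (simp add: sl_def trace_def sum_2 sum_3 dPhi_eq)

lemma matrix_add_rdistrib: "(A + B) ** C = A ** C + B ** C"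
  for A B :: "real^'n^'m" and C :: "real^'k^'n"
  by (simp add: matrix_matrix_mult_def vec_eq_iff sum.distrib algebra_simps)

text \<open>Tested on symmetric matrices, on which \<open>Phi A\<close> acts by S to A S A^T and
  \<open>dPhi X\<close> by S to X S + S X^T.\<close>

lemma dPhi_Ad:
  assumes "A \<in> SL" shows "dPhi (Ad A X) = Ad (Phi A) (dPhi X)"
proof -
  have d: "det A = 1" using assms by (simp add: SL_def)
  have i: "invertible A" using d by (simp add: invertible_det_nz)
  have iP: "invertible (Phi A)" using d by (simp add: invertible_det_nz det_Phi)
  have "dPhi (Ad A X) ** Phi A = Phi A ** dPhi X"
  proof (rule matrix_eq[THEN iffD2], rule allI)
    fix y
    let ?S = "sym_of y"
    have s1: "transpose (A ** ?S ** transpose A) = A ** ?S ** transpose A"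
      by (simp add: matrix_transpose_mul transpose_sym_of matrix_mul_assoc)
    have s2: "transpose (X ** ?S + ?S ** transpose X) = X ** ?S + ?S ** transpose X"
      by (simp add: vec_eq_iff transpose_def forall_2 matrix_matrix_mult_def sum_2 sym_of_def algebra_simps)
    have a: "matrix_inv A ** (A ** B) = B" for B :: "real^2^2" by (simp add: matrix_mul_assoc matrix_inv_left[OF i])
    have t: "transpose A ** (transpose (matrix_inv A) ** B) = B" for B :: "real^2^2"
      by (simp add: matrix_mul_assoc matrix_transpose_mul[symmetric] matrix_inv_left[OF i] transpose_mat)
    have "(dPhi (Ad A X) ** Phi A) *v y = dPhi (Ad A X) *v coords_of (A ** ?S ** transpose A)"
      by (simp add: matrix_vector_mul_assoc[symmetric] Phi_mult_vec)
    also have "\<dots> = coords_of (Ad A X ** (A ** ?S ** transpose A) + (A ** ?S ** transpose A) ** transpose (Ad A X))"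
      by (simp add: dPhi_mult_vec sym_of_coords_of[OF s1])
    also have "Ad A X ** (A ** ?S ** transpose A) + (A ** ?S ** transpose A) ** transpose (Ad A X) = A ** (X ** ?S + ?S ** transpose X) ** transpose A"
      by (simp add: Ad_def matrix_transpose_mul matrix_mul_assoc[symmetric] a t matrix_add_ldistrib matrix_add_rdistrib)
    also have "coords_of (A ** (X ** ?S + ?S ** transpose X) ** transpose A) = (Phi A ** dPhi X) *v y"
      by (simp add: matrix_vector_mul_assoc[symmetric] dPhi_mult_vec Phi_mult_vec sym_of_coords_of[OF s2])
    finally show "(dPhi (Ad A X) ** Phi A) *v y = (Phi A ** dPhi X) *v y" .
  qed
  then have "dPhi (Ad A X) ** (Phi A ** matrix_inv (Phi A)) = Phi A ** dPhi X ** matrix_inv (Phi A)"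
    by (simp add: matrix_mul_assoc)
  then show ?thesis by (simp add: matrix_inv_right[OF iP] Ad_def)
qed

text \<open>The real part of \<open>c\<close> times the nilpotent matrix whose Killing field is \<open>w \<mapsto> (w - z)\<^sup>2\<close>.\<close>
definition nilp :: "complex \<Rightarrow> complex \<Rightarrow> real^2^2" where
  "nilp z c = vector [vector [- Re (c * z), Re (c * z\<^sup>2)], vector [- Re c, Re (c * z)]]"

lemma linear_nilp: "linear (nilp z)"
  by (rule linearI) (simp_all add: nilp_def vec_eq_iff forall_2 algebra_simps)

lemma nilp_sl: "nilp z c \<in> sl"
  by (simp add: nilp_def sl_def trace_def sum_2)

text \<open>Pushing the field (w - z)^2 forward moves its double zero to \<open>mobius A z\<close>
  and multiplies it by the inverse of the derivative of A at z.\<close>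

lemma nilp_Ad:
  assumes "A \<in> SL" "Im z > 0"
  shows "Ad A (nilp z c) = nilp (mobius A z) (c * (mden A z)\<^sup>2)"
proof -
  define n where "n = of_real (A$1$1) * z + of_real (A$1$2)"
  define q where "q = mden A z"
  have q: "q \<noteq> 0" using mden_nz[OF assms] by (simp add: q_def)
  have w: "mobius A z = n / q" by (simp add: mobius_eq n_def q_def mden_def)
  have e: "c * q\<^sup>2 * (n / q) = c * (q * n)" "c * q\<^sup>2 * (n / q)\<^sup>2 = c * n\<^sup>2"
    using q by (simp_all add: power2_eq_square)
  show ?thesis
    unfolding w q_def[symmetric] nilp_def[of "n / q"] e Ad_def matrix_inv_SL2[OF assms(1)]
    by (simp add: nilp_def matrix_matrix_mult_def vec_eq_iff forall_2 sum_2 n_def q_def mden_def power2_eq_square algebra_simps)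
qed

text \<open>Half the sum of c (w - z)^2 and its conjugate field cnj c (w - cnj z)^2, evaluated at w
  = z: the first vanishes, the second is (2 i Im z)^2 cnj c. This is the origin of the factor -2 (Im
  z)^2 in the Beltrami coefficients.\<close>

lemma killing_field_nilp: "killing_field (nilp z c) z = - 2 * (Im z)\<^sup>2 *\<^sub>R cnj c"
  by (simp add: killing_field_def nilp_def complex_eq_iff power2_eq_square algebra_simps)

section \<open>The fibre metric on traceless matrices\<close>

lemma matrix_inner_mult_left: "A \<bullet> (X ** B) = (transpose X ** A) \<bullet> B"
  for A B X :: "real^'n^'n"
proof -
  have "A \<bullet> (X ** B) = (\<Sum>i\<in>UNIV. \<Sum>j\<in>UNIV. \<Sum>k\<in>UNIV. A$i$j * (X$i$k * B$k$j))"
    by (simp add: inner_vec_def matrix_matrix_mult_def sum_distrib_left)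
  also have "\<dots> = (\<Sum>k\<in>UNIV. \<Sum>j\<in>UNIV. \<Sum>i\<in>UNIV. A$i$j * (X$i$k * B$k$j))"
    by (subst sum.swap, subst (2) sum.swap, subst sum.swap) (rule refl)
  also have "\<dots> = (transpose X ** A) \<bullet> B"
    by (simp add: inner_vec_def matrix_matrix_mult_def transpose_def sum_distrib_right sum_distrib_left mult_ac)
  finally show ?thesis .
qed

lemma matrix_inner_transpose: "transpose A \<bullet> transpose B = A \<bullet> B"
  for A B :: "real^'n^'n"
  unfolding inner_vec_def transpose_def by simp (rule sum.swap)

lemma matrix_inner_mult_right: "A \<bullet> (B ** X) = (A ** transpose X) \<bullet> B"
  for A B X :: "real^'n^'n"
  using matrix_inner_mult_left[of "transpose A" "transpose X" "transpose B"]
  by (simp add: matrix_transpose_mul[symmetric] matrix_inner_transpose) (metis matrix_inner_transpose matrix_transpose_mul transpose_transpose)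

lemma transpose_matrix_inv: "invertible A \<Longrightarrow> transpose (matrix_inv A) = matrix_inv (transpose A)"
  for A :: "real^'n^'n"
  by (rule matrix_inv_eqI[symmetric]) (simp only: matrix_transpose_mul[symmetric] matrix_inv_left transpose_mat)

lemma tensor_product_metric_eq:
  assumes "transpose H = H" "invertible H"
  shows "tensor_product_metric H A B = A \<bullet> (H ** B ** matrix_inv H)"
proof -
  have s: "matrix_inv H $ j $ l = matrix_inv H $ l $ j" for j l
  proof -
    have "transpose (matrix_inv H) = matrix_inv H" using transpose_matrix_inv[OF assms(2)] assms(1) by simp
    from arg_cong[OF this, of "\<lambda>M. M $ l $ j"] show ?thesis by (simp add: transpose_def)
  qed
  have "A \<bullet> (H ** B ** matrix_inv H) = (\<Sum>i\<in>UNIV. \<Sum>j\<in>UNIV. \<Sum>l\<in>UNIV. \<Sum>k\<in>UNIV. A$i$j * B$k$l * H$i$k * matrix_inv H $ j $ l)"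
    by (simp add: inner_vec_def matrix_matrix_mult_def sum_distrib_left sum_distrib_right s mult_ac)
  also have "\<dots> = tensor_product_metric H A B"
    unfolding tensor_product_metric_def by (intro sum.cong refl sum.swap)
  finally show ?thesis by simp
qed

abbreviation light_fibre :: "real^3 \<Rightarrow> real^3^3 \<Rightarrow> real^3^3 \<Rightarrow> real" where
  "light_fibre x \<equiv> tensor_product_metric (cone_metric x)"

lemma light_fibre_eq: "x \<in> lcone \<Longrightarrow> light_fibre x A B = A \<bullet> (cone_metric x ** B ** matrix_inv (cone_metric x))"
  by (intro tensor_product_metric_eq cone_metric_symmetric invertible_cone_metric)

lemma light_fibre_Ad:
  assumes x: "x \<in> lcone" and M: "det M = 1" "\<And>u v. lorentz (M *v u) (M *v v) = lorentz u v" "M *v x \<in> lcone"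
  shows "light_fibre (M *v x) (Ad M A) (Ad M B) = light_fibre x A B"
proof -
  have iM: "invertible M" using M(1) by (simp add: invertible_det_nz)
  let ?H = "cone_metric x" and ?K = "cone_metric (M *v x)" and ?N = "matrix_inv M"
  have iK: "invertible ?K" by (rule invertible_cone_metric[OF M(3)])
  have K: "transpose M ** ?K ** M = ?H" by (rule cone_metric_pullback[where c=1]) (auto simp: M(2))
  have "matrix_inv ?H = ?N ** matrix_inv ?K ** transpose ?N"
  proof (rule matrix_inv_eqI)
    have "?H ** (?N ** matrix_inv ?K ** transpose ?N) = transpose M ** (?K ** ((M ** ?N) ** (matrix_inv ?K ** transpose ?N)))"
      unfolding K[symmetric] by (simp only: matrix_mul_assoc)
    also have "\<dots> = transpose M ** ((?K ** matrix_inv ?K) ** transpose ?N)"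
      by (simp add: matrix_inv_right[OF iM] matrix_mul_assoc)
    also have "\<dots> = mat 1" by (simp add: matrix_inv_right[OF iK] matrix_transpose_mul[symmetric] matrix_inv_left[OF iM] transpose_mat)
    finally show "?H ** (?N ** matrix_inv ?K ** transpose ?N) = mat 1" .
  qed
  note Hi = this
  have "light_fibre (M *v x) (Ad M A) (Ad M B) = (M ** (A ** ?N)) \<bullet> (?K ** (M ** B ** ?N) ** matrix_inv ?K)"
    by (simp add: light_fibre_eq[OF M(3)] Ad_def matrix_mul_assoc)
  also have "\<dots> = (A ** ?N) \<bullet> (transpose M ** (?K ** (M ** B ** ?N) ** matrix_inv ?K))"
    by (simp add: matrix_inner_mult_left)
  also have "\<dots> = A \<bullet> ((transpose M ** (?K ** (M ** B ** ?N) ** matrix_inv ?K)) ** transpose ?N)"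
    by (simp add: matrix_inner_mult_right)
  also have "(transpose M ** (?K ** (M ** B ** ?N) ** matrix_inv ?K)) ** transpose ?N = (transpose M ** ?K ** M) ** B ** (?N ** matrix_inv ?K ** transpose ?N)"
    by (simp only: matrix_mul_assoc)
  also have "\<dots> = ?H ** B ** matrix_inv ?H" by (simp only: K Hi)
  finally show ?thesis by (simp add: light_fibre_eq[OF x])
qed

lemma matrix_inv_mat_1: "matrix_inv (mat 1 :: real^'n^'n) = mat 1"
  by (rule matrix_inv_eqI) simp

lemma light_fibre_apex: "light_fibre apex A B = A \<bullet> B"
  using light_fibre_eq[OF apex_in, of A B] by (simp add: cone_metric_apex matrix_inv_mat_1)

text \<open>An automorphism carries x to \<open>apex\<close>, where the fibre metric is the
  Euclidean inner product of matrices. Symmetry and definiteness are read off there.\<close>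

lemma light_fibre_frame:
  assumes "x \<in> lcone" "lq x = 1"
  obtains T where "invertible T" "\<And>A B. light_fibre x A B = Ad T A \<bullet> Ad T B"
proof -
  obtain A where A: "det A = 1" "x = Phi A *v apex" using lcone_transitive[OF assms(1)] assms(2) by auto
  let ?M = "Phi A" and ?T = "matrix_inv (Phi A)"
  have d: "det ?M = 1" by (simp add: det_Phi A(1))
  have iM: "invertible ?M" by (simp add: invertible_det_nz d)
  have iT: "invertible ?T" using matrix_inv_left[OF iM] matrix_inv_right[OF iM] unfolding invertible_def by blast
  have TT: "matrix_inv ?T = ?M" by (rule matrix_inv_eqI) (rule matrix_inv_left[OF iM])
  have AA: "Ad ?M (Ad ?T X) = X" for X
  proof -
    have "Ad ?M (Ad ?T X) = (?M ** ?T) ** X ** (?M ** ?T)" unfolding Ad_def TT by (simp only: matrix_mul_assoc)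
    then show ?thesis by (simp add: matrix_inv_right[OF iM])
  qed
  have "light_fibre x X Y = Ad ?T X \<bullet> Ad ?T Y" for X Y
    using light_fibre_Ad[OF apex_in d, of "Ad ?T X" "Ad ?T Y"] A assms(1) by (simp add: lq_Phi AA light_fibre_apex)
  then show ?thesis using that[OF iT] by blast
qed

lemma light_fibre_pos:
  assumes "x \<in> lcone" "lq x = 1"
  shows "light_fibre x A A \<ge> 0" "light_fibre x A A = 0 \<longleftrightarrow> A = 0" "light_fibre x A B = light_fibre x B A"
proof -
  obtain T where T: "invertible T" "\<And>A B. light_fibre x A B = Ad T A \<bullet> Ad T B" using light_fibre_frame[OF assms] by blast
  show "light_fibre x A A \<ge> 0" "light_fibre x A B = light_fibre x B A" by (simp_all add: T(2) inner_commute)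
  have "A = 0" if "Ad T A = 0"
  proof -
    have "A = (matrix_inv T ** T) ** A ** (matrix_inv T ** T)" by (simp add: matrix_inv_left[OF T(1)])
    also have "\<dots> = matrix_inv T ** Ad T A ** T" unfolding Ad_def by (simp only: matrix_mul_assoc)
    finally show ?thesis using that by (simp add: matrix_matrix_mult_def vec_eq_iff)
  qed
  then show "light_fibre x A A = 0 \<longleftrightarrow> A = 0"
    by (auto simp: T(2) Ad_def matrix_matrix_mult_def vec_eq_iff)
qed

lemma light_fibre_linear: "linear (light_fibre x A)" "linear (\<lambda>A. light_fibre x A B)"
  by (rule linearI; simp add: tensor_product_metric_def sum.distrib sum_distrib_left algebra_simps)+

text \<open>With F the image of the nilpotent matrix and H the metric at the hyperboloid point over
  z, H F = F^T H. The metric therefore disappears from the pairing with a constant matrix B, and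
  this makes the explicit forms harmonic.\<close>

lemma light_fibre_nilp:
  assumes z: "Im z > 0"
  shows "light_fibre (hyperboloid z) B (dPhi (nilp z c)) = B \<bullet> transpose (dPhi (nilp z c))"
proof -
  let ?H = "cone_metric (hyperboloid z)" and ?F = "dPhi (nilp z c)"
  have h: "hyperboloid z \<in> lcone" by (rule hyperboloid_lcone[OF z])
  define x y where "x = Re z" and "y = Im z"
  have y: "y > 0" using z by (simp add: y_def)
  define m where "m = hyperboloid z"
  have m: "m$1 = (x\<^sup>2 + y\<^sup>2 - 1) / (2 * y)" "m$2 = x / y" "m$3 = (x\<^sup>2 + y\<^sup>2 + 1) / (2 * y)"
    by (simp_all add: m_def hyperboloid_def cmod_power2 x_def y_def)
  have q: "lq m = 1" using z by (simp add: m_def lq_hyperboloid)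
  have "?H ** ?F = transpose ?F ** ?H"
    unfolding m_def[symmetric]
    by (simp add: vec_eq_iff forall_3 matrix_matrix_mult_def sum_3 transpose_def cone_metric_def q lorentz_axis dPhi_eq nilp_def)
       (simp add: m axis_def x_def[symmetric] y_def[symmetric] power2_eq_square, use y in \<open>simp add: field_simps\<close>)
  then have "?H ** ?F ** matrix_inv ?H = transpose ?F ** (?H ** matrix_inv ?H)" by (simp add: matrix_mul_assoc)
  then show ?thesis by (simp add: light_fibre_eq[OF h] matrix_inv_right[OF invertible_cone_metric[OF h]])
qed

text \<open>Along \<open>dPhi\<close> the trace form of 3 by 3 matrices restricts to 4 times that of
  2 by 2 matrices, and the trace of A against the complex nilpotent matrix at z is minus the Killing
  field of A at z.\<close>

lemma dPhi_nilp_pairing: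
  assumes "A \<in> sl" shows "dPhi A \<bullet> transpose (dPhi (nilp z c)) = - 4 * Re (c * killing_field A z)"
proof -
  have "A$2$2 = - A$1$1" using assms by (simp add: sl_def trace_def sum_2)
  then show ?thesis
    by (simp add: inner_vec_def sum_3 transpose_def dPhi_eq nilp_def killing_field_def power2_eq_square algebra_simps)
qed

lemma killing_field_Ad:
  assumes "A \<in> SL" "Im z > 0"
  shows "killing_field (Ad A X) (mobius A z) = killing_field X z / (mden A z)\<^sup>2"
proof -
  define n where "n = of_real (A$1$1) * z + of_real (A$1$2)"
  define q where "q = mden A z"
  have q: "q \<noteq> 0" using mden_nz[OF assms] by (simp add: q_def)
  have w: "mobius A z = n / q" by (simp add: mobius_eq n_def q_def mden_def)
  have e: "(of_real (A$1$1) * of_real (A$2$2) - of_real (A$1$2) * of_real (A$2$1) :: complex) = 1"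
    using SL_det[OF assms(1)] by (metis of_real_1 of_real_diff of_real_mult)
  have k: "killing_field Y (n / q) * q\<^sup>2 = of_real (Y$1$2) * q\<^sup>2 + of_real (Y$1$1 - Y$2$2) * (n * q) - of_real (Y$2$1) * n\<^sup>2" for Y
    using q by (simp add: killing_field_def field_simps power2_eq_square)
  have "killing_field (Ad A X) (n / q) * q\<^sup>2 = killing_field X z * (of_real (A$1$1) * of_real (A$2$2) - of_real (A$1$2) * of_real (A$2$1))\<^sup>2"
    unfolding k Ad_def matrix_inv_SL2[OF assms(1)]
    by (simp add: matrix_matrix_mult_def sum_2 n_def q_def mden_def killing_field_def power2_eq_square algebra_simps)
  then show ?thesis using q unfolding w e q_def[symmetric] by (simp add: field_simps)
qed

section \<open>Hodge theory on a hyperbolic surface\<close>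

text \<open>At unit Lorentzian length the matrix H of the metric preserves the Lorentz form J, so
  its inverse is J H J. The inverse is thus as visibly smooth as H.\<close>

lemma cone_metric_matrix_inv:
  assumes "x \<in> lcone" "lq x = 1"
  shows "matrix_inv (cone_metric x) = (\<chi> i j. lorentz (axis i 1) (axis i 1) * lorentz (axis j 1) (axis j 1) * cone_metric x $ i $ j)"
proof (rule matrix_inv_eqI)
  define a b c where "a = x$1" and "b = x$2" and "c = x$3"
  have q: "c * c = 1 + a * a + b * b" using assms(2) by (simp add: lorentz_def a_def b_def c_def)
  have qq: "c * (c * y) = y + a * (a * y) + b * (b * y)" for y using q by (simp add: mult.assoc[symmetric] distrib_right)
  show "cone_metric x ** (\<chi> i j. lorentz (axis i 1) (axis i 1) * lorentz (axis j 1) (axis j 1) * cone_metric x $ i $ j) = mat 1"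
    by (simp add: vec_eq_iff forall_3 matrix_matrix_mult_def sum_3 cone_metric_def assms(2) lorentz_axis)
      (simp add: mat_def axis_def a_def[symmetric] b_def[symmetric] c_def[symmetric] algebra_simps q qq)
qed

lemma smooth_inner: "open U \<Longrightarrow> smooth_on U f \<Longrightarrow> smooth_on U g \<Longrightarrow> smooth_on U (\<lambda>x. f x \<bullet> g x)"
  by (rule smooth_bilinear[OF bounded_bilinear_inner])

lemma smooth_matrix_mult:
  fixes f :: "'a::euclidean_space \<Rightarrow> real^'n^'m" and g :: "'a \<Rightarrow> real^'k^'n"
  assumes "open U" "smooth_on U f" "smooth_on U g"
  shows "smooth_on U (\<lambda>x. f x ** g x)"
  by (rule smooth_matrix[OF assms(1)], simp add: matrix_matrix_mult_def, intro smooth_sum smooth_mult smooth_nth assms)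

abbreviation unit_matrix :: "3 \<Rightarrow> 3 \<Rightarrow> real^3^3" where
  "unit_matrix i j \<equiv> axis i (axis j 1)"

lemma matrix_unit_sum: "B = (\<Sum>i\<in>UNIV. \<Sum>j\<in>UNIV. B$i$j *\<^sub>R unit_matrix i j)" for B :: "real^3^3"
  by (simp add: vec_eq_iff forall_3 sum_3 axis_def)

lemma linear_matrix_sum: "linear f \<Longrightarrow> f B = (\<Sum>i\<in>UNIV. \<Sum>j\<in>UNIV. B$i$j *\<^sub>R f (unit_matrix i j))"
  for f :: "real^3^3 \<Rightarrow> 'b::real_vector"
  by (subst matrix_unit_sum) (simp add: linear_sum linear_scale)

lemma smooth_form_C1: "(\<And>s. linear (\<alpha> s)) \<Longrightarrow> (\<And>v. smooth_on UNIV (\<lambda>s. \<alpha> s v)) \<Longrightarrow> form_C1 \<alpha>"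
  unfolding form_C1_def smooth_on_def by blast

locale hyperbolic_surface = surface S p for S :: "'s::t2_space set" and p +
  fixes d :: "plane \<Rightarrow> complex" and r :: "(plane \<Rightarrow> plane) \<Rightarrow> real^2^2"
  assumes hyp: "(d, r) \<in> hyperbolic_structures p"
begin

abbreviation "e1 \<equiv> axis 1 1 :: plane"
abbreviation "e2 \<equiv> axis 2 1 :: plane"

lemma Im_d: "Im (d s) > 0" by (rule hyperbolic_structure_facts(2)[OF hyp])

lemma d_smooth: "smooth_on UNIV d"
  using hyp by (simp add: hyperbolic_structures_def diffeo_onto_def)

abbreviation D :: "plane \<Rightarrow> plane \<Rightarrow> complex" where "D s \<equiv> \<D> d s"

lemma D_derivative: "(d has_derivative D s) (at s)"
  using smooth_derivative[OF d_smooth] by simp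

lemma linear_D: "linear (D s)" using D_derivative has_derivative_linear by blast

lemma smooth_D: "smooth_on UNIV (\<lambda>s. D s v)" by (rule smooth_fderiv[OF d_smooth])

lemma jac_pos: "jac (D s) > 0"
  using hyp by (simp add: hyperbolic_structures_def jac_def)

lemma r_SL: "\<gamma> \<in> deck p \<Longrightarrow> r \<gamma> \<in> SL" and d_deck: "\<gamma> \<in> deck p \<Longrightarrow> d (\<gamma> s) = mobius (r \<gamma>) (d s)"
  using hyp by (auto simp: hyperbolic_structures_def)

lemma D_eq: "D s v = of_real (v$1) * D s e1 + of_real (v$2) * D s e2"
  using linear_plane[OF linear_D, of s v] by (simp add: scaleR_conv_of_real)

lemma D_deck:
  assumes "\<gamma> \<in> deck p"
  shows "D (\<gamma> s) (\<D> \<gamma> s v) = D s v / (mden (r \<gamma>) (d s))\<^sup>2"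
proof -
  have "((\<lambda>s. d (\<gamma> s)) has_derivative (\<lambda>v. D (\<gamma> s) (\<D> \<gamma> s v))) (at s)"
    by (rule has_derivative_compose[OF deck_derivative[OF assms] D_derivative])
  moreover have "((\<lambda>s. mobius (r \<gamma>) (d s)) has_derivative (\<lambda>v. 1 / (mden (r \<gamma>) (d s))\<^sup>2 * D s v)) (at s)"
    by (rule has_derivative_compose[OF D_derivative mobius_derivative[OF r_SL[OF assms] mden_nz[OF r_SL[OF assms] Im_d], unfolded has_field_derivative_def]])
  ultimately have "(\<lambda>v. D (\<gamma> s) (\<D> \<gamma> s v)) = (\<lambda>v. 1 / (mden (r \<gamma>) (d s))\<^sup>2 * D s v)"
    unfolding d_deck[OF assms] by (rule has_derivative_unique)
  from fun_cong[OF this, of v] show ?thesis by simp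
qed

lemma D_inj: "D s v = D s w \<Longrightarrow> v = w"
proof -
  assume e: "D s v = D s w"
  have "v$2 * jac (D s) = Im (cnj (D s e1) * D s v)" "v$1 * jac (D s) = - Im (cnj (D s e2) * D s v)" for v
    by (simp_all add: D_eq[of s v] jac_def algebra_simps)
  then show "v = w" using e jac_pos[of s] by (simp add: vec_eq_iff forall_2) (metis mult_cancel_right less_irrefl)
qed

text \<open>Multiplication by -i transported to the source by the developing map, in terms of the
  first fundamental form. The star of a one-form is precomposition with it.\<close>

definition rot :: "plane \<Rightarrow> plane \<Rightarrow> plane" where
  "rot s v = vector [((D s e1 \<bullet> D s e2) * v$1 + (D s e2 \<bullet> D s e2) * v$2) / jac (D s),
     - ((D s e1 \<bullet> D s e1) * v$1 + (D s e1 \<bullet> D s e2) * v$2) / jac (D s)]"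

lemma D_rot: "D s (rot s v) = - \<i> * D s v"
proof -
  define a b where "a = D s e1" and "b = D s e2"
  define j where "j = jac (D s)"
  have j: "j \<noteq> 0" "j = Re a * Im b - Im a * Re b" using jac_pos[of s] by (simp_all add: j_def jac_def a_def b_def)
  have "of_real j * D s (rot s v) = of_real (((a \<bullet> b) * v$1 + (b \<bullet> b) * v$2)) * a + of_real (- ((a \<bullet> a) * v$1 + (a \<bullet> b) * v$2)) * b"
  proof -
    have "j * rot s v $ 1 = (a \<bullet> b) * v$1 + (b \<bullet> b) * v$2" "j * rot s v $ 2 = - ((a \<bullet> a) * v$1 + (a \<bullet> b) * v$2)"
      using j(1) by (simp_all add: rot_def a_def[symmetric] b_def[symmetric] j_def[symmetric])
    from this[symmetric] show ?thesis
      by (subst D_eq) (simp add: a_def[symmetric] b_def[symmetric] algebra_simps)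
  qed
  also have "\<dots> = of_real j * (- \<i> * D s v)"
    by (subst D_eq) (simp add: a_def[symmetric] b_def[symmetric] j(2) complex_eq_iff inner_complex_def algebra_simps)
  finally have E: "of_real j * D s (rot s v) = of_real j * (- \<i> * D s v)" .
  have "(of_real j :: complex) \<noteq> 0" using j(1) by simp
  from mult_left_cancel[THEN iffD1, OF this E] show ?thesis .
qed

lemma linear_rot: "linear (rot s)"
proof (rule linearI)
  show "rot s (v + w) = rot s v + rot s w" for v w
    by (simp add: rot_def vec_eq_iff forall_2 add_divide_distrib[symmetric] minus_divide_left[symmetric] algebra_simps)
  show "rot s (c *\<^sub>R v) = c *\<^sub>R rot s v" for c v
    by (simp add: rot_def vec_eq_iff forall_2 add_divide_distrib[symmetric] minus_divide_left[symmetric] algebra_simps)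
qed

lemma rot_deck:
  assumes "\<gamma> \<in> deck p"
  shows "rot (\<gamma> s) (\<D> \<gamma> s v) = \<D> \<gamma> s (rot s v)"
  by (rule D_inj[of "\<gamma> s"]) (simp only: D_rot D_deck[OF assms] times_divide_eq_right)

lemma smooth_jac: "smooth_on UNIV (\<lambda>s. jac (D s))"
proof -
  have "smooth_on UNIV (\<lambda>s. Re (D s e1) * Im (D s e2) - Im (D s e1) * Re (D s e2))"
    by (intro smooth_minus smooth_mult smooth_linear_compose[OF _ _ smooth_D] bounded_linear_Re bounded_linear_Im open_UNIV)
  then show ?thesis by (simp add: jac_def)
qed

lemma smooth_rot: "smooth_on UNIV (\<lambda>s. rot s v)"
proof (rule smooth_vec[OF open_UNIV])
  fix i :: 2
  have "smooth_on UNIV (\<lambda>s. ((D s e1 \<bullet> D s e2) * v$1 + (D s e2 \<bullet> D s e2) * v$2) / jac (D s))"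
    "smooth_on UNIV (\<lambda>s. - ((D s e1 \<bullet> D s e1) * v$1 + (D s e1 \<bullet> D s e2) * v$2) / jac (D s))"
    using jac_pos by (intro smooth_divide smooth_uminus smooth_add smooth_mult smooth_inner smooth_D smooth_const smooth_jac open_UNIV; simp add: less_imp_neq[symmetric])+
  then have "\<forall>i. smooth_on UNIV (\<lambda>s. rot s v $ i)" unfolding forall_2 rot_def by simp
  then show "smooth_on UNIV (\<lambda>s. rot s v $ i)" by blast
qed

abbreviation G :: "real \<Rightarrow> plane \<Rightarrow> real^2^2" where "G c \<equiv> conformal_metric c d"

definition vol :: "real \<Rightarrow> plane \<Rightarrow> real" where
  "vol c s = c * jac (D s) / (Im (d s))\<^sup>2"

lemma vol_pos: "c > 0 \<Longrightarrow> vol c s > 0"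
  using jac_pos[of s] Im_d[of s] by (simp add: vol_def)

lemma det_G: "det (G c s) = (vol c s)\<^sup>2"
proof -
  have "(D s e1 \<bullet> D s e1) * (D s e2 \<bullet> D s e2) - (D s e1 \<bullet> D s e2) * (D s e1 \<bullet> D s e2) = (jac (D s))\<^sup>2"
    by (simp add: jac_def inner_complex_def power2_eq_square algebra_simps)
  then have "det (G c s) = c\<^sup>2 * (jac (D s))\<^sup>2 / ((Im (d s))\<^sup>2)\<^sup>2"
    using Im_d[of s] by (simp add: det_2 conformal_metric_def inner_commute[of "D s e2" "D s e1"] field_simps power2_eq_square)
  then show ?thesis by (simp add: vol_def power_divide power_mult_distrib)
qed

lemma sqrt_det_G: "c > 0 \<Longrightarrow> sqrt (det (G c s)) = vol c s"
  using vol_pos[of c s] by (simp add: det_G)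

lemma matrix_inv_G:
  assumes c: "c > 0"
  shows "vol c s *\<^sub>R matrix_inv (G c s) = (1 / jac (D s)) *\<^sub>R vector [vector [D s e2 \<bullet> D s e2, - (D s e1 \<bullet> D s e2)], vector [- (D s e1 \<bullet> D s e2), D s e1 \<bullet> D s e1]]"
proof -
  let ?M = "vector [vector [D s e2 \<bullet> D s e2, - (D s e1 \<bullet> D s e2)], vector [- (D s e1 \<bullet> D s e2), D s e1 \<bullet> D s e1]] :: real^2^2"
  define k where "k = (Im (d s))\<^sup>2 / (c * (jac (D s))\<^sup>2)"
  have j: "jac (D s) > 0" "Im (d s) > 0" using jac_pos Im_d by auto
  have E: "(D s e1 \<bullet> D s e1) * (D s e2 \<bullet> D s e2) - (D s e1 \<bullet> D s e2) * (D s e1 \<bullet> D s e2) = (jac (D s))\<^sup>2"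
    by (simp add: jac_def inner_complex_def power2_eq_square algebra_simps)
  have "G c s = (c / (Im (d s))\<^sup>2) *\<^sub>R vector [vector [D s e1 \<bullet> D s e1, D s e1 \<bullet> D s e2], vector [D s e1 \<bullet> D s e2, D s e2 \<bullet> D s e2]]"
    by (simp add: conformal_metric_def vec_eq_iff forall_2 inner_commute)
  moreover have "vector [vector [D s e1 \<bullet> D s e1, D s e1 \<bullet> D s e2], vector [D s e1 \<bullet> D s e2, D s e2 \<bullet> D s e2]] ** ?M = (jac (D s))\<^sup>2 *\<^sub>R mat 1"
    unfolding E[symmetric] by (simp add: matrix_matrix_mult_def vec_eq_iff forall_2 sum_2 mat_def algebra_simps)
  ultimately have "G c s ** (k *\<^sub>R ?M) = mat 1"
    using j c by (simp add: matrix_mult_scaleR k_def)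
  then have mi: "matrix_inv (G c s) = k *\<^sub>R ?M" by (rule matrix_inv_eqI)
  have vk: "vol c s * k = 1 / jac (D s)" using j c by (simp add: vol_def k_def power2_eq_square field_simps)
  show ?thesis unfolding mi scaleR_scaleR vk ..
qed

text \<open>The factor c cancels between the area density and the inverse metric: in dimension two
  the star on one-forms depends on the conformal class only. This removes the difference between the
  DG and Blaschke metrics.\<close>

lemma star1_rot:
  assumes c: "c > 0" and lin: "linear (\<alpha> s)"
  shows "star1 (G c) \<alpha> s v = \<alpha> s (rot s v)"
proof -
  have m: "vol c s * matrix_inv (G c s) $ k $ i = (1 / jac (D s)) * (vector [vector [D s e2 \<bullet> D s e2, - (D s e1 \<bullet> D s e2)], vector [- (D s e1 \<bullet> D s e2), D s e1 \<bullet> D s e1]] :: real^2^2) $ k $ i" for k i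
    using arg_cong[OF matrix_inv_G[OF c, of s], of "\<lambda>M. M $ k $ i"] by simp
  have "star1 (G c) \<alpha> s v = (\<Sum>i\<in>UNIV. \<Sum>k\<in>UNIV. ((vol c s * matrix_inv (G c s) $ k $ i) * area (axis k 1) v) *\<^sub>R \<alpha> s (axis i 1))"
    by (simp add: star1_def sqrt_det_G[OF c] scaleR_sum_right mult_ac)
  also have "\<dots> = ((vol c s * matrix_inv (G c s) $ 1 $ 1) * v$2 - (vol c s * matrix_inv (G c s) $ 2 $ 1) * v$1) *\<^sub>R \<alpha> s e1
      + ((vol c s * matrix_inv (G c s) $ 1 $ 2) * v$2 - (vol c s * matrix_inv (G c s) $ 2 $ 2) * v$1) *\<^sub>R \<alpha> s e2"
    by (simp add: sum_2 area_def axis_def scaleR_diff_left)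
  also have "\<dots> = (rot s v $ 1) *\<^sub>R \<alpha> s e1 + (rot s v $ 2) *\<^sub>R \<alpha> s e2"
  proof -
    have "(vol c s * matrix_inv (G c s) $ 1 $ 1) * v$2 - (vol c s * matrix_inv (G c s) $ 2 $ 1) * v$1 = rot s v $ 1"
      "(vol c s * matrix_inv (G c s) $ 1 $ 2) * v$2 - (vol c s * matrix_inv (G c s) $ 2 $ 2) * v$1 = rot s v $ 2"
      unfolding m rot_def by (simp_all add: add_divide_distrib diff_divide_distrib)
    then show ?thesis by (simp only:)
  qed
  also have "\<dots> = \<alpha> s (rot s v)" by (rule linear_plane[OF lin, symmetric])
  finally show ?thesis .
qed

lemma jac_deck:
  assumes "\<gamma> \<in> deck p"
  shows "jac (D (\<gamma> s)) * det (matrix (\<D> \<gamma> s)) = jac (D s) / (cmod (mden (r \<gamma>) (d s)))^4"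
proof -
  define u where "u = \<D> \<gamma> s e1"
  define w where "w = \<D> \<gamma> s e2"
  define q where "q = (mden (r \<gamma>) (d s))\<^sup>2"
  have "Im (cnj (D (\<gamma> s) u) * D (\<gamma> s) w) = jac (D (\<gamma> s)) * (u$1 * w$2 - u$2 * w$1)"
    by (subst D_eq, subst (2) D_eq) (simp add: jac_def algebra_simps)
  moreover have "u$1 * w$2 - u$2 * w$1 = det (matrix (\<D> \<gamma> s))" by (simp add: det_2 matrix_def u_def w_def)
  moreover have "cnj (D (\<gamma> s) u) * D (\<gamma> s) w = (cnj (D s e1) * D s e2) / of_real ((cmod q)\<^sup>2)"
    unfolding u_def w_def D_deck[OF assms] q_def[symmetric] by (simp add: complex_norm_square[symmetric] mult.commute)
  then have "Im (cnj (D (\<gamma> s) u) * D (\<gamma> s) w) = jac (D s) / (cmod q)\<^sup>2" by (simp add: jac_def)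
  moreover have "(cmod q)\<^sup>2 = (cmod (mden (r \<gamma>) (d s)))^4" by (simp add: q_def norm_power)
  ultimately show ?thesis by simp
qed

lemma vol_deck:
  assumes "\<gamma> \<in> deck p"
  shows "det (matrix (\<D> \<gamma> s)) * vol c (\<gamma> s) = vol c s"
proof -
  have q: "cmod (mden (r \<gamma>) (d s)) > 0" using mden_nz[OF r_SL[OF assms] Im_d] by simp
  have "det (matrix (\<D> \<gamma> s)) * vol c (\<gamma> s) = c * (jac (D (\<gamma> s)) * det (matrix (\<D> \<gamma> s))) / (Im (d (\<gamma> s)))\<^sup>2"
    by (simp add: vol_def)
  also have "\<dots> = vol c s"
    unfolding jac_deck[OF assms] d_deck[OF assms] Im_mobius[OF r_SL[OF assms] Im_d] using q Im_d[of s]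
    by (simp add: vol_def power_divide field_simps power4_eq_xxxx power2_eq_square)
  finally show ?thesis .
qed

abbreviation l :: "plane \<Rightarrow> real^3^3 \<Rightarrow> real^3^3 \<Rightarrow> real" where "l \<equiv> fibre_metric d"

lemma hyperboloid_d: "hyperboloid (d s) \<in> lcone" "lq (hyperboloid (d s)) = 1"
  using hyperboloid_lcone[OF Im_d] lq_hyperboloid[of "d s"] Im_d[of s] by auto

lemma l_pos: "l s A A \<ge> 0" "l s A A = 0 \<longleftrightarrow> A = 0" "l s A B = l s B A"
  unfolding fibre_metric_def using light_fibre_pos[OF hyperboloid_d] by blast+

lemma l_linear: "linear (l s A)" "linear (\<lambda>A. l s A B)"
  unfolding fibre_metric_def by (rule light_fibre_linear)+

lemma l_deck:
  assumes "\<gamma> \<in> deck p"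
  shows "l (\<gamma> s) (Ad (Phi (r \<gamma>)) A) (Ad (Phi (r \<gamma>)) B) = l s A B"
proof -
  have d1: "det (r \<gamma>) = 1" using r_SL[OF assms] by (simp add: SL_def)
  have "hyperboloid (d (\<gamma> s)) = Phi (r \<gamma>) *v hyperboloid (d s)"
    unfolding d_deck[OF assms] by (rule hyperboloid_mobius[OF r_SL[OF assms] Im_d])
  then show ?thesis
    unfolding fibre_metric_def using hyperboloid_d(1)[of "\<gamma> s"] 
    by (simp only:) (intro light_fibre_Ad hyperboloid_d; simp add: det_Phi d1 lq_Phi)
qed

definition H :: "plane \<Rightarrow> real^3^3" where "H s = cone_metric (hyperboloid (d s))"

lemma l_H: "l s A B = A \<bullet> (H s ** B ** matrix_inv (H s))"
  unfolding fibre_metric_def H_def by (rule light_fibre_eq[OF hyperboloid_d(1)])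

lemma invertible_H: "invertible (H s)"
  unfolding H_def by (rule invertible_cone_metric[OF hyperboloid_d(1)])

lemma smooth_hyperboloid: "smooth_on UNIV (\<lambda>s. hyperboloid (d s) $ i)"
proof -
  have RI: "smooth_on UNIV (\<lambda>s. Re (d s))" "smooth_on UNIV (\<lambda>s. Im (d s))"
    by (intro smooth_linear_compose[OF _ _ d_smooth] bounded_linear_Re bounded_linear_Im open_UNIV)+
  have nz: "Im (d s) \<noteq> 0" for s using Im_d[of s] by simp
  have "\<forall>i. smooth_on UNIV (\<lambda>s. hyperboloid (d s) $ i)"
    unfolding forall_3 hyperboloid_def cmod_power2 vector_3
    by (intro conjI smooth_divide smooth_add smooth_minus smooth_mult smooth_power smooth_const RI open_UNIV) (simp_all add: nz)
  then show ?thesis by blast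
qed

lemma smooth_H_entry: "smooth_on UNIV (\<lambda>s. H s $ i $ j)"
proof -
  have e: "H s $ i $ j = 2 * lorentz (hyperboloid (d s)) (axis i 1) * lorentz (hyperboloid (d s)) (axis j 1) - lorentz (axis i 1) (axis j 1)" for s
    using hyperboloid_d(2)[of s] by (simp add: H_def cone_metric_def)
  have L: "smooth_on UNIV (\<lambda>s. lorentz (hyperboloid (d s)) u)" for u
    unfolding lorentz_def by (intro smooth_minus smooth_mult smooth_const smooth_hyperboloid open_UNIV)
  show ?thesis
    unfolding e by (intro smooth_minus smooth_mult smooth_const L open_UNIV)
qed

lemma smooth_H: "smooth_on UNIV H" by (rule smooth_matrix[OF open_UNIV smooth_H_entry])

lemma smooth_Hi: "smooth_on UNIV (\<lambda>s. matrix_inv (H s))"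
proof (rule smooth_matrix[OF open_UNIV])
  fix i j :: 3
  have "matrix_inv (H s) $ i $ j = lorentz (axis i 1) (axis i 1) * lorentz (axis j 1) (axis j 1) * H s $ i $ j" for s
    using cone_metric_matrix_inv[OF hyperboloid_d, of s] by (simp add: H_def)
  then show "smooth_on UNIV (\<lambda>s. matrix_inv (H s) $ i $ j)"
    by (simp only:) (rule smooth_mult[OF open_UNIV smooth_const[OF open_UNIV] smooth_H_entry])
qed

lemma smooth_l: "smooth_on UNIV A \<Longrightarrow> smooth_on UNIV B \<Longrightarrow> smooth_on UNIV (\<lambda>s. l s (A s) (B s))"
  unfolding l_H by (intro smooth_inner smooth_matrix_mult smooth_H smooth_Hi open_UNIV)

text \<open>The component at B of the dual-valued form obtained from \<xi> by applying sharp and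
  then the star.\<close>

definition dual_form :: "(real^3^3) form1 \<Rightarrow> real^3^3 \<Rightarrow> real form1" where
  "dual_form \<xi> B s v = l s B (\<xi> s (rot s v))"

definition smooth_form :: "(real^'n^'n) form1 \<Rightarrow> bool" where
  "smooth_form \<xi> \<longleftrightarrow> (\<forall>s. linear (\<xi> s)) \<and> (\<forall>v. smooth_on UNIV (\<lambda>s. \<xi> s v))"

lemma forms1_smooth: "\<xi> \<in> bundle_forms1 p \<rho> \<Longrightarrow> smooth_form \<xi>"
  by (auto simp: bundle_forms1_def smooth_form_def)

lemma smooth_form_moving: "smooth_form \<xi> \<Longrightarrow> smooth_on UNIV w \<Longrightarrow> smooth_on UNIV (\<lambda>s. \<xi> s (w s))"
  by (rule smooth_linear_apply) (auto simp: smooth_form_def)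

lemma smooth_dual_form: "smooth_form \<xi> \<Longrightarrow> smooth_on UNIV B \<Longrightarrow> smooth_on UNIV (\<lambda>s. dual_form \<xi> (B s) s v)"
  unfolding dual_form_def by (rule smooth_l[OF _ smooth_form_moving[OF _ smooth_rot]])

lemma linear_dual_form:
  assumes "smooth_form \<xi>"
  shows "linear (dual_form \<xi> B s)"
proof -
  have "linear (\<xi> s)" using assms by (simp add: smooth_form_def)
  from linear_compose[OF linear_compose[OF linear_rot this] l_linear(1)] show ?thesis
    by (simp add: comp_def dual_form_def[abs_def])
qed

lemma dual_form_C1: "smooth_form \<xi> \<Longrightarrow> form_C1 (dual_form \<xi> B)"
  using smooth_dual_form[OF _ smooth_const[OF open_UNIV]] linear_dual_form by (intro smooth_form_C1) auto

lemma dual_form_sum: "dual_form \<xi> B s v = (\<Sum>i\<in>UNIV. \<Sum>j\<in>UNIV. B$i$j * dual_form \<xi> (unit_matrix i j) s v)"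
  unfolding dual_form_def by (rule linear_matrix_sum[OF l_linear(2), unfolded real_scaleR_def])

text \<open>The differential of that dual-valued form as a matrix: its component at B is the inner
  product with B. It is the codifferential up to sign, before division by the area density and
  before sharp is undone.\<close>

definition codiff :: "(real^3^3) form1 \<Rightarrow> plane \<Rightarrow> real^3^3" where
  "codiff \<xi> s = (\<chi> i j. d1 (dual_form \<xi> (unit_matrix i j)) s e1 e2)"

lemma smooth_codiff: "smooth_form \<xi> \<Longrightarrow> smooth_on UNIV (codiff \<xi>)"
  by (rule smooth_matrix[OF open_UNIV], simp add: codiff_def d1_def,
      intro smooth_diff smooth_fderiv smooth_dual_form[OF _ smooth_const] open_UNIV)

text \<open>The Leibniz rule when the constant matrix B is replaced by a section f. The terms with
  df form the integrand of the product of df with \<xi>; this is the pointwise form of Green's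
  formula.\<close>

lemma d1_dual_form_section:
  assumes \<xi>: "smooth_form \<xi>" and f: "smooth_on UNIV f"
  shows "d1 (\<lambda>s. dual_form \<xi> (f s) s) s e1 e2 =
    l s (d0 f s e1) (\<xi> s (rot s e2)) - l s (d0 f s e2) (\<xi> s (rot s e1)) + f s \<bullet> codiff \<xi> s"
proof -
  let ?b = "\<lambda>i j. dual_form \<xi> (unit_matrix i j)"
  have Df: "(f has_derivative \<D> f s) (at s)" using smooth_derivative[OF f] by simp
  have Dij: "((\<lambda>s. f s $ i $ j) has_derivative (\<lambda>v. d0 f s v $ i $ j)) (at s)" for i j
    unfolding d0_def by (intro bounded_linear.has_derivative[OF bounded_linear_vec_nth] Df)
  have "((\<lambda>t. dual_form \<xi> (f t) t v) has_derivative
     (\<lambda>w. \<Sum>i\<in>UNIV. \<Sum>j\<in>UNIV. f s $ i $ j * \<D> (\<lambda>t. ?b i j t v) s w + d0 f s w $ i $ j * ?b i j s v)) (at s)" for v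
    by (subst dual_form_sum) (intro has_derivative_sum has_derivative_mult Dij form_C1_derivative dual_form_C1 \<xi>)
  then have F: "\<D> (\<lambda>t. dual_form \<xi> (f t) t v) s w =
     (\<Sum>i\<in>UNIV. \<Sum>j\<in>UNIV. f s $ i $ j * \<D> (\<lambda>t. ?b i j t v) s w + d0 f s w $ i $ j * ?b i j s v)" for v w
    by (rule fun_cong[OF frechet_eq])
  have L: "(\<Sum>i\<in>UNIV. \<Sum>j\<in>UNIV. A $ i $ j * ?b i j s v) = l s A (\<xi> s (rot s v))" for A v
    by (simp only: dual_form_sum[of \<xi> A s v, symmetric]) (simp only: dual_form_def)
  have "f s \<bullet> codiff \<xi> s = (\<Sum>i\<in>UNIV. \<Sum>j\<in>UNIV. f s $ i $ j * (\<D> (\<lambda>t. ?b i j t e2) s e1 - \<D> (\<lambda>t. ?b i j t e1) s e2))"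
    by (simp add: inner_vec_def codiff_def d1_def)
  then show ?thesis
    unfolding d1_def F sum.distrib L by (simp add: \<open>f s \<bullet> codiff \<xi> s = _\<close> right_diff_distrib sum_subtractf)
qed

lemma d1_dual_form: "smooth_form \<xi> \<Longrightarrow> d1 (dual_form \<xi> B) s e1 e2 = B \<bullet> codiff \<xi> s"
  using d1_dual_form_section[of \<xi> "\<lambda>_. B" s, OF _ smooth_const[OF open_UNIV]]
  by (simp add: d0_def frechet_derivative_const linear_0[OF l_linear(2)])

text \<open>A functional on \<open>sl\<close> sees only the traceless part of N, and conjugation by
  H undoes the twist in the fibre metric. The explicit solution settles the definite description and
  shows smooth dependence on the point.\<close>

lemma sharp_inv_eq:
  assumes w: "\<And>B. B \<in> sl \<Longrightarrow> w B = B \<bullet> N"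
  shows "sharp_inv l s w = matrix_inv (H s) ** (N - (trace N / 3) *\<^sub>R mat 1) ** H s" (is "_ = ?A")
    and "sharp_inv l s w \<in> sl" "B \<in> sl \<Longrightarrow> l s B (sharp_inv l s w) = w B"
proof -
  have tr: "trace (X ** Y) = trace (Y ** X)" for X Y :: "real^3^3" by (rule trace_mul_sym)
  have A1: "?A \<in> sl"
  proof -
    have "trace ?A = trace (H s ** (matrix_inv (H s) ** (N - (trace N / 3) *\<^sub>R mat 1)))" by (rule tr)
    also have "\<dots> = trace (N - (trace N / 3) *\<^sub>R mat 1)" by (simp add: matrix_mul_assoc matrix_inv_right[OF invertible_H])
    also have "\<dots> = 0" by (simp add: trace_def sum_3 mat_def field_simps)
    finally show ?thesis by (simp add: sl_def)
  qed
  have A2: "l s B ?A = w B" if B: "B \<in> sl" for B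
  proof -
    have "H s ** ?A ** matrix_inv (H s) = (H s ** matrix_inv (H s)) ** (N - (trace N / 3) *\<^sub>R mat 1) ** (H s ** matrix_inv (H s))"
      by (simp only: matrix_mul_assoc)
    then have "l s B ?A = B \<bullet> (N - (trace N / 3) *\<^sub>R mat 1)" by (simp add: l_H matrix_inv_right[OF invertible_H])
    moreover have "B \<bullet> mat 1 = 0" using B by (simp add: sl_def trace_def inner_vec_def sum_3 mat_def)
    ultimately show ?thesis using w[OF B] by (simp add: inner_diff_right)
  qed
  have U: "A = ?A" if A: "A \<in> sl \<and> (\<forall>B\<in>sl. l s B A = w B)" for A
  proof -
    have "A - ?A \<in> sl" using A A1 by (simp add: sl_def trace_def sum_subtractf)
    then have "l s (A - ?A) A = l s (A - ?A) ?A" using A A2 by simp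
    then have "l s (A - ?A) (A - ?A) = 0" by (simp add: linear_diff[OF l_linear(1)])
    then show ?thesis using l_pos(2) by simp
  qed
  have "sharp_inv l s w = ?A" unfolding sharp_inv_def by (rule the_equality) (use A1 A2 U in blast)+
  then show "sharp_inv l s w = ?A" "sharp_inv l s w \<in> sl" "B \<in> sl \<Longrightarrow> l s B (sharp_inv l s w) = w B"
    using A1 A2 by simp_all
qed

lemma star1_dual_form:
  assumes "c > 0" "smooth_form \<xi>"
  shows "star1 (G c) (\<lambda>t v. l t B (\<xi> t v)) = dual_form \<xi> B"
proof (intro ext)
  fix s v
  have "linear (\<lambda>v. l s B (\<xi> s v))"
    using assms(2) linear_compose[OF _ l_linear(1), of "\<xi> s" s B] by (simp add: comp_def smooth_form_def)
  then show "star1 (G c) (\<lambda>t v. l t B (\<xi> t v)) s v = dual_form \<xi> B s v"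
    unfolding dual_form_def by (rule star1_rot[OF assms(1)])
qed

lemma delta1_eq:
  assumes c: "c > 0" and \<xi>: "smooth_form \<xi>"
  shows "delta1 (G c) l \<xi> s = - sharp_inv l s (\<lambda>B. B \<bullet> ((1 / vol c s) *\<^sub>R codiff \<xi> s))"
  by (simp add: delta1_def star2_def sqrt_det_G[OF c] star1_dual_form[OF c \<xi>] d1_dual_form[OF \<xi>])

lemma delta1_spec:
  assumes c: "c > 0" and \<xi>: "smooth_form \<xi>"
  shows "delta1 (G c) l \<xi> s \<in> sl" "B \<in> sl \<Longrightarrow> vol c s * l s B (delta1 (G c) l \<xi> s) = - (B \<bullet> codiff \<xi> s)"
    "smooth_on UNIV (delta1 (G c) l \<xi>)"
proof -
  note S = sharp_inv_eq[of "\<lambda>B. B \<bullet> ((1 / vol c s) *\<^sub>R codiff \<xi> s)" "(1 / vol c s) *\<^sub>R codiff \<xi> s" for s, OF refl]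
  show "delta1 (G c) l \<xi> s \<in> sl" using S(2) by (simp add: delta1_eq[OF c \<xi>] sl_def trace_def sum_negf)
  show "vol c s * l s B (delta1 (G c) l \<xi> s) = - (B \<bullet> codiff \<xi> s)" if "B \<in> sl"
    using S(3)[OF that, of s] vol_pos[OF c, of s] by (simp add: delta1_eq[OF c \<xi>] linear_neg[OF l_linear(1)])
  have v: "smooth_on UNIV (\<lambda>s. 1 / vol c s)"
    unfolding vol_def using c jac_pos Im_d
    by (intro smooth_divide smooth_mult smooth_const smooth_jac smooth_power smooth_linear_compose[OF _ bounded_linear_Im d_smooth] open_UNIV)
      (simp_all add: less_imp_neq[symmetric])
  have t: "smooth_on UNIV (\<lambda>s. trace ((1 / vol c s) *\<^sub>R codiff \<xi> s))"
    unfolding trace_def by (intro smooth_sum smooth_nth smooth_scaleR v smooth_codiff[OF \<xi>] open_UNIV)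
  show "smooth_on UNIV (delta1 (G c) l \<xi>)"
    unfolding delta1_eq[OF c \<xi>, abs_def] S(1)
    by (intro smooth_uminus smooth_matrix_mult smooth_diff smooth_scaleR smooth_divide t v smooth_codiff[OF \<xi>] smooth_H smooth_Hi smooth_const open_UNIV) simp
qed

end

section \<open>Deck equivariance, Green's formula and uniqueness of harmonic forms\<close>

lemma linear_Ad: "linear (Ad M)"
  by (rule linearI) (simp_all add: Ad_def matrix_add_ldistrib matrix_add_rdistrib matrix_mult_scaleR[of 1, simplified] matrix_mult_scaleR[of _ _ 1, simplified])

lemma Ad_sl: "invertible M \<Longrightarrow> X \<in> sl \<Longrightarrow> Ad M X \<in> sl"
  for M :: "real^'n^'n"
proof -
  assume M: "invertible M" and X: "X \<in> sl"
  have "trace (Ad M X) = trace (matrix_inv M ** (M ** X))" unfolding Ad_def by (rule trace_mul_sym)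
  also have "\<dots> = trace X" by (simp add: matrix_mul_assoc matrix_inv_left[OF M])
  finally show ?thesis using X by (simp add: sl_def)
qed

lemma Ad_surj:
  assumes M: "invertible M" and X: "X \<in> sl"
  obtains Y where "Y \<in> sl" "Ad M Y = X"
proof -
  let ?Y = "matrix_inv M ** X ** M"
  have "trace ?Y = trace (M ** (matrix_inv M ** X))" by (rule trace_mul_sym)
  also have "\<dots> = trace X" by (simp add: matrix_mul_assoc matrix_inv_right[OF M])
  finally have "?Y \<in> sl" using X by (simp add: sl_def)
  moreover have "Ad M ?Y = (M ** matrix_inv M) ** X ** (M ** matrix_inv M)" by (simp add: Ad_def matrix_mul_assoc)
  then have "Ad M ?Y = X" by (simp add: matrix_inv_right[OF M])
  ultimately show ?thesis using that by blast
qed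

lemma sl_minus: "X \<in> sl \<Longrightarrow> Y \<in> sl \<Longrightarrow> X - Y \<in> sl" and sl_plus: "X \<in> sl \<Longrightarrow> Y \<in> sl \<Longrightarrow> X + Y \<in> sl"
  and sl_neg: "X \<in> sl \<Longrightarrow> - X \<in> sl" and sl_0: "0 \<in> sl"
  by (simp_all add: sl_def trace_def sum_subtractf sum.distrib sum_negf)

lemma invertible_Phi: "A \<in> SL \<Longrightarrow> invertible (Phi A)"
  by (simp add: invertible_det_nz det_Phi SL_def)

lemma d0_linear_compose:
  fixes L :: "'b::euclidean_space \<Rightarrow> 'c::euclidean_space"
  assumes "linear L" "smooth_on UNIV f"
  shows "d0 (\<lambda>s. L (f s)) s v = L (d0 f s v)"
  unfolding d0_def
  using frechet_derivative_linear_compose[of L f s v] smooth_derivative[OF assms(2)] linear_conv_bounded_linear[of L] assms(1)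
  by (auto simp: differentiable_def)

context hyperbolic_surface
begin

lemma l_0: "l s A 0 = 0" "l s 0 A = 0"
  using linear_0[OF l_linear(1)] linear_0[OF l_linear(2)] by blast+

lemma d0_deck:
  assumes f: "f \<in> bundle_sections p \<rho>" and g: "\<gamma> \<in> deck p"
  shows "d0 f (\<gamma> s) (\<D> \<gamma> s v) = Ad (\<rho> \<gamma>) (d0 f s v)"
proof -
  have sm: "smooth_on UNIV f" and eq: "\<And>s. f (\<gamma> s) = Ad (\<rho> \<gamma>) (f s)" using f g by (auto simp: bundle_sections_def)
  have D: "(f has_derivative \<D> f s) (at s)" for s using smooth_derivative[OF sm] by simp
  have "((\<lambda>s. f (\<gamma> s)) has_derivative (\<lambda>v. d0 f (\<gamma> s) (\<D> \<gamma> s v))) (at s)"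
    unfolding d0_def by (rule has_derivative_compose[OF deck_derivative[OF g] D])
  moreover have "((\<lambda>s. Ad (\<rho> \<gamma>) (f s)) has_derivative (\<lambda>v. Ad (\<rho> \<gamma>) (d0 f s v))) (at s)"
    unfolding d0_def
    by (rule bounded_linear.has_derivative[OF _ D]) (use linear_Ad in \<open>simp add: linear_conv_bounded_linear[symmetric]\<close>)
  ultimately have "(\<lambda>v. d0 f (\<gamma> s) (\<D> \<gamma> s v)) = (\<lambda>v. Ad (\<rho> \<gamma>) (d0 f s v))"
    unfolding eq by (rule has_derivative_unique)
  then show ?thesis by (rule fun_cong)
qed

lemma linear_d0: "smooth_on UNIV f \<Longrightarrow> linear (d0 f s)"
  unfolding d0_def[abs_def] using smooth_derivative[of UNIV f s] has_derivative_linear by blast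

lemma smooth_d0: "smooth_on UNIV f \<Longrightarrow> smooth_on UNIV (\<lambda>s. d0 f s v)"
  unfolding d0_def by (rule smooth_fderiv)

lemma d0_sl:
  assumes f: "smooth_on UNIV f" "range f \<subseteq> sl" shows "d0 f s v \<in> sl"
proof -
  have tl: "linear (trace :: real^'n^'n \<Rightarrow> real)" by (rule linearI) (simp_all add: trace_def sum.distrib sum_distrib_left)
  have "trace (f s) = 0" for s using f(2) by (auto simp: sl_def)
  then have "d0 (\<lambda>s. trace (f s)) s v = 0" by (simp add: d0_def frechet_derivative_const)
  then show ?thesis using d0_linear_compose[OF tl f(1)] by (simp add: sl_def)
qed

lemma d0_bundle_forms:
  assumes "f \<in> bundle_sections p \<rho>" shows "d0 f \<in> bundle_forms1 p \<rho>"
  unfolding bundle_forms1_def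
  using d0_deck[OF assms] assms linear_d0 smooth_d0 d0_sl by (auto simp: bundle_sections_def)

abbreviation \<rho> :: "(plane \<Rightarrow> plane) \<Rightarrow> real^3^3" where "\<rho> \<equiv> Phi \<circ> r"

lemma dual_form_deck:
  assumes \<xi>: "\<xi> \<in> bundle_forms1 p \<rho>" and g: "\<gamma> \<in> deck p"
  shows "dual_form \<xi> (Ad (\<rho> \<gamma>) B) (\<gamma> s) (\<D> \<gamma> s v) = dual_form \<xi> B s v"
proof -
  have "\<xi> (\<gamma> s) (\<D> \<gamma> s w) = Ad (\<rho> \<gamma>) (\<xi> s w)" for w
    using \<xi> g by (auto simp: bundle_forms1_def)
  then show ?thesis using l_deck[OF g] by (simp add: dual_form_def rot_deck[OF g])
qed

lemma codiff_deck:
  assumes \<xi>: "\<xi> \<in> bundle_forms1 p \<rho>" and g: "\<gamma> \<in> deck p"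
  shows "det (matrix (\<D> \<gamma> s)) * (Ad (\<rho> \<gamma>) B \<bullet> codiff \<xi> (\<gamma> s)) = B \<bullet> codiff \<xi> s"
  using d1_pullback[OF dual_form_C1[OF forms1_smooth[OF \<xi>]] deck_smooth[OF g] dual_form_deck[OF \<xi> g]]
  by (simp add: d1_dual_form[OF forms1_smooth[OF \<xi>]])

text \<open>Both sides have the same fibre product with every traceless matrix, because the area
  density and \<open>codiff\<close> carry the same determinant. The difference of the sides is
  itself traceless and thus orthogonal to itself.\<close>

lemma delta1_deck:
  assumes c: "c > 0" and \<xi>: "\<xi> \<in> bundle_forms1 p \<rho>" and g: "\<gamma> \<in> deck p"
  shows "delta1 (G c) l \<xi> (\<gamma> s) = Ad (\<rho> \<gamma>) (delta1 (G c) l \<xi> s)"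
proof -
  let ?M = "\<rho> \<gamma>" and ?J = "det (matrix (\<D> \<gamma> s))"
  note sp = delta1_spec[OF c forms1_smooth[OF \<xi>]]
  have iM: "invertible ?M" using invertible_Phi[OF r_SL[OF g]] by simp
  have E: "l (\<gamma> s) (Ad ?M B) (delta1 (G c) l \<xi> (\<gamma> s)) = l (\<gamma> s) (Ad ?M B) (Ad ?M (delta1 (G c) l \<xi> s))" if B: "B \<in> sl" for B
  proof -
    have "vol c s * l (\<gamma> s) (Ad ?M B) (delta1 (G c) l \<xi> (\<gamma> s)) = ?J * (vol c (\<gamma> s) * l (\<gamma> s) (Ad ?M B) (delta1 (G c) l \<xi> (\<gamma> s)))"
      by (simp only: vol_deck[OF g, of s c, symmetric] mult.assoc)
    also have "\<dots> = - (B \<bullet> codiff \<xi> s)"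
      unfolding sp(2)[OF Ad_sl[OF iM B]] using codiff_deck[OF \<xi> g, of s B] by simp
    also have "\<dots> = vol c s * l s B (delta1 (G c) l \<xi> s)" unfolding sp(2)[OF B] ..
    also have "\<dots> = vol c s * l (\<gamma> s) (Ad ?M B) (Ad ?M (delta1 (G c) l \<xi> s))" using l_deck[OF g, of s B] by simp
    finally show ?thesis using vol_pos[OF c, of s] by simp
  qed
  define X where "X = delta1 (G c) l \<xi> (\<gamma> s) - Ad ?M (delta1 (G c) l \<xi> s)"
  have "X \<in> sl" unfolding X_def by (intro sl_minus sp(1) Ad_sl[OF iM])
  then obtain Y where Y: "Y \<in> sl" "Ad ?M Y = X" using Ad_surj[OF iM] by blast
  have "l (\<gamma> s) X X = 0" using E[OF Y(1)] unfolding Y(2) by (subst (2) X_def) (simp add: linear_diff[OF l_linear(1)])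
  then show ?thesis using l_pos(2) by (simp add: X_def)
qed

lemma delta1_section:
  assumes c: "c > 0" and \<xi>: "\<xi> \<in> bundle_forms1 p \<rho>"
  shows "delta1 (G c) l \<xi> \<in> bundle_sections p \<rho>"
  using delta1_spec[OF c forms1_smooth[OF \<xi>]] delta1_deck[OF c \<xi>] by (auto simp: bundle_sections_def)

text \<open>The coefficient of the wedge of \<xi> with the star of \<eta>; the factor of the surface
  metric is already gone.\<close>

definition pair_form :: "(real^3^3) form1 \<Rightarrow> (real^3^3) form1 \<Rightarrow> plane \<Rightarrow> real" where
  "pair_form \<xi> \<eta> s = l s (\<xi> s e1) (\<eta> s (rot s e2)) - l s (\<xi> s e2) (\<eta> s (rot s e1))"

lemma form_product_eq:
  assumes "c > 0" "\<eta> \<in> bundle_forms1 p \<rho>"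
  shows "form_product p (G c) l \<xi> \<eta> = (LINT s:FD|lborel. pair_form \<xi> \<eta> s)"
proof -
  have "linear (\<eta> s)" for s using assms(2) by (simp add: bundle_forms1_def)
  then show ?thesis unfolding form_product_def pair_form_def by (simp add: star1_rot[OF assms(1)])
qed

lemma pair_form_density:
  assumes "\<xi> \<in> bundle_forms1 p \<rho>" "\<eta> \<in> bundle_forms1 p \<rho>"
  shows "invariant_density (pair_form \<xi> \<eta>)"
proof -
  have lin: "linear (\<xi> s)" "linear (\<eta> s)" for s using assms by (auto simp: bundle_forms1_def)
  have sm: "smooth_form \<xi>" "smooth_form \<eta>" by (rule forms1_smooth; fact)+
  have "smooth_on UNIV (pair_form \<xi> \<eta>)"
    unfolding pair_form_def[abs_def]
    by (intro smooth_minus smooth_l open_UNIV smooth_form_moving[OF sm(1)] smooth_form_moving[OF sm(2)] smooth_rot smooth_const)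
  moreover have "det (matrix (\<D> \<gamma> s)) * pair_form \<xi> \<eta> (\<gamma> s) = pair_form \<xi> \<eta> s" if g: "\<gamma> \<in> deck p" for \<gamma> s
  proof -
    define u w where "u = \<D> \<gamma> s e1" and "w = \<D> \<gamma> s e2"
    define b where "b x y = l (\<gamma> s) (\<xi> (\<gamma> s) x) (\<eta> (\<gamma> s) (rot (\<gamma> s) y))" for x y
    have eq: "\<xi> (\<gamma> s) (\<D> \<gamma> s v) = Ad (\<rho> \<gamma>) (\<xi> s v)" "\<eta> (\<gamma> s) (\<D> \<gamma> s v) = Ad (\<rho> \<gamma>) (\<eta> s v)" for v
      using assms g by (auto simp: bundle_forms1_def)
    have p: "pair_form \<xi> \<eta> s = b u w - b w u"
      using l_deck[OF g] by (simp add: b_def u_def w_def rot_deck[OF g] eq pair_form_def)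
    have b1: "b x y = x$1 * b e1 y + x$2 * b e2 y" for x y
    proof -
      have "linear (\<lambda>x. b x y)" unfolding b_def using linear_compose[OF lin(1) l_linear(2)] by (simp add: comp_def)
      from linear_plane[OF this, of x] show ?thesis by simp
    qed
    have b2: "b x y = y$1 * b x e1 + y$2 * b x e2" for x y
    proof -
      have "linear (\<lambda>y. b x y)" unfolding b_def
        using linear_compose[OF linear_compose[OF linear_rot lin(2)] l_linear(1)] by (simp add: comp_def)
      from linear_plane[OF this, of y] show ?thesis by simp
    qed
    have "b u w - b w u = (u$1 * w$2 - u$2 * w$1) * (b e1 e2 - b e2 e1)"
      unfolding b1[of u] b1[of w] b2[of _ u] b2[of _ w] by (simp add: algebra_simps)
    moreover have "det (matrix (\<D> \<gamma> s)) = u$1 * w$2 - u$2 * w$1" by (simp add: det_2 matrix_def u_def w_def)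
    moreover have "pair_form \<xi> \<eta> (\<gamma> s) = b e1 e2 - b e2 e1" by (simp add: pair_form_def b_def)
    ultimately show ?thesis using p by simp
  qed
  ultimately show ?thesis using smooth_cont by (auto simp: invariant_density_def)
qed

text \<open>Completing the square with the first fundamental form E, F, K and its area element J: E
  J times the density is the squared length of E y - F x plus J^2 times that of x.\<close>

lemma pair_form_positive:
  assumes lin: "linear (\<xi> s)"
  shows "pair_form \<xi> \<xi> s \<ge> 0" "pair_form \<xi> \<xi> s = 0 \<Longrightarrow> \<xi> s v = 0"
proof -
  define E F K J where "E = D s e1 \<bullet> D s e1" and "F = D s e1 \<bullet> D s e2" and "K = D s e2 \<bullet> D s e2" and "J = jac (D s)"
  have J: "J > 0" using jac_pos by (simp add: J_def)
  have EK: "E * K - F * F = J\<^sup>2"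
    by (simp add: E_def F_def K_def J_def jac_def inner_complex_def power2_eq_square algebra_simps)
  have "E \<ge> 0" by (simp add: E_def)
  moreover have "E \<noteq> 0" using EK J by (auto simp: power2_eq_square) (metis not_square_less_zero mult_pos_pos neg_0_less_iff_less)
  ultimately have E: "E > 0" by simp
  define x y where "x = \<xi> s e1" and "y = \<xi> s e2"
  have r1: "\<xi> s (rot s e1) = (F / J) *\<^sub>R x + (- E / J) *\<^sub>R y" and r2: "\<xi> s (rot s e2) = (K / J) *\<^sub>R x + (- F / J) *\<^sub>R y"
    by (subst linear_plane[OF lin], simp add: rot_def E_def F_def K_def J_def x_def y_def axis_def)+
  note L = linear_add[OF l_linear(1)] linear_scale[OF l_linear(1)] linear_diff[OF l_linear(1)]
    linear_add[OF l_linear(2)] linear_scale[OF l_linear(2)] linear_diff[OF l_linear(2)]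
  let ?w = "E *\<^sub>R y - F *\<^sub>R x"
  have w: "l s ?w ?w = E * E * l s y y - 2 * E * F * l s x y + F * F * l s x x"
    by (simp add: L l_pos(3)[of s y x] algebra_simps)
  have "J * pair_form \<xi> \<xi> s = K * l s x x - 2 * F * l s x y + E * l s y y"
    unfolding pair_form_def r1 r2 x_def[symmetric] y_def[symmetric] using J by (simp add: L l_pos(3)[of s y x] field_simps)
  then have "E * J * pair_form \<xi> \<xi> s = E * (K * l s x x - 2 * F * l s x y + E * l s y y)" by simp
  also have "\<dots> = l s ?w ?w + (E * K - F * F) * l s x x" unfolding w by (simp add: algebra_simps)
  finally have P: "E * J * pair_form \<xi> \<xi> s = l s ?w ?w + J\<^sup>2 * l s x x" unfolding EK .
  have nn: "l s ?w ?w \<ge> 0" "l s x x \<ge> 0" by (rule l_pos(1))+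
  have "E * J * pair_form \<xi> \<xi> s \<ge> 0" unfolding P using nn by simp
  then show "pair_form \<xi> \<xi> s \<ge> 0" using mult_pos_pos[OF E J] unfolding zero_le_mult_iff[of "E * J"] by linarith
  assume 0: "pair_form \<xi> \<xi> s = 0"
  then have "l s ?w ?w + J\<^sup>2 * l s x x = 0" using P by simp
  then have "l s ?w ?w = 0" "J\<^sup>2 * l s x x = 0" using nn by (auto simp: add_nonneg_eq_0_iff)
  then have "?w = 0" "x = 0" using J l_pos(2) by auto
  then have "y = 0" using E by simp
  then show "\<xi> s v = 0" using linear_plane[OF lin, of v] \<open>x = 0\<close> by (simp add: x_def y_def)
qed

text \<open>The difference is the exterior derivative of an invariant scalar one-form, the dual form
  of \<xi> contracted with f, so Stokes applies. With this sign \<open>delta1\<close> is the adjoint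
  of \<open>d0\<close>.\<close>

lemma green:
  assumes c: "c > 0" and f: "f \<in> bundle_sections p \<rho>" and \<xi>: "\<xi> \<in> bundle_forms1 p \<rho>"
  defines "b \<equiv> (\<lambda>s. pair_form (d0 f) \<xi> s - vol c s * l s (f s) (delta1 (G c) l \<xi> s))"
  shows "invariant_density b" "(LINT s:FD|lborel. b s) = 0"
proof -
  let ?\<beta> = "\<lambda>s. dual_form \<xi> (f s) s"
  have f': "smooth_on UNIV f" "\<And>s. f s \<in> sl" "\<And>\<gamma> s. \<gamma> \<in> deck p \<Longrightarrow> f (\<gamma> s) = Ad (\<rho> \<gamma>) (f s)"
    using f by (auto simp: bundle_sections_def)
  have sm: "smooth_form \<xi>" by (rule forms1_smooth[OF \<xi>])
  have C1: "form_C1 ?\<beta>" by (rule smooth_form_C1[OF linear_dual_form[OF sm] smooth_dual_form[OF sm f'(1)]])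
  have inv: "?\<beta> (\<gamma> s) (\<D> \<gamma> s v) = ?\<beta> s v" if "\<gamma> \<in> deck p" for \<gamma> s v
    using dual_form_deck[OF \<xi> that] f'(3)[OF that] by simp
  have b: "b = (\<lambda>s. d1 ?\<beta> s e1 e2)"
    using delta1_spec(2)[OF c sm f'(2)] by (simp add: b_def d1_dual_form_section[OF sm f'(1)] pair_form_def)
  show "(LINT s:FD|lborel. b s) = 0" unfolding b by (rule stokes[OF C1 inv])
  show "invariant_density b"
    unfolding b invariant_density_def using form_C1_d1_continuous[OF C1] d1_pullback[OF C1 deck_smooth inv] by simp
qed

lemma closed_formsD:
  assumes "\<alpha> \<in> closed_forms1 p \<tau>"
  shows "\<alpha> \<in> bundle_forms1 p \<tau>" "d1 \<alpha> = (\<lambda>s v w. 0)"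
  using assms by (auto simp: closed_forms1_def fun_eq_iff)

lemma laplacian_closed:
  assumes c: "c > 0" and \<xi>: "\<xi> \<in> closed_forms1 p \<rho>"
  shows "laplacian (G c) l \<xi> s v = d0 (delta1 (G c) l \<xi>) s v"
proof -
  have "star1 (G c) (\<lambda>t v. 0::real) s v = 0" by (simp add: star1_def)
  moreover have "d0 (star2 (G c) (\<lambda>t v w. 0::real)) = (\<lambda>t v. 0)"
    by (simp add: fun_eq_iff star2_def[abs_def] d0_def frechet_derivative_const)
  ultimately have "delta2 (G c) l (\<lambda>t v w. 0) s v = - sharp_inv l s (\<lambda>B. 0)"
    by (simp add: delta2_def l_0)
  also have "sharp_inv l s (\<lambda>B. 0) = 0"
    by (subst sharp_inv_eq(1)[where N=0]) (simp_all add: trace_def)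
  finally show ?thesis unfolding laplacian_def closed_formsD(2)[OF \<xi>] by simp
qed

text \<open>A competitor is \<omega> + df. The Laplacian of a closed form is the differential of its
  codifferential h, and here h is also the codifferential of df, since \<omega> is coclosed. Two
  applications of Green's formula give h = 0 and then df = 0.\<close>

lemma harmonic_unique:
  assumes c: "c > 0" and \<omega>: "\<omega> \<in> closed_forms1 p \<rho>" "\<And>s. codiff \<omega> s = 0"
  shows "harmonic_rep (G c) l (cohomologous p \<rho> `` {\<omega>}) = \<omega>"
  unfolding harmonic_rep_def
proof (rule the_equality)
  have sm: "smooth_form \<omega>" by (rule forms1_smooth[OF closed_formsD(1)[OF \<omega>(1)]])
  have \<delta>\<omega>: "delta1 (G c) l \<omega> = (\<lambda>s. 0)"
  proof
    show "delta1 (G c) l \<omega> s = 0" for s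
      unfolding delta1_eq[OF c sm] \<omega>(2) by (subst sharp_inv_eq(1)[where N=0]) (simp_all add: trace_def)
  qed
  have z: "(\<lambda>s. 0) \<in> bundle_sections p \<rho>"
    using linear_0[OF linear_Ad] by (auto simp: bundle_sections_def sl_0 intro: smooth_const)
  show "\<omega> \<in> cohomologous p \<rho> `` {\<omega>} \<and> (\<forall>s v. laplacian (G c) l \<omega> s v = 0)"
    using \<omega>(1) by (auto simp: cohomologous_def laplacian_closed[OF c \<omega>(1)] \<delta>\<omega> d0_def frechet_derivative_const intro!: bexI[OF _ z])
  fix \<xi> assume "\<xi> \<in> cohomologous p \<rho> `` {\<omega>} \<and> (\<forall>s v. laplacian (G c) l \<xi> s v = 0)"
  then obtain f where \<xi>: "\<xi> \<in> closed_forms1 p \<rho>" and L: "\<And>s v. laplacian (G c) l \<xi> s v = 0"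
    and f: "f \<in> bundle_sections p \<rho>" "\<And>s v. \<xi> s v - \<omega> s v = d0 f s v"
    by (auto simp: cohomologous_def)
  have smx: "smooth_form \<xi>" by (rule forms1_smooth[OF closed_formsD(1)[OF \<xi>]])
  let ?F = "d0 f"
  have F: "?F \<in> bundle_forms1 p \<rho>" by (rule d0_bundle_forms[OF f(1)])
  have smF: "smooth_form ?F" by (rule forms1_smooth[OF F])
  have \<xi>F: "\<xi> s v = \<omega> s v + ?F s v" for s v using f(2)[of s v] by (simp add: algebra_simps)
  have cod: "codiff \<xi> s = codiff ?F s" for s
  proof -
    have "d1 (dual_form \<xi> B) s e1 e2 = d1 (dual_form \<omega> B) s e1 e2 + d1 (dual_form ?F B) s e1 e2" for B
    proof -
      have e: "dual_form \<xi> B = (\<lambda>s v. dual_form \<omega> B s v + dual_form ?F B s v)"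
        by (simp add: fun_eq_iff dual_form_def \<xi>F linear_add[OF l_linear(1)])
      have "\<D> (\<lambda>t. dual_form \<xi> B t v) s = (\<lambda>w. \<D> (\<lambda>t. dual_form \<omega> B t v) s w + \<D> (\<lambda>t. dual_form ?F B t v) s w)" for v
        unfolding e by (intro frechet_eq has_derivative_add form_C1_derivative dual_form_C1 sm smF)
      then show ?thesis by (simp add: d1_def)
    qed
    then show ?thesis using \<omega>(2)[of s] by (simp add: vec_eq_iff codiff_def)
  qed
  define h where "h = delta1 (G c) l ?F"
  have h\<xi>: "h = delta1 (G c) l \<xi>" unfolding h_def delta1_eq[OF c smx, abs_def] delta1_eq[OF c smF, abs_def] cod ..
  have hs: "h \<in> bundle_sections p \<rho>" unfolding h_def by (rule delta1_section[OF c F])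
  have dh: "d0 h s v = 0" for s v using L[of s v] unfolding laplacian_closed[OF c \<xi>] h\<xi> .
  have h0: "h s = 0" for s
  proof -
    \<comment> \<open>Applied to h and df: the integral of the squared length of h equals that of
      the product of dh with df, and dh = 0.\<close>
    note g = green[OF c hs F, folded h_def]
    have e: "pair_form (d0 h) ?F s - vol c s * l s (h s) (h s) = - (vol c s * l s (h s) (h s))" for s
      by (simp add: pair_form_def dh l_0)
    have i: "invariant_density (\<lambda>s. vol c s * l s (h s) (h s))"
      using g(1) unfolding e invariant_density_def by (auto dest: continuous_on_minus)
    have z: "(LINT s:FD|lborel. vol c s * l s (h s) (h s)) = 0"
      using g(2) unfolding e by (simp add: set_lebesgue_integral_def)
    have "vol c s * l s (h s) (h s) = 0"
      by (rule invariant_density_vanishes[OF i _ z]) (use vol_pos[OF c] l_pos(1) in \<open>simp add: less_imp_le\<close>)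
    then show ?thesis using vol_pos[OF c, of s] l_pos(2) by simp
  qed
  have "?F s v = 0" for s v
  proof (rule pair_form_positive(2))
    show "linear (?F s)" for s using F by (simp add: bundle_forms1_def)
    \<comment> \<open>Applied to f and df: now that h = 0, the squared norm of df is 0.\<close>
    note g = green[OF c f(1) F, folded h_def]
    have e: "pair_form (d0 f) ?F s - vol c s * l s (f s) (h s) = pair_form ?F ?F s" for s by (simp add: h0 l_0)
    show "pair_form ?F ?F s = 0"
      by (rule invariant_density_vanishes[OF g(1)[unfolded e] pair_form_positive(1) g(2)[unfolded e]]) fact
  qed
  then show "\<xi> = \<omega>" using \<xi>F by (simp add: fun_eq_iff)
qed

end

section \<open>Forms of quadratic differentials\<close>

lemma open_H: "open \<H>"
  by (simp add: upper_half_plane_def open_halfspace_Im_gt)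

lemma convex_upper_half_plane: "convex \<H>"
  by (simp add: upper_half_plane_def convex_halfspace_Im_gt)

lemma upper_half_plane_primitive:
  assumes "g holomorphic_on \<H>"
  obtains F where "\<And>z. Im z > 0 \<Longrightarrow> (F has_field_derivative g z) (at z)"
proof -
  obtain F where F: "\<And>z. z \<in> \<H> \<Longrightarrow> (F has_field_derivative g z) (at z within \<H>)"
    using holomorphic_convex_primitive'[OF convex_upper_half_plane open_H assms] by blast
  have "(F has_field_derivative g z) (at z)" if "Im z > 0" for z
  proof -
    have "z \<in> \<H>" using that by (simp add: upper_half_plane_def)
    from F[OF this] show ?thesis by (simp add: at_within_open[OF \<open>z \<in> \<H>\<close> open_H])
  qed
  then show ?thesis by (rule that)
qed

lemma quadratic_differential_mobius:
  assumes "\<phi> \<in> quadratic_differentials p (d, r)" "\<gamma> \<in> deck p" "r \<gamma> \<in> SL" "Im z > 0"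
  shows "\<phi> (mobius (r \<gamma>) z) = \<phi> z * (mden (r \<gamma>) z)^4"
proof -
  have "\<phi> (mobius (r \<gamma>) z) * (deriv (mobius (r \<gamma>)) z)\<^sup>2 = \<phi> z"
    using assms(1,2,4) by (simp add: quadratic_differentials_def upper_half_plane_def)
  then have "\<phi> (mobius (r \<gamma>) z) * (1 / (mden (r \<gamma>) z)\<^sup>2)\<^sup>2 = \<phi> z"
    by (simp only: deriv_mobius[OF assms(3,4)])
  then show ?thesis using mden_nz[OF assms(3,4)] by (simp add: field_simps power2_eq_square power4_eq_xxxx)
qed

context hyperbolic_surface
begin

abbreviation "QD \<equiv> quadratic_differentials p (d, r)"

definition om :: "(complex \<Rightarrow> complex) \<Rightarrow> (real^2^2) form1" where
  "om \<phi> s v = nilp (d s) (\<phi> (d s) * D s v)"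

lemma d_compose_derivative:
  assumes "\<And>z. Im z > 0 \<Longrightarrow> (F has_field_derivative g z) (at z)"
  shows "((\<lambda>s. F (d s)) has_derivative (\<lambda>v. g (d s) * D s v)) (at s)"
  by (rule has_derivative_compose[OF D_derivative assms[OF Im_d, unfolded has_field_derivative_def]])

lemma d_compose_smooth:
  assumes "\<And>z. Im z > 0 \<Longrightarrow> (F has_field_derivative g z) (at z)"
  shows "smooth_on UNIV (\<lambda>s. F (d s))"
proof (rule smooth_compose[OF _ d_smooth])
  show "smooth_on \<H> F"
  proof (rule holomorphic_smooth[OF _ open_H])
    show "F holomorphic_on \<H>"
      unfolding holomorphic_on_open[OF open_H] using assms by (auto simp: upper_half_plane_def)
  qed
  show "d ` UNIV \<subseteq> \<H>" using Im_d by (auto simp: upper_half_plane_def)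
qed (rule open_UNIV open_H)+

text \<open>The entries of \<open>nilp\<close> are polynomials in z of degree at most 2, so
  primitives of \<phi>, \<phi> z and \<phi> z^2 integrate the form of \<phi>. This is the Eichler
  integral of \<phi> as a real matrix.\<close>

definition matrix_potential :: "(complex \<Rightarrow> complex) \<Rightarrow> (complex \<Rightarrow> complex) \<Rightarrow> (complex \<Rightarrow> complex) \<Rightarrow> complex \<Rightarrow> real^2^2" where
  "matrix_potential F0 F1 F2 z = vector [vector [- Re (F1 z), Re (F2 z)], vector [- Re (F0 z), Re (F1 z)]]"

lemma om_matrix_potential:
  assumes F: "\<And>z. Im z > 0 \<Longrightarrow> (F0 has_field_derivative \<phi> z) (at z)"
    "\<And>z. Im z > 0 \<Longrightarrow> (F1 has_field_derivative \<phi> z * z) (at z)"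
    "\<And>z. Im z > 0 \<Longrightarrow> (F2 has_field_derivative \<phi> z * z\<^sup>2) (at z)"
  shows "smooth_on UNIV (\<lambda>s. matrix_potential F0 F1 F2 (d s))" "d0 (\<lambda>s. matrix_potential F0 F1 F2 (d s)) = om \<phi>"
proof -
  let ?E = "\<lambda>s. matrix_potential F0 F1 F2 (d s)"
  have R: "smooth_on UNIV (\<lambda>s. Re (F (d s)))" "d0 (\<lambda>s. Re (F (d s))) s v = Re (g (d s) * D s v)"
    "d0 (\<lambda>s. - Re (F (d s))) s v = - Re (g (d s) * D s v)"
    if "\<And>z. Im z > 0 \<Longrightarrow> (F has_field_derivative g z) (at z)" for F g s v
  proof -
    show "smooth_on UNIV (\<lambda>s. Re (F (d s)))"
      by (rule smooth_linear_compose[OF open_UNIV bounded_linear_Re d_compose_smooth[OF that]])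
    have D: "((\<lambda>s. Re (F (d s))) has_derivative (\<lambda>v. Re (g (d s) * D s v))) (at s)"
      by (rule bounded_linear.has_derivative[OF bounded_linear_Re d_compose_derivative[OF that]])
    show "d0 (\<lambda>s. Re (F (d s))) s v = Re (g (d s) * D s v)" "d0 (\<lambda>s. - Re (F (d s))) s v = - Re (g (d s) * D s v)"
      unfolding d0_def using frechet_eq[OF D] frechet_eq[OF has_derivative_minus[OF D]] by simp_all
  qed
  have "\<forall>i j. smooth_on UNIV (\<lambda>s. ?E s $ i $ j)"
    unfolding forall_2 matrix_potential_def using R(1)[OF F(1)] R(1)[OF F(2)] R(1)[OF F(3)] by (simp add: smooth_uminus)
  then show sm: "smooth_on UNIV ?E" by (intro smooth_matrix open_UNIV) blast
  have c: "d0 ?E s v $ i $ j = d0 (\<lambda>s. ?E s $ i $ j) s v" for s v i j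
    by (rule d0_linear_compose[OF _ sm, symmetric]) (rule linearI; simp)
  have "\<forall>i j. d0 ?E s v $ i $ j = om \<phi> s v $ i $ j" for s v
    unfolding c unfolding forall_2 matrix_potential_def om_def nilp_def vector_2
    by (simp only: R(3)[of F0 \<phi>, OF F(1)] R(2)[of F1 "\<lambda>z. \<phi> z * z", OF F(2)] R(3)[of F1 "\<lambda>z. \<phi> z * z", OF F(2)]
      R(2)[of F2 "\<lambda>z. \<phi> z * z\<^sup>2", OF F(3)]) (simp add: algebra_simps)
  then show "d0 ?E = om \<phi>" by (simp add: fun_eq_iff vec_eq_iff)
qed

lemma om_potential:
  assumes "\<phi> holomorphic_on \<H>"
  obtains F0 F1 F2 where "\<And>z. Im z > 0 \<Longrightarrow> (F0 has_field_derivative \<phi> z) (at z)"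
    "\<And>z. Im z > 0 \<Longrightarrow> (F1 has_field_derivative \<phi> z * z) (at z)"
    "\<And>z. Im z > 0 \<Longrightarrow> (F2 has_field_derivative \<phi> z * z\<^sup>2) (at z)"
    "smooth_on UNIV (\<lambda>s. matrix_potential F0 F1 F2 (d s))" "d0 (\<lambda>s. matrix_potential F0 F1 F2 (d s)) = om \<phi>"
proof -
  have h: "(\<lambda>z. \<phi> z * z) holomorphic_on \<H>" "(\<lambda>z. \<phi> z * z\<^sup>2) holomorphic_on \<H>"
    by (intro holomorphic_intros assms)+
  obtain F0 where F0: "\<And>z. Im z > 0 \<Longrightarrow> (F0 has_field_derivative \<phi> z) (at z)" using upper_half_plane_primitive[OF assms] by blast
  obtain F1 where F1: "\<And>z. Im z > 0 \<Longrightarrow> (F1 has_field_derivative \<phi> z * z) (at z)" using upper_half_plane_primitive[OF h(1)] by blast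
  obtain F2 where F2: "\<And>z. Im z > 0 \<Longrightarrow> (F2 has_field_derivative \<phi> z * z\<^sup>2) (at z)" using upper_half_plane_primitive[OF h(2)] by blast
  show ?thesis by (rule that[OF F0 F1 F2 om_matrix_potential[OF F0 F1 F2]])
qed

lemma om_deck:
  assumes "\<phi> \<in> QD" and g: "\<gamma> \<in> deck p"
  shows "om \<phi> (\<gamma> s) (\<D> \<gamma> s v) = Ad (r \<gamma>) (om \<phi> s v)"
proof -
  note A = r_SL[OF g] Im_d[of s]
  have "\<phi> (d (\<gamma> s)) * D (\<gamma> s) (\<D> \<gamma> s v) = \<phi> (d s) * D s v * (mden (r \<gamma>) (d s))\<^sup>2"
    unfolding D_deck[OF g] d_deck[OF g] quadratic_differential_mobius[OF assms A]
    using mden_nz[OF A] by (simp add: power2_eq_square power4_eq_xxxx)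
  then show ?thesis unfolding om_def nilp_Ad[OF A] by (simp add: d_deck[OF g])
qed

lemma om_closed_forms:
  assumes \<phi>: "\<phi> \<in> QD"
  shows "om \<phi> \<in> closed_forms1 p r"
proof -
  have "\<phi> holomorphic_on \<H>" using \<phi> by (simp add: quadratic_differentials_def)
  then obtain F0 F1 F2 where E: "smooth_on UNIV (\<lambda>s. matrix_potential F0 F1 F2 (d s))" "d0 (\<lambda>s. matrix_potential F0 F1 F2 (d s)) = om \<phi>"
    by (rule om_potential) blast
  have "linear (om \<phi> s)" "smooth_on UNIV (\<lambda>s. om \<phi> s v)" for s v
    unfolding E(2)[symmetric] by (rule linear_d0[OF E(1)] smooth_d0[OF E(1)])+
  moreover have "d1 (om \<phi>) s v w = 0" for s v w unfolding E(2)[symmetric] by (rule d1_d0[OF E(1)])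
  moreover have "range (om \<phi> s) \<subseteq> sl" for s by (auto simp: om_def nilp_sl)
  ultimately show ?thesis using om_deck[OF \<phi>] by (simp add: closed_forms1_def bundle_forms1_def)
qed

lemma dPhi_section: "f \<in> bundle_sections p r \<Longrightarrow> (\<lambda>s. dPhi (f s)) \<in> bundle_sections p \<rho>"
  unfolding bundle_sections_def using dPhi_sl dPhi_Ad[OF r_SL] smooth_linear_compose[OF open_UNIV linear_dPhi[unfolded linear_conv_bounded_linear]]
  by auto

definition dPhi_form :: "(real^2^2) form1 \<Rightarrow> (real^3^3) form1" where
  "dPhi_form \<alpha> s v = dPhi (\<alpha> s v)"

lemma dPhi_closed_forms:
  assumes a: "\<alpha> \<in> closed_forms1 p r"
  shows "dPhi_form \<alpha> \<in> closed_forms1 p \<rho>"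
proof -
  have \<alpha>: "linear (\<alpha> s)" "\<alpha> s v \<in> sl" "smooth_on UNIV (\<lambda>s. \<alpha> s v)" for s v
    using closed_formsD(1)[OF a] by (auto simp: bundle_forms1_def)
  have "linear (dPhi_form \<alpha> s)" for s
    unfolding dPhi_form_def[abs_def] using linear_compose[OF \<alpha>(1) linear_dPhi] by (simp add: comp_def)
  moreover have "smooth_on UNIV (\<lambda>s. dPhi_form \<alpha> s v)" for v
    unfolding dPhi_form_def by (rule smooth_linear_compose[OF open_UNIV linear_dPhi[unfolded linear_conv_bounded_linear] \<alpha>(3)])
  moreover have "d1 (dPhi_form \<alpha>) s v w = dPhi (d1 \<alpha> s v w)" for s v w
    unfolding d1_def dPhi_form_def d0_def[symmetric] d0_linear_compose[OF linear_dPhi \<alpha>(3)] by (simp add: linear_diff[OF linear_dPhi])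
  then have "d1 (dPhi_form \<alpha>) s v w = 0" for s v w
    by (simp add: closed_formsD(2)[OF a] linear_0[OF linear_dPhi])
  moreover have "dPhi_form \<alpha> (\<gamma> s) (\<D> \<gamma> s v) = Ad (\<rho> \<gamma>) (dPhi_form \<alpha> s v)" if "\<gamma> \<in> deck p" for \<gamma> s v
    using closed_formsD(1)[OF a] that dPhi_Ad[OF r_SL[OF that]] by (auto simp: bundle_forms1_def dPhi_form_def)
  moreover have "range (dPhi_form \<alpha> s) \<subseteq> sl" for s using dPhi_sl \<alpha>(2) by (auto simp: dPhi_form_def)
  ultimately show ?thesis by (simp add: closed_forms1_def bundle_forms1_def)
qed

lemma l_om: "l s B (dPhi_form (om \<phi>) s v) = B \<bullet> transpose (dPhi (om \<phi> s v))"
  unfolding fibre_metric_def dPhi_form_def om_def by (rule light_fibre_nilp[OF Im_d])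

lemma om_rot: "om \<phi> s (rot s v) = om (\<lambda>z. - \<i> * \<phi> z) s v"
  by (simp only: om_def D_rot) (simp add: mult_ac)

text \<open>Rotating the argument multiplies \<phi> by -i. By self-adjointness of the nilpotent
  matrices the dual form at B is a fixed linear image of the form of -i \<phi>, which has a
  potential; its exterior derivative vanishes.\<close>

lemma codiff_om:
  assumes \<phi>: "\<phi> holomorphic_on \<H>"
  shows "codiff (dPhi_form (om \<phi>)) s = 0"
proof -
  have "(\<lambda>z. - \<i> * \<phi> z) holomorphic_on \<H>" by (intro holomorphic_intros \<phi>)
  then obtain F0 F1 F2 where E: "smooth_on UNIV (\<lambda>s. matrix_potential F0 F1 F2 (d s))"
    "d0 (\<lambda>s. matrix_potential F0 F1 F2 (d s)) = om (\<lambda>z. - \<i> * \<phi> z)"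
    by (rule om_potential) blast
  let ?E = "\<lambda>s. matrix_potential F0 F1 F2 (d s)"
  have "dual_form (dPhi_form (om \<phi>)) B = d0 (\<lambda>s. B \<bullet> transpose (dPhi (?E s)))" for B
  proof -
    have L: "linear (\<lambda>A. B \<bullet> transpose (dPhi A))"
      by (rule linearI) (simp_all add: linear_add[OF linear_dPhi] linear_scale[OF linear_dPhi] inner_vec_def transpose_def sum.distrib sum_distrib_left algebra_simps)
    show ?thesis
      by (intro ext) (simp only: dual_form_def l_om om_rot d0_linear_compose[OF L E(1)] E(2))
  qed
  moreover have "smooth_on UNIV (\<lambda>s. B \<bullet> transpose (dPhi (?E s)))" for B
  proof -
    have "linear (\<lambda>A. B \<bullet> transpose (dPhi A))"
      by (rule linearI) (simp_all add: linear_add[OF linear_dPhi] linear_scale[OF linear_dPhi] inner_vec_def transpose_def sum.distrib sum_distrib_left algebra_simps)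
    then show ?thesis by (intro smooth_linear_compose[OF open_UNIV _ E(1)]) (simp add: linear_conv_bounded_linear)
  qed
  ultimately show ?thesis by (simp add: codiff_def vec_eq_iff d1_d0)
qed

lemma cohomologous_refl:
  assumes "\<alpha> \<in> closed_forms1 p \<tau>"
  shows "(\<alpha>, \<alpha>) \<in> cohomologous p \<tau>"
proof -
  have "(\<lambda>s. 0) \<in> bundle_sections p \<tau>"
    using linear_0[OF linear_Ad] by (auto simp: bundle_sections_def sl_0 intro: smooth_const)
  moreover have "\<alpha> s v - \<alpha> s v = d0 (\<lambda>s. 0) s v" for s v by (simp add: d0_def frechet_derivative_const)
  ultimately show ?thesis using assms unfolding cohomologous_def by blast
qed

lemma cohomologous_sym: "(\<alpha>, \<beta>) \<in> cohomologous p \<tau> \<Longrightarrow> (\<beta>, \<alpha>) \<in> cohomologous p \<tau>"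
proof -
  assume "(\<alpha>, \<beta>) \<in> cohomologous p \<tau>"
  then obtain f where f: "\<alpha> \<in> closed_forms1 p \<tau>" "\<beta> \<in> closed_forms1 p \<tau>" "f \<in> bundle_sections p \<tau>" "\<And>s v. \<beta> s v - \<alpha> s v = d0 f s v"
    by (auto simp: cohomologous_def)
  have sm: "smooth_on UNIV f" using f(3) by (simp add: bundle_sections_def)
  have n: "linear (\<lambda>A :: real^'n^'n. - A)" by (rule linearI) simp_all
  have "(\<lambda>s. - f s) \<in> bundle_sections p \<tau>"
    using f(3) by (auto simp: bundle_sections_def linear_neg[OF linear_Ad] intro!: smooth_uminus sl_neg)
  moreover have "\<alpha> s v - \<beta> s v = d0 (\<lambda>s. - f s) s v" for s v
    unfolding d0_linear_compose[OF n sm] f(4)[symmetric] by simp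
  ultimately show ?thesis using f(1,2) unfolding cohomologous_def by blast
qed

lemma cohomologous_trans: "(\<alpha>, \<beta>) \<in> cohomologous p \<tau> \<Longrightarrow> (\<beta>, \<eta>) \<in> cohomologous p \<tau> \<Longrightarrow> (\<alpha>, \<eta>) \<in> cohomologous p \<tau>"
proof -
  assume 1: "(\<alpha>, \<beta>) \<in> cohomologous p \<tau>" and 2: "(\<beta>, \<eta>) \<in> cohomologous p \<tau>"
  obtain f where f: "\<alpha> \<in> closed_forms1 p \<tau>" "f \<in> bundle_sections p \<tau>" "\<And>s v. \<beta> s v - \<alpha> s v = d0 f s v"
    using 1 by (auto simp: cohomologous_def)
  obtain g where g: "\<eta> \<in> closed_forms1 p \<tau>" "g \<in> bundle_sections p \<tau>" "\<And>s v. \<eta> s v - \<beta> s v = d0 g s v"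
    using 2 by (auto simp: cohomologous_def)
  have sm: "smooth_on UNIV f" "smooth_on UNIV g" using f(2) g(2) by (auto simp: bundle_sections_def)
  have "(\<lambda>s. f s + g s) \<in> bundle_sections p \<tau>"
    using f(2) g(2) by (auto simp: bundle_sections_def linear_add[OF linear_Ad] intro!: smooth_add sl_plus)
  moreover have "\<eta> s v - \<alpha> s v = d0 (\<lambda>s. f s + g s) s v" for s v
  proof -
    have "d0 (\<lambda>s. f s + g s) s v = d0 f s v + d0 g s v"
      unfolding d0_def using fun_cong[OF frechet_eq[OF has_derivative_add[OF smooth_derivative[OF sm(1)] smooth_derivative[OF sm(2)]]]] by simp
    then show ?thesis unfolding f(3)[symmetric] g(3)[symmetric] by simp
  qed
  ultimately show ?thesis using f(1) g(1) unfolding cohomologous_def by blast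
qed

lemma dPhi_cohomologous:
  assumes "(\<alpha>, \<beta>) \<in> cohomologous p r" shows "(dPhi_form \<alpha>, dPhi_form \<beta>) \<in> cohomologous p \<rho>"
proof -
  obtain f where f: "\<alpha> \<in> closed_forms1 p r" "\<beta> \<in> closed_forms1 p r" "f \<in> bundle_sections p r" "\<And>s v. \<beta> s v - \<alpha> s v = d0 f s v"
    using assms by (auto simp: cohomologous_def)
  have "smooth_on UNIV f" using f(3) by (simp add: bundle_sections_def)
  then have "dPhi_form \<beta> s v - dPhi_form \<alpha> s v = d0 (\<lambda>s. dPhi (f s)) s v" for s v
    by (simp add: d0_linear_compose[OF linear_dPhi] f(4)[symmetric] dPhi_form_def linear_diff[OF linear_dPhi])
  then show ?thesis using dPhi_closed_forms f(1,2) dPhi_section[OF f(3)] unfolding cohomologous_def by blast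
qed

text \<open>Only the class in dimension three is taken by the metric, so the image of the whole
  class u has to be collapsed to the class of one explicit form before uniqueness applies.\<close>

lemma harmonic_rep_class:
  assumes c: "c > 0" and \<phi>: "\<phi> \<in> QD" and u: "u = cohomologous p r `` {om \<phi>}"
  shows "harmonic_rep (G c) l (d_teich_embedding p (d, r) u) = dPhi_form (om \<phi>)"
proof -
  have hol: "\<phi> holomorphic_on \<H>" using \<phi> by (simp add: quadratic_differentials_def)
  have cl: "dPhi_form (om \<phi>) \<in> closed_forms1 p \<rho>" by (rule dPhi_closed_forms[OF om_closed_forms[OF \<phi>]])
  have "d_teich_embedding p (d, r) u = cohomologous p \<rho> `` (dPhi_form ` u)"
    by (simp add: d_teich_embedding_def teich_embedding_def dPhi_form_def[abs_def])
  also have "\<dots> = cohomologous p \<rho> `` {dPhi_form (om \<phi>)}"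
  proof -
    have "om \<phi> \<in> u" using cohomologous_refl[OF om_closed_forms[OF \<phi>]] by (simp add: u)
    moreover have "(dPhi_form (om \<phi>), dPhi_form \<alpha>) \<in> cohomologous p \<rho>" if "\<alpha> \<in> u" for \<alpha>
      using that dPhi_cohomologous by (simp add: u)
    ultimately show ?thesis using cohomologous_trans[of "dPhi_form (om \<phi>)"] by blast
  qed
  finally show ?thesis using harmonic_unique[OF c cl codiff_om[OF hol]] by simp
qed

end

section \<open>Beltrami coefficients and the Weil-Petersson pairing\<close>

lemma set_integral_cnj_scale:
  fixes f :: "'a \<Rightarrow> complex"
  shows "(LINT x:A|M. c * cnj (f x)) = c * cnj (LINT x:A|M. f x)"
proof -
  have "(LINT x:A|M. c * cnj (f x)) = (LINT x|M. c * cnj (indicat_real A x *\<^sub>R f x))"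
    by (simp add: set_lebesgue_integral_def scaleR_conv_of_real mult_ac)
  then show ?thesis
    by (simp only: set_lebesgue_integral_def integral_mult_right_zero Bochner_Integration.integral_cnj)
qed

lemma set_integral_Re: "set_integrable M A f \<Longrightarrow> Re (LINT x:A|M. f x) = (LINT x:A|M. Re (f x))"
  unfolding set_integrable_def set_lebesgue_integral_def by (subst integral_Re[symmetric]) simp_all

context hyperbolic_surface
begin

definition e :: "complex \<Rightarrow> plane" where "e = inv_into UNIV d"

lemma d_diffeo: "diffeo_onto d \<H>" by (rule hyperbolic_structure_facts(1)[OF hyp])

lemma d_inj: "inj d" and range_d: "range d = \<H>"
  using d_diffeo by (auto simp: diffeo_onto_def bij_betw_def)

lemma e_d: "e (d s) = s" by (simp add: e_def d_inj)

lemma d_e: "Im z > 0 \<Longrightarrow> d (e z) = z"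
  unfolding e_def by (rule f_inv_into_f) (simp add: range_d upper_half_plane_def)

lemma e_smooth: "smooth_on \<H> e"
  using d_diffeo by (simp add: diffeo_onto_def e_def)

lemma D_De: "D s (\<D> e (d s) w) = w"
proof -
  have "d s \<in> \<H>" using range_d by blast
  then have De: "(e has_derivative \<D> e (d s)) (at (d s))" by (rule smooth_derivative[OF e_smooth])
  have "((\<lambda>z. d (e z)) has_derivative (\<lambda>w. D s (\<D> e (d s) w))) (at (d s))"
    using has_derivative_compose[OF De, of d "D s"] D_derivative[of s] by (simp add: e_d)
  moreover have "((\<lambda>z. d (e z)) has_derivative (\<lambda>w. w)) (at (d s))"
    by (rule has_derivative_transform_within_open[OF has_derivative_ident open_H \<open>d s \<in> _\<close>])
      (simp add: d_e upper_half_plane_def)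
  ultimately have "(\<lambda>w. D s (\<D> e (d s) w)) = (\<lambda>w. w)" by (rule has_derivative_unique)
  then show ?thesis by (rule fun_cong)
qed

lemma linear_killing_field: "linear (\<lambda>A. killing_field A z)"
  by (rule linearI) (simp_all add: killing_field_def algebra_simps scaleR_conv_of_real[where x="_::complex"])

text \<open>The definition uses the derivative of the inverse developing map. Cramer's rule for the
  preimages of 1 and i rewrites it in the coordinate frame, which gives continuity and the same
  shape as \<open>pair_form\<close>.\<close>

lemma beltrami_d:
  assumes lin: "linear (\<alpha> s)"
  shows "beltrami (d, r) \<alpha> (d s) = - \<i> * (D s e2 * killing_field (\<alpha> s e1) (d s) - D s e1 * killing_field (\<alpha> s e2) (d s)) / of_real (2 * jac (D s))"
proof -
  define J a b where "J = jac (D s)" and "a = D s e1" and "b = D s e2"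
  define K where "K v = killing_field (\<alpha> s v) (d s)" for v
  define u w where "u = \<D> e (d s) 1" and "w = \<D> e (d s) \<i>"
  have J: "J > 0" using jac_pos by (simp add: J_def)
  have comp: "v$2 * J = Im (cnj a * D s v)" "v$1 * J = - Im (cnj b * D s v)" for v
    by (simp_all add: D_eq[of s v] jac_def J_def a_def b_def algebra_simps)
  have D: "D s u = 1" "D s w = \<i>" unfolding u_def w_def by (rule D_De)+
  have uw: "of_real J * complex_of_real (u$1) = Im b" "of_real J * complex_of_real (u$2) = - Im a"
    "of_real J * complex_of_real (w$1) = - Re b" "of_real J * complex_of_real (w$2) = Re a"
    using comp[of u] comp[of w] unfolding D by (simp_all add: of_real_mult[symmetric] mult.commute del: of_real_mult)
  have "linear K" unfolding K_def using linear_compose[OF lin linear_killing_field] by (simp add: comp_def)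
  note K = linear_plane[OF this, unfolded scaleR_conv_of_real]
  have "of_real J * (K u + \<i> * K w) = (of_real J * of_real (u$1) + \<i> * (of_real J * of_real (w$1))) * K e1 + (of_real J * of_real (u$2) + \<i> * (of_real J * of_real (w$2))) * K e2"
    by (subst K, subst (3) K) (simp add: algebra_simps)
  also have "\<dots> = - \<i> * b * K e1 + \<i> * a * K e2"
  proof -
    have "of_real (Im b) + \<i> * - of_real (Re b) = - \<i> * b" "- of_real (Im a) + \<i> * of_real (Re a) = \<i> * a"
      by (simp_all add: complex_eq_iff)
    then show ?thesis unfolding uw by simp
  qed
  finally have E: "of_real J * (K u + \<i> * K w) = - \<i> * b * K e1 + \<i> * a * K e2" .
  have "beltrami (d, r) \<alpha> (d s) = (K u + \<i> * K w) / 2"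
    by (simp add: beltrami_def Let_def e_def[symmetric] e_d K_def u_def w_def)
  also have "\<dots> = of_real J * (K u + \<i> * K w) / of_real (2 * J)" using J by simp
  also have "\<dots> = - \<i> * (b * K e1 - a * K e2) / of_real (2 * J)" unfolding E by (simp add: algebra_simps)
  finally show ?thesis by (simp add: K_def J_def a_def b_def)
qed

lemma beltrami_om:
  assumes "Im z > 0" shows "beltrami (d, r) (om \<phi>) z = - 2 * (Im z)\<^sup>2 *\<^sub>R cnj (\<phi> z)"
proof -
  define s where "s = e z"
  have z: "z = d s" using d_e[OF assms] by (simp add: s_def)
  show ?thesis
    by (simp add: beltrami_def Let_def e_def[symmetric] e_d z om_def D_De killing_field_nilp)
      (simp add: complex_eq_iff)
qed

lemma beltrami_continuous:
  assumes \<alpha>: "\<alpha> \<in> bundle_forms1 p r"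
  shows "continuous_on \<H> (beltrami (d, r) \<alpha>)"
proof -
  have lin: "linear (\<alpha> s)" and sm: "smooth_on UNIV (\<lambda>s. \<alpha> s v)" for s v using \<alpha> by (auto simp: bundle_forms1_def)
  let ?b = "\<lambda>s. - \<i> * (D s e2 * killing_field (\<alpha> s e1) (d s) - D s e1 * killing_field (\<alpha> s e2) (d s)) / of_real (2 * jac (D s))"
  note c = smooth_cont[OF sm] smooth_cont[OF smooth_D] smooth_cont[OF smooth_jac] smooth_cont[OF d_smooth]
  have c1: "continuous_on UNIV (\<lambda>s. \<alpha> s v $ i $ j)" for v i j
    by (rule smooth_cont[OF smooth_nth[OF open_UNIV smooth_nth[OF open_UNIV sm]]])
  have "continuous_on UNIV ?b"
    unfolding killing_field_def using jac_pos by (intro continuous_intros c c1) (simp add: less_imp_neq[symmetric])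
  then have "continuous_on \<H> (\<lambda>z. ?b (e z))"
    by (rule continuous_on_compose2[OF _ smooth_cont[OF e_smooth]]) simp
  moreover have "?b (e z) = beltrami (d, r) \<alpha> z" if "z \<in> \<H>" for z
    using beltrami_d[of \<alpha> "e z", OF lin] d_e[of z] that by (simp add: upper_half_plane_def)
  ultimately show ?thesis by (rule continuous_on_eq)
qed

lemma integral_over_image:
  fixes f :: "complex \<Rightarrow> complex"
  assumes f: "continuous_on \<H> f"
  shows "(LINT z:d ` FD|lborel. f z) = (LINT s:FD|lborel. jac (D s) *\<^sub>R f (d s))"
proof -
  have im: "d ` FD = \<H> \<inter> e -` FD"
  proof (rule equalityI; rule subsetI)
    fix z assume "z \<in> d ` FD" then show "z \<in> \<H> \<inter> e -` FD" using e_d range_d by auto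
  next
    fix z assume z: "z \<in> \<H> \<inter> e -` FD"
    then have "d (e z) = z" by (simp add: d_e upper_half_plane_def)
    then show "z \<in> d ` FD" using z by (metis IntD2 imageI vimageE)
  qed
  have H: "\<H> \<in> sets borel" using open_H by simp
  have "(\<lambda>z. indicator \<H> z *\<^sub>R e z) \<in> borel_measurable borel"
    using borel_measurable_continuous_on_indicator[OF H smooth_cont[OF e_smooth]] .
  from measurable_sets[OF this fundamental_domain(1)]
  have "(\<lambda>z. indicator \<H> z *\<^sub>R e z) -` FD \<in> sets borel" by simp
  moreover have "d ` FD = \<H> \<inter> (\<lambda>z. indicator \<H> z *\<^sub>R e z) -` FD"
    unfolding im by (auto simp: indicator_def)
  ultimately have im_b: "d ` FD \<in> sets borel" using H by simp
  have m: "set_borel_measurable borel \<H> f"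
    unfolding set_borel_measurable_def by (rule borel_measurable_continuous_on_indicator[OF H f])
  have "(\<lambda>z. indicat_real (d ` FD) z *\<^sub>R (indicat_real \<H> z *\<^sub>R f z)) \<in> borel_measurable borel"
    by (rule borel_measurable_scaleR[OF borel_measurable_indicator[OF im_b] m[unfolded set_borel_measurable_def]])
  then have m2: "set_borel_measurable borel (d ` UNIV) (\<lambda>z. indicat_real (d ` FD) z *\<^sub>R f z)"
    unfolding set_borel_measurable_def range_d by (simp add: mult.commute)
  have sub: "d ` FD \<subseteq> \<H>" using range_d by blast
  have "(LINT z:d ` FD|lborel. f z) = (LINT z:d ` UNIV|lborel. indicat_real (d ` FD) z *\<^sub>R f z)"
    unfolding set_lebesgue_integral_def range_d using sub
    by (intro Bochner_Integration.integral_cong) (auto simp: indicator_def)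
  also have "\<dots> = (LINT s:UNIV|lborel. \<bar>jac (D s)\<bar> *\<^sub>R indicat_real (d ` FD) (d s) *\<^sub>R f (d s))"
    by (rule set_integral_substitution_complex(2)[OF open_UNIV D_derivative d_inj smooth_cont[OF smooth_jac] m2])
  also have "\<dots> = (LINT s:FD|lborel. jac (D s) *\<^sub>R f (d s))"
    unfolding set_lebesgue_integral_def using jac_pos d_inj
    by (intro Bochner_Integration.integral_cong) (auto simp: indicator_def less_imp_le inj_image_mem_iff inj_eq)
  finally show ?thesis .
qed

text \<open>The 8 is the 4 from the trace form times the 2 in the denominator of
  \<open>beltrami_d\<close>.\<close>

lemma pair_form_beltrami:
  assumes \<alpha>: "\<alpha> \<in> bundle_forms1 p r"
  shows "pair_form (dPhi_form \<alpha>) (dPhi_form (om \<psi>)) s = - 8 * Re (jac (D s) *\<^sub>R (beltrami (d, r) \<alpha> (d s) * \<psi> (d s)))"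
proof -
  have lin: "linear (\<alpha> s)" and sl: "\<alpha> s v \<in> sl" for v using \<alpha> by (auto simp: bundle_forms1_def)
  let ?K = "\<lambda>v. killing_field (\<alpha> s v) (d s)"
  have E: "l s (dPhi_form \<alpha> s v) (dPhi_form (om \<psi>) s (rot s w)) = - 4 * Re (- \<i> * \<psi> (d s) * D s w * ?K v)" for v w
    unfolding l_om unfolding om_rot unfolding om_def dPhi_form_def dPhi_nilp_pairing[OF sl] ..
  have "pair_form (dPhi_form \<alpha>) (dPhi_form (om \<psi>)) s = - 4 * Re (- \<i> * (D s e2 * ?K e1 - D s e1 * ?K e2) * \<psi> (d s))"
    unfolding pair_form_def E by (simp add: algebra_simps)
  also have "- \<i> * (D s e2 * ?K e1 - D s e1 * ?K e2) = of_real (2 * jac (D s)) * beltrami (d, r) \<alpha> (d s)"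
    using jac_pos[of s] unfolding beltrami_d[of \<alpha> s, OF lin] by simp
  finally show ?thesis by (simp add: scaleR_conv_of_real algebra_simps)
qed

lemma QD_holomorphic: "\<psi> \<in> QD \<Longrightarrow> \<psi> holomorphic_on \<H>"
  by (simp add: quadratic_differentials_def)

lemma QD_scale: "\<phi> \<in> QD \<Longrightarrow> (\<lambda>z. t * \<phi> z) \<in> QD"
  by (auto simp: quadratic_differentials_def mult.assoc intro!: holomorphic_intros)

text \<open>The bridge between the two sides: fibre product, star and dimension three on the left,
  Beltrami coefficients on the right. The right side does not contain c.\<close>

lemma teich_pairing_form_product:
  assumes c: "c > 0" and \<alpha>: "\<alpha> \<in> closed_forms1 p r" and \<psi>: "\<psi> \<in> QD"
  shows "form_product p (G c) l (dPhi_form \<alpha>) (dPhi_form (om \<psi>)) = - 8 * teich_pairing p (d, r) \<alpha> \<psi>"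
proof -
  note a = closed_formsD(1)[OF \<alpha>]
  have fo: "dPhi_form \<alpha> \<in> bundle_forms1 p \<rho>" "dPhi_form (om \<psi>) \<in> bundle_forms1 p \<rho>"
    by (rule closed_formsD(1)[OF dPhi_closed_forms[OF \<alpha>]] closed_formsD(1)[OF dPhi_closed_forms[OF om_closed_forms[OF \<psi>]]])+
  let ?f = "\<lambda>z. beltrami (d, r) \<alpha> z * \<psi> z"
  have cf: "continuous_on \<H> ?f"
    by (intro continuous_on_mult beltrami_continuous[OF a] holomorphic_on_imp_continuous_on[OF QD_holomorphic[OF \<psi>]])
  let ?k = "\<lambda>s. jac (D s) *\<^sub>R ?f (d s)"
  have "continuous_on UNIV (\<lambda>s. ?f (d s))"
    by (rule continuous_on_compose2[OF cf smooth_cont[OF d_smooth]]) (simp add: range_d)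
  then have ck: "continuous_on UNIV ?k" by (rule continuous_on_scaleR[OF smooth_cont[OF smooth_jac]])
  have int: "set_integrable lborel FD ?k"
  proof -
    \<comment> \<open>Integrability is known for real densities \<open>pair_form\<close>. The
      complex density is assembled from its real parts for \<psi> and for -i \<psi>, both quadratic
      differentials.\<close>
    have re: "set_integrable lborel FD (\<lambda>s. Re (c * ?k s))" if "(\<lambda>z. c * \<psi> z) \<in> QD" for c
    proof -
      have "dPhi_form (om (\<lambda>z. c * \<psi> z)) \<in> bundle_forms1 p \<rho>"
        by (rule closed_formsD(1)[OF dPhi_closed_forms[OF om_closed_forms[OF that]]])
      from set_integrable_mult_right[OF invariant_density_integrable[OF pair_form_density[OF fo(1) this]], of "- 1 / 8"]
      show ?thesis unfolding pair_form_beltrami[OF a] by (simp add: mult_ac)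
    qed
    have of_real: "set_integrable lborel FD (\<lambda>s. complex_of_real (b s))" if "set_integrable lborel FD b" for b
      using integrable_of_real[OF that[unfolded set_integrable_def], where 'a=complex]
      by (simp add: set_integrable_def scaleR_conv_of_real)
    have "set_integrable lborel FD (\<lambda>s. of_real (Re (1 * ?k s)) + \<i> * of_real (Re (- \<i> * ?k s)))"
      using \<psi> QD_scale[OF \<psi>, of "- \<i>"]
      by (intro set_integral_add set_integrable_mult_right of_real re) simp_all
    moreover have "of_real (Re (1 * x)) + \<i> * of_real (Re (- \<i> * x)) = x" for x :: complex by (simp add: complex_eq_iff)
    ultimately show ?thesis by (simp only:)
  qed
  have "teich_pairing p (d, r) \<alpha> \<psi> = Re (LINT s:FD|lborel. ?k s)"
    by (simp add: teich_pairing_def integral_over_image[OF cf])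
  also have "\<dots> = (LINT s:FD|lborel. Re (?k s))"
    by (rule set_integral_Re[OF int])
  finally have "- 8 * teich_pairing p (d, r) \<alpha> \<psi> = (LINT s:FD|lborel. - 8 * Re (?k s))"
    by (simp only: set_lebesgue_integral_def real_scaleR_def mult.left_commute[of _ "- 8"] integral_mult_right_zero)
  also have "\<dots> = form_product p (G c) l (dPhi_form \<alpha>) (dPhi_form (om \<psi>))"
    unfolding form_product_eq[OF c fo(2)] pair_form_beltrami[OF a] ..
  finally show ?thesis ..
qed

lemma form_product_exact:
  assumes f: "f \<in> bundle_sections p \<rho>" and \<psi>: "\<psi> \<in> QD"
  shows "(LINT s:FD|lborel. pair_form (d0 f) (dPhi_form (om \<psi>)) s) = 0"
proof -
  have cl: "dPhi_form (om \<psi>) \<in> bundle_forms1 p \<rho>" by (rule closed_formsD(1)[OF dPhi_closed_forms[OF om_closed_forms[OF \<psi>]]])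
  have sm: "smooth_form (dPhi_form (om \<psi>))" by (rule forms1_smooth[OF cl])
  have "delta1 (G 1) l (dPhi_form (om \<psi>)) s = 0" for s
    unfolding delta1_eq[OF zero_less_one sm] codiff_om[OF QD_holomorphic[OF \<psi>]] by (subst sharp_inv_eq(1)[where N=0]) (simp_all add: trace_def)
  then show ?thesis using green(2)[OF zero_less_one f cl] by (simp add: l_0)
qed

text \<open>An exact form contributes the product of df with a coclosed form, which integrates to 0
  by Green's formula. The pairing is thus well defined on classes.\<close>

lemma teich_pairing_cohomologous:
  assumes "(\<alpha>, \<beta>) \<in> cohomologous p r" and \<psi>: "\<psi> \<in> QD"
  shows "teich_pairing p (d, r) \<beta> \<psi> = teich_pairing p (d, r) \<alpha> \<psi>"
proof -
  obtain f where \<alpha>: "\<alpha> \<in> closed_forms1 p r" and \<beta>: "\<beta> \<in> closed_forms1 p r" and f: "f \<in> bundle_sections p r"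
    and df: "\<And>s v. \<beta> s v - \<alpha> s v = d0 f s v" using assms(1) by (auto simp: cohomologous_def)
  let ?\<omega> = "dPhi_form (om \<psi>)" and ?f = "\<lambda>s. dPhi (f s)"
  have sf: "smooth_on UNIV f" using f by (simp add: bundle_sections_def)
  have F: "?f \<in> bundle_sections p \<rho>" by (rule dPhi_section[OF f])
  have \<omega>: "?\<omega> \<in> bundle_forms1 p \<rho>" by (rule closed_formsD(1)[OF dPhi_closed_forms[OF om_closed_forms[OF \<psi>]]])
  have "dPhi_form \<beta> s v = dPhi_form \<alpha> s v + d0 ?f s v" for s v
    unfolding d0_linear_compose[OF linear_dPhi sf] df[symmetric] by (simp add: dPhi_form_def linear_diff[OF linear_dPhi])
  then have "pair_form (dPhi_form \<beta>) ?\<omega> = (\<lambda>s. pair_form (dPhi_form \<alpha>) ?\<omega> s + pair_form (d0 ?f) ?\<omega> s)"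
    by (simp add: fun_eq_iff pair_form_def linear_add[OF l_linear(2)])
  moreover have "set_integrable lborel FD (pair_form (dPhi_form \<alpha>) ?\<omega>)" "set_integrable lborel FD (pair_form (d0 ?f) ?\<omega>)"
    by (intro invariant_density_integrable pair_form_density \<omega> closed_formsD(1)[OF dPhi_closed_forms[OF \<alpha>]] d0_bundle_forms[OF F])+
  ultimately have "(LINT s:FD|lborel. pair_form (dPhi_form \<beta>) ?\<omega> s) = (LINT s:FD|lborel. pair_form (dPhi_form \<alpha>) ?\<omega> s)"
    using form_product_exact[OF F \<psi>] by simp
  then show ?thesis
    using teich_pairing_form_product[OF zero_less_one \<alpha> \<psi>] teich_pairing_form_product[OF zero_less_one \<beta> \<psi>]
    unfolding form_product_eq[OF zero_less_one \<omega>] by simp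
qed

lemma image_FD_Im: "z \<in> d ` FD \<Longrightarrow> Im z > 0" using Im_d by auto

lemma teich_pairing_om: "teich_pairing p (d, r) (om \<phi>) \<psi> = - 2 * wp_cometric p (d, r) \<phi> \<psi>"
proof -
  have "(LINT z:d ` FD|lborel. beltrami (d, r) (om \<phi>) z * \<psi> z) = (LINT z:d ` FD|lborel. - 2 * cnj (\<phi> z * cnj (\<psi> z) * of_real ((Im z)\<^sup>2)))"
    unfolding set_lebesgue_integral_def
    by (intro Bochner_Integration.integral_cong refl)
      (auto simp: indicator_def beltrami_om[OF image_FD_Im] scaleR_conv_of_real mult_ac)
  also have "\<dots> = - 2 * cnj (LINT z:d ` FD|lborel. \<phi> z * cnj (\<psi> z) * of_real ((Im z)\<^sup>2))"
    by (rule set_integral_cnj_scale)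
  finally show ?thesis by (simp add: teich_pairing_def wp_cometric_def)
qed

lemma wp_cometric_sym: "wp_cometric p (d, r) \<phi> \<psi> = wp_cometric p (d, r) \<psi> \<phi>"
proof -
  have "(LINT z:d ` FD|lborel. \<phi> z * cnj (\<psi> z) * of_real ((Im z)\<^sup>2)) = cnj (LINT z:d ` FD|lborel. \<psi> z * cnj (\<phi> z) * of_real ((Im z)\<^sup>2))"
    using set_integral_cnj_scale[of lborel "d ` FD" 1 "\<lambda>z. \<psi> z * cnj (\<phi> z) * of_real ((Im z)\<^sup>2)"] by (simp add: mult_ac)
  then show ?thesis by (simp add: wp_cometric_def)
qed

lemma wp_cometric_scale: "wp_cometric p (d, r) (\<lambda>z. of_real t * \<phi> z) \<psi> = t * wp_cometric p (d, r) \<phi> \<psi>"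
proof -
  have "(LINT z:d ` FD|lborel. of_real t * \<phi> z * cnj (\<psi> z) * of_real ((Im z)\<^sup>2)) = of_real t * (LINT z:d ` FD|lborel. \<phi> z * cnj (\<psi> z) * of_real ((Im z)\<^sup>2))"
    by (simp add: mult.assoc)
  then show ?thesis by (simp add: wp_cometric_def)
qed

text \<open>The chosen differential enters only through its pairings, which the defining property
  fixes. The multiple -2 \<phi> shows that the property can be met.\<close>

lemma wp_dual:
  assumes \<phi>: "\<phi> \<in> QD" and u: "u = cohomologous p r `` {om \<phi>}"
  shows "wp_dual p (d, r) u \<in> QD"
    "\<psi> \<in> QD \<Longrightarrow> wp_cometric p (d, r) (wp_dual p (d, r) u) \<psi> = - 2 * wp_cometric p (d, r) \<phi> \<psi>"
proof -
  let ?P = "\<lambda>\<eta>. \<eta> \<in> QD \<and>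
     (\<forall>\<alpha>\<in>u. \<forall>\<psi>\<in>QD. teich_pairing p (d, r) \<alpha> \<psi> = wp_cometric p (d, r) \<eta> \<psi>)"
  have pair: "teich_pairing p (d, r) \<alpha> \<psi> = - 2 * wp_cometric p (d, r) \<phi> \<psi>" if "\<alpha> \<in> u" "\<psi> \<in> QD" for \<alpha> \<psi>
    using teich_pairing_cohomologous[of "om \<phi>" \<alpha> \<psi>] that teich_pairing_om by (simp add: u)
  have "?P (\<lambda>z. of_real (- 2) * \<phi> z)"
    using QD_scale[OF \<phi>, of "of_real (- 2)"] pair wp_cometric_scale[of "- 2" \<phi>] by simp
  from someI[of ?P, OF this] have W: "?P (wp_dual p (d, r) u)" unfolding wp_dual_def .
  then show "wp_dual p (d, r) u \<in> QD" by blast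
  have "om \<phi> \<in> u" using cohomologous_refl[OF om_closed_forms[OF \<phi>]] by (simp add: u)
  then show "wp_cometric p (d, r) (wp_dual p (d, r) u) \<psi> = - 2 * wp_cometric p (d, r) \<phi> \<psi>"
    if "\<psi> \<in> QD" using W pair that by metis
qed

lemma wp_metric_om:
  assumes "\<phi> \<in> QD" "u = cohomologous p r `` {om \<phi>}"
    "\<psi> \<in> QD" "v = cohomologous p r `` {om \<psi>}"
  shows "wp_metric p (d, r) u v = 4 * wp_cometric p (d, r) \<phi> \<psi>"
  unfolding wp_metric_def
  by (simp add: wp_dual(2)[OF assms(1,2) wp_dual(1)[OF assms(3,4)]] wp_cometric_sym[of \<phi>] wp_dual(2)[OF assms(3,4) assms(1)])

text \<open>The left side is (-8)(-2) = 16 times the cometric of \<phi> and \<psi>; on the right the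
  duals -2 \<phi> and -2 \<psi> give 4 times it.\<close>

lemma L2_metric_om:
  assumes c: "c > 0" and "\<phi> \<in> QD" "u = cohomologous p r `` {om \<phi>}"
    "\<psi> \<in> QD" "v = cohomologous p r `` {om \<psi>}"
  shows "L2_metric p (G c) l (d_teich_embedding p (d, r) u) (d_teich_embedding p (d, r) v) = 4 * wp_metric p (d, r) u v"
  unfolding L2_metric_def harmonic_rep_class[OF c assms(2,3)] harmonic_rep_class[OF c assms(4,5)]
    teich_pairing_form_product[OF c om_closed_forms[OF assms(2)] assms(4)] teich_pairing_om wp_metric_om[OF assms(2-5)]
  by simp

end

section \<open>The Cauchy-Riemann equation on the upper half plane\<close>

text \<open>p and q are the derivatives with respect to z and to its conjugate. As a relation it
  records real differentiability together with both values.\<close>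

definition wirtinger :: "(complex \<Rightarrow> complex) \<Rightarrow> complex \<Rightarrow> complex \<Rightarrow> complex \<Rightarrow> bool" where
  "wirtinger f p q z \<longleftrightarrow> (f has_derivative (\<lambda>v. p * v + q * cnj v)) (at z)"

lemma wirtinger_const: "wirtinger (\<lambda>z. c) 0 0 z"
  by (simp add: wirtinger_def)

lemma wirtinger_ident: "wirtinger (\<lambda>z. z) 1 0 z"
  by (simp add: wirtinger_def)

lemma wirtinger_cnj: "wirtinger cnj 0 1 z"
  using bounded_linear.has_derivative[OF bounded_linear_cnj has_derivative_ident[of "at z"]] by (simp add: wirtinger_def)

lemma wirtinger_field: "(f has_field_derivative p) (at z) \<Longrightarrow> wirtinger f p 0 z"
  by (simp add: wirtinger_def has_field_derivative_def)

lemma wirtinger_holomorphic: "wirtinger f p 0 z \<Longrightarrow> (f has_field_derivative p) (at z)"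
  by (simp add: wirtinger_def has_field_derivative_def)

lemma wirtinger_add: "wirtinger f p q z \<Longrightarrow> wirtinger g p' q' z \<Longrightarrow> wirtinger (\<lambda>z. f z + g z) (p + p') (q + q') z"
  unfolding wirtinger_def by (drule (1) has_derivative_add) (simp add: algebra_simps)

lemma wirtinger_diff: "wirtinger f p q z \<Longrightarrow> wirtinger g p' q' z \<Longrightarrow> wirtinger (\<lambda>z. f z - g z) (p - p') (q - q') z"
  unfolding wirtinger_def by (drule (1) has_derivative_diff) (simp add: algebra_simps)

lemma wirtinger_mult:
  "wirtinger f p q z \<Longrightarrow> wirtinger g p' q' z \<Longrightarrow> wirtinger (\<lambda>z. f z * g z) (f z * p' + p * g z) (f z * q' + q * g z) z"
  unfolding wirtinger_def by (drule (1) has_derivative_mult) (simp add: algebra_simps)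

lemma wirtinger_cmult: "wirtinger f p q z \<Longrightarrow> wirtinger (\<lambda>z. c * f z) (c * p) (c * q) z"
  using wirtinger_mult[OF wirtinger_const[of c]] by fastforce

lemma wirtinger_compose_holomorphic:
  assumes "wirtinger f p q z" "(g has_field_derivative g') (at (f z))"
  shows "wirtinger (\<lambda>z. g (f z)) (g' * p) (g' * q) z"
  using has_derivative_compose[OF assms(1)[unfolded wirtinger_def] assms(2)[unfolded has_field_derivative_def]]
  by (simp add: wirtinger_def algebra_simps)

lemma wirtinger_precompose_holomorphic:
  assumes "(g has_field_derivative g') (at z)" "wirtinger f p q (g z)"
  shows "wirtinger (\<lambda>z. f (g z)) (p * g') (q * cnj g') z"
  using has_derivative_compose[OF assms(1)[unfolded has_field_derivative_def] assms(2)[unfolded wirtinger_def]]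
  by (simp add: wirtinger_def algebra_simps)

lemma wirtinger_inverse:
  assumes "wirtinger f p q z" "f z \<noteq> 0"
  shows "wirtinger (\<lambda>z. 1 / f z) (- p / (f z)\<^sup>2) (- q / (f z)\<^sup>2) z"
proof -
  have "((\<lambda>w. 1 / w) has_field_derivative - 1 / (f z)\<^sup>2) (at (f z))"
    using assms(2) by (auto intro!: derivative_eq_intros simp: power2_eq_square)
  from wirtinger_compose_holomorphic[OF assms(1) this] show ?thesis by simp
qed

lemma wirtinger_unique:
  assumes "wirtinger f p q z" "wirtinger f p' q' z" shows "p = p'" "q = q'"
proof -
  have e: "(\<lambda>v. p * v + q * cnj v) = (\<lambda>v. p' * v + q' * cnj v)"
    using has_derivative_unique assms unfolding wirtinger_def by blast
  have 1: "p + q = p' + q'" using fun_cong[OF e, of 1] by simp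
  have "\<i> * (p - q) = \<i> * (p' - q')" using fun_cong[OF e, of \<i>] by (simp add: algebra_simps)
  then have 2: "p - q = p' - q'" by simp
  have "2 * p = 2 * p'" using arg_cong2[OF 1 2, of "(+)"] by simp
  then show "p = p'" by simp
  then show "q = q'" using 1 by simp
qed

lemma wirtinger_cong:
  assumes "wirtinger f p q z" "open U" "z \<in> U" "\<And>w. w \<in> U \<Longrightarrow> f w = g w"
  shows "wirtinger g p q z"
  using has_derivative_transform_within_open[OF assms(1)[unfolded wirtinger_def] assms(2-4)] by (simp add: wirtinger_def)

lemma wirtingerI:
  assumes "(f has_derivative f') (at z)"
  shows "wirtinger f ((f' 1 - \<i> * f' \<i>) / 2) ((f' 1 + \<i> * f' \<i>) / 2) z"
proof -
  have lin: "linear f'" using assms by (rule has_derivative_linear)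
  have "f' v = ((f' 1 - \<i> * f' \<i>) / 2) * v + ((f' 1 + \<i> * f' \<i>) / 2) * cnj v" for v
  proof -
    have "v = Re v *\<^sub>R 1 + Im v *\<^sub>R \<i>" by (simp add: complex_eq_iff)
    then have "f' v = Re v *\<^sub>R f' 1 + Im v *\<^sub>R f' \<i>" by (metis lin linear_add linear_scale)
    also have "\<dots> = ((f' 1 - \<i> * f' \<i>) / 2) * v + ((f' 1 + \<i> * f' \<i>) / 2) * cnj v"
      by (simp add: complex_eq_iff field_simps)
    finally show ?thesis .
  qed
  then have "f' = (\<lambda>v. ((f' 1 - \<i> * f' \<i>) / 2) * v + ((f' 1 + \<i> * f' \<i>) / 2) * cnj v)" by (rule ext)
  then show ?thesis using assms by (simp add: wirtinger_def)
qed

lemma wirtinger_continuous: "wirtinger f p q z \<Longrightarrow> isCont f z"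
  unfolding wirtinger_def by (rule has_derivative_continuous)

section \<open>The Cauchy-Pompeiu formula\<close>

lemma decay_le_cauchy_majorant:
  assumes "w \<noteq> 0" shows "1 / (1 + cmod w) ^ 4 \<le> cauchy_majorant w"
proof -
  have 1: "0 < 1 + cmod w" by (simp add: add_pos_nonneg)
  have p: "0 < cmod w * (1 + cmod w) ^ 3" by (rule mult_pos_pos[OF _ zero_less_power[OF 1]]) (simp add: assms)
  have "cmod w * (1 + cmod w) ^ 3 \<le> (1 + cmod w) * (1 + cmod w) ^ 3" by (rule mult_right_mono) simp_all
  also have "\<dots> = (1 + cmod w) ^ 4" by (simp add: power_numeral_reduce)
  finally show ?thesis unfolding cauchy_majorant_def by (rule divide_left_mono) (simp_all only: zero_le_one mult_pos_pos[OF zero_less_power[OF 1] p])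
qed

lemma integrable_decay:
  fixes f :: "complex \<Rightarrow> 'b::{banach,second_countable_topology}"
  assumes m: "f \<in> borel_measurable borel" and b: "\<And>w. norm (f w) \<le> C / (1 + cmod w) ^ 4"
  shows "integrable lborel f"
proof (rule Bochner_Integration.integrable_bound)
  show "integrable lborel (\<lambda>w. C * cauchy_majorant w)" by (intro integrable_mult_right integrable_cauchy_majorant)
  show "f \<in> borel_measurable lborel" using m by simp
  have C: "0 \<le> C" using order_trans[OF norm_ge_zero b[of 0]] by simp
  show "AE w in lborel. norm (f w) \<le> norm (C * cauchy_majorant w)"
  proof (rule eventually_mono[OF AE_lborel_singleton[of 0]])
    fix w :: complex assume "w \<noteq> 0"
    from mult_left_mono[OF decay_le_cauchy_majorant[OF this] C]
    have "C / (1 + cmod w) ^ 4 \<le> C * cauchy_majorant w" by simp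
    then show "norm (f w) \<le> norm (C * cauchy_majorant w)" using b[of w] C cauchy_majorant_nonneg[of w] by simp
  qed
qed

abbreviation mass :: "complex \<Rightarrow> real" where
  "mass w \<equiv> 1 / (1 + (cmod w)\<^sup>2)\<^sup>2"

text \<open>The total mass of the approximate identity in \<open>pompeiu\<close>, hence the constant
  of the Cauchy kernel; its value is pi. Positivity is what allows division by it.\<close>

definition plane_mass :: real where
  "plane_mass = (\<integral>w. mass w \<partial>lborel)"

lemma mass_decay: "mass w \<le> 4 / (1 + cmod w) ^ 4"
proof -
  have "(1 + cmod w)\<^sup>2 \<le> 2 * (1 + (cmod w)\<^sup>2)"
    using sum_squares_ge_zero[of "cmod w - 1" 0] by (simp add: power2_eq_square algebra_simps)
  then have "((1 + cmod w)\<^sup>2)\<^sup>2 \<le> (2 * (1 + (cmod w)\<^sup>2))\<^sup>2" by (rule power_mono) simp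
  moreover have "(2 * (1 + (cmod w)\<^sup>2))\<^sup>2 = 4 * (1 + (cmod w)\<^sup>2)\<^sup>2" by (simp only: power_mult_distrib) simp
  moreover have "((1 + cmod w)\<^sup>2)\<^sup>2 = (1 + cmod w) ^ 4" by (simp only: power_mult[symmetric]) simp
  ultimately have "(1 + cmod w) ^ 4 \<le> 4 * (1 + (cmod w)\<^sup>2)\<^sup>2" by (simp only:)
  moreover have "0 < 1 + cmod w" "0 < 1 + (cmod w)\<^sup>2" by (simp_all add: add_pos_nonneg)
  ultimately show ?thesis by (simp add: divide_le_eq le_divide_eq mult.commute)
qed

lemma integrable_mass: "integrable lborel mass"
  by (rule integrable_decay[where C=4]) (use mass_decay in auto)

lemma plane_mass_pos: "plane_mass > 0"
proof -
  have nn: "0 \<le> mass w" for w by simp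
  have "plane_mass \<noteq> 0"
  proof
    assume "plane_mass = 0"
    then have "AE w in lborel. mass w = 0"
      using integral_nonneg_eq_0_iff_AE[OF integrable_mass] nn by (simp add: plane_mass_def)
    moreover have "mass w \<noteq> 0" for w :: complex
    proof -
      have "0 < 1 + (cmod w)\<^sup>2" by (simp add: add_pos_nonneg)
      then show ?thesis by simp
    qed
    ultimately have "AE w in (lborel :: complex measure). False" by simp
    then have "emeasure lborel (UNIV :: complex set) = 0" by (simp add: AE_iff_measurable[OF _ refl])
    then show False by simp
  qed
  moreover have "plane_mass \<ge> 0" unfolding plane_mass_def by (rule Bochner_Integration.integral_nonneg) (rule nn)
  ultimately show ?thesis by simp
qed

lemma integral_affine_complex:
  fixes f :: "complex \<Rightarrow> 'b::{banach,second_countable_topology}"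
  assumes f: "f \<in> borel_measurable borel" and c: "c \<noteq> 0"
  shows "integrable lborel f \<longleftrightarrow> integrable lborel (\<lambda>w. f (z - c * w))"
    "(\<integral>w. f w \<partial>lborel) = (\<integral>w. (cmod c)\<^sup>2 *\<^sub>R f (z - c * w) \<partial>lborel)"
proof -
  let ?g = "\<lambda>w. z - c * w"
  have D: "(?g has_field_derivative - c) (at w)" for w by (auto intro!: derivative_eq_intros)
  have i: "inj_on ?g UNIV" using c by (auto simp: inj_on_def)
  have s: "?g ` UNIV = UNIV"
  proof -
    have "w = ?g ((z - w) / c)" for w using c by simp
    then show ?thesis by (metis surj_def)
  qed
  have m: "set_borel_measurable borel (?g ` UNIV) f" using f by (simp add: s set_borel_measurable_def)
  note S = set_integral_substitution_holomorphic[OF open_UNIV D i continuous_on_const m, unfolded s set_lebesgue_integral_def set_integrable_def]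
  have "integrable lborel f \<longleftrightarrow> integrable lborel (\<lambda>w. (cmod c)\<^sup>2 *\<^sub>R f (z - c * w))" using S(1) by simp
  also have "\<dots> \<longleftrightarrow> integrable lborel (\<lambda>w. f (z - c * w))"
  proof
    assume "integrable lborel (\<lambda>w. (cmod c)\<^sup>2 *\<^sub>R f (z - c * w))"
    from integrable_scaleR_right[of "1 / (cmod c)\<^sup>2", OF this] show "integrable lborel (\<lambda>w. f (z - c * w))" using c by simp
  qed simp
  finally show "integrable lborel f \<longleftrightarrow> integrable lborel (\<lambda>w. f (z - c * w))" .
  show "(\<integral>w. f w \<partial>lborel) = (\<integral>w. (cmod c)\<^sup>2 *\<^sub>R f (z - c * w) \<partial>lborel)"
    using S(2) by simp
qed

text \<open>On the compact support the factor (1 + |z - u|)^3 is bounded, so the kernel is at most a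
  constant times a translate of \<open>cauchy_majorant\<close>.\<close>

lemma integrable_cauchy_kernel:
  fixes q :: "complex \<Rightarrow> complex"
  assumes q: "continuous_on UNIV q" and K: "compact K" "\<And>z. z \<notin> K \<Longrightarrow> q z = 0"
  shows "integrable lborel (\<lambda>u. norm (q u / (z - u)))"
proof -
  have "compact (q ` K)" by (rule compact_continuous_image[OF continuous_on_subset[OF q] K(1)]) simp
  from compact_imp_bounded[OF this, unfolded bounded_pos]
  obtain C where C: "\<And>x. x \<in> K \<Longrightarrow> norm (q x) \<le> C" "C > 0" by auto
  from compact_imp_bounded[OF K(1), unfolded bounded_pos]
  obtain R where R: "\<And>x. x \<in> K \<Longrightarrow> norm x \<le> R" "R > 0" by auto
  define B where "B = C * (1 + cmod z + R) ^ 3"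
  have "integrable lborel (\<lambda>u. cauchy_majorant (z - 1 * u))"
    using integral_affine_complex(1)[of cauchy_majorant 1 z] integrable_cauchy_majorant borel_measurable_integrable[OF integrable_cauchy_majorant] by simp
  then have M: "integrable lborel (\<lambda>u. B * cauchy_majorant (z - u))" by simp
  have qm: "q \<in> borel_measurable borel" by (rule borel_measurable_continuous_onI[OF q])
  show ?thesis
  proof (rule Bochner_Integration.integrable_bound[OF M])
    show "(\<lambda>u. norm (q u / (z - u))) \<in> borel_measurable lborel" using qm by measurable
    have "norm (q u / (z - u)) \<le> B * cauchy_majorant (z - u)" for u
    proof (cases "u \<in> K \<and> u \<noteq> z")
      case True
      let ?r = "cmod (z - u)"
      have r: "?r > 0" "1 + ?r \<le> 1 + cmod z + R" using True R(1)[of u] norm_triangle_ineq4[of z u] by auto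
      have "(1 + ?r) ^ 3 \<le> (1 + cmod z + R) ^ 3" by (rule power_mono[OF r(2)]) simp
      then have "norm (q u) * (1 + ?r) ^ 3 \<le> B" unfolding B_def using C True by (intro mult_mono) auto
      moreover have "0 < (1 + ?r) ^ 3" by (simp add: add_pos_nonneg)
      ultimately have "norm (q u) \<le> B / (1 + ?r) ^ 3" by (simp add: le_divide_eq)
      from divide_right_mono[OF this, of ?r] show ?thesis using r(1) by (simp add: norm_divide cauchy_majorant_def mult.commute)
    next
      case False
      moreover have "B \<ge> 0" using C(2) R(2) by (simp add: B_def)
      ultimately show ?thesis using K(2) cauchy_majorant_nonneg by (auto simp: zero_le_mult_iff)
    qed
    then show "AE u in lborel. norm (norm (q u / (z - u))) \<le> norm (B * cauchy_majorant (z - u))"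
      by (intro always_eventually allI) (simp, meson abs_ge_self order_trans)
  qed
qed

lemma integral_wirtinger:
  assumes W: "\<And>z. wirtinger f (p z) (q z) z" and c: "continuous_on UNIV p" "continuous_on UNIV q"
    and K: "compact K" "\<And>z. z \<notin> K \<Longrightarrow> f z = 0"
  shows "(\<integral>z. q z \<partial>lborel) = 0"
proof -
  define D where "D z v = p z * v + q z * cnj v" for z v
  have fD: "(f has_derivative D z) (at z)" for z using W[of z] by (simp add: wirtinger_def D_def[abs_def])
  have cont: "continuous_on UNIV (\<lambda>z. D z v)" for v unfolding D_def by (intro continuous_intros c)
  have I: "integrable lborel (\<lambda>z. D z v)" "(\<integral>z. D z v \<partial>lborel) = 0" for v
    by (rule integral_derivative_compact_support[of f D, OF fD cont K]; assumption)+
  have "q = (\<lambda>z. (D z 1 + \<i> * D z \<i>) * (1 / 2))" by (simp add: fun_eq_iff D_def algebra_simps)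
  then have "(\<integral>z. q z \<partial>lborel) = (\<integral>z. (D z 1 + \<i> * D z \<i>) * (1 / 2) \<partial>lborel)" by simp
  also have "\<dots> = ((\<integral>z. D z 1 \<partial>lborel) + \<i> * (\<integral>z. D z \<i> \<partial>lborel)) * (1 / 2)"
    by (simp only: integral_mult_left_zero integral_mult_right_zero Bochner_Integration.integral_add[OF I(1) integrable_mult_right[OF I(1)]])
  also have "\<dots> = 0" unfolding I(2) by simp
  finally show ?thesis .
qed

text \<open>The kernel 1 / w is regularised to cnj w / (|w|^2 + e^2), whose derivative with respect
  to cnj w is e^2 / (|w|^2 + e^2)^2. Integration by parts moves it onto g; rescaling by e turns it
  into the fixed density \<open>mass\<close>, and e tends to 0 on both sides by dominated
  convergence.\<close>

theorem pompeiu: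
  assumes W: "\<And>z. wirtinger g (p z) (q z) z" and c: "continuous_on UNIV p" "continuous_on UNIV q"
    and K: "compact K" "\<And>z. z \<notin> K \<Longrightarrow> g z = 0"
  shows "(\<integral>u. q u / (z - u) \<partial>lborel) = of_real plane_mass * g z"
proof -
  have pq0: "p u = 0" "q u = 0" if "u \<notin> K" for u
  proof -
    have "wirtinger g 0 0 u"
      by (rule wirtinger_cong[OF wirtinger_const[of 0], of "- K"]) (use that K compact_imp_closed in \<open>auto simp: closed_def[symmetric]\<close>)
    from wirtinger_unique[OF W[of u] this] show "p u = 0" "q u = 0" by simp_all
  qed
  have gc: "continuous_on UNIV g" by (intro continuous_at_imp_continuous_on ballI wirtinger_continuous[OF W])
  define e where "e n = 1 / real (Suc n)" for n
  have e: "e n > 0" for n by (simp add: e_def)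
  define den where "den n w = w * cnj w + of_real ((e n)\<^sup>2)" for n w
  have den: "den n w = of_real ((cmod w)\<^sup>2 + (e n)\<^sup>2)" for n w by (simp only: den_def of_real_add complex_norm_square)
  have den0: "den n w \<noteq> 0" for n w
  proof -
    have "0 < (cmod w)\<^sup>2 + (e n)\<^sup>2" using e[of n] by (simp add: add_nonneg_pos)
    then show ?thesis unfolding den of_real_eq_0_iff by linarith
  qed
  have denc: "continuous_on A (\<lambda>w. den n (z - w))" for A n unfolding den_def by (intro continuous_intros)
  have by_parts: "(\<integral>u. q u * (cnj (z - u) / den n (z - u)) \<partial>lborel) = (\<integral>u. g u * (of_real ((e n)\<^sup>2) / (den n (z - u))\<^sup>2) \<partial>lborel)" for n
  proof -
    let ?k = "\<lambda>u. cnj (z - u) / den n (z - u)"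
    let ?kp = "\<lambda>u. (cnj (z - u))\<^sup>2 / (den n (z - u))\<^sup>2" and ?kq = "\<lambda>u. - of_real ((e n)\<^sup>2) / (den n (z - u))\<^sup>2"
    have k: "wirtinger ?k (?kp u) (?kq u) u" for u
    proof -
      have 1: "wirtinger (\<lambda>u. z - u) (0 - 1) (0 - 0) u" by (rule wirtinger_diff[OF wirtinger_const wirtinger_ident])
      have "wirtinger (\<lambda>u. cnj z - cnj u) (0 - 0) (0 - 1) u" by (rule wirtinger_diff[OF wirtinger_const wirtinger_cnj])
      then have 2: "wirtinger (\<lambda>u. cnj (z - u)) 0 (- 1) u" by simp
      have 3: "wirtinger (\<lambda>u. den n (z - u)) (- cnj (z - u)) (- (z - u)) u"
        using wirtinger_add[OF wirtinger_mult[OF 1 2] wirtinger_const[of "of_real ((e n)\<^sup>2)"]] by (simp add: den_def)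
      have "wirtinger (\<lambda>u. cnj (z - u) * (1 / den n (z - u)))
          (cnj (z - u) * (- (- cnj (z - u)) / (den n (z - u))\<^sup>2) + 0 * (1 / den n (z - u)))
          (cnj (z - u) * (- (- (z - u)) / (den n (z - u))\<^sup>2) + - 1 * (1 / den n (z - u))) u"
        by (rule wirtinger_mult[OF 2 wirtinger_inverse[OF 3 den0]])
      moreover have "cnj (z - u) * (- (- (z - u)) / (den n (z - u))\<^sup>2) + - 1 * (1 / den n (z - u)) = ?kq u"
      proof -
        have "- 1 * (1 / den n (z - u)) = - den n (z - u) / (den n (z - u))\<^sup>2" using den0 by (simp add: power2_eq_square)
        then show ?thesis by (simp add: diff_divide_distrib[symmetric]) (simp add: den_def algebra_simps)
      qed
      ultimately show ?thesis by (simp add: power2_eq_square)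
    qed
    let ?p = "\<lambda>u. g u * ?kp u + p u * ?k u" and ?q = "\<lambda>u. g u * ?kq u + q u * ?k u"
    have pc: "continuous_on UNIV ?p" and qc: "continuous_on UNIV ?q"
      by (intro continuous_intros c gc denc; simp add: den0)+
    have z0: "g u * ?k u = 0" if "u \<notin> K" for u using K(2)[OF that] by simp
    have Q: "(\<integral>u. ?q u \<partial>lborel) = 0"
      by (rule integral_wirtinger[of "\<lambda>u. g u * ?k u" ?p ?q K, OF wirtinger_mult[OF W k] pc qc K(1) z0])
    have i1: "integrable lborel (\<lambda>u. g u * ?kq u)"
      by (rule integrable_compact_support[OF _ K(1)]) (use K(2) den0 in \<open>auto intro!: continuous_intros gc denc\<close>)
    have i2: "integrable lborel (\<lambda>u. q u * ?k u)"
      by (rule integrable_compact_support[OF _ K(1)]) (use pq0(2) den0 in \<open>auto intro!: continuous_intros c(2) denc\<close>)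
    have "(\<integral>u. q u * ?k u \<partial>lborel) = - (\<integral>u. g u * ?kq u \<partial>lborel)"
      using Q unfolding Bochner_Integration.integral_add[OF i1 i2] by (simp add: add_eq_0_iff)
    then show ?thesis by simp
  qed
  have "(\<lambda>n. \<integral>u. q u * (cnj (z - u) / den n (z - u)) \<partial>lborel) \<longlonglongrightarrow> (\<integral>u. q u / (z - u) \<partial>lborel)"
  proof (rule integral_dominated_convergence[where w="\<lambda>u. norm (q u / (z - u))"])
    have qm: "q \<in> borel_measurable borel" by (rule borel_measurable_continuous_onI[OF c(2)])
    show "(\<lambda>u. q u / (z - u)) \<in> borel_measurable lborel" using qm by measurable
    show "(\<lambda>u. q u * (cnj (z - u) / den n (z - u))) \<in> borel_measurable lborel" for n
      by (simp, rule borel_measurable_continuous_onI) (use den0 in \<open>auto intro!: continuous_intros c(2) denc\<close>)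
    show "integrable lborel (\<lambda>u. norm (q u / (z - u)))" by (rule integrable_cauchy_kernel[OF c(2) K(1) pq0(2)])
    have e0: "e \<longlonglongrightarrow> 0" unfolding e_def by (rule LIMSEQ_Suc[OF lim_1_over_n])
    show "AE u in lborel. (\<lambda>n. q u * (cnj (z - u) / den n (z - u))) \<longlonglongrightarrow> q u / (z - u)"
    proof (rule eventually_mono[OF AE_lborel_singleton[of z]])
      fix u assume "u \<noteq> z"
      then have nz: "z - u \<noteq> 0" by simp
      have "(\<lambda>n. den n (z - u)) \<longlonglongrightarrow> (z - u) * cnj (z - u) + of_real (0\<^sup>2)"
        unfolding den_def by (intro tendsto_intros e0)
      then have "(\<lambda>n. q u * (cnj (z - u) / den n (z - u))) \<longlonglongrightarrow> q u * (cnj (z - u) / ((z - u) * cnj (z - u) + of_real (0\<^sup>2)))"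
        by (intro tendsto_intros) (use nz in auto)
      also have "q u * (cnj (z - u) / ((z - u) * cnj (z - u) + of_real (0\<^sup>2))) = q u / (z - u)" using nz by simp
      finally show "(\<lambda>n. q u * (cnj (z - u) / den n (z - u))) \<longlonglongrightarrow> q u / (z - u)" .
    qed
    have "norm (q u * (cnj (z - u) / den n (z - u))) \<le> norm (q u / (z - u))" if "u \<noteq> z" for u n
    proof -
      define x where "x = cmod (z - u)"
      have x: "x > 0" using that by (simp add: x_def)
      have "x / (x\<^sup>2 + (e n)\<^sup>2) \<le> x / x\<^sup>2" using x by (intro divide_left_mono) (auto simp: add_pos_nonneg)
      then have "x / (x\<^sup>2 + (e n)\<^sup>2) \<le> 1 / x" using x by (simp add: power2_eq_square)
      from mult_left_mono[OF this norm_ge_zero[of "q u"]]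
      show ?thesis unfolding den norm_mult norm_divide complex_mod_cnj norm_of_real x_def[symmetric] by (simp add: abs_of_nonneg)
    qed
    then show "AE u in lborel. norm (q u * (cnj (z - u) / den n (z - u))) \<le> norm (q u / (z - u))" for n
      by (intro eventually_mono[OF AE_lborel_singleton[of z]]) blast
  qed
  moreover have "(\<lambda>n. \<integral>u. g u * (of_real ((e n)\<^sup>2) / (den n (z - u))\<^sup>2) \<partial>lborel) \<longlonglongrightarrow> of_real plane_mass * g z"
  proof -
    have E: "(\<integral>u. g u * (of_real ((e n)\<^sup>2) / (den n (z - u))\<^sup>2) \<partial>lborel) = (\<integral>w. g (z - of_real (e n) * w) * of_real (mass w) \<partial>lborel)" for n
    proof -
      have m: "(\<lambda>u. g u * (of_real ((e n)\<^sup>2) / (den n (z - u))\<^sup>2)) \<in> borel_measurable borel"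
        by (rule borel_measurable_continuous_onI) (use den0 in \<open>auto intro!: continuous_intros gc denc\<close>)
      have nz: "complex_of_real (e n) \<noteq> 0" using e[of n] by simp
      have s: "(cmod (of_real (e n)))\<^sup>2 *\<^sub>R (g (z - of_real (e n) * w) * (of_real ((e n)\<^sup>2) / (den n (z - (z - of_real (e n) * w)))\<^sup>2))
        = g (z - of_real (e n) * w) * of_real (mass w)" for w
      proof -
        have "den n (z - (z - of_real (e n) * w)) = of_real ((e n)\<^sup>2 * (1 + (cmod w)\<^sup>2))"
          unfolding den using e[of n] by (simp add: norm_mult power_mult_distrib algebra_simps)
        moreover have "(e n)\<^sup>2 * ((e n)\<^sup>2 / ((e n)\<^sup>2 * (1 + (cmod w)\<^sup>2))\<^sup>2) = mass w"
          using e[of n] by (simp add: power_mult_distrib power2_eq_square)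
        then have "of_real ((e n)\<^sup>2) * (of_real ((e n)\<^sup>2) / (complex_of_real ((e n)\<^sup>2 * (1 + (cmod w)\<^sup>2)))\<^sup>2) = of_real (mass w)"
          unfolding of_real_power[symmetric] of_real_divide[symmetric] of_real_mult[symmetric] by (rule arg_cong)
        moreover have "(cmod (of_real (e n)))\<^sup>2 *\<^sub>R (x * y) = x * (of_real ((e n)\<^sup>2) * y)" for x y :: complex
          by (simp add: scaleR_conv_of_real)
        ultimately show ?thesis by (simp only:)
      qed
      show ?thesis unfolding integral_affine_complex(2)[OF m nz, of z] s ..
    qed
    have P: "of_real plane_mass * g z = (\<integral>w. g z * of_real (mass w) \<partial>lborel)"
      unfolding plane_mass_def by (simp only: integral_mult_right_zero integral_complex_of_real mult.commute)
    have "compact (g ` K)" by (rule compact_continuous_image[OF continuous_on_subset[OF gc] K(1)]) simp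
    from compact_imp_bounded[OF this, unfolded bounded_pos]
  obtain C where C: "\<And>x. x \<in> K \<Longrightarrow> norm (g x) \<le> C" "C > 0" by auto
    have C': "norm (g x) \<le> C" for x using C K(2)[of x] by (cases "x \<in> K") auto
    show ?thesis unfolding E P
    proof (rule integral_dominated_convergence[where w="\<lambda>w. C * (mass w)"])
      have gm: "g \<in> borel_measurable borel" by (rule borel_measurable_continuous_onI[OF gc])
      show "(\<lambda>w. g z * complex_of_real (mass w)) \<in> borel_measurable lborel" by measurable
      show "(\<lambda>w. g (z - complex_of_real (e n) * w) * complex_of_real (mass w)) \<in> borel_measurable lborel" for n
        using gm by measurable
      show "integrable lborel (\<lambda>w. C * (mass w))" by (rule integrable_mult_right[OF integrable_mass])
      have e0: "e \<longlonglongrightarrow> 0" unfolding e_def by (rule LIMSEQ_Suc[OF lim_1_over_n])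
      have "(\<lambda>n. g (z - complex_of_real (e n) * w)) \<longlonglongrightarrow> g (z - of_real 0 * w)" for w
        by (rule continuous_on_tendsto_compose[OF gc]) (auto intro!: tendsto_intros e0 simp del: of_real_0)
      then show "AE w in lborel. (\<lambda>n. g (z - complex_of_real (e n) * w) * complex_of_real (mass w)) \<longlonglongrightarrow> g z * complex_of_real (mass w)"
        by (intro always_eventually allI tendsto_mult tendsto_const) simp
      show "AE w in lborel. norm (g (z - complex_of_real (e n) * w) * complex_of_real (mass w)) \<le> C * (mass w)" for n
        unfolding norm_mult norm_of_real using C' by (intro always_eventually allI mult_mono) (auto simp: C less_imp_le)
    qed
  qed
  ultimately show ?thesis unfolding by_parts by (rule LIMSEQ_unique)
qed

text \<open>The potential is the integral of \<alpha> along the segment from 0 to x. The last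
  conclusion passes linear constraints on the values to the potential; it is there for the
  trace.\<close>

lemma poincare:
  fixes \<alpha> :: "'b::euclidean_space form1"
  assumes lin: "\<And>s. linear (\<alpha> s)" and sm: "\<And>v. smooth_on UNIV (\<lambda>s. \<alpha> s v)" and closed: "\<And>s v w. d1 \<alpha> s v w = 0"
  obtains E where "smooth_on UNIV E" "d0 E = \<alpha>" "\<And>(L :: 'b \<Rightarrow> real) s. linear L \<Longrightarrow> (\<And>s v. L (\<alpha> s v) = 0) \<Longrightarrow> L (E s) = 0"
proof -
  let ?e1 = "axis 1 1 :: plane" and ?e2 = "axis 2 1 :: plane" and ?I = "indicat_real {0..1::real}"
  define \<beta> where "\<beta> y u v = \<D> (\<lambda>y. \<alpha> y u) y v" for y u v
  have \<beta>: "((\<lambda>y. \<alpha> y u) has_derivative \<beta> y u) (at y)" for y u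
    unfolding \<beta>_def using smooth_derivative[OF sm, of y u] by simp
  have lin_\<beta>: "linear (\<beta> y u)" for y u using \<beta> has_derivative_linear by blast
  have sym: "\<beta> y u v = \<beta> y v u" for y u v using closed[of y u v] by (simp add: d1_def \<beta>_def)
  have cont_\<beta>: "continuous_on A (\<lambda>y. \<beta> y u v)" for A u v
    unfolding \<beta>_def by (rule continuous_on_subset[OF smooth_cont[OF smooth_fderiv[OF sm]]]) simp
  have cont_\<alpha>: "continuous_on A (\<lambda>y. \<alpha> y u)" for A u by (rule continuous_on_subset[OF smooth_cont[OF sm]]) simp
  define h where "h x t v = t *\<^sub>R (x$1 *\<^sub>R \<beta> (t *\<^sub>R x) v ?e1 + x$2 *\<^sub>R \<beta> (t *\<^sub>R x) v ?e2) + \<alpha> (t *\<^sub>R x) v" for x t v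
  have h: "h x t v = t *\<^sub>R \<beta> (t *\<^sub>R x) v x + \<alpha> (t *\<^sub>R x) v" for x t v
    unfolding h_def linear_plane[OF lin_\<beta>, of _ _ x] ..
  have hc: "continuous_on A (\<lambda>z. h (fst z) (snd z) v)" for A v
    unfolding h_def by (intro continuous_intros continuous_on_compose2[OF cont_\<beta>[of UNIV]] continuous_on_compose2[OF cont_\<alpha>[of UNIV]]) auto
  have lin_h: "linear (h x t)" for x t
  proof -
    have "h x t = (\<lambda>v. t *\<^sub>R \<beta> (t *\<^sub>R x) x v + \<alpha> (t *\<^sub>R x) v)" unfolding h[abs_def] by (simp add: sym[of _ _ x])
    then show ?thesis using linear_compose_add[OF linear_compose_scale_right[OF lin_\<beta>] lin] by simp
  qed
  have D: "((\<lambda>x. \<alpha> (t *\<^sub>R x) x) has_derivative h x t) (at x)" for x t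
  proof -
    have c: "((\<lambda>x. \<alpha> (t *\<^sub>R x) u) has_derivative (\<lambda>v. \<beta> (t *\<^sub>R x) u (t *\<^sub>R v))) (at x)" for u
      by (rule has_derivative_compose[OF _ \<beta>]) (auto intro!: derivative_eq_intros)
    have n: "((\<lambda>x. x $ i) has_derivative (\<lambda>v. v $ i)) (at x)" for i :: 2
      by (rule bounded_linear_imp_has_derivative[OF bounded_linear_vec_nth])
    have e: "\<alpha> (t *\<^sub>R x) x = x$1 *\<^sub>R \<alpha> (t *\<^sub>R x) ?e1 + x$2 *\<^sub>R \<alpha> (t *\<^sub>R x) ?e2" for x
      by (rule linear_plane[OF lin])
    have "((\<lambda>x. x$1 *\<^sub>R \<alpha> (t *\<^sub>R x) ?e1 + x$2 *\<^sub>R \<alpha> (t *\<^sub>R x) ?e2) has_derivative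
       (\<lambda>v. (x$1 *\<^sub>R \<beta> (t *\<^sub>R x) ?e1 (t *\<^sub>R v) + v$1 *\<^sub>R \<alpha> (t *\<^sub>R x) ?e1)
          + (x$2 *\<^sub>R \<beta> (t *\<^sub>R x) ?e2 (t *\<^sub>R v) + v$2 *\<^sub>R \<alpha> (t *\<^sub>R x) ?e2))) (at x)"
      by (intro has_derivative_add has_derivative_scaleR n c)
    moreover have "(x$1 *\<^sub>R \<beta> (t *\<^sub>R x) ?e1 (t *\<^sub>R v) + v$1 *\<^sub>R \<alpha> (t *\<^sub>R x) ?e1)
          + (x$2 *\<^sub>R \<beta> (t *\<^sub>R x) ?e2 (t *\<^sub>R v) + v$2 *\<^sub>R \<alpha> (t *\<^sub>R x) ?e2) = h x t v" for v
    proof -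
      have "\<alpha> (t *\<^sub>R x) v = v$1 *\<^sub>R \<alpha> (t *\<^sub>R x) ?e1 + v$2 *\<^sub>R \<alpha> (t *\<^sub>R x) ?e2" by (rule linear_plane[OF lin])
      then show ?thesis
        unfolding h_def by (simp add: linear_scale[OF lin_\<beta>] sym[of _ v ?e1] sym[of _ v ?e2] scaleR_add_right mult.commute)
    qed
    ultimately show ?thesis by (simp only: e[symmetric]) 
  qed
  define E where "E x = (\<integral>t. ?I t *\<^sub>R \<alpha> (t *\<^sub>R x) x \<partial>lborel)" for x
  have int: "integrable lborel (\<lambda>t. ?I t *\<^sub>R \<alpha> (t *\<^sub>R x) x)" for x
  proof -
    have "continuous_on {0..1} (\<lambda>t. \<alpha> (t *\<^sub>R x) x)"
      by (rule continuous_on_compose2[OF cont_\<alpha>[of UNIV]]) (auto intro!: continuous_intros)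
    from borel_integrable_atLeastAtMost'[OF this] show ?thesis by (simp add: set_integrable_def)
  qed
  have ED: "(E has_derivative \<alpha> x0) (at x0)" for x0
  proof -
    have "\<exists>b. \<forall>x\<in>cball x0 1. \<forall>t\<in>{0..1}. norm (h x t v) \<le> b" for v
    proof -
      have "compact ((\<lambda>z. h (fst z) (snd z) v) ` (cball x0 1 \<times> {0..1}))"
        by (intro compact_continuous_image hc compact_Times compact_cball compact_Icc)
      from compact_imp_bounded[OF this, unfolded bounded_pos]
      obtain b where "\<forall>x\<in>cball x0 1. \<forall>t\<in>{0..1}. norm (h x t v) \<le> b" by auto
      then show ?thesis by (rule exI)
    qed
    then obtain b where "\<And>v. \<forall>x\<in>cball x0 1. \<forall>t\<in>{0..1}. norm (h x t v) \<le> b v" by metis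
    then have b: "norm (h x t v) \<le> b v" if "x \<in> cball x0 1" "t \<in> {0..1}" for x t v using that by blast
    have hb: "norm (h x t v) \<le> (b ?e1 + b ?e2) * norm v" if "x \<in> cball x0 1" "t \<in> {0..1}" for x t v
    proof -
      have "h x t v = v$1 *\<^sub>R h x t ?e1 + v$2 *\<^sub>R h x t ?e2" by (rule linear_plane[OF lin_h])
      then have "norm (h x t v) \<le> \<bar>v$1\<bar> * norm (h x t ?e1) + \<bar>v$2\<bar> * norm (h x t ?e2)"
        by (metis norm_triangle_ineq norm_scaleR real_norm_def)
      also have "\<dots> \<le> norm v * b ?e1 + norm v * b ?e2"
        using component_le_norm_cart[of v 1] component_le_norm_cart[of v 2] b[OF that] by (intro add_mono mult_mono) auto
      finally show ?thesis by (simp add: algebra_simps)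
    qed
    have "((\<lambda>x. \<integral>t. ?I t *\<^sub>R \<alpha> (t *\<^sub>R x) x \<partial>lborel) has_derivative (\<lambda>v. \<integral>t. ?I t *\<^sub>R h x0 t v \<partial>lborel)) (at x0)"
    proof (rule has_derivative_integral(2)[where e=1 and B="\<lambda>t. ?I t * (b ?e1 + b ?e2)" and f="\<lambda>x t. ?I t *\<^sub>R \<alpha> (t *\<^sub>R x) x" and f'="\<lambda>x t v. ?I t *\<^sub>R h x t v"])
      show "integrable lborel (\<lambda>t. ?I t *\<^sub>R \<alpha> (t *\<^sub>R x) x)" for x by (rule int)
      show "((\<lambda>x. ?I t *\<^sub>R \<alpha> (t *\<^sub>R x) x) has_derivative (\<lambda>v. ?I t *\<^sub>R h x t v)) (at x)" for x t
        by (rule has_derivative_scaleR_right[OF D])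
      show "norm (?I t *\<^sub>R h x t v) \<le> ?I t * (b ?e1 + b ?e2) * norm v" if "x \<in> ball x0 1" for x t v
        using hb[of x t v] that by (auto simp: indicator_def)
      show "integrable lborel (\<lambda>t. ?I t * (b ?e1 + b ?e2))" by simp
      have "continuous_on {0..1} (\<lambda>t. h x0 t v)" for v
        using continuous_on_compose2[OF hc[of UNIV v], of "{0..1}" "\<lambda>t. (x0, t)"] by (simp add: continuous_intros)
      from borel_measurable_continuous_on_indicator[OF _ this]
      show "(\<lambda>t. ?I t *\<^sub>R h x0 t v) \<in> borel_measurable lborel" for v by simp
    qed simp
    moreover have "(\<integral>t. ?I t *\<^sub>R h x0 t v \<partial>lborel) = \<alpha> x0 v" for v
    proof -
      \<comment> \<open>Closedness has turned the derivative of the integrand in x into the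
        t-derivative of t times \<alpha> at t x, so the integral is evaluated by the fundamental
        theorem.\<close>
      have "((\<lambda>t. t *\<^sub>R \<alpha> (t *\<^sub>R x0) v) has_vector_derivative h x0 t v) (at t within {0..1})" for t
      proof -
        have "((\<lambda>t. \<alpha> (t *\<^sub>R x0) v) has_derivative (\<lambda>u. \<beta> (t *\<^sub>R x0) v (u *\<^sub>R x0))) (at t within {0..1})"
          by (rule has_derivative_compose[OF _ \<beta>]) (auto intro!: derivative_eq_intros)
        from has_derivative_scaleR[OF has_derivative_ident this] show ?thesis
          unfolding has_vector_derivative_def h by (simp add: linear_scale[OF lin_\<beta>] algebra_simps)
      qed
      moreover have "continuous_on {0..1} (\<lambda>t. h x0 t v)"
        using continuous_on_compose2[OF hc[of UNIV v], of "{0..1}" "\<lambda>t. (x0, t)"] by (simp add: continuous_intros)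
      ultimately have "(\<integral>t. ?I t *\<^sub>R h x0 t v \<partial>lborel) = 1 *\<^sub>R \<alpha> (1 *\<^sub>R x0) v - 0 *\<^sub>R \<alpha> (0 *\<^sub>R x0) v"
        by (intro integral_FTC_Icc) auto
      then show ?thesis by simp
    qed
    ultimately show ?thesis unfolding E_def[abs_def] by simp
  qed
  have "Ck_on (Suc k) UNIV E" for k
    by (rule Ck_SucI[OF open_UNIV ED]) (use sm in \<open>simp add: smooth_on_def\<close>)
  then have "smooth_on UNIV E" unfolding smooth_on_def using Ck_Suc by blast
  moreover have "d0 E = \<alpha>" using frechet_eq[OF ED] by (simp add: fun_eq_iff d0_def)
  moreover have "L (E s) = 0" if L: "linear L" "\<And>s v. L (\<alpha> s v) = 0" for L :: "'b \<Rightarrow> real" and s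
    unfolding E_def using integral_bounded_linear[OF _ int, of L s] L by (simp add: linear_conv_bounded_linear[symmetric] linear_scale)
  ultimately show ?thesis by (rule that)
qed

text \<open>The quotient b1 / (b1 + b2), where b1 is positive exactly inside radius 3 e and b2
  exactly outside radius 2 e, so the denominator never vanishes.\<close>

lemma cutoff:
  fixes z0 :: complex
  assumes e: "e > 0"
  obtains h p q where "\<And>z. wirtinger h (p z) (q z) z" "continuous_on UNIV p" "continuous_on UNIV q"
    "\<And>z. dist z0 z < 2 * e \<Longrightarrow> h z = 1" "\<And>z. z \<notin> cball z0 (3 * e) \<Longrightarrow> h z = 0"
proof -
  define b1 where "b1 = ball_bump z0 (3 * e)"
  define b2 where "b2 z = bump ((z - z0) \<bullet> (z - z0) - (2 * e)\<^sup>2)" for z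
  have l: "Ck_on 1 UNIV (\<lambda>x. x - z0)"
    using Ck_add[OF open_UNIV Ck_linear[OF bounded_linear_ident open_UNIV] Ck_const[OF open_UNIV], of 1 "- z0"] by simp
  have "Ck_on 1 UNIV (\<lambda>x. (x - z0) \<bullet> (x - z0) + - (2 * e)\<^sup>2)"
    by (intro Ck_add Ck_const open_UNIV Ck_bilinear[OF bounded_bilinear_inner open_UNIV l l])
  from Ck_compose[OF open_UNIV open_UNIV _ bump_C1 this] have b2: "Ck_on 1 UNIV b2" by (simp add: b2_def[abs_def])
  have b1: "Ck_on 1 UNIV b1" unfolding b1_def by (rule ball_bump_C1)
  have nn: "b1 z \<ge> 0" "b2 z \<ge> 0" for z by (simp_all add: b1_def ball_bump_nonneg b2_def bump_def)
  have pos: "b1 z + b2 z \<noteq> 0" for z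
  proof (cases "z \<in> ball z0 (3 * e)")
    case True
    then show ?thesis using ball_bump_pos[OF True] nn(2)[of z] by (simp add: b1_def)
  next
    case False
    then have "2 * e < norm (z - z0)" using e by (simp add: dist_norm norm_minus_commute)
    then have "(2 * e)\<^sup>2 < (norm (z - z0))\<^sup>2" using e by (intro power_strict_mono) auto
    then have "b2 z > 0" by (simp add: b2_def bump_def power2_norm_eq_inner max_def)
    then show ?thesis using nn(1)[of z] by linarith
  qed
  have o: "open {x. x \<noteq> (0::real)}" by (simp add: open_Collect_neq)
  have "Ck_on 1 UNIV (\<lambda>z. inverse (b1 z + b2 z))"
    by (rule Ck_compose[OF open_UNIV o _ Ck_inverse Ck_add[OF open_UNIV b1 b2]]) (use pos in auto)
  from Ck_bilinear[OF bounded_bilinear_mult open_UNIV b1 this]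
  have "Ck_on (Suc 0) UNIV (\<lambda>z. b1 z * inverse (b1 z + b2 z))" by simp
  then obtain c where c: "c = (\<lambda>z. b1 z * inverse (b1 z + b2 z))" and C1: "Ck_on (Suc 0) UNIV c" by blast
  define c' where "c' z v = \<D> c z v" for z v
  have cD: "(c has_derivative c' z) (at z)" for z unfolding c'_def[abs_def] using Ck_SucD[OF C1] by simp
  have c'c: "continuous_on UNIV (\<lambda>z. c' z v)" for v unfolding c'_def using C1 by simp
  have "((\<lambda>z. complex_of_real (c z)) has_derivative (\<lambda>v. complex_of_real (c' z v))) (at z)" for z
    by (rule bounded_linear.has_derivative[OF bounded_linear_of_real cD])
  from wirtingerI[OF this] show ?thesis
  proof (rule that)
    show "complex_of_real (c z) = 1" if "dist z0 z < 2 * e" for z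
    proof -
      have "norm (z - z0) < 2 * e" using that by (simp add: dist_norm norm_minus_commute)
      then have "(norm (z - z0))\<^sup>2 < (2 * e)\<^sup>2" by (intro power_strict_mono) auto
      then have "b2 z = 0" by (simp add: b2_def bump_def power2_norm_eq_inner max_def)
      then show ?thesis using pos[of z] by (simp add: c)
    qed
    show "complex_of_real (c z) = 0" if "z \<notin> cball z0 (3 * e)" for z
      using ball_bump_zero[OF that] e by (simp add: c b1_def)
  qed (auto intro!: continuous_intros c'c)
qed

text \<open>A bound uniform in both variables on the region P. Being closed under sums and products,
  it reduces kernel estimates to a few bounded factors.\<close>

definition bounded2 :: "(complex \<Rightarrow> complex \<Rightarrow> bool) \<Rightarrow> (complex \<Rightarrow> complex \<Rightarrow> complex) \<Rightarrow> bool" where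
  "bounded2 P f \<longleftrightarrow> (\<exists>C. \<forall>z w. P z w \<longrightarrow> cmod (f z w) \<le> C)"

lemma bounded2I: "(\<And>z w. P z w \<Longrightarrow> cmod (f z w) \<le> C) \<Longrightarrow> bounded2 P f"
  by (auto simp: bounded2_def)

lemma bounded2_const: "bounded2 P (\<lambda>z w. c)"
  by (rule bounded2I) (rule order_refl)

lemma bounded2_add:
  assumes "bounded2 P f" "bounded2 P g" shows "bounded2 P (\<lambda>z w. f z w + g z w)"
proof -
  obtain C C' where "\<And>z w. P z w \<Longrightarrow> cmod (f z w) \<le> C" "\<And>z w. P z w \<Longrightarrow> cmod (g z w) \<le> C'"
    using assms by (auto simp: bounded2_def)
  then show ?thesis by (intro bounded2I[where C="C + C'"] norm_triangle_mono)
qed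

lemma bounded2_mult:
  assumes "bounded2 P f" "bounded2 P g" shows "bounded2 P (\<lambda>z w. f z w * g z w)"
proof -
  obtain C C' where C: "\<And>z w. P z w \<Longrightarrow> cmod (f z w) \<le> C" "\<And>z w. P z w \<Longrightarrow> cmod (g z w) \<le> C'"
    using assms by (auto simp: bounded2_def)
  have "cmod (f z w * g z w) \<le> C * C'" if "P z w" for z w
    unfolding norm_mult using C[OF that] order_trans[OF norm_ge_zero C(1)[OF that]] by (intro mult_mono) auto
  then show ?thesis by (rule bounded2I)
qed

lemma bounded2_minus: "bounded2 P f \<Longrightarrow> bounded2 P (\<lambda>z w. - f z w)"
  by (simp add: bounded2_def)

lemma bounded2_diff: "bounded2 P f \<Longrightarrow> bounded2 P g \<Longrightarrow> bounded2 P (\<lambda>z w. f z w - g z w)"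
  using bounded2_add[OF _ bounded2_minus, of P f g] by simp

lemma bounded2_power: "bounded2 P f \<Longrightarrow> bounded2 P (\<lambda>z w. f z w ^ n)"
  by (induction n) (auto intro: bounded2_const bounded2_mult)

lemmas bounded2_intros = bounded2_const bounded2_add bounded2_mult bounded2_minus bounded2_diff bounded2_power

lemma bounded2_cong: "bounded2 P f \<Longrightarrow> (\<And>z w. P z w \<Longrightarrow> f z w = g z w) \<Longrightarrow> bounded2 P g"
  by (simp add: bounded2_def)

lemma bounded2_cases:
  assumes "bounded2 (\<lambda>z w. P z w \<and> Q z w) f" "bounded2 (\<lambda>z w. P z w \<and> \<not> Q z w) f"
  shows "bounded2 P f"
proof -
  obtain C C' where "\<And>z w. P z w \<and> Q z w \<Longrightarrow> cmod (f z w) \<le> C" "\<And>z w. P z w \<and> \<not> Q z w \<Longrightarrow> cmod (f z w) \<le> C'"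
    using assms by (auto simp: bounded2_def)
  then have "cmod (f z w) \<le> max C C'" if "P z w" for z w using that by (cases "Q z w") (auto simp: le_max_iff_disj)
  then show ?thesis by (rule bounded2I)
qed

text \<open>\<open>hyp_kernel z w\<close> differs from the Cauchy kernel \<open>1 / (z - w)\<close> by \<open>regular_kernel z w\<close>, which is holomorphic
  in \<open>w\<close>; the correction makes it covariant under \<open>SL(2,\<real>)\<close>, a vector field in \<open>z\<close> and a quadratic
  differential in \<open>w\<close>.\<close>

definition hyp_kernel :: "complex \<Rightarrow> complex \<Rightarrow> complex" where
  "hyp_kernel z w = - ((z - cnj z) ^ 3) / ((z - w) * (cnj z - w) ^ 3)"

definition regular_kernel :: "complex \<Rightarrow> complex \<Rightarrow> complex" where
  "regular_kernel z w = - 1 / (cnj z - w) + (z - cnj z) / (cnj z - w)\<^sup>2 - (z - cnj z)\<^sup>2 / (cnj z - w) ^ 3"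

text \<open>With a = z - w and t = cnj z - w the numerator is (a - t)^3; this is the partial
  fraction expansion of -(a - t)^3 / (a t^3).\<close>

lemma hyp_kernel_eq:
  assumes "z \<noteq> w" "cnj z \<noteq> w" shows "hyp_kernel z w = 1 / (z - w) + regular_kernel z w"
proof -
  define a t where "a = z - w" and "t = cnj z - w"
  have nz: "a \<noteq> 0" "t \<noteq> 0" using assms by (auto simp: a_def t_def)
  have s: "z - cnj z = a - t" by (simp add: a_def t_def)
  show ?thesis
    unfolding hyp_kernel_def regular_kernel_def s a_def[symmetric] t_def[symmetric]
    using nz by (simp add: field_simps power2_eq_square power3_eq_cube)
qed

lemma wirtinger_power:
  assumes f: "wirtinger f p q z"
  shows "wirtinger (\<lambda>z. f z ^ n) (of_nat n * f z ^ (n - 1) * p) (of_nat n * f z ^ (n - 1) * q) z"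
  by (rule wirtinger_compose_holomorphic[OF f]) (auto intro!: derivative_eq_intros)

lemma wirtinger_kernel_factors:
  "wirtinger (\<lambda>z. z - w) 1 0 z" "wirtinger (\<lambda>z. cnj z - w) 0 1 z" "wirtinger (\<lambda>z. z - cnj z) 1 (- 1) z"
  using wirtinger_diff[OF wirtinger_ident wirtinger_const, of w z] wirtinger_diff[OF wirtinger_cnj wirtinger_const, of w z]
    wirtinger_diff[OF wirtinger_ident wirtinger_cnj, of z] by simp_all

text \<open>In the derivative with respect to cnj z the pole at z = w cancels. What remains is, up
  to the factor (z - cnj z)^2, the conjugate Bergman kernel for quadratic differentials.\<close>

lemma wirtinger_hyp_kernel:
  assumes "z \<noteq> w" "cnj z \<noteq> w"
  shows "wirtinger (\<lambda>z. hyp_kernel z w)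
    (- 3 * (z - cnj z)\<^sup>2 / ((z - w) * (cnj z - w) ^ 3) + (z - cnj z) ^ 3 / ((z - w)\<^sup>2 * (cnj z - w) ^ 3))
    (3 * (z - cnj z)\<^sup>2 / (cnj z - w) ^ 4) z" (is "wirtinger _ ?p ?q z")
proof -
  define a t s where "a = z - w" and "t = cnj z - w" and "s = z - cnj z"
  have nz: "a \<noteq> 0" "t \<noteq> 0" using assms by (auto simp: a_def t_def)
  have st: "s = a - t" by (simp add: a_def t_def s_def)
  note F = wirtinger_kernel_factors(1,2)[of w z] wirtinger_kernel_factors(3)[of z]
  have d: "wirtinger (\<lambda>z. (z - w) * (cnj z - w) ^ 3) (a * (of_nat 3 * t ^ (3 - 1) * 0) + 1 * t ^ 3) (a * (of_nat 3 * t ^ (3 - 1) * 1) + 0 * t ^ 3) z"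
    unfolding a_def t_def by (rule wirtinger_mult[OF F(1) wirtinger_power[OF F(2)]])
  have d0: "(z - w) * (cnj z - w) ^ 3 \<noteq> 0" using nz by (simp add: a_def t_def)
  have "wirtinger (\<lambda>z. - ((z - cnj z) ^ 3 * (1 / ((z - w) * (cnj z - w) ^ 3))))
     (- (s ^ 3 * (- (t ^ 3) / (a * t ^ 3)\<^sup>2) + (3 * s\<^sup>2) * (1 / (a * t ^ 3))))
     (- (s ^ 3 * (- (3 * a * t\<^sup>2) / (a * t ^ 3)\<^sup>2) + (- 3 * s\<^sup>2) * (1 / (a * t ^ 3)))) z"
    using wirtinger_cmult[OF wirtinger_mult[OF wirtinger_power[OF F(3), of 3] wirtinger_inverse[OF d d0]], of "- 1"]
    by (simp add: a_def[symmetric] t_def[symmetric] s_def[symmetric] mult_ac)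
  moreover have "- (s ^ 3 * (- (t ^ 3) / (a * t ^ 3)\<^sup>2) + (3 * s\<^sup>2) * (1 / (a * t ^ 3))) = ?p"
    unfolding a_def[symmetric] t_def[symmetric] s_def[symmetric] using nz
    by (simp add: field_simps power2_eq_square power3_eq_cube)
  moreover have "- (s ^ 3 * (- (3 * a * t\<^sup>2) / (a * t ^ 3)\<^sup>2) + (- 3 * s\<^sup>2) * (1 / (a * t ^ 3))) = ?q"
  proof -
    have "- (s ^ 3 * (- (3 * a * t\<^sup>2) / (a * t ^ 3)\<^sup>2) + (- 3 * s\<^sup>2) * (1 / (a * t ^ 3))) = 3 * s\<^sup>2 * (s + t) / (a * t ^ 4)"
      using nz by (simp add: field_simps power2_eq_square power3_eq_cube power4_eq_xxxx)
    also have "\<dots> = 3 * s\<^sup>2 / t ^ 4" using nz by (simp add: st)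
    finally show ?thesis by (simp add: t_def s_def)
  qed
  moreover have "(\<lambda>z. - ((z - cnj z) ^ 3 * (1 / ((z - w) * (cnj z - w) ^ 3)))) = (\<lambda>z. hyp_kernel z w)"
    by (simp add: hyp_kernel_def fun_eq_iff)
  ultimately show ?thesis by simp
qed

lemma wirtinger_regular_kernel:
  assumes "cnj z \<noteq> w"
  shows "wirtinger (\<lambda>z. regular_kernel z w)
    (1 / (cnj z - w)\<^sup>2 - 2 * (z - cnj z) / (cnj z - w) ^ 3) (3 * (z - cnj z)\<^sup>2 / (cnj z - w) ^ 4) z" (is "wirtinger _ ?p ?q z")
proof -
  define t s where "t = cnj z - w" and "s = z - cnj z"
  have nz: "t \<noteq> 0" using assms by (auto simp: t_def)
  note F = wirtinger_kernel_factors(1,2)[of w z] wirtinger_kernel_factors(3)[of z]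
  have t0: "cnj z - w \<noteq> 0" using nz by (simp add: t_def)
  note I = wirtinger_inverse[OF F(2) t0]
  have "wirtinger (\<lambda>z. - 1 * (1 / (cnj z - w)) + (z - cnj z) * (1 / (cnj z - w))\<^sup>2 - (z - cnj z)\<^sup>2 * (1 / (cnj z - w)) ^ 3)
     ((1 / t)\<^sup>2 - 2 * s * (1 / t) ^ 3)
     (1 / t\<^sup>2 + (s * (2 * (1 / t) * (- 1 / t\<^sup>2)) - (1 / t)\<^sup>2) - (s\<^sup>2 * (3 * (1 / t)\<^sup>2 * (- 1 / t\<^sup>2)) - 2 * s * (1 / t) ^ 3)) z"
    using wirtinger_diff[OF wirtinger_add[OF wirtinger_cmult[OF I, of "- 1"] wirtinger_mult[OF F(3) wirtinger_power[OF I, of 2]]]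
      wirtinger_mult[OF wirtinger_power[OF F(3), of 2] wirtinger_power[OF I, of 3]]]
    by (simp add: t_def[symmetric] s_def[symmetric])
  moreover have "1 / t\<^sup>2 + (s * (2 * (1 / t) * (- 1 / t\<^sup>2)) - (1 / t)\<^sup>2) - (s\<^sup>2 * (3 * (1 / t)\<^sup>2 * (- 1 / t\<^sup>2)) - 2 * s * (1 / t) ^ 3) = ?q"
    unfolding t_def[symmetric] s_def[symmetric] using nz by (simp add: field_simps power2_eq_square power3_eq_cube power4_eq_xxxx)
  moreover have "(1 / t)\<^sup>2 - 2 * s * (1 / t) ^ 3 = ?p"
    unfolding t_def[symmetric] s_def[symmetric] using nz by (simp add: field_simps power2_eq_square power3_eq_cube)
  moreover have "(\<lambda>z. - 1 * (1 / (cnj z - w)) + (z - cnj z) * (1 / (cnj z - w))\<^sup>2 - (z - cnj z)\<^sup>2 * (1 / (cnj z - w)) ^ 3) = (\<lambda>z. regular_kernel z w)"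
    by (simp add: regular_kernel_def fun_eq_iff power_one_over)
  ultimately show ?thesis by simp
qed

section \<open>Solving the dbar equation with the covariant kernel\<close>

lemma borel_measurable_cnj: "cnj \<in> borel_measurable borel"
  by (rule borel_measurable_continuous_onI) (intro continuous_intros)

lemma norm_wirtinger: "cmod (p * v + q * cnj v) \<le> (cmod p + cmod q) * cmod v"
  by (rule order_trans[OF norm_triangle_ineq]) (simp add: norm_mult distrib_right)

lemma has_derivative_integral_wirtinger:
  fixes Q :: "complex \<Rightarrow> complex \<Rightarrow> complex"
  assumes e: "e > 0" and int: "\<And>z. z \<in> ball z0 e \<Longrightarrow> integrable lborel (Q z)"
    and D: "\<And>z w. z \<in> ball z0 e \<Longrightarrow> wirtinger (\<lambda>z. Q z w) (P z w) (R z w) z"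
    and bP: "\<And>z w. z \<in> ball z0 e \<Longrightarrow> cmod (P z w) \<le> CP / (1 + cmod w) ^ 4"
    and bR: "\<And>z w. z \<in> ball z0 e \<Longrightarrow> cmod (R z w) \<le> CR / (1 + cmod w) ^ 4"
    and P: "P z0 \<in> borel_measurable borel" and R: "R z0 \<in> borel_measurable borel"
  shows "wirtinger (\<lambda>z. \<integral>w. Q z w \<partial>lborel) (\<integral>w. P z0 w \<partial>lborel) (\<integral>w. R z0 w \<partial>lborel) z0"
proof -
  define F where "F z w v = P z w * v + R z w * cnj v" for z w v
  have z0: "z0 \<in> ball z0 e" using e by simp
  have "(\<lambda>w. (CP + CR) / (1 + cmod w) ^ 4) \<in> borel_measurable borel" by measurable
  then have iB: "integrable lborel (\<lambda>w. (CP + CR) / (1 + cmod w) ^ 4)"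
    by (rule integrable_decay[where C="\<bar>CP + CR\<bar>"]) simp
  have bd: "norm (F z w v) \<le> (CP + CR) / (1 + cmod w) ^ 4 * norm v" if "z \<in> ball z0 e" for z w v
  proof -
    have "norm (F z w v) \<le> (cmod (P z w) + cmod (R z w)) * norm v" unfolding F_def by (rule norm_wirtinger)
    also have "\<dots> \<le> (CP / (1 + cmod w) ^ 4 + CR / (1 + cmod w) ^ 4) * norm v"
      by (intro mult_right_mono add_mono bP bR that) simp
    finally show ?thesis by (simp add: add_divide_distrib)
  qed
  have FD: "((\<lambda>z. Q z w) has_derivative F z w) (at z)" if "z \<in> ball z0 e" for z w
    using D[OF that] unfolding wirtinger_def F_def[abs_def] .
  have mF: "(\<lambda>w. F z0 w v) \<in> borel_measurable lborel" for v unfolding F_def using P R by measurable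
  note H = has_derivative_integral[where f=Q and f'=F and M=lborel and ?x0.0=z0, OF e int FD bd iB mF]
  have iP: "integrable lborel (P z0)" and iR: "integrable lborel (R z0)"
    by (rule integrable_decay[OF P bP[OF z0]] integrable_decay[OF R bR[OF z0]])+
  have "(\<integral>w. F z0 w v \<partial>lborel) = (\<integral>w. P z0 w \<partial>lborel) * v + (\<integral>w. R z0 w \<partial>lborel) * cnj v" for v
    unfolding F_def
    by (simp only: Bochner_Integration.integral_add[OF integrable_mult_left[OF iP] integrable_mult_left[OF iR]] integral_mult_left_zero)
  moreover have "((\<lambda>z. \<integral>w. Q z w \<partial>lborel) has_derivative (\<lambda>v. \<integral>w. F z0 w v \<partial>lborel)) (at z0)" by (rule H(2))
  ultimately show ?thesis unfolding wirtinger_def by simp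
qed

text \<open>The real number 1 + |w| taken as a complex number, so that decay estimates can be
  written as products within the calculus of \<open>bounded2\<close>.\<close>

definition weight :: "complex \<Rightarrow> complex" where
  "weight w = of_real (1 + cmod w)"

lemma weight: "cmod (weight w) = 1 + cmod w" "weight w \<noteq> 0" "cmod (1 / weight w) \<le> 1"
proof -
  show n: "cmod (weight w) = 1 + cmod w" by (simp only: weight_def norm_of_real) simp
  have p: "0 < 1 + cmod w" by (simp add: add_pos_nonneg)
  show "weight w \<noteq> 0" by (rule notI) (use n p in simp)
  show "cmod (1 / weight w) \<le> 1" unfolding norm_divide n norm_one divide_le_eq_1_pos[OF p] by simp
qed

lemma weight_quotient:
  assumes e: "e > 0" and x: "cmod x \<ge> e" "cmod w \<le> cmod x + K" and K: "K \<ge> 0"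
  shows "cmod (weight w / x) \<le> 1 + (1 + K) / e"
proof -
  have "1 + K \<le> (1 + K) / e * cmod x" using mult_left_mono[OF x(1), of "(1 + K) / e"] e K by simp
  then have "1 + cmod w \<le> (1 + (1 + K) / e) * cmod x" using x(2) by (simp add: algebra_simps)
  moreover have "x \<noteq> 0" using x(1) e by auto
  ultimately show ?thesis by (simp add: norm_divide weight(1) divide_le_eq)
qed

lemma bounded2_decay:
  assumes "bounded2 (\<lambda>z w. z \<in> ball z0 e) (\<lambda>z w. f z w * weight w ^ 4)"
  obtains C where "\<And>z w. z \<in> ball z0 e \<Longrightarrow> cmod (f z w) \<le> C / (1 + cmod w) ^ 4"
proof -
  obtain C where C: "\<And>z w. z \<in> ball z0 e \<Longrightarrow> cmod (f z w * weight w ^ 4) \<le> C"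
    using assms by (auto simp: bounded2_def)
  have "cmod (f z w) \<le> C / (1 + cmod w) ^ 4" if "z \<in> ball z0 e" for z w
  proof -
    have p: "0 < (1 + cmod w) ^ 4" by (rule zero_less_power) (simp add: add_pos_nonneg)
    show ?thesis using C[OF that, of w] p by (simp add: le_divide_eq norm_mult norm_power weight(1))
  qed
  then show ?thesis by (rule that)
qed

text \<open>V will be the vector field of a potential and mu its Beltrami coefficient. Setting mu to
  0 below the real axis lets all integrals run over the whole complex plane.\<close>

locale dbar_problem =
  fixes V V' mu :: "complex \<Rightarrow> complex" and B :: real
  assumes V: "\<And>z. Im z > 0 \<Longrightarrow> wirtinger V (V' z) (mu z) z"
    and V'_cont: "continuous_on \<H> V'" and mu_cont: "continuous_on \<H> mu"
    and mu_bound: "\<And>z. cmod (mu z) \<le> B" and mu_0: "\<And>z. Im z \<le> 0 \<Longrightarrow> mu z = 0"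
begin

lemma mu_measurable: "mu \<in> borel_measurable borel"
proof -
  have "(\<lambda>z. indicator \<H> z *\<^sub>R mu z) \<in> borel_measurable borel"
    by (rule borel_measurable_continuous_on_indicator[OF _ mu_cont]) (simp add: open_H)
  moreover have "(\<lambda>z. indicator \<H> z *\<^sub>R mu z) = mu"
    using mu_0 by (auto simp: fun_eq_iff indicator_def upper_half_plane_def not_less)
  ultimately show ?thesis by simp
qed

lemma V_cont: "continuous_on \<H> V"
  by (intro continuous_at_imp_continuous_on ballI wirtinger_continuous[OF V]) (simp add: upper_half_plane_def)

text \<open>The Cauchy transform of mu with the covariant kernel. Its dbar derivative is mu up to
  the Bergman term produced by the correction of the kernel.\<close>

definition invariant_field :: "complex \<Rightarrow> complex" where
  "invariant_field z = (\<integral>w. mu w * hyp_kernel z w \<partial>lborel) / of_real plane_mass"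

text \<open>The constant comes from the dbar derivative of the kernel: 3 (z - cnj z)^2 is -12 (Im
  z)^2, and -2 (Im z)^2 is split off to match the Beltrami coefficient of the form of a quadratic
  differential.\<close>

definition bergman :: "complex \<Rightarrow> complex" where
  "bergman z = - (6 / of_real plane_mass) * (\<integral>w. cnj (mu w) / (z - cnj w) ^ 4 \<partial>lborel)"

lemma ball_Im:
  assumes "z \<in> ball z0 e" "e \<le> Im z0 / 8" shows "Im z \<ge> 7 * e" "cmod z \<le> cmod z0 + e"
proof -
  have d: "cmod (z0 - z) < e" using assms(1) by (simp add: dist_norm)
  have "Im z0 - Im z \<le> cmod (z0 - z)" using abs_Im_le_cmod[of "z0 - z"] by simp
  then show "Im z \<ge> 7 * e" using d assms(2) by linarith
  show "cmod z \<le> cmod z0 + e" using norm_triangle_ineq2[of z z0] d by (simp add: norm_minus_commute)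
qed

lemma conj_kernel_bound:
  assumes e: "e > 0" "e \<le> Im z0 / 8" and z: "z \<in> ball z0 e" and w: "Im w > 0"
  shows "cmod (weight w / (cnj z - w)) \<le> 1 + (1 + (cmod z0 + e)) / e"
proof (rule weight_quotient[OF e(1)])
  note b = ball_Im[OF z e(2)]
  show "cmod (cnj z - w) \<ge> e" using abs_Im_le_cmod[of "cnj z - w"] b(1) w e(1) by simp
  show "cmod w \<le> cmod (cnj z - w) + (cmod z0 + e)"
    using norm_triangle_ineq2[of w "cnj z"] b(2) by (simp add: norm_minus_commute)
qed (use e(1) in simp)

text \<open>Pompeiu's formula needs compact support, so V is cut off to g; its dbar derivative u
  still agrees with mu near z0. The choice of e keeps the disc of radius 4 e inside the half
  plane.\<close>

lemma local_cutoff: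
  assumes e: "e > 0" "e \<le> Im z0 / 8"
  obtains g gp u where "\<And>z. wirtinger g (gp z) (u z) z" "continuous_on UNIV gp" "continuous_on UNIV u"
    "\<And>z. dist z0 z < 2 * e \<Longrightarrow> g z = V z \<and> u z = mu z" "\<And>z. z \<notin> cball z0 (3 * e) \<Longrightarrow> g z = 0 \<and> u z = 0"
proof -
  obtain h p q where h: "\<And>z. wirtinger h (p z) (q z) z" "continuous_on UNIV p" "continuous_on UNIV q"
    "\<And>z. dist z0 z < 2 * e \<Longrightarrow> h z = 1" "\<And>z. z \<notin> cball z0 (3 * e) \<Longrightarrow> h z = 0"
    using cutoff[OF e(1), of z0] by metis
  let ?U = "ball z0 (4 * e)" and ?K = "- cball z0 (3 * e)"
  have U: "Im z > 0" if "z \<in> ?U" for z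
  proof -
    have "Im z0 - Im z \<le> cmod (z0 - z)" using abs_Im_le_cmod[of "z0 - z"] by simp
    moreover have "cmod (z0 - z) < 4 * e" using that by (simp add: dist_norm)
    ultimately show ?thesis using e by linarith
  qed
  have UK: "?U \<union> ?K = UNIV" using e(1) by auto
  have oK: "open ?K" by (simp add: open_Compl)
  define g where "g z = (if z \<in> ?U then h z * V z else 0)" for z
  define gp where "gp z = (if z \<in> ?U then h z * V' z + p z * V z else 0)" for z
  define u where "u z = (if z \<in> ?U then h z * mu z + q z * V z else 0)" for z
  have pq0: "p z = 0" "q z = 0" if "z \<in> ?K" for z
  proof -
    have "wirtinger h 0 0 z" by (rule wirtinger_cong[OF wirtinger_const[of 0] oK that]) (use h(5) in auto)
    from wirtinger_unique[OF h(1)[of z] this] show "p z = 0" "q z = 0" by simp_all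
  qed
  have q0: "q z = 0" if "dist z0 z < 2 * e" for z
  proof -
    have "wirtinger h 0 0 z" by (rule wirtinger_cong[OF wirtinger_const[of 1] open_ball[of z0 "2 * e"]]) (use that h(4) in auto)
    from wirtinger_unique(2)[OF h(1)[of z] this] show "q z = 0" .
  qed
  have K0: "g z = 0" "gp z = 0" "u z = 0" if "z \<in> ?K" for z
    using pq0[OF that] h(5)[of z] that by (auto simp: g_def gp_def u_def)
  have W: "wirtinger g (gp z) (u z) z" for z
  proof (cases "z \<in> ?U")
    case True
    have "wirtinger (\<lambda>z. h z * V z) (h z * V' z + p z * V z) (h z * mu z + q z * V z) z"
      by (rule wirtinger_mult[OF h(1) V[OF U[OF True]]])
    then have "wirtinger g (h z * V' z + p z * V z) (h z * mu z + q z * V z) z"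
      by (rule wirtinger_cong[OF _ open_ball True]) (simp add: g_def)
    then show ?thesis using True by (simp add: gp_def u_def)
  next
    case False
    then have z: "z \<in> ?K" using UK by blast
    have "wirtinger g 0 0 z" by (rule wirtinger_cong[OF wirtinger_const[of 0] oK z]) (simp add: K0(1))
    then show ?thesis using K0(2,3)[OF z] by simp
  qed
  have UH: "?U \<subseteq> \<H>" using U by (auto simp: upper_half_plane_def)
  have hc: "continuous_on UNIV h" by (intro continuous_at_imp_continuous_on ballI wirtinger_continuous[OF h(1)])
  note c = continuous_on_subset[OF hc subset_UNIV] continuous_on_subset[OF h(2) subset_UNIV] continuous_on_subset[OF h(3) subset_UNIV]
    continuous_on_subset[OF V_cont UH] continuous_on_subset[OF V'_cont UH] continuous_on_subset[OF mu_cont UH]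
  have glue: "continuous_on UNIV f" if "continuous_on ?U f" "\<And>z. z \<in> ?K \<Longrightarrow> f z = 0" for f :: "complex \<Rightarrow> complex"
  proof -
    have "continuous_on ?K f" by (rule continuous_on_cong[THEN iffD2, OF refl _ continuous_on_const[of _ 0]]) (rule that(2))
    from continuous_on_open_Un[OF open_ball oK that(1) this] show ?thesis by (simp only: UK)
  qed
  have "continuous_on ?U (\<lambda>z. h z * V' z + p z * V z)" "continuous_on ?U (\<lambda>z. h z * mu z + q z * V z)"
    by (intro continuous_on_add continuous_on_mult c)+
  from this[THEN continuous_on_eq] have "continuous_on ?U gp" "continuous_on ?U u" by (simp_all add: gp_def u_def)
  then have "continuous_on UNIV gp" "continuous_on UNIV u" using K0 by (intro glue; blast)+
  moreover have "g z = V z \<and> u z = mu z" if "dist z0 z < 2 * e" for z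
    using that e(1) h(4)[OF that] q0[OF that] by (simp add: g_def u_def)
  ultimately show ?thesis using W K0 by (intro that[of g gp u]) auto
qed

text \<open>The integral defining the field is singular at w = z and cannot be differentiated
  directly. By Pompeiu's formula for the cut-off of V, the difference of V and the field is near z0
  the integral of a kernel Q without singularity, and for Q differentiation under the integral is
  legitimate.\<close>

lemma dbar_solution:
  assumes z0: "Im z0 > 0"
  shows "\<exists>p. wirtinger (\<lambda>z. V z - invariant_field z) p (- 2 * (Im z0)\<^sup>2 *\<^sub>R cnj (bergman z0)) z0"
proof -
  define e where "e = Im z0 / 8"
  have e: "e > 0" "e \<le> Im z0 / 8" using z0 by (simp_all add: e_def)
  obtain g gp u where g: "\<And>z. wirtinger g (gp z) (u z) z" "continuous_on UNIV gp" "continuous_on UNIV u"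
    and g1: "\<And>z. dist z0 z < 2 * e \<Longrightarrow> g z = V z \<and> u z = mu z" and g0: "\<And>z. z \<notin> cball z0 (3 * e) \<Longrightarrow> g z = 0 \<and> u z = 0"
    using local_cutoff[OF e] by metis
  note [measurable] = mu_measurable borel_measurable_continuous_onI[OF g(3)]
  define near where "near w \<longleftrightarrow> dist z0 w < 2 * e" for w
  \<comment> \<open>Q is u / (z - w) minus mu times the covariant kernel. Near z0, where u = mu, the
    two Cauchy singularities cancel and the regular part is left. The branches depend on w only, and
    both have the dbar derivative R.\<close>
  define Q where "Q z w = (if Im w \<le> 0 then 0 else if near w then - 1 * (mu w * regular_kernel z w) else u w * (1 / (z - w)) - mu w * hyp_kernel z w)" for z w
  define P where "P z w = (if Im w \<le> 0 then 0 else if near w then - 1 * (mu w * (1 / (cnj z - w)\<^sup>2 - 2 * (z - cnj z) / (cnj z - w) ^ 3))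
    else u w * (- 1 / (z - w)\<^sup>2) - mu w * (- 3 * (z - cnj z)\<^sup>2 / ((z - w) * (cnj z - w) ^ 3) + (z - cnj z) ^ 3 / ((z - w)\<^sup>2 * (cnj z - w) ^ 3)))" for z w
  define R where "R z w = - mu w * (3 * (z - cnj z)\<^sup>2 / (cnj z - w) ^ 4)" for z w
  have up: "Im z > 0" if "z \<in> ball z0 e" for z using ball_Im(1)[OF that e(2)] e(1) by linarith
  have nz: "cnj z \<noteq> w" if "z \<in> ball z0 e" "Im w > 0" for z w using up[OF that(1)] that(2) by auto
  have far: "z \<noteq> w" "cmod (z - w) \<ge> e" if "z \<in> ball z0 e" "\<not> near w" for z w
  proof -
    have "2 * e \<le> dist z0 z + dist z w" using that(2) dist_triangle[of z0 w z] unfolding near_def by linarith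
    then show "cmod (z - w) \<ge> e" using that(1) by (simp add: dist_norm[of z w])
    then show "z \<noteq> w" using e(1) by auto
  qed
  have near_Im: "Im w > 0" if "dist z0 w \<le> 3 * e" for w
  proof -
    have "Im z0 - Im w \<le> cmod (z0 - w)" using abs_Im_le_cmod[of "z0 - w"] by simp
    then show ?thesis using that e by (simp add: dist_norm)
  qed
  have W: "wirtinger (\<lambda>z. Q z w) (P z w) (R z w) z" if z: "z \<in> ball z0 e" for z w
  proof -
    consider "Im w \<le> 0" | "Im w > 0" "near w" | "Im w > 0" "\<not> near w" by linarith
    then show ?thesis
    proof cases
      case 1 then show ?thesis by (simp add: Q_def P_def R_def mu_0 wirtinger_const)
    next
      case 2
      from wirtinger_cmult[OF wirtinger_cmult[OF wirtinger_regular_kernel[OF nz[OF z 2(1)]], of "mu w"], of "- 1"] 2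
      show ?thesis by (simp add: Q_def P_def R_def)
    next
      case 3
      have "z - w \<noteq> 0" using far(1)[OF z 3(2)] by simp
      from wirtinger_diff[OF wirtinger_cmult[OF wirtinger_inverse[OF wirtinger_kernel_factors(1) this], of "u w"]
          wirtinger_cmult[OF wirtinger_hyp_kernel[OF far(1)[OF z 3(2)] nz[OF z 3(1)]], of "mu w"]] 3
      show ?thesis by (simp add: Q_def P_def R_def)
    qed
  qed
  let ?B = "\<lambda>z w. z \<in> ball z0 e"
  define P0 where "P0 z w \<longleftrightarrow> z \<in> ball z0 e \<and> Im w > 0" for z w
  define P1 where "P1 z w \<longleftrightarrow> P0 z w \<and> near w" for z w
  define P2 where "P2 z w \<longleftrightarrow> P0 z w \<and> \<not> near w" for z w
  \<comment> \<open>Each kernel times the fourth power of the weight is a polynomial in these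
    quantities, the inverse weight and mu, apart from the factors u, which vanish off a compact set,
    and weights at points w near z0. The quotient a is bounded only away from z0, hence the two
    regions.\<close>
  define t s a where "t z w = weight w / (cnj z - w)" and "s z w = z - cnj z" and "a z w = weight w / (z - w)" for z w :: complex
  have mono: "bounded2 P1 f" "bounded2 P2 f" if "bounded2 P0 f" for f
    using that by (auto simp: bounded2_def P1_def P2_def)
  have bt: "bounded2 P0 t" unfolding t_def[abs_def] by (rule bounded2I, rule conj_kernel_bound[OF e]) (auto simp: P0_def)
  have bs: "bounded2 P0 s"
  proof (rule bounded2I)
    fix z w assume "P0 z w"
    then have "cmod z \<le> cmod z0 + e" using ball_Im(2)[OF _ e(2)] by (auto simp: P0_def)
    then show "cmod (s z w) \<le> 2 * (cmod z0 + e)" using norm_triangle_ineq4[of z "cnj z"] by (simp add: s_def)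
  qed
  have bmu: "bounded2 P0 (\<lambda>z w. mu w)" by (rule bounded2I, rule mu_bound)
  have bi: "bounded2 P0 (\<lambda>z w. 1 / weight w)"
  by (rule bounded2I[where C=1]) (rule weight)
  have bm: "bounded2 P1 (\<lambda>z w. weight w)"
  proof (rule bounded2I)
    fix z w assume "P1 z w"
    then have "cmod (w - z0) < 2 * e" by (simp add: P1_def near_def dist_norm norm_minus_commute)
    then have "cmod w \<le> cmod z0 + 2 * e" using norm_triangle_ineq2[of w z0] by linarith
    then show "cmod (weight w) \<le> 1 + cmod z0 + 2 * e" unfolding weight(1) by linarith
  qed
  have ba: "bounded2 P2 a"
    unfolding a_def[abs_def]
  proof (rule bounded2I, rule weight_quotient[OF e(1)])
    fix z w assume "P2 z w"
    then have z: "z \<in> ball z0 e" "\<not> near w" by (auto simp: P2_def P0_def)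
    show "cmod (z - w) \<ge> e" by (rule far(2)[OF z])
    show "cmod w \<le> cmod (z - w) + (cmod z0 + e)"
      using norm_triangle_ineq2[of w z] ball_Im(2)[OF z(1) e(2)] by (simp add: norm_minus_commute)
  qed (use e(1) in simp)
  have bu: "bounded2 P0 (\<lambda>z w. u w * weight w ^ 3)"
  proof -
    have "compact ((\<lambda>w. u w * weight w ^ 3) ` cball z0 (3 * e))"
      unfolding weight_def by (intro compact_continuous_image compact_cball continuous_intros continuous_on_subset[OF g(3) subset_UNIV])
    from compact_imp_bounded[OF this, unfolded bounded_pos]
    obtain b where b: "b > 0" "\<forall>w\<in>cball z0 (3 * e). cmod (u w * weight w ^ 3) \<le> b" by auto
    have "cmod (u w * weight w ^ 3) \<le> b" for w
    proof (cases "w \<in> cball z0 (3 * e)")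
      case True then show ?thesis using b(2) by blast
    next
      case False then show ?thesis using g0[OF False] b(1) by simp
    qed
    then show ?thesis by (rule bounded2I)
  qed
  have split: "bounded2 ?B f" if "bounded2 P1 f" "bounded2 P2 f" "\<And>z w. Im w \<le> 0 \<Longrightarrow> f z w = 0" for f
  proof (rule bounded2_cases[where Q="\<lambda>z w. Im w > 0"])
    show "bounded2 (\<lambda>z w. z \<in> ball z0 e \<and> 0 < Im w) f"
      by (rule bounded2_cases[where Q="\<lambda>z w. near w"]) (use that(1,2) in \<open>simp_all add: P1_def[abs_def] P2_def[abs_def] P0_def\<close>)
    show "bounded2 (\<lambda>z w. z \<in> ball z0 e \<and> \<not> 0 < Im w) f"
      by (rule bounded2I[where C=0]) (use that(3) in auto)
  qed
  have tm: "1 / (cnj z - w) = t z w * (1 / weight w)" for z w using weight(2)[of w] by (simp add: t_def)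
  have am: "1 / (z - w) = a z w * (1 / weight w)" for z w using weight(2)[of w] by (simp add: a_def)
  note bb = bounded2_intros mono(1)[OF bt] mono(1)[OF bs] mono(1)[OF bmu] mono(1)[OF bi] bm
    mono(2)[OF bt] mono(2)[OF bs] mono(2)[OF bmu] mono(2)[OF bi] ba mono(2)[OF bu]
  have cancel: "x / weight w ^ n * weight w ^ n = x" for x w n using weight(2)[of w] by simp
  have bQ: "bounded2 ?B (\<lambda>z w. Q z w * weight w ^ 4)"
  proof (rule split)
    show "bounded2 P1 (\<lambda>z w. Q z w * weight w ^ 4)"
    proof (rule bounded2_cong)
      show "bounded2 P1 (\<lambda>z w. - (mu w * (- (t z w * (1 / weight w)) + s z w * (t z w * (1 / weight w))\<^sup>2 - (s z w)\<^sup>2 * (t z w * (1 / weight w)) ^ 3) * weight w ^ 4))" (is "bounded2 _ ?f")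
        by (intro bb)
      fix z w assume "P1 z w"
      then show "?f z w = Q z w * weight w ^ 4"
        unfolding tm[symmetric] by (simp add: Q_def P1_def P0_def regular_kernel_def s_def power_one_over)
    qed
    show "bounded2 P2 (\<lambda>z w. Q z w * weight w ^ 4)"
    proof (rule bounded2_cong)
      show "bounded2 P2 (\<lambda>z w. (u w * weight w ^ 3) * a z w + mu w * (s z w) ^ 3 * a z w * (t z w) ^ 3)" (is "bounded2 _ ?f")
        by (intro bb)
      fix z w assume P: "P2 z w"
      define M b k y where "M = weight w" and "b = z - w" and "k = cnj z - w" and "y = z - cnj z"
      have "M \<noteq> 0" "b \<noteq> 0" "k \<noteq> 0"
        using P weight(2) far(1)[of z w] nz[of z w] by (auto simp: P2_def P0_def M_def b_def k_def)
      then show "?f z w = Q z w * weight w ^ 4"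
        using P unfolding Q_def P2_def P0_def hyp_kernel_def a_def t_def s_def M_def[symmetric] b_def[symmetric] k_def[symmetric] y_def[symmetric]
        by (simp add: field_simps power_numeral_reduce)
    qed
  qed (simp add: Q_def)
  have bP: "bounded2 ?B (\<lambda>z w. P z w * weight w ^ 4)"
  proof (rule split)
    show "bounded2 P1 (\<lambda>z w. P z w * weight w ^ 4)"
    proof (rule bounded2_cong)
      show "bounded2 P1 (\<lambda>z w. - (mu w * ((t z w * (1 / weight w))\<^sup>2 - 2 * s z w * (t z w * (1 / weight w)) ^ 3) * weight w ^ 4))" (is "bounded2 _ ?f")
        by (intro bb)
      fix z w assume "P1 z w"
      then show "?f z w = P z w * weight w ^ 4"
        unfolding tm[symmetric] by (simp add: P_def P1_def P0_def s_def power_one_over)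
    qed
    show "bounded2 P2 (\<lambda>z w. P z w * weight w ^ 4)"
    proof (rule bounded2_cong)
      show "bounded2 P2 (\<lambda>z w. - ((u w * weight w ^ 3) * (1 / weight w) * (a z w)\<^sup>2) + 3 * mu w * (s z w)\<^sup>2 * a z w * (t z w) ^ 3
          - mu w * (s z w) ^ 3 * (a z w)\<^sup>2 * (t z w) ^ 3 * (1 / weight w))" (is "bounded2 _ ?f")
        by (intro bb)
      fix z w assume P: "P2 z w"
      define M b k where "M = weight w" and "b = z - w" and "k = cnj z - w"
      have nzs: "M \<noteq> 0" "b \<noteq> 0" "k \<noteq> 0"
        using P weight(2) far(1)[of z w] nz[of z w] by (auto simp: P2_def P0_def M_def b_def k_def)
      show "?f z w = P z w * weight w ^ 4"
        using P nzs unfolding P_def P2_def P0_def a_def t_def s_def M_def[symmetric] b_def[symmetric] k_def[symmetric]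
        by (simp add: field_simps power_numeral_reduce)
    qed
  qed (simp add: P_def)
  have bR: "bounded2 ?B (\<lambda>z w. R z w * weight w ^ 4)"
  proof -
    have E: "- mu w * (3 * (s z w)\<^sup>2 * t z w ^ 4) = R z w * weight w ^ 4" for z w
      by (simp add: R_def s_def t_def power_divide)
    have "bounded2 P1 (\<lambda>z w. - mu w * (3 * (s z w)\<^sup>2 * t z w ^ 4))" "bounded2 P2 (\<lambda>z w. - mu w * (3 * (s z w)\<^sup>2 * t z w ^ 4))"
      by (intro bb)+
    then show ?thesis unfolding E by (rule split) (simp add: R_def mu_0)
  qed
  obtain CQ where CQ: "\<And>z w. z \<in> ball z0 e \<Longrightarrow> cmod (Q z w) \<le> CQ / (1 + cmod w) ^ 4" using bounded2_decay[OF bQ] by metis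
  obtain CP where CP: "\<And>z w. z \<in> ball z0 e \<Longrightarrow> cmod (P z w) \<le> CP / (1 + cmod w) ^ 4" using bounded2_decay[OF bP] by metis
  obtain CR where CR: "\<And>z w. z \<in> ball z0 e \<Longrightarrow> cmod (R z w) \<le> CR / (1 + cmod w) ^ 4" using bounded2_decay[OF bR] by metis
  have mK: "(\<lambda>w. mu w * hyp_kernel z w) \<in> borel_measurable borel" for z unfolding hyp_kernel_def by measurable
  have mQ: "Q z \<in> borel_measurable borel" for z unfolding Q_def near_def regular_kernel_def hyp_kernel_def by measurable
  have iQ: "integrable lborel (Q z)" if "z \<in> ball z0 e" for z by (rule integrable_decay[OF mQ CQ[OF that]])
  have mR: "R z0 \<in> borel_measurable borel" unfolding R_def by measurable
  have mP: "P z0 \<in> borel_measurable borel" unfolding P_def near_def by measurable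
  have D: "wirtinger (\<lambda>z. \<integral>w. Q z w \<partial>lborel) (\<integral>w. P z0 w \<partial>lborel) (\<integral>w. R z0 w \<partial>lborel) z0"
    by (rule has_derivative_integral_wirtinger[OF e(1) iQ W CP CR mP mR])
  have \<kappa>: "complex_of_real plane_mass \<noteq> 0" using plane_mass_pos by simp
  have eq: "(1 / of_real plane_mass) * (\<integral>w. Q z w \<partial>lborel) = V z - invariant_field z" if z: "z \<in> ball z0 e" for z
  proof -
    have "integrable lborel (\<lambda>w. norm (u w / (z - w)))" by (rule integrable_cauchy_kernel[OF g(3) compact_cball]) (use g0 in blast)
    then have iu: "integrable lborel (\<lambda>w. u w / (z - w))" by (rule integrable_norm_cancel) measurable
    have AE: "mu w * hyp_kernel z w = u w / (z - w) - Q z w" if "w \<noteq> z" for w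
    proof -
      consider "Im w \<le> 0" | "Im w > 0" "near w" | "Im w > 0" "\<not> near w" by linarith
      then show ?thesis
      proof cases
        case 1
        then have "w \<notin> cball z0 (3 * e)" using near_Im[of w] by auto
        then show ?thesis using g0 1 by (simp add: Q_def mu_0)
      next
        case 2
        then have "u w = mu w" using g1 by (simp add: near_def)
        then show ?thesis using 2 hyp_kernel_eq[of z w] that nz[OF z 2(1)] by (simp add: Q_def algebra_simps)
      next
        case 3 then show ?thesis by (simp add: Q_def)
      qed
    qed
    have "(\<integral>w. mu w * hyp_kernel z w \<partial>lborel) = (\<integral>w. u w / (z - w) - Q z w \<partial>lborel)"
    proof (rule integral_cong_AE)
      show "(\<lambda>w. mu w * hyp_kernel z w) \<in> borel_measurable lborel" using mK by simp
      show "(\<lambda>w. u w / (z - w) - Q z w) \<in> borel_measurable lborel"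
        by (rule borel_measurable_diff) (use iu iQ[OF z] in \<open>auto dest: borel_measurable_integrable\<close>)
      show "AE w in lborel. mu w * hyp_kernel z w = u w / (z - w) - Q z w"
        by (rule eventually_mono[OF AE_lborel_singleton[of z] AE])
    qed
    also have "\<dots> = (\<integral>w. u w / (z - w) \<partial>lborel) - (\<integral>w. Q z w \<partial>lborel)"
      by (rule Bochner_Integration.integral_diff[OF iu iQ[OF z]])
    also have "(\<integral>w. u w / (z - w) \<partial>lborel) = of_real plane_mass * g z"
      by (rule pompeiu[OF g(1) g(2) g(3) compact_cball]) (use g0 in blast)
    also have "g z = V z" using g1[of z] z e(1) by auto
    finally show ?thesis unfolding invariant_field_def using \<kappa> by (simp add: field_simps)
  qed
  have "wirtinger (\<lambda>z. V z - invariant_field z) (1 / of_real plane_mass * (\<integral>w. P z0 w \<partial>lborel)) (1 / of_real plane_mass * (\<integral>w. R z0 w \<partial>lborel)) z0"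
    by (rule wirtinger_cong[OF wirtinger_cmult[OF D] open_ball[of z0 e]]) (use e(1) eq in auto)
  moreover have "1 / of_real plane_mass * (\<integral>w. R z0 w \<partial>lborel) = - 2 * (Im z0)\<^sup>2 *\<^sub>R cnj (bergman z0)"
  proof -
    have "(z0 - cnj z0)\<^sup>2 = - 4 * of_real ((Im z0)\<^sup>2)" by (simp add: complex_eq_iff power2_eq_square)
    then have "R z0 = (\<lambda>w. 12 * of_real ((Im z0)\<^sup>2) * cnj (cnj (mu w) / (z0 - cnj w) ^ 4))"
      by (simp add: fun_eq_iff R_def)
    then have "(\<integral>w. R z0 w \<partial>lborel) = 12 * of_real ((Im z0)\<^sup>2) * cnj (\<integral>w. cnj (mu w) / (z0 - cnj w) ^ 4 \<partial>lborel)"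
      by (simp only: integral_mult_right_zero Bochner_Integration.integral_cnj)
    then show ?thesis by (simp add: bergman_def scaleR_conv_of_real)
  qed
  ultimately show ?thesis by auto
qed

text \<open>For w in the upper half plane z - cnj w stays away from 0, so differentiation under the
  integral applies directly to an integrand holomorphic in z.\<close>

lemma bergman_holomorphic: "bergman holomorphic_on \<H>"
proof -
  have "\<exists>f'. (bergman has_field_derivative f') (at z0)" if z0: "Im z0 > 0" for z0
  proof -
    define e where "e = Im z0 / 8"
    have e: "e > 0" "e \<le> Im z0 / 8" using z0 by (simp_all add: e_def)
    define Q where "Q z w = cnj (mu w) * (1 / (z - cnj w) ^ 4)" for z w
    define P where "P z w = cnj (mu w) * (- (4 * (z - cnj w) ^ 3) / ((z - cnj w) ^ 4)\<^sup>2)" for z w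
    note [measurable] = mu_measurable borel_measurable_cnj
    have up: "Im z > 0" if "z \<in> ball z0 e" for z using ball_Im(1)[OF that e(2)] e(1) by linarith
    have nz: "z - cnj w \<noteq> 0" if "z \<in> ball z0 e" "Im w > 0" for z w
      using up[OF that(1)] that(2) by (auto simp: complex_eq_iff)
    have W: "wirtinger (\<lambda>z. Q z w) (P z w) 0 z" if "z \<in> ball z0 e" for z w
    proof (cases "Im w > 0")
      case True
      note n = nz[OF that True]
      have "((\<lambda>z. cnj (mu w) * (1 / (z - cnj w) ^ 4)) has_field_derivative P z w) (at z)"
        using n unfolding P_def by (auto intro!: derivative_eq_intros simp: power2_eq_square)
      then show ?thesis unfolding Q_def by (rule wirtinger_field)
    next
      case False then show ?thesis by (simp add: Q_def P_def mu_0 wirtinger_const)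
    qed
    let ?B = "\<lambda>z w. z \<in> ball z0 e"
    define t where "t z w = (if Im w > 0 then weight w / (z - cnj w) else 0)" for z w
    have bt: "bounded2 ?B t"
    proof (rule bounded2I)
      fix z w assume z: "z \<in> ball z0 e"
      show "cmod (t z w) \<le> 1 + (1 + (cmod z0 + e)) / e"
      proof (cases "Im w > 0")
        case True
        have "cmod (z - cnj w) = cmod (cnj z - w)" by (metis complex_cnj_cnj complex_cnj_diff complex_mod_cnj)
        then show ?thesis using conj_kernel_bound[OF e z True] True by (simp add: t_def norm_divide)
      next
        case False then show ?thesis using e(1) by (simp add: t_def add_nonneg_nonneg)
      qed
    qed
    have bmu: "bounded2 ?B (\<lambda>z w. cnj (mu w))" by (rule bounded2I[where C=B]) (simp add: mu_bound)
    have bi: "bounded2 ?B (\<lambda>z w. 1 / weight w)"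
    by (rule bounded2I[where C=1]) (rule weight)
    have bQ: "bounded2 ?B (\<lambda>z w. Q z w * weight w ^ 4)"
    proof (rule bounded2_cong)
      show "bounded2 ?B (\<lambda>z w. cnj (mu w) * t z w ^ 4)" by (intro bounded2_intros bmu bt)
      show "cnj (mu w) * t z w ^ 4 = Q z w * weight w ^ 4" for z w
        by (cases "Im w > 0") (simp_all add: Q_def t_def mu_0 power_divide)
    qed
    have bP: "bounded2 ?B (\<lambda>z w. P z w * weight w ^ 4)"
    proof (rule bounded2_cong)
      show "bounded2 ?B (\<lambda>z w. - 4 * cnj (mu w) * t z w ^ 5 * (1 / weight w))" by (intro bounded2_intros bmu bt bi)
      fix z w assume z: "z \<in> ball z0 e"
      define M k where "M = weight w" and "k = z - cnj w"
      show "- 4 * cnj (mu w) * t z w ^ 5 * (1 / weight w) = P z w * weight w ^ 4"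
      proof (cases "Im w > 0")
        case True
        have "M \<noteq> 0" "k \<noteq> 0" using weight(2) nz[OF z True] by (auto simp: M_def k_def)
        then show ?thesis using True unfolding P_def t_def M_def[symmetric] k_def[symmetric]
          by (simp add: field_simps power_numeral_reduce)
      next
        case False then show ?thesis by (simp add: P_def mu_0)
      qed
    qed
    obtain CQ where CQ: "\<And>z w. z \<in> ball z0 e \<Longrightarrow> cmod (Q z w) \<le> CQ / (1 + cmod w) ^ 4" using bounded2_decay[OF bQ] by metis
    obtain CP where CP: "\<And>z w. z \<in> ball z0 e \<Longrightarrow> cmod (P z w) \<le> CP / (1 + cmod w) ^ 4" using bounded2_decay[OF bP] by metis
    have mQ: "Q z \<in> borel_measurable borel" and mP: "P z \<in> borel_measurable borel" for z
      unfolding Q_def P_def by measurable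
    have "wirtinger (\<lambda>z. \<integral>w. Q z w \<partial>lborel) (\<integral>w. P z0 w \<partial>lborel) (\<integral>w. 0 \<partial>(lborel :: complex measure)) z0"
      by (rule has_derivative_integral_wirtinger[where R="\<lambda>z w. 0" and CR=0, OF e(1) integrable_decay[OF mQ CQ] W CP]) (simp_all add: mP)
    from wirtinger_cmult[OF this, of "- (6 / of_real plane_mass)"]
    have "wirtinger (\<lambda>z. - (6 / of_real plane_mass) * (\<integral>w. Q z w \<partial>lborel)) (- (6 / of_real plane_mass) * (\<integral>w. P z0 w \<partial>lborel)) 0 z0"
      by simp
    moreover have "(\<lambda>z. - (6 / of_real plane_mass) * (\<integral>w. Q z w \<partial>lborel)) = bergman"
      by (simp add: fun_eq_iff bergman_def Q_def)
    ultimately show ?thesis using wirtinger_holomorphic by metis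
  qed
  then show ?thesis unfolding holomorphic_on_open[OF open_H] by (auto simp: upper_half_plane_def)
qed

end

section \<open>Harmonic representatives\<close>

lemma SL_inverse_den:
  assumes "A \<in> SL" "mden A z \<noteq> 0"
  shows "1 / mden A z = of_real (A$1$1) - of_real (A$2$1) * mobius A z"
proof -
  have "of_real (A$1$1) * mden A z - of_real (A$2$1) * (of_real (A$1$1) * z + of_real (A$1$2)) = complex_of_real (A$1$1 * A$2$2 - A$1$2 * A$2$1)"
    by (simp add: mden_def algebra_simps)
  then show ?thesis using assms unfolding mobius_eq mden_def[symmetric] SL_det[OF assms(1)] by (simp add: field_simps)
qed

lemma cnj_mobius: "cnj (mobius A z) = mobius A (cnj z)" and cnj_mden: "cnj (mden A z) = mden A (cnj z)"
  by (simp_all add: mobius_eq mden_def)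

text \<open>Each difference in the kernel is divided by the denominators at its two points. Counting
  powers, those at cnj z cancel, two remain below at z, and four remain above at w.\<close>

lemma hyp_kernel_mobius:
  assumes A: "A \<in> SL" and z: "Im z > 0" and w: "Im w > 0"
  shows "hyp_kernel (mobius A z) (mobius A w) = hyp_kernel z w * (mden A w) ^ 4 / (mden A z)\<^sup>2"
proof -
  define P Q R where "P = mden A z" and "Q = mden A (cnj z)" and "R = mden A w"
  have nz: "P \<noteq> 0" "R \<noteq> 0" using mden_nz[OF A] z w by (simp_all add: P_def R_def)
  have Q: "Q \<noteq> 0" using nz(1) by (simp add: P_def Q_def cnj_mden[symmetric])
  have "hyp_kernel (mobius A z) (mobius A w) = - (((z - cnj z) / (P * Q)) ^ 3) / (((z - w) / (P * R)) * ((cnj z - w) / (Q * R)) ^ 3)"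
    unfolding hyp_kernel_def cnj_mobius P_def Q_def R_def
    by (simp only: mobius_diff[OF A nz(1)[unfolded P_def] Q[unfolded Q_def]]
      mobius_diff[OF A nz(1)[unfolded P_def] nz(2)[unfolded R_def]] mobius_diff[OF A Q[unfolded Q_def] nz(2)[unfolded R_def]])
  also have "\<dots> = - ((z - cnj z) ^ 3) / ((z - w) * (cnj z - w) ^ 3) * R ^ 4 / P\<^sup>2"
  proof (cases "z - w = 0 \<or> cnj z - w = 0")
    case True then show ?thesis by auto
  next
    case False
    define x y t where "x = z - cnj z" and "y = z - w" and "t = cnj z - w"
    have "y \<noteq> 0" "t \<noteq> 0" using False by (auto simp: y_def t_def)
    then show ?thesis unfolding x_def[symmetric] y_def[symmetric] t_def[symmetric]
      using nz Q by (simp add: field_simps power_numeral_reduce)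
  qed
  finally show ?thesis by (simp add: hyp_kernel_def P_def R_def)
qed

lemma killing_field_wirtinger:
  "((\<lambda>z. killing_field A z) has_field_derivative of_real (A$1$1 - A$2$2) - 2 * of_real (A$2$1) * z) (at z)"
  unfolding killing_field_def by (auto intro!: derivative_eq_intros)

context hyperbolic_surface
begin

lemma mobius_image:
  assumes g: "\<gamma> \<in> deck p"
  shows "mobius (r \<gamma>) ` \<H> = \<H>" "inj_on (mobius (r \<gamma>)) \<H>"
proof -
  note A = r_SL[OF g]
  show "mobius (r \<gamma>) ` \<H> = \<H>"
  proof (rule equalityI; rule subsetI)
    fix z assume "z \<in> mobius (r \<gamma>) ` \<H>"
    then show "z \<in> \<H>" using Im_mobius_pos[OF A] by (auto simp: upper_half_plane_def)
  next
    fix z assume "z \<in> \<H>"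
    then have z: "d (e z) = z" by (simp add: d_e upper_half_plane_def)
    obtain s where "e z = \<gamma> s" using bij_is_surj[OF deck_bij[OF g]] by (metis surjD)
    then have "z = mobius (r \<gamma>) (d s)" using z d_deck[OF g] by simp
    moreover have "d s \<in> \<H>" using range_d by blast
    ultimately show "z \<in> mobius (r \<gamma>) ` \<H>" by blast
  qed
  show "inj_on (mobius (r \<gamma>)) \<H>"
  proof (rule inj_onI)
    fix z w assume zw: "z \<in> \<H>" "w \<in> \<H>" "mobius (r \<gamma>) z = mobius (r \<gamma>) w"
    then have nz: "mden (r \<gamma>) z \<noteq> 0" "mden (r \<gamma>) w \<noteq> 0" using mden_nz[OF A] by (auto simp: upper_half_plane_def)
    show "z = w" using mobius_diff[OF A nz] zw(3) nz by simp
  qed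
qed

lemma e_mobius:
  assumes "\<gamma> \<in> deck p" "Im z > 0" shows "e (mobius (r \<gamma>) z) = \<gamma> (e z)"
proof -
  have "mobius (r \<gamma>) z = d (\<gamma> (e z))" by (simp add: d_deck[OF assms(1)] d_e[OF assms(2)])
  then show ?thesis by (simp add: e_d)
qed

text \<open>The failure of equivariance of a potential has derivative 0, because its differential is
  equivariant; the constant is the value of the cocycle.\<close>

lemma potential_cocycle:
  fixes E :: "plane \<Rightarrow> real^2^2"
  assumes E: "smooth_on UNIV E" and dE: "d0 E \<in> bundle_forms1 p r" and g: "\<gamma> \<in> deck p"
  obtains C where "\<And>s. E (\<gamma> s) = Ad (r \<gamma>) (E s) + C"
proof -
  let ?f = "\<lambda>s. E (\<gamma> s) - Ad (r \<gamma>) (E s)"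
  have D: "(E has_derivative d0 E s) (at s)" for s unfolding d0_def[abs_def] using smooth_derivative[OF E, of s] by simp
  have "(?f has_derivative (\<lambda>v. d0 E (\<gamma> s) (\<D> \<gamma> s v) - Ad (r \<gamma>) (d0 E s v))) (at s)" for s
    by (intro has_derivative_diff has_derivative_compose[OF deck_derivative[OF g] D] bounded_linear.has_derivative[OF _ D])
      (use linear_Ad in \<open>simp add: linear_conv_bounded_linear[symmetric]\<close>)
  moreover have "d0 E (\<gamma> s) (\<D> \<gamma> s v) - Ad (r \<gamma>) (d0 E s v) = 0" for s v
    using dE g by (auto simp: bundle_forms1_def)
  ultimately have "(?f has_derivative (\<lambda>v. 0)) (at s)" for s by simp
  then have "\<exists>c. \<forall>s\<in>UNIV. ?f s = c" by (intro has_derivative_zero_constant) auto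
  then obtain C where C: "\<And>s. ?f s = C" by blast
  show ?thesis
  proof (rule that[of C])
    show "E (\<gamma> s) = Ad (r \<gamma>) (E s) + C" for s using C[of s] by (simp add: algebra_simps)
  qed
qed

definition potential_field :: "(plane \<Rightarrow> real^2^2) \<Rightarrow> complex \<Rightarrow> complex" where
  "potential_field E z = killing_field (E (e z)) z"

lemma potential_field_mobius:
  assumes C: "\<And>s. E (\<gamma> s) = Ad (r \<gamma>) (E s) + C" and g: "\<gamma> \<in> deck p" and z: "Im z > 0"
  shows "potential_field E (mobius (r \<gamma>) z) = potential_field E z / (mden (r \<gamma>) z)\<^sup>2 + killing_field C (mobius (r \<gamma>) z)"
  unfolding potential_field_def e_mobius[OF g z] C linear_add[OF linear_killing_field] killing_field_Ad[OF r_SL[OF g] z] ..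

text \<open>In the transformation law of the field only F fails to be holomorphic, so the cocycle
  drops out under the dbar derivative. It is applied to V for the invariance of mu, and to V minus
  the invariant field for the weight of the Bergman projection.\<close>

lemma cocycle_dbar:
  assumes W: "\<And>z. Im z > 0 \<Longrightarrow> wirtinger F (P z) (Q z) z" and g: "\<gamma> \<in> deck p"
    and F: "\<And>z. Im z > 0 \<Longrightarrow> F (mobius (r \<gamma>) z) = F z / (mden (r \<gamma>) z)\<^sup>2 + killing_field C (mobius (r \<gamma>) z)"
    and z: "Im z > 0"
  shows "Q (mobius (r \<gamma>) z) * cnj (1 / (mden (r \<gamma>) z)\<^sup>2) = Q z / (mden (r \<gamma>) z)\<^sup>2"
proof -
  note A = r_SL[OF g]
  let ?M = "mobius (r \<gamma>)" and ?q = "mden (r \<gamma>)"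
  have nz: "?q z \<noteq> 0" by (rule mden_nz[OF A z])
  have D: "(?M has_field_derivative 1 / (?q z)\<^sup>2) (at z)" by (rule mobius_derivative[OF A nz])
  have q: "(?q has_field_derivative of_real (r \<gamma> $ 2 $ 1)) (at z)"
    unfolding mden_def[abs_def] by (auto intro!: derivative_eq_intros)
  obtain i' where i: "((\<lambda>z. 1 / (?q z)\<^sup>2) has_field_derivative i') (at z)"
    using DERIV_divide[OF DERIV_const DERIV_power[OF q]] nz by (metis power_not_zero)
  have L: "wirtinger (\<lambda>z. F (?M z)) (P (?M z) * (1 / (?q z)\<^sup>2)) (Q (?M z) * cnj (1 / (?q z)\<^sup>2)) z"
    by (rule wirtinger_precompose_holomorphic[OF D W[OF Im_mobius_pos[OF A z]]])
  have k: "wirtinger (\<lambda>z. killing_field C (?M z)) ((of_real (C$1$1 - C$2$2) - 2 * of_real (C$2$1) * ?M z) * (1 / (?q z)\<^sup>2)) 0 z"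
    by (rule wirtinger_field[OF DERIV_chain2[OF killing_field_wirtinger D]])
  have "wirtinger (\<lambda>z. F z * (1 / (?q z)\<^sup>2) + killing_field C (?M z))
     ((F z * i' + P z * (1 / (?q z)\<^sup>2)) + (of_real (C$1$1 - C$2$2) - 2 * of_real (C$2$1) * ?M z) * (1 / (?q z)\<^sup>2))
     ((F z * 0 + Q z * (1 / (?q z)\<^sup>2)) + 0) z"
    by (rule wirtinger_add[OF wirtinger_mult[OF W[OF z] wirtinger_field[OF i]] k])
  then have "wirtinger (\<lambda>z. F (?M z)) ((F z * i' + P z * (1 / (?q z)\<^sup>2)) + (of_real (C$1$1 - C$2$2) - 2 * of_real (C$2$1) * ?M z) * (1 / (?q z)\<^sup>2))
     ((F z * 0 + Q z * (1 / (?q z)\<^sup>2)) + 0) z"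
    by (rule wirtinger_cong[OF _ open_H]) (use z F in \<open>simp_all add: upper_half_plane_def\<close>)
  from wirtinger_unique(2)[OF L this] show ?thesis by simp
qed

text \<open>Finitely many compact discs meet every deck orbit.\<close>

lemma invariant_bounded:
  fixes b :: "plane \<Rightarrow> real"
  assumes b: "continuous_on UNIV b" and inv: "\<And>\<gamma> s. \<gamma> \<in> deck p \<Longrightarrow> b (\<gamma> s) = b s"
  obtains C where "\<And>s. b s \<le> C"
proof -
  obtain F where F: "finite F" "S = (\<Union>c\<in>F. p ` ball c (inj_radius c))" using finite_ball_cover by blast
  have "compact (\<Union>c\<in>F. cball c (inj_radius c))" by (intro compact_UN F(1)) auto
  from compact_imp_bounded[OF compact_continuous_image[OF continuous_on_subset[OF b subset_UNIV] this], unfolded bounded_pos]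
  obtain C where C: "\<forall>c\<in>F. \<forall>x\<in>cball c (inj_radius c). \<bar>b x\<bar> \<le> C" by auto
  have "b s \<le> C" for s
  proof -
    have "p s \<in> (\<Union>c\<in>F. p ` ball c (inj_radius c))" using F(2) p_in by blast
    then obtain c x where x: "c \<in> F" "x \<in> ball c (inj_radius c)" "p s = p x" by blast
    obtain \<gamma> where "\<gamma> \<in> deck p" "\<gamma> s = x" using deck_transitive[OF x(3)] by blast
    then have "b s = b x" using inv by metis
    moreover have "x \<in> cball c (inj_radius c)" using x(2) by simp
    then have "\<bar>b x\<bar> \<le> C" using C x(1) by blast
    ultimately show ?thesis by simp
  qed
  then show ?thesis by (rule that)
qed

lemma potential_field_wirtinger:
  assumes E: "smooth_on UNIV E" and z: "Im z > 0"
  shows "wirtinger (potential_field E)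
    ((killing_field (d0 E (e z) (\<D> e z 1)) z - \<i> * killing_field (d0 E (e z) (\<D> e z \<i>)) z) / 2
      + (of_real (E (e z) $ 1 $ 1 - E (e z) $ 2 $ 2) - 2 * of_real (E (e z) $ 2 $ 1) * z))
    (beltrami (d, r) (d0 E) z) z"
proof -
  let ?g = "of_real (E (e z) $ 1 $ 1 - E (e z) $ 2 $ 2) - 2 * of_real (E (e z) $ 2 $ 1) * z"
  let ?k = "\<lambda>v. d0 E (e z) (\<D> e z v)"
  have zH: "z \<in> \<H>" using z by (simp add: upper_half_plane_def)
  have De: "(e has_derivative \<D> e z) (at z)" by (rule smooth_derivative[OF e_smooth zH])
  have DE: "(E has_derivative d0 E s) (at s)" for s unfolding d0_def[abs_def] using smooth_derivative[OF E, of s] by simp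
  have B: "((\<lambda>z. E (e z)) has_derivative ?k) (at z)" by (rule has_derivative_compose[OF De DE])
  have n: "((\<lambda>z. complex_of_real (E (e z) $ i $ j)) has_derivative (\<lambda>v. complex_of_real (?k v $ i $ j))) (at z)" for i j
    by (intro bounded_linear.has_derivative[OF bounded_linear_of_real] bounded_linear.has_derivative[OF bounded_linear_vec_nth] B)
  have "((\<lambda>z. of_real (E (e z) $ 1 $ 2) + (of_real (E (e z) $ 1 $ 1) - of_real (E (e z) $ 2 $ 2)) * z - of_real (E (e z) $ 2 $ 1) * (z * z)) has_derivative
     (\<lambda>v. of_real (?k v $ 1 $ 2) + ((of_real (E (e z) $ 1 $ 1) - of_real (E (e z) $ 2 $ 2)) * v + (of_real (?k v $ 1 $ 1) - of_real (?k v $ 2 $ 2)) * z)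
       - (of_real (E (e z) $ 2 $ 1) * (z * v + v * z) + of_real (?k v $ 2 $ 1) * (z * z)))) (at z)"
    by (intro has_derivative_diff has_derivative_add has_derivative_mult n has_derivative_ident)
  moreover have "(\<lambda>v. of_real (?k v $ 1 $ 2) + ((of_real (E (e z) $ 1 $ 1) - of_real (E (e z) $ 2 $ 2)) * v + (of_real (?k v $ 1 $ 1) - of_real (?k v $ 2 $ 2)) * z)
       - (of_real (E (e z) $ 2 $ 1) * (z * v + v * z) + of_real (?k v $ 2 $ 1) * (z * z))) = (\<lambda>v. killing_field (?k v) z + ?g * v)"
    by (simp add: fun_eq_iff killing_field_def power2_eq_square algebra_simps)
  ultimately have "(potential_field E has_derivative (\<lambda>v. killing_field (?k v) z + ?g * v)) (at z)"
    by (simp add: potential_field_def[abs_def] killing_field_def power2_eq_square)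
  from wirtingerI[OF this] show ?thesis
    by (simp add: beltrami_def Let_def e_def[symmetric] algebra_simps add_divide_distrib diff_divide_distrib)
qed

end

lemma trace_linear: "linear (trace :: real^'n^'n \<Rightarrow> real)"
  by (rule linearI) (simp_all add: trace_def sum.distrib sum_distrib_left)

context hyperbolic_surface
begin

text \<open>The modulus of the Beltrami coefficient is invariant under deck transformations and
  hence bounded, although the half plane is not compact. The bound makes the kernel integrals
  converge.\<close>

lemma bounded_dbar_problem:
  assumes E: "smooth_on UNIV E" and dE: "d0 E \<in> bundle_forms1 p r"
  defines "mu \<equiv> \<lambda>z. if Im z > 0 then beltrami (d, r) (d0 E) z else 0"
  obtains V' B where "dbar_problem (potential_field E) V' mu B"
proof -
  define V' where "V' z = (killing_field (d0 E (e z) (\<D> e z 1)) z - \<i> * killing_field (d0 E (e z) (\<D> e z \<i>)) z) / 2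
      + (of_real (E (e z) $ 1 $ 1 - E (e z) $ 2 $ 2) - 2 * of_real (E (e z) $ 2 $ 1) * z)" for z
  have W: "wirtinger (potential_field E) (V' z) (beltrami (d, r) (d0 E) z) z" if "Im z > 0" for z
    unfolding V'_def by (rule potential_field_wirtinger[OF E that])
  have c: "continuous_on \<H> (\<lambda>z. E (e z) $ i $ j)"
    "continuous_on \<H> (\<lambda>z. d0 E (e z) (\<D> e z v) $ i $ j)" for i j v
  proof -
    have "smooth_on \<H> (\<lambda>z. d0 E (e z) (\<D> e z v))"
      by (rule smooth_linear_apply[OF open_H linear_d0[OF E]
            smooth_compose[OF smooth_d0[OF E] e_smooth _ open_H open_UNIV] smooth_fderiv[OF e_smooth]]) simp
    then show "continuous_on \<H> (\<lambda>z. d0 E (e z) (\<D> e z v) $ i $ j)"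
      by (intro smooth_cont smooth_nth open_H)
    have "smooth_on \<H> (\<lambda>z. E (e z))"
      by (rule smooth_compose[OF E e_smooth _ open_H open_UNIV]) simp
    then show "continuous_on \<H> (\<lambda>z. E (e z) $ i $ j)"
      by (intro smooth_cont smooth_nth open_H)
  qed
  have V'c: "continuous_on \<H> V'"
  proof -
    have k: "continuous_on \<H> (\<lambda>z. killing_field (d0 E (e z) (\<D> e z v)) z)" for v
      unfolding killing_field_def of_real_diff
      by (intro continuous_on_add continuous_on_diff continuous_on_mult continuous_on_of_real continuous_on_power continuous_on_id c)
    have "continuous_on \<H> (\<lambda>z. of_real (E (e z) $ 1 $ 1 - E (e z) $ 2 $ 2) - 2 * of_real (E (e z) $ 2 $ 1) * z)"
      unfolding of_real_diff by (intro continuous_on_diff continuous_on_mult continuous_on_of_real continuous_on_id continuous_on_const c)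
    from continuous_on_add[OF continuous_on_divide[OF continuous_on_diff[OF k[of 1] continuous_on_mult[OF continuous_on_const[of _ \<i>] k[of \<i>]]]
      continuous_on_const[of _ 2]] this]
    show ?thesis by (simp add: V'_def[abs_def])
  qed
  have bc: "continuous_on \<H> (beltrami (d, r) (d0 E))" by (rule beltrami_continuous[OF dE])
  define b where "b s = cmod (beltrami (d, r) (d0 E) (d s))" for s
  have b1: "continuous_on UNIV b" unfolding b_def
    by (intro continuous_on_norm continuous_on_compose2[OF bc smooth_cont[OF d_smooth]]) (simp add: range_d)
  have b2: "b (\<gamma> s) = b s" if g: "\<gamma> \<in> deck p" for \<gamma> s
  proof -
    obtain C where C: "\<And>s. E (\<gamma> s) = Ad (r \<gamma>) (E s) + C" using potential_cocycle[OF E dE g] by blast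
    have "beltrami (d, r) (d0 E) (mobius (r \<gamma>) (d s)) * cnj (1 / (mden (r \<gamma>) (d s))\<^sup>2) = beltrami (d, r) (d0 E) (d s) / (mden (r \<gamma>) (d s))\<^sup>2"
      by (rule cocycle_dbar[OF W g potential_field_mobius[of E \<gamma> C, OF C g] Im_d])
    from arg_cong[OF this, of cmod] show ?thesis
      using mden_nz[OF r_SL[OF g] Im_d] by (simp add: b_def d_deck[OF g] norm_mult norm_divide norm_power)
  qed
  have "\<exists>B. \<forall>s. b s \<le> B"
  proof (rule invariant_bounded[OF b1])
    show "b (\<gamma> s) = b s" if "\<gamma> \<in> deck p" for \<gamma> s by (rule b2[OF that])
    show "\<exists>B. \<forall>s. b s \<le> B" if "\<And>s. b s \<le> C" for C using that by blast
  qed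
  then obtain B where B: "\<And>s. cmod (beltrami (d, r) (d0 E) (d s)) \<le> B" unfolding b_def by blast
  have bd: "cmod (mu z) \<le> B" for z
  proof (cases "Im z > 0")
    case True
    then show ?thesis using B[of "e z"] by (simp add: mu_def d_e)
  next
    case False
    then show ?thesis using order_trans[OF norm_ge_zero B] by (simp add: mu_def)
  qed
  have "dbar_problem (potential_field E) V' mu B"
  proof
    show "wirtinger (potential_field E) (V' z) (mu z) z" if "Im z > 0" for z using W[OF that] that by (simp add: mu_def)
    show "continuous_on \<H> mu"
      by (rule continuous_on_eq[OF bc]) (simp add: mu_def upper_half_plane_def)
  qed (use V'c bd in \<open>auto simp: mu_def\<close>)
  then show ?thesis by (rule that)
qed

text \<open>Change of variables in w: the squared modulus of the derivative, the transformation law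
  of mu and the fourth power of the denominator at w cancel, and the inverse square at z
  remains.\<close>

lemma invariant_field_mobius:
  assumes P: "dbar_problem V V' mu B"
    and mu: "\<And>z. Im z > 0 \<Longrightarrow> mu (mobius (r \<gamma>) z) * cnj (1 / (mden (r \<gamma>) z)\<^sup>2) = mu z / (mden (r \<gamma>) z)\<^sup>2"
    and g: "\<gamma> \<in> deck p" and z: "Im z > 0"
  shows "dbar_problem.invariant_field mu (mobius (r \<gamma>) z) = dbar_problem.invariant_field mu z / (mden (r \<gamma>) z)\<^sup>2"
proof -
  note A = r_SL[OF g]
  interpret dbar_problem V V' mu B by (rule P)
  note [measurable] = mu_measurable
  let ?M = "mobius (r \<gamma>)" and ?q = "mden (r \<gamma>)"
  let ?f = "\<lambda>w. mu w * hyp_kernel (?M z) w"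
  have HI: "(LINT w:\<H>|lborel. mu w * k w) = (\<integral>w. mu w * k w \<partial>lborel)" for k
    unfolding set_lebesgue_integral_def using mu_0
    by (intro Bochner_Integration.integral_cong refl) (auto simp: indicator_def upper_half_plane_def)
  have nz: "?q w \<noteq> 0" if "w \<in> \<H>" for w using mden_nz[OF A] that by (simp add: upper_half_plane_def)
  have D: "(?M has_field_derivative 1 / (?q w)\<^sup>2) (at w)" if "w \<in> \<H>" for w
    by (rule mobius_derivative[OF A nz[OF that]])
  have qc: "continuous_on \<H> (\<lambda>w. 1 / (?q w)\<^sup>2)"
    using nz unfolding mden_def by (intro continuous_intros) auto
  have m: "set_borel_measurable borel (?M ` \<H>) ?f"
  proof -
    have "\<H> \<in> sets borel" by (simp add: open_H)
    then show ?thesis unfolding mobius_image(1)[OF g] set_borel_measurable_def hyp_kernel_def by measurable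
  qed
  have "(\<integral>w. ?f w \<partial>lborel) = (LINT w:?M ` \<H>|lborel. ?f w)" unfolding mobius_image(1)[OF g] HI ..
  also have "\<dots> = (LINT w:\<H>|lborel. (cmod (1 / (?q w)\<^sup>2))\<^sup>2 *\<^sub>R ?f (?M w))"
    by (rule set_integral_substitution_holomorphic(2)[OF open_H D mobius_image(2)[OF g] qc m])
  also have "\<dots> = (LINT w:\<H>|lborel. mu w * (hyp_kernel z w * (1 / (?q z)\<^sup>2)))"
  proof -
    have "(cmod (1 / (?q w)\<^sup>2))\<^sup>2 *\<^sub>R ?f (?M w) = mu w * (hyp_kernel z w * (1 / (?q z)\<^sup>2))" if w: "Im w > 0" for w
    proof -
      define i where "i = 1 / (?q w)\<^sup>2"
      have q: "?q w \<noteq> 0" by (rule mden_nz[OF A w])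
      have i1: "i * (?q w)\<^sup>2 = 1" using q by (simp add: i_def)
      have "(cmod i)\<^sup>2 *\<^sub>R ?f (?M w) = i * (mu (?M w) * cnj i) * (hyp_kernel z w * (?q w) ^ 4 / (?q z)\<^sup>2)"
        unfolding hyp_kernel_mobius[OF A z w] scaleR_conv_of_real complex_norm_square by (simp add: mult_ac)
      also have "mu (?M w) * cnj i = mu w * i" using mu[OF w] by (simp add: i_def)
      also have "i * (mu w * i) * (hyp_kernel z w * (?q w) ^ 4 / (?q z)\<^sup>2) = (i * (?q w)\<^sup>2)\<^sup>2 * (mu w * (hyp_kernel z w * (1 / (?q z)\<^sup>2)))"
        by (simp add: power_mult_distrib power2_eq_square power4_eq_xxxx)
      finally show ?thesis unfolding i1 by (simp add: i_def)
    qed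
    then show ?thesis unfolding set_lebesgue_integral_def
      by (intro Bochner_Integration.integral_cong refl) (auto simp: indicator_def upper_half_plane_def simp del: scaleR_complex.sel)
  qed
  also have "\<dots> = (\<integral>w. mu w * hyp_kernel z w * (1 / (?q z)\<^sup>2) \<partial>lborel)" unfolding HI by (simp add: mult.assoc)
  also have "\<dots> = (\<integral>w. mu w * hyp_kernel z w \<partial>lborel) * (1 / (?q z)\<^sup>2)" by (rule integral_mult_left_zero)
  finally show ?thesis by (simp add: invariant_field_def)
qed

section \<open>Two-jets of holomorphic vector fields\<close>

lemma weight_four:
  assumes f: "\<phi> holomorphic_on \<H>"
    and w: "\<And>\<gamma> z. \<gamma> \<in> deck p \<Longrightarrow> Im z > 0 \<Longrightarrow> \<phi> (mobius (r \<gamma>) z) = (mden (r \<gamma>) z) ^ 4 * \<phi> z"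
  shows "\<phi> \<in> QD"
proof -
  have "\<phi> (mobius (r \<gamma>) z) * (deriv (mobius (r \<gamma>)) z)\<^sup>2 = \<phi> z" if g: "\<gamma> \<in> deck p" and "z \<in> \<H>" for \<gamma> z
  proof -
    have z: "Im z > 0" using that(2) by (simp add: upper_half_plane_def)
    have "mden (r \<gamma>) z \<noteq> 0" by (rule mden_nz[OF r_SL[OF g] z])
    then show ?thesis unfolding w[OF g z] deriv_mobius[OF r_SL[OF g] z]
      by (simp add: power2_eq_square power4_eq_xxxx)
  qed
  then show ?thesis using f by (simp add: quadratic_differentials_def)
qed

lemma potential_field_om:
  assumes F: "\<And>z. Im z > 0 \<Longrightarrow> (F0 has_field_derivative \<phi> z) (at z)"
    "\<And>z. Im z > 0 \<Longrightarrow> (F1 has_field_derivative \<phi> z * z) (at z)"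
    "\<And>z. Im z > 0 \<Longrightarrow> (F2 has_field_derivative \<phi> z * z\<^sup>2) (at z)"
    and z: "Im z > 0"
  shows "\<exists>q. wirtinger (potential_field (\<lambda>s. matrix_potential F0 F1 F2 (d s))) q (- 2 * (Im z)\<^sup>2 *\<^sub>R cnj (\<phi> z)) z"
proof -
  have sm: "smooth_on UNIV (\<lambda>s. matrix_potential F0 F1 F2 (d s))" by (rule om_matrix_potential(1)[OF F])
  have D: "d0 (\<lambda>s. matrix_potential F0 F1 F2 (d s)) = om \<phi>" by (rule om_matrix_potential(2)[OF F])
  show ?thesis using potential_field_wirtinger[OF sm z] unfolding D beltrami_om[OF z] by (rule exI)
qed

text \<open>The Killing field with the two-jet of a holomorphic vector field at \<open>z\<close>.\<close>
definition osculating :: "(complex \<Rightarrow> complex) \<Rightarrow> (complex \<Rightarrow> complex) \<Rightarrow> (complex \<Rightarrow> complex) \<Rightarrow> complex \<Rightarrow> real^2^2" where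
  "osculating h h1 h2 = matrix_potential (\<lambda>z. h2 z / 2) (\<lambda>z. (h2 z * z - h1 z) / 2) (\<lambda>z. h z - h1 z * z + h2 z * z\<^sup>2 / 2)"

text \<open>The coefficients of the Taylor polynomial of degree 2, as functions of the base point,
  have derivatives in which all terms below third order cancel. The differential is therefore the
  form of half the third derivative.\<close>

lemma osculating_om:
  assumes h: "\<And>z. Im z > 0 \<Longrightarrow> (h has_field_derivative h1 z) (at z)" "\<And>z. Im z > 0 \<Longrightarrow> (h1 has_field_derivative h2 z) (at z)"
    "\<And>z. Im z > 0 \<Longrightarrow> (h2 has_field_derivative h3 z) (at z)"
  shows "smooth_on UNIV (\<lambda>s. osculating h h1 h2 (d s))" "d0 (\<lambda>s. osculating h h1 h2 (d s)) = om (\<lambda>z. h3 z / 2)"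
proof -
  have "((\<lambda>z. h2 z / 2) has_field_derivative h3 z / 2) (at z)"
    "((\<lambda>z. (h2 z * z - h1 z) / 2) has_field_derivative h3 z / 2 * z) (at z)"
    "((\<lambda>z. h z - h1 z * z + h2 z * z\<^sup>2 / 2) has_field_derivative h3 z / 2 * z\<^sup>2) (at z)" if z: "Im z > 0" for z
    using h[OF z] by (auto intro!: derivative_eq_intros simp: power2_eq_square algebra_simps)
  from om_matrix_potential[OF this]
  show "smooth_on UNIV (\<lambda>s. osculating h h1 h2 (d s))" "d0 (\<lambda>s. osculating h h1 h2 (d s)) = om (\<lambda>z. h3 z / 2)"
    by (simp_all add: osculating_def)
qed

text \<open>Taking two-jets is equivariant: \<open>Ad A\<close> pushes Killing fields forward, and
  the Killing field of C is its own two-jet. With the jets at the image point taken as hypotheses,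
  this becomes pure algebra.\<close>

lemma osculating_mobius:
  assumes A: "A \<in> SL" and C: "C \<in> sl" and z: "mden A z \<noteq> 0"
    and j0: "h (mobius A z) = x0 * (1 / mden A z)\<^sup>2 + killing_field C (mobius A z)"
    and j1: "h1 (mobius A z) = x1 - 2 * of_real (A$2$1) * x0 * (1 / mden A z) + (of_real (C$1$1 - C$2$2) - 2 * of_real (C$2$1) * mobius A z)"
    and j2: "h2 (mobius A z) = (mden A z)\<^sup>2 * x2 - 2 * of_real (A$2$1) * mden A z * x1 + 2 * (of_real (A$2$1))\<^sup>2 * x0 - 2 * of_real (C$2$1)"
    and x: "h z = x0" "h1 z = x1" "h2 z = x2"
  shows "osculating h h1 h2 (mobius A z) = Ad A (osculating h h1 h2 z) + C"
proof -
  define a b c D where "a = A$1$1" and "b = A$1$2" and "c = A$2$1" and "D = A$2$2"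
  define N q where "N = mobius A z" and "q = mden A z"
  let ?c = "complex_of_real"
  have det: "a * D - b * c = 1" using SL_det[OF A] by (simp add: a_def b_def c_def D_def)
  have i: "1 / q = ?c a - ?c c * N" using SL_inverse_den[OF A z] by (simp add: N_def q_def a_def c_def)
  have qN: "q * N = ?c a * z + ?c b" using z by (simp add: N_def q_def mobius_eq mden_def a_def b_def)
  have q: "q = ?c c * z + ?c D" by (simp add: q_def mden_def c_def D_def)
  have i1: "q * (?c a - ?c c * N) = 1" using z unfolding i[symmetric] by (simp add: q_def)
  \<comment> \<open>The matrix entries before real parts are taken. As A and C are real, the three
    entries can be compared over the complex numbers and the real part is taken at the end.\<close>
  define g0 g1 g2 where "g0 = x2 / 2" and "g1 = (x2 * z - x1) / 2" and "g2 = x0 - x1 * z + x2 * z\<^sup>2 / 2"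
  have C22: "C$2$2 = - C$1$1" using C by (simp add: sl_def trace_def sum_2)
  have n0: "h2 N / 2 = ?c (D * D) * g0 - 2 * ?c (c * D) * - g1 + ?c (c * c) * g2 - ?c (C$2$1)"
    unfolding N_def j2 x g0_def g1_def g2_def c_def[symmetric] q_def[symmetric] q by (simp add: power2_eq_square field_simps)
  have s1: "(q\<^sup>2 * x2 - 2 * ?c c * q * x1 + 2 * (?c c)\<^sup>2 * x0) * N = q * (q * N) * x2 - 2 * ?c c * (q * N) * x1 + 2 * (?c c)\<^sup>2 * x0 * N"
    by (simp add: power2_eq_square algebra_simps)
  have cN: "?c c * N = ?c a - 1 / q" using i by simp
  have cnN: "?c c * (q * N) = ?c a * q - 1" using i1 by (simp add: algebra_simps)
  have n1: "(h2 N * N - h1 N) / 2 = ?c (a * D + b * c) * g1 + ?c (b * D) * g0 + ?c (a * c) * g2 - ?c (C$1$1)"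
  proof -
    have "h2 N * N - h1 N = q * (q * N) * x2 - (2 * (?c c * (q * N)) + 1) * x1 + 2 * ?c c * x0 * (?c c * N + 1 / q) - 2 * ?c (C$1$1)"
      unfolding N_def[symmetric] j1[folded N_def] j2[folded N_def] c_def[symmetric] q_def[symmetric] C22
      by (simp add: algebra_simps power2_eq_square)
    also have "\<dots> = q * (?c a * z + ?c b) * x2 - (2 * (?c c * (?c a * z + ?c b)) + ?c (a * D - b * c)) * x1 + 2 * ?c c * x0 * ?c a - 2 * ?c (C$1$1)"
      unfolding cN det qN by simp
    also have "\<dots> = 2 * (?c (a * D + b * c) * g1 + ?c (b * D) * g0 + ?c (a * c) * g2 - ?c (C$1$1))"
      unfolding q g0_def g1_def g2_def by (simp add: field_simps power2_eq_square)
    finally show ?thesis by simp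
  qed
  define iq where "iq = 1 / q"
  have n2: "h N - h1 N * N + h2 N * N\<^sup>2 / 2 = 2 * ?c (a * b) * g1 + ?c (b * b) * g0 + ?c (a * a) * g2 + ?c (C$1$2)"
  proof -
    have "h N - h1 N * N + h2 N * N\<^sup>2 / 2 = x0 * (iq + ?c c * N)\<^sup>2 - x1 * (N * (1 + ?c c * (q * N))) + x2 * (q * N)\<^sup>2 / 2 + ?c (C$1$2)"
      unfolding j0[folded N_def] j1[folded N_def] j2[folded N_def] c_def[symmetric] q_def[symmetric] iq_def[symmetric] C22
      by (simp add: killing_field_def C22 field_simps power2_eq_square)
    also have "\<dots> = x0 * (?c a)\<^sup>2 - x1 * (?c a * (q * N)) + x2 * (q * N)\<^sup>2 / 2 + ?c (C$1$2)"
      unfolding cN cnN by (simp add: iq_def algebra_simps)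
    also have "\<dots> = 2 * ?c (a * b) * g1 + ?c (b * b) * g0 + ?c (a * a) * g2 + ?c (C$1$2)"
      unfolding qN g0_def g1_def g2_def by (simp add: field_simps power2_eq_square)
    finally show ?thesis .
  qed
  have os: "osculating h h1 h2 z = vector [vector [- Re g1, Re g2], vector [- Re g0, Re g1]]"
    by (simp add: osculating_def matrix_potential_def x g0_def g1_def g2_def)
  have R: "Re (?c t * w) = t * Re w" for t w by simp
  show ?thesis
    unfolding os unfolding osculating_def matrix_potential_def N_def[symmetric] n0 n1 n2
    unfolding Ad_def matrix_inv_SL2[OF A] a_def[symmetric] b_def[symmetric] c_def[symmetric] D_def[symmetric]
    by (simp add: vec_eq_iff forall_2 matrix_matrix_mult_def sum_2 a_def[symmetric] b_def[symmetric] c_def[symmetric] D_def[symmetric] C22 algebra_simps)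
qed

text \<open>The transformation law of h is differentiated three times. At the third step the Killing
  field and the lower jets are gone and the third derivative has weight four: Bol's lemma with an
  inhomogeneous term.\<close>

lemma jets_mobius:
  assumes A: "A \<in> SL" and z: "Im z > 0"
    and h: "\<And>z. Im z > 0 \<Longrightarrow> (h has_field_derivative h1 z) (at z)" "\<And>z. Im z > 0 \<Longrightarrow> (h1 has_field_derivative h2 z) (at z)"
    "\<And>z. Im z > 0 \<Longrightarrow> (h2 has_field_derivative h3 z) (at z)"
    and eq: "\<And>z. Im z > 0 \<Longrightarrow> h (mobius A z) = h z / (mden A z)\<^sup>2 + killing_field C (mobius A z)"
  shows "h1 (mobius A z) = h1 z - 2 * of_real (A$2$1) * h z * (1 / mden A z) + (of_real (C$1$1 - C$2$2) - 2 * of_real (C$2$1) * mobius A z)"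
    and "h2 (mobius A z) = (mden A z)\<^sup>2 * h2 z - 2 * of_real (A$2$1) * mden A z * h1 z + 2 * (of_real (A$2$1))\<^sup>2 * h z - 2 * of_real (C$2$1)"
    and "h3 (mobius A z) = (mden A z) ^ 4 * h3 z"
proof -
  let ?M = "mobius A" and ?q = "mden A" and ?i = "\<lambda>z. 1 / (mden A z)\<^sup>2" and ?c = "complex_of_real (A$2$1)"
  let ?k1 = "\<lambda>w. of_real (C$1$1 - C$2$2) - 2 * of_real (C$2$1) * w :: complex"
  have nz: "?q z \<noteq> 0" if "Im z > 0" for z by (rule mden_nz[OF A that])
  have M: "(?M has_field_derivative 1 / (?q z)\<^sup>2) (at z)" if "Im z > 0" for z by (rule mobius_derivative[OF A nz[OF that]])
  have q: "(?q has_field_derivative ?c) (at z)" for z unfolding mden_def[abs_def] by (auto intro!: derivative_eq_intros)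
  have tr: "D1 = D2" if "Im z > 0" "(f has_field_derivative D1) (at z)" "(g has_field_derivative D2) (at z)" "\<And>z. Im z > 0 \<Longrightarrow> f z = g z" for f g :: "complex \<Rightarrow> complex" and D1 D2 z
  proof -
    have "(f has_field_derivative D2) (at z)"
      by (rule has_field_derivative_transform_within_open[OF that(3) open_H]) (use that in \<open>auto simp: upper_half_plane_def\<close>)
    then show ?thesis using DERIV_unique that(2) by blast
  qed
  have R1: "h1 (?M z) = h1 z - 2 * ?c * h z * (1 / ?q z) + ?k1 (?M z)" if z: "Im z > 0" for z
  proof -
    have "h1 (?M z) * ?i z = (h1 z * (?q z)\<^sup>2 - h z * (2 * ?q z * ?c)) / ((?q z)\<^sup>2 * (?q z)\<^sup>2) + ?k1 (?M z) * ?i z"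
    proof (rule tr[OF z _ _ eq])
      show "((\<lambda>z. h (?M z)) has_field_derivative h1 (?M z) * ?i z) (at z)"
        by (rule DERIV_chain2[OF h(1)[OF Im_mobius_pos[OF A z]] M[OF z]])
      have "((\<lambda>z. (?q z)\<^sup>2) has_field_derivative 2 * ?q z * ?c) (at z)" by (auto intro!: derivative_eq_intros q)
      then show "((\<lambda>z. h z / (?q z)\<^sup>2 + killing_field C (?M z)) has_field_derivative
         (h1 z * (?q z)\<^sup>2 - h z * (2 * ?q z * ?c)) / ((?q z)\<^sup>2 * (?q z)\<^sup>2) + ?k1 (?M z) * ?i z) (at z)"
        using nz[OF z] by (intro DERIV_add DERIV_divide h(1)[OF z] DERIV_chain2[OF killing_field_wirtinger M[OF z]]) auto
    qed
    also have "\<dots> = (h1 z - 2 * ?c * h z * (1 / ?q z) + ?k1 (?M z)) * ?i z"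
      using nz[OF z] by (simp add: field_simps power2_eq_square)
    finally show ?thesis using nz[OF z] by simp
  qed
  have R2: "h2 (?M z) = (?q z)\<^sup>2 * h2 z - 2 * ?c * ?q z * h1 z + 2 * ?c\<^sup>2 * h z - 2 * of_real (C$2$1)" if z: "Im z > 0" for z
  proof -
    have "h2 (?M z) * ?i z = (h2 z - ((2 * ?c * h1 z) * ?q z - (2 * ?c * h z) * ?c) / (?q z * ?q z)) + (0 - 2 * of_real (C$2$1)) * ?i z"
    proof (rule tr[OF z, of "\<lambda>z. h1 (?M z)" _ "\<lambda>z. h1 z - 2 * ?c * h z / ?q z + ?k1 (?M z)"])
      show "((\<lambda>z. h1 (?M z)) has_field_derivative h2 (?M z) * ?i z) (at z)"
        by (rule DERIV_chain2[OF h(2)[OF Im_mobius_pos[OF A z]] M[OF z]])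
      have k: "(?k1 has_field_derivative (0 - 2 * of_real (C$2$1))) (at w)" for w by (auto intro!: derivative_eq_intros)
      have hh: "((\<lambda>z. 2 * ?c * h z) has_field_derivative 2 * ?c * h1 z) (at z)" by (rule DERIV_cmult[OF h(1)[OF z]])
      show "((\<lambda>z. h1 z - 2 * ?c * h z / ?q z + ?k1 (?M z)) has_field_derivative
          (h2 z - ((2 * ?c * h1 z) * ?q z - (2 * ?c * h z) * ?c) / (?q z * ?q z)) + (0 - 2 * of_real (C$2$1)) * ?i z) (at z)"
        by (rule DERIV_add[OF DERIV_diff[OF h(2)[OF z] DERIV_divide[OF hh q nz[OF z]]] DERIV_chain2[OF k M[OF z]]])
      show "h1 (?M z) = h1 z - 2 * ?c * h z / ?q z + ?k1 (?M z)" if "Im z > 0" for z using R1[OF that] by simp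
    qed
    also have "\<dots> = ((?q z)\<^sup>2 * h2 z - 2 * ?c * ?q z * h1 z + 2 * ?c\<^sup>2 * h z - 2 * of_real (C$2$1)) * ?i z"
      using nz[OF z] by (simp add: field_simps power2_eq_square)
    finally show ?thesis using nz[OF z] by simp
  qed
  show "h1 (?M z) = h1 z - 2 * ?c * h z * (1 / ?q z) + ?k1 (?M z)" by (rule R1[OF z])
  show "h2 (?M z) = (?q z)\<^sup>2 * h2 z - 2 * ?c * ?q z * h1 z + 2 * ?c\<^sup>2 * h z - 2 * of_real (C$2$1)" by (rule R2[OF z])
  show "h3 (?M z) = (?q z) ^ 4 * h3 z"
  proof -
    have "h3 (?M z) * ?i z = (?q z)\<^sup>2 * h3 z"
    proof (rule tr[OF z _ _ R2])
      show "((\<lambda>z. h2 (?M z)) has_field_derivative h3 (?M z) * ?i z) (at z)"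
        by (rule DERIV_chain2[OF h(3)[OF Im_mobius_pos[OF A z]] M[OF z]])
      show "((\<lambda>z. (?q z)\<^sup>2 * h2 z - 2 * ?c * ?q z * h1 z + 2 * ?c\<^sup>2 * h z - 2 * of_real (C$2$1)) has_field_derivative (?q z)\<^sup>2 * h3 z) (at z)"
        by (auto intro!: derivative_eq_intros q h[OF z] simp: algebra_simps power2_eq_square)
    qed
    then show ?thesis using nz[OF z] by (simp add: field_simps power2_eq_square power4_eq_xxxx)
  qed
qed

theorem harmonic_representative:
  assumes a: "\<alpha> \<in> closed_forms1 p r"
  obtains \<phi> where "\<phi> \<in> QD" "(om \<phi>, \<alpha>) \<in> cohomologous p r"
proof -
  note b = closed_formsD(1)[OF a]
  have lin: "linear (\<alpha> s)" and sm: "smooth_on UNIV (\<lambda>s. \<alpha> s v)" and sl: "\<alpha> s v \<in> sl" for s v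
    using b by (auto simp: bundle_forms1_def)
  \<comment> \<open>The potential must be traceless as well, so that the final section takes values
    in \<open>sl\<close>; this is the last conclusion of the Poincare lemma for the trace.\<close>
  have "\<exists>E. smooth_on UNIV E \<and> d0 E = \<alpha> \<and> (\<forall>s. E s \<in> sl)"
  proof (rule poincare[of \<alpha>, OF lin sm])
    show "d1 \<alpha> s v w = 0" for s v w by (simp add: closed_formsD(2)[OF a])
    fix E assume E: "smooth_on UNIV E" "d0 E = \<alpha>"
      and L: "\<And>(L :: real^2^2 \<Rightarrow> real) s. linear L \<Longrightarrow> (\<And>s v. L (\<alpha> s v) = 0) \<Longrightarrow> L (E s) = 0"
    have "trace (E s) = 0" for s by (rule L[OF trace_linear]) (use sl in \<open>simp add: sl_def\<close>)
    then show "\<exists>E. smooth_on UNIV E \<and> d0 E = \<alpha> \<and> (\<forall>s. E s \<in> sl)" using E by (auto simp: sl_def)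
  qed
  then obtain E where E: "smooth_on UNIV E" "d0 E = \<alpha>" and Esl: "\<And>s. E s \<in> sl" by blast
  have dE: "d0 E \<in> bundle_forms1 p r" unfolding E(2) by (rule b)
  define mu where "mu z = (if Im z > 0 then beltrami (d, r) (d0 E) z else 0)" for z
  obtain V' B where P: "dbar_problem (potential_field E) V' mu B"
    using bounded_dbar_problem[OF E(1) dE] unfolding mu_def[abs_def, symmetric] by blast
  interpret P: dbar_problem "potential_field E" V' mu B by (rule P)
  let ?V = "potential_field E" and ?W = "P.invariant_field" and ?\<phi> = "P.bergman"
  have W: "?W (mobius (r \<gamma>) z) = ?W z / (mden (r \<gamma>) z)\<^sup>2" if g: "\<gamma> \<in> deck p" and z: "Im z > 0" for \<gamma> z
  proof (rule invariant_field_mobius[OF P _ g z])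
    fix z assume z: "Im z > 0"
    obtain C where C: "\<And>s. E (\<gamma> s) = Ad (r \<gamma>) (E s) + C" using potential_cocycle[OF E(1) dE g] by blast
    show "mu (mobius (r \<gamma>) z) * cnj (1 / (mden (r \<gamma>) z)\<^sup>2) = mu z / (mden (r \<gamma>) z)\<^sup>2"
      by (rule cocycle_dbar[OF P.V g potential_field_mobius[of E \<gamma> C, OF C g] z])
  qed
  have "\<forall>z. \<exists>q. Im z > 0 \<longrightarrow> wirtinger (\<lambda>z. ?V z - ?W z) q (- 2 * (Im z)\<^sup>2 *\<^sub>R cnj (?\<phi> z)) z"
    using P.dbar_solution by blast
  then obtain Q where Q: "\<And>z. Im z > 0 \<Longrightarrow> wirtinger (\<lambda>z. ?V z - ?W z) (Q z) (- 2 * (Im z)\<^sup>2 *\<^sub>R cnj (?\<phi> z)) z" by metis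
  \<comment> \<open>V minus the invariant field has the cocycle of V, so its dbar derivative -2 (Im
    z)^2 cnj \<phi> transforms like a Beltrami coefficient. Solving for \<phi> with the law of Im z
    gives the weight, without a substitution in the Bergman integral.\<close>
  have \<phi>QD: "?\<phi> \<in> QD"
  proof (rule weight_four[OF P.bergman_holomorphic])
    fix \<gamma> z assume g: "\<gamma> \<in> deck p" and z: "Im z > 0"
    note A = r_SL[OF g]
    define q where "q = mden (r \<gamma>) z"
    have q0: "q \<noteq> 0" using mden_nz[OF A z] by (simp add: q_def)
    obtain C where C: "\<And>s. E (\<gamma> s) = Ad (r \<gamma>) (E s) + C" using potential_cocycle[OF E(1) dE g] by blast
    have "(- 2 * (Im (mobius (r \<gamma>) z))\<^sup>2 *\<^sub>R cnj (?\<phi> (mobius (r \<gamma>) z))) * cnj (1 / q\<^sup>2) = (- 2 * (Im z)\<^sup>2 *\<^sub>R cnj (?\<phi> z)) / q\<^sup>2"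
      unfolding q_def
    proof (rule cocycle_dbar[OF Q g _ z])
      show "?V (mobius (r \<gamma>) z) - ?W (mobius (r \<gamma>) z) = (?V z - ?W z) / (mden (r \<gamma>) z)\<^sup>2 + killing_field C (mobius (r \<gamma>) z)" if "Im z > 0" for z
        unfolding W[OF g that] potential_field_mobius[of E \<gamma> C, OF C g that] by (simp add: diff_divide_distrib)
    qed
    moreover have "Im (mobius (r \<gamma>) z) = Im z / (cmod q)\<^sup>2" unfolding q_def by (rule Im_mobius[OF A z])
    moreover have "complex_of_real ((Im z / (cmod q)\<^sup>2)\<^sup>2) = of_real ((Im z)\<^sup>2) / (q * cnj q)\<^sup>2"
      by (simp only: power_divide of_real_divide of_real_power[of "(cmod q)\<^sup>2"] complex_norm_square)
    ultimately have e: "- 2 * (of_real ((Im z)\<^sup>2) / (q * cnj q)\<^sup>2 * cnj (?\<phi> (mobius (r \<gamma>) z))) * (1 / (cnj q)\<^sup>2) = - 2 * (of_real ((Im z)\<^sup>2) * cnj (?\<phi> z)) / q\<^sup>2"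
      by (simp only: scaleR_conv_of_real complex_cnj_divide complex_cnj_one complex_cnj_power)
    have "cnj (?\<phi> (mobius (r \<gamma>) z)) = (cnj q) ^ 4 * cnj (?\<phi> z)"
    proof -
      define y w X where "y = complex_of_real ((Im z)\<^sup>2)" and "w = cnj q" and "X = cnj (?\<phi> (mobius (r \<gamma>) z))"
      have "y \<noteq> 0" "w \<noteq> 0" using z q0 by (simp_all add: y_def w_def)
      then show ?thesis using e q0 unfolding y_def[symmetric] w_def[symmetric] X_def[symmetric]
        by (simp add: field_simps power2_eq_square power4_eq_xxxx)
    qed
    then show "?\<phi> (mobius (r \<gamma>) z) = (mden (r \<gamma>) z) ^ 4 * ?\<phi> z"
      unfolding q_def by (metis complex_cnj_cnj complex_cnj_mult complex_cnj_power)
  qed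
  obtain F0 F1 F2 where F: "\<And>z. Im z > 0 \<Longrightarrow> (F0 has_field_derivative ?\<phi> z) (at z)"
    "\<And>z. Im z > 0 \<Longrightarrow> (F1 has_field_derivative ?\<phi> z * z) (at z)"
    "\<And>z. Im z > 0 \<Longrightarrow> (F2 has_field_derivative ?\<phi> z * z\<^sup>2) (at z)"
    using om_potential[OF P.bergman_holomorphic] by metis
  define E1 where "E1 s = matrix_potential F0 F1 F2 (d s)" for s
  have E1: "smooth_on UNIV E1" "d0 E1 = om ?\<phi>" unfolding E1_def[abs_def]
    by (rule om_matrix_potential(1)[OF F], assumption+) (rule om_matrix_potential(2)[OF F])
  have dE1: "d0 E1 \<in> bundle_forms1 p r" unfolding E1(2) by (rule closed_formsD(1)[OF om_closed_forms[OF \<phi>QD]])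
  have E1sl: "E1 s \<in> sl" for s by (simp add: E1_def matrix_potential_def sl_def trace_def sum_2)
  \<comment> \<open>The two fields have the same dbar derivative, so h is holomorphic, although
    neither of them is.\<close>
  define h where "h z = (?V z - ?W z) - potential_field E1 z" for z
  have h_hol: "h holomorphic_on \<H>"
    unfolding holomorphic_on_open[OF open_H]
  proof
    fix z assume "z \<in> \<H>"
    then have z: "Im z > 0" by (simp add: upper_half_plane_def)
    obtain q where "wirtinger (potential_field E1) q (- 2 * (Im z)\<^sup>2 *\<^sub>R cnj (?\<phi> z)) z"
      using potential_field_om[OF F z] unfolding E1_def[abs_def] by blast
    from wirtinger_diff[OF Q[OF z] this] have "wirtinger h (Q z - q) 0 z" by (simp add: h_def[abs_def])
    then show "\<exists>f'. (h has_field_derivative f') (at z)" using wirtinger_holomorphic by blast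
  qed
  define h1 where "h1 = deriv h"
  define h2 where "h2 = deriv h1"
  define h3 where "h3 = deriv h2"
  have hols: "h1 holomorphic_on \<H>" "h2 holomorphic_on \<H>" "h3 holomorphic_on \<H>"
    unfolding h3_def h2_def h1_def by (intro holomorphic_deriv h_hol open_H)+
  have hD: "\<And>z. Im z > 0 \<Longrightarrow> (h has_field_derivative h1 z) (at z)" "\<And>z. Im z > 0 \<Longrightarrow> (h1 has_field_derivative h2 z) (at z)"
    "\<And>z. Im z > 0 \<Longrightarrow> (h2 has_field_derivative h3 z) (at z)"
    using holomorphic_derivI[OF h_hol open_H] holomorphic_derivI[OF hols(1) open_H]
      holomorphic_derivI[OF hols(2) open_H]
    by (simp_all add: h1_def h2_def h3_def upper_half_plane_def)
  define J where "J s = osculating h h1 h2 (d s)" for s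
  have J: "smooth_on UNIV J" "d0 J = om (\<lambda>z. h3 z / 2)" unfolding J_def[abs_def]
    by (rule osculating_om(1)[OF hD], assumption+) (rule osculating_om(2)[OF hD])
  have Jsl: "J s \<in> sl" for s by (simp add: J_def osculating_def matrix_potential_def sl_def trace_def sum_2)
  \<comment> \<open>The invariant field has no cocycle, so h transforms with the cocycle of E - E1.
    The same traceless constant C1 - C2 therefore appears for matrices and for vector
    fields.\<close>
  have coc: "\<exists>C1 C2. (\<forall>s. E (\<gamma> s) = Ad (r \<gamma>) (E s) + C1) \<and> (\<forall>s. E1 (\<gamma> s) = Ad (r \<gamma>) (E1 s) + C2) \<and> C1 - C2 \<in> sl \<and>
      (\<forall>z. Im z > 0 \<longrightarrow> h (mobius (r \<gamma>) z) = h z / (mden (r \<gamma>) z)\<^sup>2 + killing_field (C1 - C2) (mobius (r \<gamma>) z))" if g: "\<gamma> \<in> deck p" for \<gamma>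
  proof -
    obtain C1 where C1: "\<And>s. E (\<gamma> s) = Ad (r \<gamma>) (E s) + C1" using potential_cocycle[OF E(1) dE g] by blast
    obtain C2 where C2: "\<And>s. E1 (\<gamma> s) = Ad (r \<gamma>) (E1 s) + C2" using potential_cocycle[OF E1(1) dE1 g] by blast
    have i: "invertible (r \<gamma>)" using r_SL[OF g] by (simp add: SL_def invertible_det_nz)
    have "C1 = E (\<gamma> 0) - Ad (r \<gamma>) (E 0)" "C2 = E1 (\<gamma> 0) - Ad (r \<gamma>) (E1 0)" using C1[of 0] C2[of 0] by simp_all
    then have "C1 - C2 \<in> sl" by (simp only:) (intro sl_minus Ad_sl[OF i] Esl E1sl)
    moreover have "h (mobius (r \<gamma>) z) = h z / (mden (r \<gamma>) z)\<^sup>2 + killing_field (C1 - C2) (mobius (r \<gamma>) z)" if z: "Im z > 0" for z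
      unfolding h_def W[OF g z] potential_field_mobius[of E \<gamma> C1, OF C1 g z] potential_field_mobius[of E1 \<gamma> C2, OF C2 g z]
        linear_diff[OF linear_killing_field] by (simp add: diff_divide_distrib)
    ultimately show ?thesis using C1 C2 by blast
  qed
  \<comment> \<open>The differential of J is the form of half the third derivative of h; it joins
    the Bergman projection so that E - E1 - J accounts exactly for the rest of \<alpha>.\<close>
  define \<phi> where "\<phi> z = ?\<phi> z + h3 z / 2" for z
  have QD: "\<phi> \<in> QD"
  proof (rule weight_four)
    show "\<phi> holomorphic_on \<H>" unfolding \<phi>_def by (intro holomorphic_intros P.bergman_holomorphic hols(3)) simp
    fix \<gamma> z assume g: "\<gamma> \<in> deck p" and z: "Im z > 0"
    obtain C where C: "\<And>z. Im z > 0 \<Longrightarrow> h (mobius (r \<gamma>) z) = h z / (mden (r \<gamma>) z)\<^sup>2 + killing_field C (mobius (r \<gamma>) z)" using coc[OF g] by blast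
    have "?\<phi> (mobius (r \<gamma>) z) = ?\<phi> z * (mden (r \<gamma>) z) ^ 4" by (rule quadratic_differential_mobius[OF \<phi>QD g r_SL[OF g] z])
    moreover have "h3 (mobius (r \<gamma>) z) = (mden (r \<gamma>) z) ^ 4 * h3 z" by (rule jets_mobius(3)[OF r_SL[OF g] z hD C])
    ultimately show "\<phi> (mobius (r \<gamma>) z) = (mden (r \<gamma>) z) ^ 4 * \<phi> z"
      unfolding \<phi>_def by (simp add: algebra_simps)
  qed
  \<comment> \<open>J has cocycle C1 - C2, the one of E - E1, so the difference is equivariant and
    is a section of the flat bundle.\<close>
  define f where "f s = (E s - E1 s) - J s" for s
  have fsm: "smooth_on UNIV f" unfolding f_def by (intro smooth_diff E(1) E1(1) J(1) open_UNIV)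
  have "f \<in> bundle_sections p r"
  proof -
    have "f (\<gamma> s) = Ad (r \<gamma>) (f s)" if g: "\<gamma> \<in> deck p" for \<gamma> s
    proof -
      obtain C1 C2 where C: "\<And>s. E (\<gamma> s) = Ad (r \<gamma>) (E s) + C1" "\<And>s. E1 (\<gamma> s) = Ad (r \<gamma>) (E1 s) + C2" "C1 - C2 \<in> sl"
        and hC: "\<And>z. Im z > 0 \<Longrightarrow> h (mobius (r \<gamma>) z) = h z / (mden (r \<gamma>) z)\<^sup>2 + killing_field (C1 - C2) (mobius (r \<gamma>) z)"
        using coc[OF g] by blast
      note A = r_SL[OF g]
      have j0: "h (mobius (r \<gamma>) (d s)) = h (d s) * (1 / mden (r \<gamma>) (d s))\<^sup>2 + killing_field (C1 - C2) (mobius (r \<gamma>) (d s))"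
        by (simp add: hC[OF Im_d] power_one_over)
      have j1: "h1 (mobius (r \<gamma>) (d s)) = h1 (d s) - 2 * of_real (r \<gamma> $ 2 $ 1) * h (d s) * (1 / mden (r \<gamma>) (d s))
          + (of_real ((C1 - C2) $ 1 $ 1 - (C1 - C2) $ 2 $ 2) - 2 * of_real ((C1 - C2) $ 2 $ 1) * mobius (r \<gamma>) (d s))"
        by (rule jets_mobius(1)[OF A Im_d hD hC])
      have j2: "h2 (mobius (r \<gamma>) (d s)) = (mden (r \<gamma>) (d s))\<^sup>2 * h2 (d s) - 2 * of_real (r \<gamma> $ 2 $ 1) * mden (r \<gamma>) (d s) * h1 (d s)
          + 2 * (of_real (r \<gamma> $ 2 $ 1))\<^sup>2 * h (d s) - 2 * of_real ((C1 - C2) $ 2 $ 1)"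
        by (rule jets_mobius(2)[OF A Im_d hD hC])
      have "J (\<gamma> s) = Ad (r \<gamma>) (J s) + (C1 - C2)"
        unfolding J_def d_deck[OF g] by (rule osculating_mobius[OF A C(3) mden_nz[OF A Im_d] j0 j1 j2 refl refl refl])
      then show ?thesis unfolding f_def C(1,2) linear_diff[OF linear_Ad] by simp
    qed
    moreover have "f s \<in> sl" for s unfolding f_def by (intro sl_minus Esl E1sl Jsl)
    ultimately show ?thesis using fsm by (auto simp: bundle_sections_def)
  qed
  moreover have "\<alpha> s v - om \<phi> s v = d0 f s v" for s v
  proof -
    have D: "(F has_derivative d0 F s) (at s)" if "smooth_on UNIV F" for F :: "plane \<Rightarrow> real^2^2"
      unfolding d0_def[abs_def] using smooth_derivative[OF that, of s] by simp
    have "(f has_derivative (\<lambda>v. (\<alpha> s v - om ?\<phi> s v) - om (\<lambda>z. h3 z / 2) s v)) (at s)"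
      unfolding f_def E(2)[symmetric] E1(2)[symmetric] J(2)[symmetric] by (intro has_derivative_diff D E(1) E1(1) J(1))
    from fun_cong[OF frechet_eq[OF this], of v] have "d0 f s v = (\<alpha> s v - om ?\<phi> s v) - om (\<lambda>z. h3 z / 2) s v" by (simp add: d0_def)
    moreover have "om \<phi> s v = om ?\<phi> s v + om (\<lambda>z. h3 z / 2) s v"
      unfolding om_def \<phi>_def distrib_right by (rule linear_add[OF linear_nilp])
    ultimately show ?thesis by simp
  qed
  ultimately have "(om \<phi>, \<alpha>) \<in> cohomologous p r" using a om_closed_forms[OF QD] unfolding cohomologous_def by blast
  then show ?thesis by (rule that[OF QD])
qed

lemma H1_representative:
  assumes "u \<in> H1 p r"
  obtains \<phi> where "\<phi> \<in> QD" "u = cohomologous p r `` {om \<phi>}"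
proof -
  obtain \<alpha> where \<alpha>: "\<alpha> \<in> closed_forms1 p r" "u = cohomologous p r `` {\<alpha>}" using assms unfolding H1_def by (rule quotientE)
  obtain \<phi> where \<phi>: "\<phi> \<in> QD" "(om \<phi>, \<alpha>) \<in> cohomologous p r" by (rule harmonic_representative[OF \<alpha>(1)])
  have "cohomologous p r `` {\<alpha>} = cohomologous p r `` {om \<phi>}"
    using cohomologous_trans cohomologous_sym \<phi>(2) by blast
  then show ?thesis using that \<phi>(1) \<alpha>(2) by blast
qed

lemma L2_metric_restrict:
  assumes "c > 0" and u: "u \<in> H1 p r" and v: "v \<in> H1 p r"
  shows "L2_metric p (G c) l (d_teich_embedding p (d, r) u) (d_teich_embedding p (d, r) v) = 4 * wp_metric p (d, r) u v"
proof -
  obtain \<phi> where \<phi>: "\<phi> \<in> QD" "u = cohomologous p r `` {om \<phi>}" by (rule H1_representative[OF u])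
  obtain \<psi> where \<psi>: "\<psi> \<in> QD" "v = cohomologous p r `` {om \<psi>}" by (rule H1_representative[OF v])
  show ?thesis by (rule L2_metric_om[OF assms(1) \<phi> \<psi>])
qed

end

theorem theorem1:
  fixes S :: "'s::t2_space set" and p :: "plane \<Rightarrow> 's" and g :: nat
  assumes "closed_oriented_surface S p" and "has_genus S g" and "g > 1"
  shows "\<exists>c1>0. \<exists>c2>0.
    \<forall>T\<in>teichmueller_space p. \<forall>X\<in>T. \<forall>u\<in>H1 p (snd X). \<forall>v\<in>H1 p (snd X).
      dg_metric p (teich_embedding X) (d_teich_embedding p X u) (d_teich_embedding p X v)
        = c1 * wp_metric p X u v \<and>
      loftin_metric p (teich_embedding X) (d_teich_embedding p X u) (d_teich_embedding p X v)
        = c2 * wp_metric p X u v"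
proof (intro exI[of _ "4::real"] conjI ballI)
  fix T X u v
  assume T: "T \<in> teichmueller_space p" "X \<in> T" and u: "u \<in> H1 p (snd X)" and v: "v \<in> H1 p (snd X)"
  obtain Y where "(Y, X) \<in> marked_equiv (hyperbolic_structures p) SL (\<lambda>A z w. w = mobius A z)"
    using T unfolding teichmueller_space_def quotient_def by blast
  then have "X \<in> hyperbolic_structures p"
    unfolding marked_equiv_def by (cases X; cases Y) simp
  then interpret hyperbolic_surface S p "fst X" "snd X"
    by unfold_locales (use assms(1) in simp_all)
  show "dg_metric p (teich_embedding X) (d_teich_embedding p X u) (d_teich_embedding p X v) = 4 * wp_metric p X u v"
    using L2_metric_restrict[OF _ u v, of 3] dg_metric_hyperbolic[OF hyp] by simp
  show "loftin_metric p (teich_embedding X) (d_teich_embedding p X u) (d_teich_embedding p X v) = 4 * wp_metric p X u v"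
    using L2_metric_restrict[OF _ u v, of 1] loftin_metric_hyperbolic[OF hyp] by simp
qed simp_all

end
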